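(* Let $k$ be a field, let $A$ be a dg $k$-algebra, let $C$ be a (possibly curved) dg coalgebra, and let $\pi:C\to A$ be a twisting cochain. Put $K=A\otimes_\pi C\otimes_\pi A$ (the twisted tensor product, a dg $A$-bimodule under the outer actions). Then the map $l:\mathrm{Hom}_k^\pi(C,A)\to \mathrm{Hom}_{A^e}(K,K)$ defined by $$f\mapsto\left(a\otimes c\otimes b\mapsto (-1)^{|f|(|a|+|c_1|)}\,a\otimes c_1\otimes f(c_2)b\right)$$ is a map of dg algebras. Furthermore, if $\pi$ is acyclic, then $l$ is a quasi-isomorphism, so that $l$ gives a dg algebra quasi-isomorphism $\mathrm{Hom}_k^\pi(C,A)\to \mathrm{RHom}_{A\text{-bimod}}(A,A)$ (the target being represented by $\mathrm{Hom}_{A^e}(K,K)$), and there is an identification of graded rings $HH^\bullet(A)=H^\bullet(\mathrm{Hom}_k^\pi(C,A))$.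
   Context: All gradings are cohomological; $|x|$ is the degree of $x$; $\Delta(c)=c_1\otimes c_2$ is Sweedler notation. $A^e=A\otimes A^{op}$ with $a\cdot^{op}b=(-1)^{|a||b|}ba$; dg $A$-bimodules are dg $A^e$-modules. For dg modules $M,N$ over a dg algebra $\Pi$, $\mathrm{Hom}_\Pi(M,N)=\bigoplus_i\mathrm{Hom}^i_\Pi(M,N)$, where $\mathrm{Hom}_\Pi^i$ consists of degree $i$ maps with $f(am)=(-1)^{|f||a|}af(m)$, with differential $f\mapsto d_Nf-(-1)^{|f|}fd_M$. For bimodules this means $f(amb)=(-1)^{|f||a|}af(m)b$. $\mathrm{Hom}_{A^e}(K,K)$ is a dg algebra under composition. A curved dg coalgebra $(C,d_C,f_C)$ is a graded coalgebra with counit $\epsilon_C$, a degree 1 coderivation $d_C$ and a degree 2 linear map $f_C:C\to k$ with $d_C^2=(f_C\otimes id-id\otimes f_C)\Delta$ and $f_Cd_C=0$. A dg coalgebra is the case $f_C=0$. $\mathrm{Hom}_k(C,A)=\bigoplus_n\prod_i\mathrm{Hom}_k(C^i,A^{i+n})$ has the convolution product $(f*g)(c)=(-1)^{|c_1||g|}f(c_1)g(c_2)$. A twisting cochain is a degree 1 linear map $\pi:C\to A$ with $-1_Af_C-(d_A\pi+\pi d_C)+\mu(\pi\otimes\pi)\Delta=0$, where $\mu$ is the multiplication of $A$ and $\mu(\pi\otimes\pi)\Delta=\pi*\pi$. $\mathrm{Hom}_k^\pi(C,A)$ is the graded algebra $\mathrm{Hom}_k(C,A)$ (convolution product) with differential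 $d(f)=d_Af-(-1)^{|f|}fd_C-(\pi*f-(-1)^{|f|}f*\pi)$; it is a dg algebra. The twisted tensor product $A\otimes_\pi C\otimes_\pi A$ is the graded space $A\otimes C\otimes A$ with differential $$a\otimes c\otimes b\mapsto d_{A\otimes C\otimes A}(a\otimes c\otimes b)+(-1)^{|a|}a\pi(c_1)\otimes c_2\otimes b-(-1)^{|a|+|c_1|}a\otimes c_1\otimes\pi(c_2)b,$$ where $d_{A\otimes C\otimes A}$ is the usual tensor product operator. It is a dg $A$-bimodule under the outer $A$-actions. A curved dg coalgebra $C$ is connected if its coradical $C_0$ (sum of simple subcoalgebras) is one dimensional, $C_0=k$, and $d_C(C_0)\subset C_0$. A twisting cochain $\pi:C\to A$ is admissible if $C$ is connected and $\pi|_{C_0}=0$; it is acyclic if it is admissible and the dg bimodule map $\varepsilon:A\otimes_\pi C\otimes_\pi A\to A$, $a\otimes c\otimes b\mapsto ab\,\epsilon_C(c)$, is a quasi-isomorphism. A dg $\Pi$-module $M$ is semi-projective if it is projective as a $\Pi$-module after forgetting the differential and $\mathrm{Hom}_\Pi(M,N)$ is acyclic whenever $N$ is acyclic. A semi-projective approximation of a dg module $M$ is a surjective quasi-isomorphism $\tilde M\to M$ with $\tilde M$ semi-projective. The Hochschild cohomology ring is $HH^\bullet(A)=H^\bullet(\mathrm{RHom}_{A^e}(A,A))=H^\bullet(\mathrm{Hom}_{A^e}(\tilde A,\tilde A))$ with product induced by composition, where $\tilde A\to A$ is any semi-projective approximation of $A$ over $A^e$ (the graded ring is independent of the choice). *)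

theory Defs
  imports "HOL-Algebra.Module" "HOL-Algebra.QuotRing"
begin

section \<open>Graded spaces\<close>

text \<open>
  Over a ground field \<open>k\<close>, a graded vector space is a \<open>k\<close>-module \<open>V\<close> (the total space) together
  with subspaces \<open>grade V i\<close>, for \<open>i\<close> an integer, of which it is the internal direct sum.
  The record carries a ring structure (inherited from the module record), which is
  meaningful only for algebras, and an operator \<open>diff\<close>, which need not square to zero.
\<close>

record ('k, 'v) dgspace = "('k, 'v) module" +
  grade :: "int \<Rightarrow> 'v set"
  diff :: "'v \<Rightarrow> 'v"

definition hdecomp :: "('k, 'v, 'z) dgspace_scheme \<Rightarrow> 'v \<Rightarrow> (int \<Rightarrow> 'v) \<Rightarrow> bool" where
  "hdecomp V v u \<longleftrightarrow> (\<forall>i. u i \<in> grade V i) \<and> finite {i. u i \<noteq> \<zero>\<^bsub>V\<^esub>}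
     \<and> v = (\<Oplus>\<^bsub>V\<^esub>i\<in>{i. u i \<noteq> \<zero>\<^bsub>V\<^esub>}. u i)"

definition graded_space :: "'k ring \<Rightarrow> ('k, 'v, 'z) dgspace_scheme \<Rightarrow> bool" where
  "graded_space k V \<longleftrightarrow> module k V \<and> (\<forall>i. submodule (grade V i) k V)
     \<and> (\<forall>v\<in>carrier V. \<exists>!u. hdecomp V v u)"

definition hcomp :: "('k, 'v, 'z) dgspace_scheme \<Rightarrow> int \<Rightarrow> 'v \<Rightarrow> 'v" where
  "hcomp V i v = (THE u. hdecomp V v u) i"

text \<open>
  Formulas with Koszul signs are given on homogeneous elements. If \<open>\<phi> i\<close> is the formula for
  elements of degree \<open>i\<close>, then \<open>hsum V X \<phi>\<close> is its additive extension to all of \<open>V\<close>.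
\<close>

definition hsum :: "('k, 'v, 'z) dgspace_scheme \<Rightarrow> ('x, 'y) ring_scheme
    \<Rightarrow> (int \<Rightarrow> 'v \<Rightarrow> 'x) \<Rightarrow> 'v \<Rightarrow> 'x" where
  "hsum V X \<phi> v = (\<Oplus>\<^bsub>X\<^esub>i\<in>{i. hcomp V i v \<noteq> \<zero>\<^bsub>V\<^esub>}. \<phi> i (hcomp V i v))"

definition ksgn :: "'k ring \<Rightarrow> int \<Rightarrow> 'k" where
  "ksgn k n = (if even n then \<one>\<^bsub>k\<^esub> else \<ominus>\<^bsub>k\<^esub> \<one>\<^bsub>k\<^esub>)"

definition klinear :: "'k ring \<Rightarrow> ('k, 'v, 'y) dgspace_scheme \<Rightarrow> ('k, 'w, 'z) dgspace_scheme
    \<Rightarrow> ('v \<Rightarrow> 'w) \<Rightarrow> bool" where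
  "klinear k V W f \<longleftrightarrow> f \<in> carrier V \<rightarrow> carrier W
     \<and> (\<forall>x\<in>carrier V. \<forall>y\<in>carrier V. f (x \<oplus>\<^bsub>V\<^esub> y) = f x \<oplus>\<^bsub>W\<^esub> f y)
     \<and> (\<forall>r\<in>carrier k. \<forall>x\<in>carrier V. f (r \<odot>\<^bsub>V\<^esub> x) = r \<odot>\<^bsub>W\<^esub> f x)"

definition deg_linear :: "'k ring \<Rightarrow> ('k, 'v, 'y) dgspace_scheme \<Rightarrow> ('k, 'w, 'z) dgspace_scheme
    \<Rightarrow> int \<Rightarrow> ('v \<Rightarrow> 'w) \<Rightarrow> bool" where
  "deg_linear k V W n f \<longleftrightarrow> klinear k V W f \<and> (\<forall>i. f ` grade V i \<subseteq> grade W (i + n))"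

section \<open>Complexes and cohomology\<close>

definition dg_space :: "'k ring \<Rightarrow> ('k, 'v, 'z) dgspace_scheme \<Rightarrow> bool" where
  "dg_space k V \<longleftrightarrow> graded_space k V \<and> deg_linear k V V 1 (diff V)
     \<and> (\<forall>v\<in>carrier V. diff V (diff V v) = \<zero>\<^bsub>V\<^esub>)"

definition cocycles :: "('k, 'v, 'z) dgspace_scheme \<Rightarrow> 'v set" where
  "cocycles V = {v \<in> carrier V. diff V v = \<zero>\<^bsub>V\<^esub>}"

definition coboundaries :: "('k, 'v, 'z) dgspace_scheme \<Rightarrow> 'v set" where
  "coboundaries V = diff V ` carrier V"

text \<open>For a complex without product only the additive structure of the quotient is meaningful.\<close>

definition cohomology :: "('k, 'v, 'z) dgspace_scheme \<Rightarrow> 'v set ring" where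
  "cohomology V = (V\<lparr>carrier := cocycles V\<rparr>) Quot (coboundaries V)"

definition cohomology_grade :: "('k, 'v, 'z) dgspace_scheme \<Rightarrow> int \<Rightarrow> 'v set set" where
  "cohomology_grade V i = (\<lambda>z. coboundaries V +>\<^bsub>V\<^esub> z) ` (cocycles V \<inter> grade V i)"

definition acyclic_space :: "('k, 'v, 'z) dgspace_scheme \<Rightarrow> bool" where
  "acyclic_space V \<longleftrightarrow> cocycles V = coboundaries V"

definition chain_map :: "'k ring \<Rightarrow> ('k, 'v, 'y) dgspace_scheme \<Rightarrow> ('k, 'w, 'z) dgspace_scheme
    \<Rightarrow> ('v \<Rightarrow> 'w) \<Rightarrow> bool" where
  "chain_map k V W f \<longleftrightarrow> deg_linear k V W 0 f
     \<and> (\<forall>v\<in>carrier V. f (diff V v) = diff W (f v))"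

text \<open>The induced map on cohomology sends the coset of \<open>z\<close> to the coset of \<open>f z\<close>.\<close>

definition quasi_iso :: "'k ring \<Rightarrow> ('k, 'v, 'y) dgspace_scheme \<Rightarrow> ('k, 'w, 'z) dgspace_scheme
    \<Rightarrow> ('v \<Rightarrow> 'w) \<Rightarrow> bool" where
  "quasi_iso k V W f \<longleftrightarrow> chain_map k V W f
     \<and> bij_betw (\<lambda>X. coboundaries W <+>\<^bsub>W\<^esub> (f ` X))
         (carrier (cohomology V)) (carrier (cohomology W))"

section \<open>Differential graded algebras and bimodules\<close>

definition graded_algebra :: "'k ring \<Rightarrow> ('k, 'a, 'z) dgspace_scheme \<Rightarrow> bool" where
  "graded_algebra k A \<longleftrightarrow> graded_space k A \<and> ring A
     \<and> (\<forall>r\<in>carrier k. \<forall>x\<in>carrier A. \<forall>y\<in>carrier A.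
          (r \<odot>\<^bsub>A\<^esub> x) \<otimes>\<^bsub>A\<^esub> y = r \<odot>\<^bsub>A\<^esub> (x \<otimes>\<^bsub>A\<^esub> y) \<and> x \<otimes>\<^bsub>A\<^esub> (r \<odot>\<^bsub>A\<^esub> y) = r \<odot>\<^bsub>A\<^esub> (x \<otimes>\<^bsub>A\<^esub> y))
     \<and> \<one>\<^bsub>A\<^esub> \<in> grade A 0
     \<and> (\<forall>i j. \<forall>x\<in>grade A i. \<forall>y\<in>grade A j. x \<otimes>\<^bsub>A\<^esub> y \<in> grade A (i + j))"

definition dg_algebra :: "'k ring \<Rightarrow> ('k, 'a, 'z) dgspace_scheme \<Rightarrow> bool" where
  "dg_algebra k A \<longleftrightarrow> graded_algebra k A \<and> dg_space k A
     \<and> (\<forall>i. \<forall>x\<in>grade A i. \<forall>y\<in>carrier A.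
          diff A (x \<otimes>\<^bsub>A\<^esub> y) = diff A x \<otimes>\<^bsub>A\<^esub> y \<oplus>\<^bsub>A\<^esub> ksgn k i \<odot>\<^bsub>A\<^esub> (x \<otimes>\<^bsub>A\<^esub> diff A y))"

definition dg_algebra_hom :: "'k ring \<Rightarrow> ('k, 'a, 'y) dgspace_scheme \<Rightarrow> ('k, 'b, 'z) dgspace_scheme
    \<Rightarrow> ('a \<Rightarrow> 'b) \<Rightarrow> bool" where
  "dg_algebra_hom k A B f \<longleftrightarrow> dg_algebra k A \<and> dg_algebra k B
     \<and> f \<in> ring_hom A B \<and> chain_map k A B f"

definition graded_ring_iso :: "('k, 'a, 'y) dgspace_scheme \<Rightarrow> ('k, 'b, 'z) dgspace_scheme
    \<Rightarrow> ('a set \<Rightarrow> 'b set) \<Rightarrow> bool"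
    \<comment> \<open>an isomorphism of graded rings between the cohomology rings of two dg algebras\<close> where
  "graded_ring_iso A B \<theta> \<longleftrightarrow> \<theta> \<in> ring_iso (cohomology A) (cohomology B)
     \<and> (\<forall>i. \<theta> ` cohomology_grade A i = cohomology_grade B i)"

text \<open>
  A dg module over \<open>A \<otimes> A\<^sup>o\<^sup>p\<close> is given by its left and right \<open>A\<close>-actions,
  \<open>(a \<otimes> b) m = (-1)\<^bsup>|b||m|\<^esup> a m b\<close>.
\<close>

record ('k, 'a, 'v) dgbimod = "('k, 'v) dgspace" +
  lact :: "'a \<Rightarrow> 'v \<Rightarrow> 'v"
  ract :: "'v \<Rightarrow> 'a \<Rightarrow> 'v"

definition graded_bimodule :: "'k ring \<Rightarrow> ('k, 'a, 'z) dgspace_scheme \<Rightarrow> ('k, 'a, 'm) dgbimod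
    \<Rightarrow> bool" where
  "graded_bimodule k A M \<longleftrightarrow> graded_space k M
     \<and> (\<forall>a\<in>carrier A. klinear k M M (lact M a) \<and> klinear k M M (\<lambda>m. ract M m a))
     \<and> (\<forall>m\<in>carrier M. klinear k A M (\<lambda>a. lact M a m) \<and> klinear k A M (ract M m))
     \<and> (\<forall>m\<in>carrier M. lact M \<one>\<^bsub>A\<^esub> m = m \<and> ract M m \<one>\<^bsub>A\<^esub> = m)
     \<and> (\<forall>a\<in>carrier A. \<forall>b\<in>carrier A. \<forall>m\<in>carrier M.
          lact M (a \<otimes>\<^bsub>A\<^esub> b) m = lact M a (lact M b m)
        \<and> ract M m (a \<otimes>\<^bsub>A\<^esub> b) = ract M (ract M m a) b
        \<and> ract M (lact M a m) b = lact M a (ract M m b))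
     \<and> (\<forall>i j. \<forall>a\<in>grade A i. \<forall>m\<in>grade M j.
          lact M a m \<in> grade M (i + j) \<and> ract M m a \<in> grade M (i + j))"

definition dg_bimodule :: "'k ring \<Rightarrow> ('k, 'a, 'z) dgspace_scheme \<Rightarrow> ('k, 'a, 'm) dgbimod
    \<Rightarrow> bool" where
  "dg_bimodule k A M \<longleftrightarrow> graded_bimodule k A M \<and> dg_space k M
     \<and> (\<forall>i. \<forall>a\<in>grade A i. \<forall>m\<in>carrier M.
          diff M (lact M a m) = lact M (diff A a) m \<oplus>\<^bsub>M\<^esub> ksgn k i \<odot>\<^bsub>M\<^esub> lact M a (diff M m))
     \<and> (\<forall>i. \<forall>m\<in>grade M i. \<forall>a\<in>carrier A.
          diff M (ract M m a) = ract M (diff M m) a \<oplus>\<^bsub>M\<^esub> ksgn k i \<odot>\<^bsub>M\<^esub> ract M m (diff A a))"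

definition regular_bimodule :: "('k, 'a) dgspace \<Rightarrow> ('k, 'a, 'a) dgbimod" where
  "regular_bimodule A = dgspace.extend A (dgbimod.fields (mult A) (mult A))"

definition bimod_linear :: "'k ring \<Rightarrow> ('k, 'a, 'z) dgspace_scheme
    \<Rightarrow> ('k, 'a, 'm) dgbimod \<Rightarrow> ('k, 'a, 'n) dgbimod \<Rightarrow> int \<Rightarrow> ('m \<Rightarrow> 'n) \<Rightarrow> bool" where
  "bimod_linear k A M N n f \<longleftrightarrow> deg_linear k M N n f
     \<and> (\<forall>i. \<forall>a\<in>grade A i. \<forall>m\<in>carrier M. \<forall>b\<in>carrier A.
          f (lact M a (ract M m b)) = ksgn k (n * i) \<odot>\<^bsub>N\<^esub> lact N a (ract N (f m) b))"

section \<open>Hom complexes\<close>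

text \<open>
  Maps are taken to be extensional (\<open>undefined\<close> off the carrier of their domain), so that equality
  of elements of a Hom space is equality of maps. \<open>G n\<close> is the space of maps of degree \<open>n\<close>; the
  total space consists of the finite sums of homogeneous maps.
\<close>

definition hom_graded :: "('k, 'v, 'y) dgspace_scheme \<Rightarrow> ('k, 'w, 'z) dgspace_scheme
    \<Rightarrow> (int \<Rightarrow> ('v \<Rightarrow> 'w) set) \<Rightarrow> ('k, 'v \<Rightarrow> 'w) dgspace" where
  "hom_graded V W G =
    \<lparr>carrier = {f \<in> extensional (carrier V). \<exists>N g. finite N \<and> (\<forall>n\<in>N. g n \<in> G n)
                  \<and> (\<forall>v\<in>carrier V. f v = (\<Oplus>\<^bsub>W\<^esub>n\<in>N. g n v))},
     mult = undefined, one = undefined,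
     zero = (\<lambda>v\<in>carrier V. \<zero>\<^bsub>W\<^esub>),
     add = (\<lambda>f g. \<lambda>v\<in>carrier V. f v \<oplus>\<^bsub>W\<^esub> g v),
     smult = (\<lambda>r f. \<lambda>v\<in>carrier V. r \<odot>\<^bsub>W\<^esub> f v),
     grade = G,
     diff = undefined\<rparr>"

definition hom_complex :: "'k ring \<Rightarrow> ('k, 'v, 'y) dgspace_scheme \<Rightarrow> ('k, 'w, 'z) dgspace_scheme
    \<Rightarrow> (int \<Rightarrow> ('v \<Rightarrow> 'w) set) \<Rightarrow> ('k, 'v \<Rightarrow> 'w) dgspace" where
  "hom_complex k V W G = (let H = hom_graded V W G in
     H\<lparr>diff := hsum H H (\<lambda>n f. \<lambda>v\<in>carrier V.
          diff W (f v) \<ominus>\<^bsub>W\<^esub> ksgn k n \<odot>\<^bsub>W\<^esub> f (diff V v))\<rparr>)"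

definition Hom_k :: "'k ring \<Rightarrow> ('k, 'v, 'y) dgspace_scheme \<Rightarrow> ('k, 'w, 'z) dgspace_scheme
    \<Rightarrow> ('k, 'v \<Rightarrow> 'w) dgspace" where
  "Hom_k k V W = hom_complex k V W (\<lambda>n. {f \<in> extensional (carrier V). deg_linear k V W n f})"

definition Hom_bimod :: "'k ring \<Rightarrow> ('k, 'a, 'z) dgspace_scheme
    \<Rightarrow> ('k, 'a, 'm) dgbimod \<Rightarrow> ('k, 'a, 'n) dgbimod \<Rightarrow> ('k, 'm \<Rightarrow> 'n) dgspace" where
  "Hom_bimod k A M N =
     hom_complex k M N (\<lambda>n. {f \<in> extensional (carrier M). bimod_linear k A M N n f})"

definition End_bimod :: "'k ring \<Rightarrow> ('k, 'a, 'z) dgspace_scheme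
    \<Rightarrow> ('k, 'a, 'm) dgbimod \<Rightarrow> ('k, 'm \<Rightarrow> 'm) dgspace" where
  "End_bimod k A M = (Hom_bimod k A M M)
     \<lparr>mult := compose (carrier M), one := (\<lambda>m\<in>carrier M. m)\<rparr>"

section \<open>Semi-projective approximations\<close>

text \<open>
  HOL cannot quantify over modules of all types at once, so the test modules range over those whose
  carrier lies in a type \<open>'u\<close>, which plays the role of a universe. It is left arbitrary:
  semi-projectivity in the usual sense is semi-projectivity relative to every \<open>'u\<close>. A single
  infinite \<open>'u\<close> at least as large as \<open>A\<close> and \<open>M\<close> already detects it.
\<close>

definition graded_projective :: "'u itself \<Rightarrow> 'k ring \<Rightarrow> ('k, 'a, 'z) dgspace_scheme
    \<Rightarrow> ('k, 'a, 'm) dgbimod \<Rightarrow> bool" where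
  "graded_projective u k A M \<longleftrightarrow>
    (\<forall>(X :: ('k, 'a, 'u) dgbimod) (Y :: ('k, 'a, 'u) dgbimod) q f.
       graded_bimodule k A X \<and> graded_bimodule k A Y
       \<and> bimod_linear k A X Y 0 q \<and> q ` carrier X = carrier Y \<and> bimod_linear k A M Y 0 f
       \<longrightarrow> (\<exists>g. bimod_linear k A M X 0 g \<and> (\<forall>m\<in>carrier M. q (g m) = f m)))"

definition semi_projective :: "'u itself \<Rightarrow> 'k ring \<Rightarrow> ('k, 'a, 'z) dgspace_scheme
    \<Rightarrow> ('k, 'a, 'm) dgbimod \<Rightarrow> bool" where
  "semi_projective u k A M \<longleftrightarrow> dg_bimodule k A M \<and> graded_projective u k A M
     \<and> (\<forall>N :: ('k, 'a, 'u) dgbimod. dg_bimodule k A N \<and> acyclic_space N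
          \<longrightarrow> acyclic_space (Hom_bimod k A M N))"

definition semi_proj_approx :: "'u itself \<Rightarrow> 'k ring \<Rightarrow> ('k, 'a) dgspace
    \<Rightarrow> ('k, 'a, 'm) dgbimod \<Rightarrow> ('m \<Rightarrow> 'a) \<Rightarrow> bool"
    \<comment> \<open>\<open>p\<close> is a semi-projective approximation of the bimodule \<open>A\<close>\<close> where
  "semi_proj_approx u k A M p \<longleftrightarrow> semi_projective u k A M
     \<and> bimod_linear k A M (regular_bimodule A) 0 p
     \<and> p ` carrier M = carrier A \<and> quasi_iso k M A p"

section \<open>Tensor products\<close>

text \<open>
  Elements of \<open>V \<otimes> W\<close> are formal sums of pairs, represented by lists, modulo the congruence
  generated by commutativity of addition, biadditivity and balancedness over \<open>k\<close>.
\<close>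

inductive tensor_eq for k :: "'k ring" and V :: "('k, 'v, 'y) dgspace_scheme"
    and W :: "('k, 'w, 'z) dgspace_scheme" where
  refl: "set xs \<subseteq> carrier V \<times> carrier W \<Longrightarrow> tensor_eq k V W xs xs"
| sym: "tensor_eq k V W xs ys \<Longrightarrow> tensor_eq k V W ys xs"
| trans: "tensor_eq k V W xs ys \<Longrightarrow> tensor_eq k V W ys zs \<Longrightarrow> tensor_eq k V W xs zs"
| app: "tensor_eq k V W xs xs' \<Longrightarrow> tensor_eq k V W ys ys' \<Longrightarrow> tensor_eq k V W (xs @ ys) (xs' @ ys')"
| comm: "set xs \<subseteq> carrier V \<times> carrier W \<Longrightarrow> set ys \<subseteq> carrier V \<times> carrier W
     \<Longrightarrow> tensor_eq k V W (xs @ ys) (ys @ xs)"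
| zero: "w \<in> carrier W \<Longrightarrow> tensor_eq k V W [(\<zero>\<^bsub>V\<^esub>, w)] []"
| add_left: "v \<in> carrier V \<Longrightarrow> v' \<in> carrier V \<Longrightarrow> w \<in> carrier W
     \<Longrightarrow> tensor_eq k V W [(v \<oplus>\<^bsub>V\<^esub> v', w)] [(v, w), (v', w)]"
| add_right: "v \<in> carrier V \<Longrightarrow> w \<in> carrier W \<Longrightarrow> w' \<in> carrier W
     \<Longrightarrow> tensor_eq k V W [(v, w \<oplus>\<^bsub>W\<^esub> w')] [(v, w), (v, w')]"
| balanced: "r \<in> carrier k \<Longrightarrow> v \<in> carrier V \<Longrightarrow> w \<in> carrier W
     \<Longrightarrow> tensor_eq k V W [(r \<odot>\<^bsub>V\<^esub> v, w)] [(v, r \<odot>\<^bsub>W\<^esub> w)]"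

definition tensor_class :: "'k ring \<Rightarrow> ('k, 'v, 'y) dgspace_scheme \<Rightarrow> ('k, 'w, 'z) dgspace_scheme
    \<Rightarrow> ('v \<times> 'w) list \<Rightarrow> ('v \<times> 'w) list set" where
  "tensor_class k V W xs = {ys. tensor_eq k V W xs ys}"

definition pure :: "'k ring \<Rightarrow> ('k, 'v, 'y) dgspace_scheme \<Rightarrow> ('k, 'w, 'z) dgspace_scheme
    \<Rightarrow> 'v \<Rightarrow> 'w \<Rightarrow> ('v \<times> 'w) list set" where
  "pure k V W v w = tensor_class k V W [(v, w)]"

text \<open>\<open>tlift X \<beta>\<close> is the additive map out of the tensor product induced by a bilinear map \<open>\<beta>\<close>.\<close>

definition tlift :: "('x, 'y) ring_scheme \<Rightarrow> ('v \<Rightarrow> 'w \<Rightarrow> 'x) \<Rightarrow> ('v \<times> 'w) list set \<Rightarrow> 'x" where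
  "tlift X \<beta> t = foldr (\<lambda>(v, w) s. \<beta> v w \<oplus>\<^bsub>X\<^esub> s) (SOME xs. xs \<in> t) \<zero>\<^bsub>X\<^esub>"

text \<open>The same for \<open>\<beta>\<close> prescribed on homogeneous \<open>v\<close>, \<open>w\<close> of degrees \<open>i\<close>, \<open>j\<close> by \<open>\<phi> i j v w\<close>.\<close>

definition tlift_hom :: "('k, 'v, 'y) dgspace_scheme \<Rightarrow> ('k, 'w, 'z) dgspace_scheme
    \<Rightarrow> ('x, 'p) ring_scheme \<Rightarrow> (int \<Rightarrow> int \<Rightarrow> 'v \<Rightarrow> 'w \<Rightarrow> 'x) \<Rightarrow> ('v \<times> 'w) list set \<Rightarrow> 'x" where
  "tlift_hom V W X \<phi> = tlift X (\<lambda>v w. hsum V X (\<lambda>i v'. hsum W X (\<lambda>j w'. \<phi> i j v' w') w) v)"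

definition tensor_graded :: "'k ring \<Rightarrow> ('k, 'v, 'y) dgspace_scheme \<Rightarrow> ('k, 'w, 'z) dgspace_scheme
    \<Rightarrow> ('k, ('v \<times> 'w) list set) dgspace" where
  "tensor_graded k V W =
    \<lparr>carrier = tensor_class k V W ` {xs. set xs \<subseteq> carrier V \<times> carrier W},
     mult = undefined, one = undefined,
     zero = tensor_class k V W [],
     add = (\<lambda>S T. \<Union>xs\<in>S. \<Union>ys\<in>T. tensor_class k V W (xs @ ys)),
     smult = (\<lambda>r S. \<Union>xs\<in>S. tensor_class k V W (map (\<lambda>(v, w). (r \<odot>\<^bsub>V\<^esub> v, w)) xs)),
     grade = (\<lambda>n. tensor_class k V W `
        {xs. \<forall>(v, w)\<in>set xs. \<exists>i j. v \<in> grade V i \<and> w \<in> grade W j \<and> i + j = n}),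
     diff = undefined\<rparr>"

definition tensor :: "'k ring \<Rightarrow> ('k, 'v, 'y) dgspace_scheme \<Rightarrow> ('k, 'w, 'z) dgspace_scheme
    \<Rightarrow> ('k, ('v \<times> 'w) list set) dgspace" where
  "tensor k V W = (let T = tensor_graded k V W in
     T\<lparr>diff := tlift_hom V W T (\<lambda>i j v w.
          pure k V W (diff V v) w \<oplus>\<^bsub>T\<^esub> ksgn k i \<odot>\<^bsub>T\<^esub> pure k V W v (diff W w))\<rparr>)"

section \<open>Curved dg coalgebras\<close>

record ('k, 'c) coalg = "('k, 'c) dgspace" +
  comult :: "'c \<Rightarrow> ('c \<times> 'c) list set"
  counit :: "'c \<Rightarrow> 'k"
  curv :: "'c \<Rightarrow> 'k"

text \<open>
  Sweedler notation: \<open>sweedler C X \<phi> c\<close> is the sum of \<open>\<phi> |c\<^sub>1| |c\<^sub>2| c\<^sub>1 c\<^sub>2\<close> in \<open>X\<close>.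
\<close>

definition sweedler :: "('k, 'c) coalg \<Rightarrow> ('x, 'z) ring_scheme
    \<Rightarrow> (int \<Rightarrow> int \<Rightarrow> 'c \<Rightarrow> 'c \<Rightarrow> 'x) \<Rightarrow> 'c \<Rightarrow> 'x" where
  "sweedler C X \<phi> c = tlift_hom C C X \<phi> (comult C c)"

text \<open>A linear form on \<open>C\<close> of degree \<open>n\<close>, the field \<open>k\<close> being placed in degree \<open>0\<close>.\<close>

definition deg_form :: "'k ring \<Rightarrow> ('k, 'c, 'z) dgspace_scheme \<Rightarrow> int \<Rightarrow> ('c \<Rightarrow> 'k) \<Rightarrow> bool" where
  "deg_form k C n f \<longleftrightarrow> f \<in> carrier C \<rightarrow> carrier k
     \<and> (\<forall>x\<in>carrier C. \<forall>y\<in>carrier C. f (x \<oplus>\<^bsub>C\<^esub> y) = f x \<oplus>\<^bsub>k\<^esub> f y)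
     \<and> (\<forall>r\<in>carrier k. \<forall>x\<in>carrier C. f (r \<odot>\<^bsub>C\<^esub> x) = r \<otimes>\<^bsub>k\<^esub> f x)
     \<and> (\<forall>i. i + n \<noteq> 0 \<longrightarrow> (\<forall>x\<in>grade C i. f x = \<zero>\<^bsub>k\<^esub>))"

definition graded_coalgebra :: "'k ring \<Rightarrow> ('k, 'c) coalg \<Rightarrow> bool" where
  "graded_coalgebra k C \<longleftrightarrow> graded_space k C
     \<and> deg_linear k C (tensor k C C) 0 (comult C) \<and> deg_form k C 0 (counit C)
     \<and> (let CC = tensor k C C; CCC = tensor k CC C in \<forall>c\<in>carrier C.
          sweedler C CCC (\<lambda>_ _ x y. sweedler C CCC (\<lambda>_ _ p q. pure k CC C (pure k C C p q) y) x) c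
        = sweedler C CCC (\<lambda>_ _ x y. sweedler C CCC (\<lambda>_ _ p q. pure k CC C (pure k C C x p) q) y) c)
     \<and> (\<forall>c\<in>carrier C. sweedler C C (\<lambda>_ _ x y. counit C x \<odot>\<^bsub>C\<^esub> y) c = c
          \<and> sweedler C C (\<lambda>_ _ x y. counit C y \<odot>\<^bsub>C\<^esub> x) c = c)"

definition curved_dg_coalgebra :: "'k ring \<Rightarrow> ('k, 'c) coalg \<Rightarrow> bool" where
  "curved_dg_coalgebra k C \<longleftrightarrow> graded_coalgebra k C
     \<and> deg_linear k C C 1 (diff C)
     \<and> (\<forall>c\<in>carrier C. comult C (diff C c) = diff (tensor k C C) (comult C c))
     \<and> deg_form k C 2 (curv C)
     \<and> (\<forall>c\<in>carrier C. diff C (diff C c)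
          = sweedler C C (\<lambda>_ _ x y. curv C x \<odot>\<^bsub>C\<^esub> y \<ominus>\<^bsub>C\<^esub> curv C y \<odot>\<^bsub>C\<^esub> x) c)
     \<and> (\<forall>c\<in>carrier C. curv C (diff C c) = \<zero>\<^bsub>k\<^esub>)"

definition subcoalgebra :: "'k ring \<Rightarrow> ('k, 'c) coalg \<Rightarrow> 'c set \<Rightarrow> bool" where
  "subcoalgebra k C S \<longleftrightarrow> submodule S k C
     \<and> comult C ` S \<subseteq> tensor_class k C C ` {xs. set xs \<subseteq> S \<times> S}"

definition simple_subcoalgebra :: "'k ring \<Rightarrow> ('k, 'c) coalg \<Rightarrow> 'c set \<Rightarrow> bool" where
  "simple_subcoalgebra k C S \<longleftrightarrow> subcoalgebra k C S \<and> S \<noteq> {\<zero>\<^bsub>C\<^esub>}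
     \<and> (\<forall>T. subcoalgebra k C T \<and> T \<subseteq> S \<longrightarrow> T = {\<zero>\<^bsub>C\<^esub>} \<or> T = S)"

text \<open>The sum of a family of subspaces is the smallest subspace containing all of them.\<close>

definition coradical :: "'k ring \<Rightarrow> ('k, 'c) coalg \<Rightarrow> 'c set" where
  "coradical k C = \<Inter>{U. submodule U k C \<and> (\<forall>S. simple_subcoalgebra k C S \<longrightarrow> S \<subseteq> U)}"

definition connected_coalgebra :: "'k ring \<Rightarrow> ('k, 'c) coalg \<Rightarrow> bool" where
  "connected_coalgebra k C \<longleftrightarrow>
     (\<exists>g\<in>carrier C. g \<noteq> \<zero>\<^bsub>C\<^esub> \<and> coradical k C = {r \<odot>\<^bsub>C\<^esub> g |r. r \<in> carrier k})
     \<and> diff C ` coradical k C \<subseteq> coradical k C"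

section \<open>Twisting cochains\<close>

text \<open>\<open>conv k C A n f g\<close> is the convolution product \<open>f * g\<close> for \<open>g\<close> homogeneous of degree \<open>n\<close>.\<close>

definition conv :: "'k ring \<Rightarrow> ('k, 'c) coalg \<Rightarrow> ('k, 'a) dgspace \<Rightarrow> int
    \<Rightarrow> ('c \<Rightarrow> 'a) \<Rightarrow> ('c \<Rightarrow> 'a) \<Rightarrow> 'c \<Rightarrow> 'a" where
  "conv k C A n f g =
     (\<lambda>c\<in>carrier C. sweedler C A (\<lambda>i _ x y. ksgn k (i * n) \<odot>\<^bsub>A\<^esub> (f x \<otimes>\<^bsub>A\<^esub> g y)) c)"

definition twisting_cochain :: "'k ring \<Rightarrow> ('k, 'c) coalg \<Rightarrow> ('k, 'a) dgspace
    \<Rightarrow> ('c \<Rightarrow> 'a) \<Rightarrow> bool" where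
  "twisting_cochain k C A \<pi> \<longleftrightarrow> \<pi> \<in> extensional (carrier C) \<and> deg_linear k C A 1 \<pi>
     \<and> (\<forall>c\<in>carrier C. \<ominus>\<^bsub>A\<^esub> (curv C c \<odot>\<^bsub>A\<^esub> \<one>\<^bsub>A\<^esub>) \<ominus>\<^bsub>A\<^esub> (diff A (\<pi> c) \<oplus>\<^bsub>A\<^esub> \<pi> (diff C c))
          \<oplus>\<^bsub>A\<^esub> conv k C A 1 \<pi> \<pi> c = \<zero>\<^bsub>A\<^esub>)"

definition Hom_tw :: "'k ring \<Rightarrow> ('k, 'c) coalg \<Rightarrow> ('k, 'a) dgspace \<Rightarrow> ('c \<Rightarrow> 'a)
    \<Rightarrow> ('k, 'c \<Rightarrow> 'a) dgspace" where
  "Hom_tw k C A \<pi> = (let H = Hom_k k C A in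
     H\<lparr>mult := (\<lambda>f g. hsum H H (\<lambda>n g'. conv k C A n f g') g),
       one := (\<lambda>c\<in>carrier C. counit C c \<odot>\<^bsub>A\<^esub> \<one>\<^bsub>A\<^esub>),
       diff := hsum H H (\<lambda>n f. diff H f \<ominus>\<^bsub>H\<^esub>
          (conv k C A n \<pi> f \<ominus>\<^bsub>H\<^esub> ksgn k n \<odot>\<^bsub>H\<^esub> conv k C A 1 f \<pi>))\<rparr>)"

section \<open>The twisted tensor product\<close>

abbreviation ACA :: "'k ring \<Rightarrow> ('k, 'a) dgspace \<Rightarrow> ('k, 'c) coalg
    \<Rightarrow> ('k, (('a \<times> 'c) list set \<times> 'a) list set) dgspace" where
  "ACA k A C \<equiv> tensor k (tensor k A C) A"

definition pure3 :: "'k ring \<Rightarrow> ('k, 'a) dgspace \<Rightarrow> ('k, 'c) coalg \<Rightarrow> 'a \<Rightarrow> 'c \<Rightarrow> 'a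
    \<Rightarrow> (('a \<times> 'c) list set \<times> 'a) list set" where
  "pure3 k A C a c b = pure k (tensor k A C) A (pure k A C a c) b"

text \<open>
  The additive map on \<open>A \<otimes> C \<otimes> A\<close> given by \<open>\<phi> |a| |c| a c b\<close> on \<open>a \<otimes> c \<otimes> b\<close> with \<open>a\<close>, \<open>c\<close>
  homogeneous.
\<close>

definition lift3 :: "('k, 'a) dgspace \<Rightarrow> ('k, 'c) coalg \<Rightarrow> ('x, 'z) ring_scheme
    \<Rightarrow> (int \<Rightarrow> int \<Rightarrow> 'a \<Rightarrow> 'c \<Rightarrow> 'a \<Rightarrow> 'x) \<Rightarrow> (('a \<times> 'c) list set \<times> 'a) list set \<Rightarrow> 'x" where
  "lift3 A C X \<phi> = tlift X (\<lambda>u b. tlift_hom A C X (\<lambda>i j a c. \<phi> i j a c b) u)"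

definition twisted_tensor :: "'k ring \<Rightarrow> ('k, 'a) dgspace \<Rightarrow> ('k, 'c) coalg \<Rightarrow> ('c \<Rightarrow> 'a)
    \<Rightarrow> ('k, 'a, (('a \<times> 'c) list set \<times> 'a) list set) dgbimod" where
  "twisted_tensor k A C \<pi> = (let T = ACA k A C in dgspace.extend
     (T\<lparr>diff := (\<lambda>t. diff T t \<oplus>\<^bsub>T\<^esub> lift3 A C T (\<lambda>i j a c b.
          sweedler C T (\<lambda>p q x y. ksgn k i \<odot>\<^bsub>T\<^esub> pure3 k A C (a \<otimes>\<^bsub>A\<^esub> \<pi> x) y b) c
          \<ominus>\<^bsub>T\<^esub> sweedler C T (\<lambda>p q x y. ksgn k (i + p) \<odot>\<^bsub>T\<^esub> pure3 k A C a x (\<pi> y \<otimes>\<^bsub>A\<^esub> b)) c) t)\<rparr>)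
     (dgbimod.fields
       (\<lambda>a'. lift3 A C T (\<lambda>_ _ a c b. pure3 k A C (a' \<otimes>\<^bsub>A\<^esub> a) c b))
       (\<lambda>t b'. lift3 A C T (\<lambda>_ _ a c b. pure3 k A C a c (b \<otimes>\<^bsub>A\<^esub> b')) t)))"

definition tw_augmentation :: "('k, 'a) dgspace \<Rightarrow> ('k, 'c) coalg
    \<Rightarrow> (('a \<times> 'c) list set \<times> 'a) list set \<Rightarrow> 'a" where
  "tw_augmentation A C = lift3 A C A (\<lambda>_ _ a c b. counit C c \<odot>\<^bsub>A\<^esub> (a \<otimes>\<^bsub>A\<^esub> b))"

definition admissible :: "'k ring \<Rightarrow> ('k, 'c) coalg \<Rightarrow> ('k, 'a) dgspace \<Rightarrow> ('c \<Rightarrow> 'a) \<Rightarrow> bool" where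
  "admissible k C A \<pi> \<longleftrightarrow> connected_coalgebra k C \<and> (\<forall>c\<in>coradical k C. \<pi> c = \<zero>\<^bsub>A\<^esub>)"

definition acyclic_cochain :: "'k ring \<Rightarrow> ('k, 'c) coalg \<Rightarrow> ('k, 'a) dgspace \<Rightarrow> ('c \<Rightarrow> 'a)
    \<Rightarrow> bool" where
  "acyclic_cochain k C A \<pi> \<longleftrightarrow> admissible k C A \<pi>
     \<and> quasi_iso k (twisted_tensor k A C \<pi>) A (tw_augmentation A C)"

definition l_map :: "'k ring \<Rightarrow> ('k, 'c) coalg \<Rightarrow> ('k, 'a) dgspace \<Rightarrow> ('c \<Rightarrow> 'a) \<Rightarrow> ('c \<Rightarrow> 'a)
    \<Rightarrow> (('a \<times> 'c) list set \<times> 'a) list set \<Rightarrow> (('a \<times> 'c) list set \<times> 'a) list set" where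
  "l_map k C A \<pi> = (let K = twisted_tensor k A C \<pi> in
     hsum (Hom_tw k C A \<pi>) (End_bimod k A K) (\<lambda>n f. \<lambda>t\<in>carrier K.
       lift3 A C K (\<lambda>i j a c b.
         sweedler C K (\<lambda>p q x y. ksgn k (n * (i + p)) \<odot>\<^bsub>K\<^esub> pure3 k A C a x (f y \<otimes>\<^bsub>A\<^esub> b)) c) t))"

end

(*
  As a graded bimodule K = A (x) C (x) A is free on the elements 1 (x) c (x) 1, so bimodule maps out of K are linear
  maps out of C and all identities are checked on these generators; l is injective because composing l(f) with the
  augmentation K -> A gives back f, and the dg algebra axioms of Hom^pi(C, A) are pulled back along l.

  If C is connected, the annihilators W_n of the powers of the ideal of linear forms vanishing on the grouplike element
  exhaust C, and in the differential of a generator with c in W_(n+1) all terms involving pi lie over W_n because pi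
  vanishes on the coradical. A contraction of an acyclic bimodule N therefore yields, by successive approximation along
  W_n, a primitive of every cocycle of Hom(K, N); hence K is semi-projective. For acyclic pi, Hom(K, ker(K -> A)) is
  then acyclic, so the surjection Hom(K, K) -> Hom(K, A) is a quasi-isomorphism; its composite with l is bijective, so l
  is one too. Any other semi-projective approximation of A is homotopy equivalent to K, hence has the same cohomology
  ring of endomorphisms.
*)
theory Submission
  imports Defs
begin

section \<open>Signs and graded spaces\<close>

\<comment> \<open>That the \<open>W_n\<close> exhaust C is not formal: the coradical is defined by
  simple subcoalgebras, and the step from there to a filtration rests on local finiteness, namely on
  each comultiplication being a finite sum. Dimensions of subspaces are measured by counting pivots.
  The \<open>W_n\<close> are defined by all linear forms, homogeneous or not, and are not shown to
  be graded or stable under \<open>d_C\<close>. Koszul signs are therefore absorbed into linear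
  operators before the filtration is used. The approximation controls only the twisting terms of a
  generator, while \<open>d_C c\<close> is handled through the cocycle equation. For a curved C the
  square of \<open>d_C\<close> is not 0; its curvature terms cancel in the square of the twisted
  differential against those of the twisting equation. Semi-projectivity of another approximation M
  is tested by modules in a fixed type only, so K, A and the kernel of K -> A have to be copied into
  that type along injections. The comparison F |-> \<alpha> F \<beta> of endomorphisms respects
  products only up to coboundaries, and the passage to cohomology rings is set up for such
  maps.\<close>
syntax
  "_subid" :: "id \<Rightarrow> index" ("\<^sub>_" [1000] 1000)
  "_sublongid" :: "longid \<Rightarrow> index" ("\<^sub>_" [1000] 1000)
translations
  "_subid x" \<rightharpoonup> "_index x"
  "_sublongid x" \<rightharpoonup> "_index x"

text \<open>Many records below share carrier, addition and zero but differ in other fields, such as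
  \<open>T\<close> and \<open>K\<close>, or \<open>A\<close> and its regular bimodule. This and the
  following lemmas move sums, negatives and lifts from one to the other.\<close>

lemma finsum_cong_struct:
  assumes "carrier G = carrier H" "add G = add H" "zero G = zero H"
  shows "finsum G f S = finsum H f S" using assms unfolding finsum_def finprod_def by simp

lemma a_inv_cong_struct:
  assumes "carrier G = carrier H" "add G = add H" "zero G = zero H"
  shows "a_inv G x = a_inv H x" using assms unfolding a_inv_def m_inv_def by simp

lemma a_minus_cong_struct:
  assumes "carrier G = carrier H" "add G = add H" "zero G = zero H"
  shows "a_minus G x y = a_minus H x y" using assms a_inv_cong_struct[OF assms] unfolding a_minus_def by simp

lemma hsum_cong_struct:
  assumes "carrier G = carrier H" "add G = add H" "zero G = zero H"
  shows "hsum V G \<phi> v = hsum V H \<phi> v" unfolding hsum_def by (rule finsum_cong_struct[OF assms])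

lemma tlift_cong_struct:
  assumes "add G = add H" "zero G = zero H"
  shows "tlift G \<beta> t = tlift H \<beta> t" unfolding tlift_def using assms by simp

lemma ksgn_0 [simp]: "ksgn k 0 = \<one>\<^sub>k" by (simp add: ksgn_def)

lemma ksgn_cong: "even m = even n ==> ksgn k m = ksgn k n" by (simp add: ksgn_def)

lemma ksgn_closed [simp]: "ring k ==> ksgn k n \<in> carrier k"
proof -
  assume "ring k" then interpret ring k .
  show ?thesis by (simp add: ksgn_def)
qed

lemma ksgn_mult:
  assumes "ring k" shows "ksgn k m \<otimes>\<^sub>k ksgn k n = ksgn k (m + n)"
proof -
  interpret ring k by fact
  show ?thesis by (auto simp add: ksgn_def l_minus r_minus)
qed

locale kmod = module k V for k :: "'k ring" and V :: "('k, 'v, 'z) module_scheme"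
begin

lemma ksgn_cl [simp]: "ksgn k n \<in> carrier k" using R.ring_axioms by (rule ksgn_closed)

lemma ksgn_ksgn: "x \<in> carrier V ==> ksgn k m \<odot>\<^sub>V (ksgn k n \<odot>\<^sub>V x) = ksgn k (m + n) \<odot>\<^sub>V x"
  by (simp add: smult_assoc1[symmetric] ksgn_mult[OF R.ring_axioms])

lemma ksgn_even: "even n ==> x \<in> carrier V ==> ksgn k n \<odot>\<^sub>V x = x" by (simp add: ksgn_def)

lemma ksgn_odd: "odd n ==> x \<in> carrier V ==> ksgn k n \<odot>\<^sub>V x = \<ominus>\<^sub>V x" by (simp add: ksgn_def smult_l_minus)

lemma minus_as_ksgn: "x \<in> carrier V ==> \<ominus>\<^sub>V x = ksgn k 1 \<odot>\<^sub>V x" by (simp add: ksgn_odd)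

lemma smult_comm: "r \<in> carrier k ==> s \<in> carrier k ==> x \<in> carrier V
    ==> r \<odot>\<^sub>V (s \<odot>\<^sub>V x) = s \<odot>\<^sub>V (r \<odot>\<^sub>V x)" by (metis smult_assoc1 R.m_comm)

lemma diff_zero_eq: "x \<in> carrier V ==> y \<in> carrier V ==> x \<ominus>\<^sub>V y = \<zero>\<^sub>V ==> x = y"
  using M.minus_equality[of x "\<ominus>\<^sub>V y"] by (simp add: a_minus_def)

text \<open>Cancellations in product rules and in squares of differentials end here: two copies of
  one element whose signs have opposite parity.\<close>

lemma ksgn_add_zero:
  assumes "x \<in> carrier V" "odd (m + n)"
  shows "ksgn k m \<odot>\<^sub>V x \<oplus>\<^sub>V ksgn k n \<odot>\<^sub>V x = \<zero>\<^sub>V"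
  using assms by (cases "even m") (auto simp: ksgn_odd ksgn_even M.l_neg M.r_neg)

abbreviation "subm S \<equiv> submodule S k V"

text \<open>Negation is scalar multiplication by -1, so closure under it follows from closure under
  scalars.\<close>

lemma submI:
  assumes "S \<subseteq> carrier V" "\<zero>\<^sub>V \<in> S" "!!x y. x \<in> S ==> y \<in> S ==> x \<oplus>\<^sub>V y \<in> S"
    "!!r x. r \<in> carrier k ==> x \<in> S ==> r \<odot>\<^sub>V x \<in> S"
  shows "subm S"
proof (rule submoduleI[OF assms(1,2)])
  show "\<ominus>\<^sub>V x \<in> S" if "x \<in> S" for x using assms(4)[of "ksgn k 1" x] assms(1) that by (auto simp: minus_as_ksgn)
qed (use assms in auto)

lemma subm_car: "subm S ==> x \<in> S ==> x \<in> carrier V"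
  and subm_add: "subm S ==> x \<in> S ==> y \<in> S ==> x \<oplus>\<^sub>V y \<in> S"
  and subm_smult: "subm S ==> r \<in> carrier k ==> x \<in> S ==> r \<odot>\<^sub>V x \<in> S"
  and subm_uminus: "subm S ==> x \<in> S ==> \<ominus>\<^sub>V x \<in> S" using submoduleE(1)[of S] by (blast, simp_all add: submoduleE(3-5))

lemma subm_zero: "subm S ==> \<zero>\<^sub>V \<in> S" using submoduleE(2)[of S] subm_smult[of S "\<zero>\<^sub>k"] subm_car[of S] by fastforce

abbreviation "gsums G \<equiv> {v. \<exists>N u. finite N & (\<forall>n. u n \<in> G n) & v = (\<Oplus>\<^sub>V n\<in>N. u n)}"

text \<open>Both families are padded by zero to the union of their index sets, so that they can be
  added degree by degree. Tensor products and Hom spaces obtain their homogeneous decompositions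
  from this.\<close>

lemma gsums_subm:
  fixes G :: "int => 'v set"
  assumes s: "!!n. subm (G n)" shows "subm (gsums G)"
proof (rule submI)
  have c: "u n \<in> carrier V" if "\<forall>n. u n \<in> G n" for u n using subm_car[OF s] that by blast
  thus "gsums G \<subseteq> carrier V" by (auto intro!: M.finsum_closed)
  show "\<zero>\<^sub>V \<in> gsums G" using subm_zero[OF s] by (auto intro!: exI[of _ "{}"] exI[of _ "%_. \<zero>\<^sub>V"])
  show "r \<odot>\<^sub>V x \<in> gsums G" if r: "r \<in> carrier k" and "x \<in> gsums G" for r x
  proof -
    obtain N u where u: "finite N" "\<forall>n. u n \<in> G n" "x = (\<Oplus>\<^sub>V n\<in>N. u n)" using \<open>x \<in> gsums G\<close> by blast
    have "r \<odot>\<^sub>V x = (\<Oplus>\<^sub>V n\<in>N. r \<odot>\<^sub>V u n)" unfolding u(3) by (rule finsum_smult_ldistr[OF u(1) r]) (use c[OF u(2)] in blast)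
    moreover have "\<forall>n. r \<odot>\<^sub>V u n \<in> G n" using u(2) r subm_smult[OF s] by blast
    ultimately show ?thesis using u(1) by (intro CollectI exI[of _ N] exI[of _ "%n. r \<odot>\<^sub>V u n"] conjI)
  qed
  fix x y assume "x \<in> gsums G" "y \<in> gsums G"
  then obtain N u N' u' where u: "finite N" "\<forall>n. u n \<in> G n" "x = (\<Oplus>\<^sub>V n\<in>N. u n)"
    and u': "finite N'" "\<forall>n. u' n \<in> G n" "y = (\<Oplus>\<^sub>V n\<in>N'. u' n)" by blast
  let ?u = "%n. if n \<in> N then u n else \<zero>\<^sub>V" and ?u' = "%n. if n \<in> N' then u' n else \<zero>\<^sub>V"
  have g: "?u n \<in> G n" "?u' n \<in> G n" for n using u(2) u'(2) subm_zero[OF s] by simp_all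
  have "x = (\<Oplus>\<^sub>V n\<in>N \<union> N'. ?u n)" "y = (\<Oplus>\<^sub>V n\<in>N \<union> N'. ?u' n)"
    unfolding u(3) u'(3) by (rule M.add.finprod_mono_neutral_cong_left; use u(1) u'(1) c[OF u(2)] c[OF u'(2)] in auto)+
  moreover have "?u \<in> S \<rightarrow> carrier V" "?u' \<in> S \<rightarrow> carrier V" for S using c[OF u(2)] c[OF u'(2)] by auto
  ultimately have "x \<oplus>\<^sub>V y = (\<Oplus>\<^sub>V n\<in>N \<union> N'. ?u n \<oplus>\<^sub>V ?u' n)" by (simp add: M.finsum_addf)
  moreover have "\<forall>n. ?u n \<oplus>\<^sub>V ?u' n \<in> G n" using subm_add[OF s] g by blast
  ultimately show "x \<oplus>\<^sub>V y \<in> gsums G" using u(1) u'(1)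
    by (intro CollectI exI[of _ "N \<union> N'"] exI[of _ "%n. ?u n \<oplus>\<^sub>V ?u' n"] conjI finite_UnI)
qed

lemma gsums_member: "(!!n. subm (G n)) ==> x \<in> G n ==> x \<in> gsums G" using subm_zero[of "G _"] subm_car[of "G n" x]
  by (auto intro!: exI[of _ "{n}"] exI[of _ "%i. if i = n then x else \<zero>\<^sub>V"] simp: M.finsum_insert M.r_zero)

end

section \<open>Additive and linear maps\<close>

definition additive :: "('v, 'y) ring_scheme => ('w, 'z) ring_scheme => ('v => 'w) => bool" where
  "additive V W f \<longleftrightarrow> f \<in> carrier V \<rightarrow> carrier W
     & (\<forall>x\<in>carrier V. \<forall>y\<in>carrier V. f (x \<oplus>\<^sub>V y) = f x \<oplus>\<^sub>W f y)"

lemma additiveD: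
  assumes "additive V W f"
  shows "x \<in> carrier V ==> f x \<in> carrier W"
    and "x \<in> carrier V ==> y \<in> carrier V ==> f (x \<oplus>\<^sub>V y) = f x \<oplus>\<^sub>W f y" using assms by (auto simp: additive_def)

lemma additive_hom:
  assumes "abelian_group V" "abelian_group W" "additive V W f"
  shows "abelian_group_hom V W f"
proof -
  interpret V: abelian_group V by fact
  interpret W: abelian_group W by fact
  show ?thesis using additiveD[OF assms(3)] by unfold_locales (auto simp: hom_def)
qed

lemma additive_zero:
  assumes "abelian_group V" "abelian_group W" "additive V W f"
  shows "f \<zero>\<^sub>V = \<zero>\<^sub>W" using abelian_group_hom.hom_zero[OF additive_hom[OF assms]] .

lemma additive_minus:
  assumes "abelian_group V" "abelian_group W" "additive V W f" "x \<in> carrier V"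
  shows "f (\<ominus>\<^sub>V x) = \<ominus>\<^sub>W f x"
proof -
  interpret abelian_group_hom V W f by (rule additive_hom[OF assms(1-3)])
  show ?thesis using assms(4) by (rule hom_a_inv)
qed

lemma additive_diff:
  assumes "abelian_group V" "abelian_group W" "additive V W f" "x \<in> carrier V" "y \<in> carrier V"
  shows "f (x \<ominus>\<^sub>V y) = f x \<ominus>\<^sub>W f y"
proof -
  interpret V: abelian_group V by fact
  show ?thesis using assms additiveD[OF assms(3)] additive_minus[OF assms(1-3)] by (simp add: a_minus_def)
qed

lemma additive_finsum:
  assumes "abelian_group V" "abelian_group W" "additive V W f" "finite S" "g \<in> S \<rightarrow> carrier V"
  shows "f (\<Oplus>\<^sub>V i\<in>S. g i) = (\<Oplus>\<^sub>W i\<in>S. f (g i))"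
proof -
  interpret V: abelian_group V by fact
  interpret W: abelian_group W by fact
  show ?thesis using assms(4,5)
  proof (induction S)
    case empty thus ?case using additive_zero[OF assms(1-3)] by simp
  next
    case (insert a S)
    thus ?case using additiveD[OF assms(3)] by (simp add: V.finsum_insert W.finsum_insert Pi_iff V.finsum_closed)
  qed
qed

lemma klinearD:
  assumes "klinear k V W f"
  shows "x \<in> carrier V ==> f x \<in> carrier W"
    and "x \<in> carrier V ==> y \<in> carrier V ==> f (x \<oplus>\<^sub>V y) = f x \<oplus>\<^sub>W f y"
    and "r \<in> carrier k ==> x \<in> carrier V ==> f (r \<odot>\<^sub>V x) = r \<odot>\<^sub>W f x" using assms by (auto simp: klinear_def)

lemma klinear_additive: "klinear k V W f ==> additive V W f" by (auto simp: klinear_def additive_def)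

lemma deg_klinear: "deg_linear k V W n f ==> klinear k V W f" by (simp add: deg_linear_def)

lemmas deg_linearD = klinearD[OF deg_klinear]
lemmas deg_additive = klinear_additive[OF deg_klinear]

lemma deg_linear_grade: "deg_linear k V W n f ==> x \<in> grade V i ==> f x \<in> grade W (i + n)" by (auto simp: deg_linear_def)

lemma klinear_compose:
  "klinear k U V f ==> klinear k V W g ==> klinear k U W (%x. g (f x))" by (auto simp: klinear_def Pi_iff)

lemma deg_linear_compose:
  "deg_linear k U V m f ==> deg_linear k V W n g ==> deg_linear k U W (m + n) (%x. g (f x))" by (fastforce simp: deg_linear_def klinear_compose add.assoc)

section \<open>Homogeneous components\<close>

locale gspace = kmod k V for k :: "'k ring" and V :: "('k, 'v, 'z) dgspace_scheme" +
  assumes gs: "graded_space k V"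

lemma gspaceI: "graded_space k V ==> gspace k V" by (simp add: gspace_def kmod_def gspace_axioms_def graded_space_def)

context gspace begin

lemma gsub: "submodule (grade V i) k V" using gs by (simp add: graded_space_def)

lemma gcar: "x \<in> grade V i ==> x \<in> carrier V" using submoduleE(1)[OF gsub] by blast

lemma g_add [simp]: "x \<in> grade V i ==> y \<in> grade V i ==> x \<oplus>\<^sub>V y \<in> grade V i" using submoduleE(5)[OF gsub] by blast

lemma g_smult [simp]: "r \<in> carrier k ==> y \<in> grade V i ==> r \<odot>\<^sub>V y \<in> grade V i" using submoduleE(4)[OF gsub] by blast

lemma g_uminus [simp]: "y \<in> grade V i ==> \<ominus>\<^sub>V y \<in> grade V i" using submoduleE(3)[OF gsub] by blast

lemma g_minus [simp]: "x \<in> grade V i ==> y \<in> grade V i ==> x \<ominus>\<^sub>V y \<in> grade V i" by (simp add: a_minus_def)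

lemma g_zero [simp]: "\<zero>\<^sub>V \<in> grade V i" using submoduleE(2)[OF gsub] g_minus by (metis M.r_neg a_minus_def ex_in_conv gcar)

lemma ab: "abelian_group V" ..

lemma hdecomp_hcomp: "v \<in> carrier V ==> hdecomp V v (%i. hcomp V i v)"
proof -
  assume "v \<in> carrier V"
  hence "\<exists>!u. hdecomp V v u" using gs by (simp add: graded_space_def)
  hence "hdecomp V v (THE u. hdecomp V v u)" by (rule theI')
  thus ?thesis unfolding hcomp_def by simp
qed

lemma hcomp_unique: "v \<in> carrier V ==> hdecomp V v u ==> hcomp V i v = u i"
proof -
  assume v: "v \<in> carrier V" and u: "hdecomp V v u"
  hence "\<exists>!u. hdecomp V v u" using gs by (simp add: graded_space_def)
  hence "(%i. hcomp V i v) = u" using u hdecomp_hcomp[OF v] by blast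
  thus ?thesis by (rule fun_cong)
qed

lemma hcomp_g [simp]: "v \<in> carrier V ==> hcomp V i v \<in> grade V i" using hdecomp_hcomp by (auto simp: hdecomp_def)

lemma hcomp_cl [simp]: "v \<in> carrier V ==> hcomp V i v \<in> carrier V" using hcomp_g gcar by blast

lemma hcomp_finite: "v \<in> carrier V ==> finite {i. hcomp V i v ~= \<zero>\<^sub>V}" using hdecomp_hcomp by (auto simp: hdecomp_def)

lemma finsum_supp:
  assumes "abelian_group X" "finite S" "!!i. i \<notin> T ==> f i = \<zero>\<^sub>X" "T \<subseteq> S" "!!i. i \<in> S ==> f i \<in> carrier X"
  shows "(\<Oplus>\<^sub>X i\<in>T. f i) = (\<Oplus>\<^sub>X i\<in>S. f i)"
proof -
  interpret X: abelian_group X by fact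
  show ?thesis using assms(2-) by (intro X.add.finprod_mono_neutral_cong_left) auto
qed

lemma hcomp_sum:
  assumes "v \<in> carrier V" "finite S" "{i. hcomp V i v ~= \<zero>\<^sub>V} \<subseteq> S"
  shows "v = (\<Oplus>\<^sub>V i\<in>S. hcomp V i v)" using finsum_supp[OF ab assms(2) _ assms(3), of "%i. hcomp V i v"] hdecomp_hcomp[OF assms(1)] assms(1)
  by (auto simp: hdecomp_def)

lemma hdecompI:
  assumes "!!i. u i \<in> grade V i" "finite S" "!!i. i \<notin> S ==> u i = \<zero>\<^sub>V" "v = (\<Oplus>\<^sub>V i\<in>S. u i)"
  shows "hdecomp V v u"
proof -
  have "{i. u i ~= \<zero>\<^sub>V} \<subseteq> S" using assms by auto
  thus ?thesis unfolding hdecomp_def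
    using assms finsum_supp[OF ab assms(2), of "{i. u i ~= \<zero>\<^sub>V}" u] gcar[OF assms(1)] by (auto intro: finite_subset)
qed

text \<open>Extending the family by zero outside \<open>S\<close> gives a homogeneous decomposition
  of the sum, and decompositions are unique.\<close>

lemma hcomp_of_sum:
  assumes "!!i. i \<in> S ==> u i \<in> grade V i" "finite S"
  shows "hcomp V i (\<Oplus>\<^sub>V i\<in>S. u i) = (if i \<in> S then u i else \<zero>\<^sub>V)"
proof -
  let ?u = "%i. if i \<in> S then u i else \<zero>\<^sub>V"
  have *: "(\<Oplus>\<^sub>V i\<in>S. u i) = (\<Oplus>\<^sub>V i\<in>S. ?u i)" by (rule M.finsum_cong') (use gcar[OF assms(1)] in auto)
  have "hdecomp V (\<Oplus>\<^sub>V i\<in>S. u i) ?u" unfolding * by (rule hdecompI[of _ S]) (use assms in auto)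
  moreover have "(\<Oplus>\<^sub>V i\<in>S. u i) \<in> carrier V" by (rule M.finsum_closed) (auto intro!: gcar assms)
  ultimately show ?thesis using hcomp_unique by blast
qed

lemma hcomp_hom:
  assumes "x \<in> grade V i" shows "hcomp V j x = (if j = i then x else \<zero>\<^sub>V)"
proof -
  have "x = (\<Oplus>\<^sub>V i\<in>{i}. x)" using assms gcar by (simp add: M.finsum_insert)
  thus ?thesis using hcomp_of_sum[of "{i}" "%_. x" j] assms by auto
qed

lemma hcomp_add:
  assumes "x \<in> carrier V" "y \<in> carrier V"
  shows "hcomp V i (x \<oplus>\<^sub>V y) = hcomp V i x \<oplus>\<^sub>V hcomp V i y"
proof -
  let ?S = "{i. hcomp V i x ~= \<zero>\<^sub>V} \<union> {i. hcomp V i y ~= \<zero>\<^sub>V}"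
  have f: "finite ?S" using hcomp_finite assms by auto
  have "(\<Oplus>\<^sub>V i\<in>?S. hcomp V i x \<oplus>\<^sub>V hcomp V i y) = x \<oplus>\<^sub>V y"
    using hcomp_sum[OF assms(1) f] hcomp_sum[OF assms(2) f] assms
      M.finsum_addf[of "%i. hcomp V i x" ?S "%i. hcomp V i y"] by auto
  hence "hdecomp V (x \<oplus>\<^sub>V y) (%i. hcomp V i x \<oplus>\<^sub>V hcomp V i y)" by (intro hdecompI[of _ ?S]) (use assms f in auto)
  thus ?thesis using hcomp_unique assms by auto
qed

lemma hcomp_smult:
  assumes "x \<in> carrier V" "r \<in> carrier k"
  shows "hcomp V i (r \<odot>\<^sub>V x) = r \<odot>\<^sub>V hcomp V i x"
proof -
  let ?S = "{i. hcomp V i x ~= \<zero>\<^sub>V}"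
  have f: "finite ?S" using hcomp_finite assms by auto
  have "(\<Oplus>\<^sub>V i\<in>?S. r \<odot>\<^sub>V hcomp V i x) = r \<odot>\<^sub>V x" using hcomp_sum[OF assms(1) f] assms f
      finsum_smult_ldistr[of ?S r "%i. hcomp V i x"] by auto
  hence "hdecomp V (r \<odot>\<^sub>V x) (%i. r \<odot>\<^sub>V hcomp V i x)" by (intro hdecompI[of _ ?S]) (use assms f in auto)
  thus ?thesis using hcomp_unique assms by auto
qed

lemma graded_induct [consumes 1, case_names hom add]:
  assumes "v \<in> carrier V" "!!i x. x \<in> grade V i ==> P x"
    "!!x y. x \<in> carrier V ==> y \<in> carrier V ==> P x ==> P y ==> P (x \<oplus>\<^sub>V y)"
  shows "P v"
proof -
  have "P (\<Oplus>\<^sub>V i\<in>S. hcomp V i v)" if "finite S" for S using that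
  proof induction
    case empty thus ?case using assms(2)[OF g_zero] by simp
  next
    case (insert a S)
    have "(\<Oplus>\<^sub>V i\<in>S. hcomp V i v) \<in> carrier V" using assms(1) by (intro M.finsum_closed) auto
    thus ?case using insert assms(1) assms(2)[OF hcomp_g] by (subst M.finsum_insert) (auto intro!: assms(3))
  qed
  from this[OF hcomp_finite[OF assms(1)]] show ?thesis by (rule iffD2[OF arg_cong[OF hcomp_sum[OF assms(1) hcomp_finite[OF assms(1)] subset_refl], of P]])
qed

lemma additive_eqI:
  assumes "abelian_group X" "additive V X f" "additive V X g" "v \<in> carrier V"
    "!!i x. x \<in> grade V i ==> f x = g x"
  shows "f v = g v" using assms(4)
proof (induction rule: graded_induct)
  case (hom i x) thus ?case by (rule assms(5))
next
  case (add x y) thus ?case by (simp add: additiveD(2)[OF assms(2)] additiveD(2)[OF assms(3)])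
qed

end

section \<open>Additive extension of formulas given on homogeneous elements\<close>

definition addfam :: "('k, 'v, 'z) dgspace_scheme => ('x, 'y) ring_scheme => (int => 'v => 'x) => bool" where
  "addfam V X \<phi> \<longleftrightarrow> (\<forall>i. \<forall>x\<in>grade V i. \<phi> i x \<in> carrier X &
     (\<forall>y\<in>grade V i. \<phi> i (x \<oplus>\<^sub>V y) = \<phi> i x \<oplus>\<^sub>X \<phi> i y))"

lemma addfam_zero:
  assumes "graded_space k V" "abelian_group X" "addfam V X \<phi>"
  shows "\<phi> i \<zero>\<^sub>V = \<zero>\<^sub>X"
proof -
  interpret V: gspace k V using assms by (simp add: gspaceI)
  interpret X: abelian_group X by fact
  have "\<phi> i \<zero>\<^sub>V \<in> carrier X" using assms(3) by (auto simp: addfam_def)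
  moreover have "\<phi> i (\<zero>\<^sub>V \<oplus>\<^sub>V \<zero>\<^sub>V) = \<phi> i \<zero>\<^sub>V \<oplus>\<^sub>X \<phi> i \<zero>\<^sub>V"
    using assms(3) unfolding addfam_def by (meson V.g_zero)
  ultimately show ?thesis by simp
qed

context gspace begin

text \<open>Summands outside the support vanish because an additive family sends 0 to 0; two
  elements can thus be treated over one common index set.\<close>

lemma hsum_over:
  assumes "abelian_group X" "addfam V X \<phi>" "v \<in> carrier V" "finite S" "{i. hcomp V i v ~= \<zero>\<^sub>V} \<subseteq> S"
  shows "hsum V X \<phi> v = (\<Oplus>\<^sub>X i\<in>S. \<phi> i (hcomp V i v))"
  unfolding hsum_def using assms addfam_zero[OF gs assms(1,2)] hcomp_g[OF assms(3)] by (intro finsum_supp) (auto simp: addfam_def)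

lemma hsum_additive:
  assumes "abelian_group X" "addfam V X \<phi>"
  shows "additive V X (hsum V X \<phi>)"
proof -
  interpret X: abelian_group X by fact
  have cl: "\<phi> i (hcomp V i x) \<in> carrier X" if "x \<in> carrier V" for i x using assms(2) that hcomp_g by (auto simp: addfam_def)
  show ?thesis unfolding additive_def
  proof (intro conjI ballI Pi_I)
    fix x assume x: "x \<in> carrier V"
    show "hsum V X \<phi> x \<in> carrier X" unfolding hsum_def using cl[OF x] by (intro X.finsum_closed) auto
    fix y assume y: "y \<in> carrier V"
    let ?S = "{i. hcomp V i x ~= \<zero>\<^sub>V} \<union> {i. hcomp V i y ~= \<zero>\<^sub>V}"
    have f: "finite ?S" using hcomp_finite x y by auto
    have s: "{i. hcomp V i (x \<oplus>\<^sub>V y) ~= \<zero>\<^sub>V} \<subseteq> ?S" using x y by (auto simp: hcomp_add)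
    have "hsum V X \<phi> (x \<oplus>\<^sub>V y) = (\<Oplus>\<^sub>X i\<in>?S. \<phi> i (hcomp V i (x \<oplus>\<^sub>V y)))"
      by (rule hsum_over) (use assms x y f s in auto)
    also have "... = (\<Oplus>\<^sub>X i\<in>?S. \<phi> i (hcomp V i x) \<oplus>\<^sub>X \<phi> i (hcomp V i y))"
      using x y cl assms(2) by (intro X.finsum_cong') (auto simp: hcomp_add addfam_def)
    also have "... = hsum V X \<phi> x \<oplus>\<^sub>X hsum V X \<phi> y"
      using X.finsum_addf[of "%i. \<phi> i (hcomp V i x)" ?S "%i. \<phi> i (hcomp V i y)"] cl x y
        hsum_over[OF assms x f] hsum_over[OF assms y f] by auto
    finally show "hsum V X \<phi> (x \<oplus>\<^sub>V y) = hsum V X \<phi> x \<oplus>\<^sub>X hsum V X \<phi> y" .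
  qed
qed

lemma hsum_hom:
  assumes "abelian_group X" "addfam V X \<phi>" "x \<in> grade V i"
  shows "hsum V X \<phi> x = \<phi> i x"
proof -
  interpret X: abelian_group X by fact
  have "hsum V X \<phi> x = (\<Oplus>\<^sub>X i\<in>{i}. \<phi> i (hcomp V i x))" by (rule hsum_over) (use assms gcar hcomp_hom[OF assms(3)] in auto)
  also have "... = \<phi> i x" using assms hcomp_hom[OF assms(3)] by (subst X.finsum_insert) (auto simp: addfam_def)
  finally show ?thesis .
qed

lemma hsum_smult:
  assumes "module k X" "addfam V X \<phi>" "x \<in> carrier V" "r \<in> carrier k"
    "!!i x. x \<in> grade V i ==> \<phi> i (r \<odot>\<^sub>V x) = r \<odot>\<^sub>X \<phi> i x"
  shows "hsum V X \<phi> (r \<odot>\<^sub>V x) = r \<odot>\<^sub>X hsum V X \<phi> x"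
proof -
  interpret X: module k X by fact
  have abX: "abelian_group X" ..
  have 1: "additive V X (%x. hsum V X \<phi> (r \<odot>\<^sub>V x))" "additive V X (%x. r \<odot>\<^sub>X hsum V X \<phi> x)"
    using additiveD[OF hsum_additive[OF abX assms(2)]] assms(4) by (auto simp: additive_def smult_r_distr X.smult_r_distr)
  show ?thesis using abX 1 assms(3) by (rule additive_eqI) (simp add: hsum_hom[OF abX assms(2)] hsum_hom[OF abX assms(2) g_smult[OF assms(4)]] assms(5))
qed

lemma deg_linearI:
  assumes "module k W" "klinear k V W f" "!!i x. x \<in> grade V i ==> f x \<in> grade W (i + n)"
  shows "deg_linear k V W n f" using assms by (auto simp: deg_linear_def)

end

text \<open>The difference of two decompositions of one element is a vanishing sum of homogeneous
  elements, so the independence \<open>ind\<close> gives uniqueness.\<close>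

lemma graded_spaceI:
  assumes m: "module k V" and s: "!!i. submodule (grade V i) k V"
    and ex: "!!v. v \<in> carrier V ==> \<exists>N u. finite N & (\<forall>n\<in>N. u n \<in> grade V n) & v = (\<Oplus>\<^sub>V n\<in>N. u n)"
    and ind: "!!N u n. finite N ==> (!!i. u i \<in> grade V i) ==> (\<Oplus>\<^sub>V i\<in>N. u i) = \<zero>\<^sub>V ==> n \<in> N ==> u n = \<zero>\<^sub>V"
  shows "graded_space k V"
proof -
  interpret V: kmod k V using m by (simp add: kmod_def)
  note gE = V.submoduleE[OF s]
  have gcar: "x \<in> grade V i ==> x \<in> carrier V" for x i using gE(1) by blast
  have z: "\<zero>\<^sub>V \<in> grade V i" for i using gE(2,3,5) by (metis V.M.r_neg ex_in_conv gcar)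
  have "\<exists>!u. hdecomp V v u" if v: "v \<in> carrier V" for v
  proof (rule ex_ex1I)
    obtain N u where N: "finite N" "\<forall>n\<in>N. u n \<in> grade V n" "v = (\<Oplus>\<^sub>V n\<in>N. u n)" using ex[OF v] by blast
    let ?u = "%n. if n \<in> N then u n else \<zero>\<^sub>V"
    have "(\<Oplus>\<^sub>V n\<in>N. u n) = (\<Oplus>\<^sub>V n\<in>N. ?u n)" by (rule V.M.finsum_cong') (use N gcar in auto)
    also have "... = (\<Oplus>\<^sub>V n\<in>{i. ?u i ~= \<zero>\<^sub>V}. ?u n)" by (rule V.M.add.finprod_mono_neutral_cong_right) (use N gcar in auto)
    finally have "hdecomp V v ?u" unfolding hdecomp_def using N z by (auto intro: rev_finite_subset[OF N(1)])
    thus "\<exists>u. hdecomp V v u" by blast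
  next
    fix u w assume u: "hdecomp V v u" and w: "hdecomp V v w"
    let ?N = "{i. u i ~= \<zero>\<^sub>V} \<union> {i. w i ~= \<zero>\<^sub>V}"
    have f: "finite ?N" using u w by (auto simp: hdecomp_def)
    have uc: "u i \<in> carrier V" "w i \<in> carrier V" for i using u w gcar by (auto simp: hdecomp_def)
    have e: "v = (\<Oplus>\<^sub>V i\<in>?N. u i)" "v = (\<Oplus>\<^sub>V i\<in>?N. w i)"
    proof -
      have "(\<Oplus>\<^sub>V i\<in>{i. u i ~= \<zero>\<^sub>V}. u i) = (\<Oplus>\<^sub>V i\<in>?N. u i)"
        "(\<Oplus>\<^sub>V i\<in>{i. w i ~= \<zero>\<^sub>V}. w i) = (\<Oplus>\<^sub>V i\<in>?N. w i)"
        by (rule V.M.add.finprod_mono_neutral_cong_left; use uc f in auto)+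
      thus "v = (\<Oplus>\<^sub>V i\<in>?N. u i)" "v = (\<Oplus>\<^sub>V i\<in>?N. w i)" using u w unfolding hdecomp_def by metis+
    qed
    have lin: "additive V V (%x. \<ominus>\<^sub>V x)" by (auto simp: additive_def V.M.minus_add)
    have "(\<Oplus>\<^sub>V i\<in>?N. \<ominus>\<^sub>V w i) = \<ominus>\<^sub>V v"
      using additive_finsum[OF _ _ lin f, of w] uc e(2) V.M.abelian_group_axioms by auto
    hence "(\<Oplus>\<^sub>V i\<in>?N. u i \<ominus>\<^sub>V w i) = \<zero>\<^sub>V"
      using V.M.finsum_addf[of u ?N "%i. \<ominus>\<^sub>V w i"] uc e(1) v by (auto simp: a_minus_def V.M.r_neg)
    hence "u i \<ominus>\<^sub>V w i = \<zero>\<^sub>V" if "i \<in> ?N" for i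
      using ind[OF f, of "%i. u i \<ominus>\<^sub>V w i" i] that u w gE(3,5) by (auto simp: hdecomp_def a_minus_def)
    hence "u i = w i" for i using uc V.diff_zero_eq[of "u i" "w i"] by (cases "i \<in> ?N") auto
    thus "u = w" by (rule ext)
  qed
  thus ?thesis using m s by (simp add: graded_space_def)
qed

section \<open>Tensor products\<close>

definition bilin :: "'k ring => ('k, 'v, 'y) dgspace_scheme => ('k, 'w, 'z) dgspace_scheme
    => ('k, 'x, 'p) dgspace_scheme => ('v => 'w => 'x) => bool" where
  "bilin k V W X \<beta> \<longleftrightarrow>
     (\<forall>v\<in>carrier V. \<forall>w\<in>carrier W. \<beta> v w \<in> carrier X
       & (\<forall>v'\<in>carrier V. \<beta> (v \<oplus>\<^sub>V v') w = \<beta> v w \<oplus>\<^sub>X \<beta> v' w)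
       & (\<forall>w'\<in>carrier W. \<beta> v (w \<oplus>\<^sub>W w') = \<beta> v w \<oplus>\<^sub>X \<beta> v w')
       & (\<forall>r\<in>carrier k. \<beta> (r \<odot>\<^sub>V v) w = r \<odot>\<^sub>X \<beta> v w & \<beta> v (r \<odot>\<^sub>W w) = r \<odot>\<^sub>X \<beta> v w))"

lemma bilinD:
  assumes "bilin k V W X \<beta>"
  shows "v \<in> carrier V ==> w \<in> carrier W ==> \<beta> v w \<in> carrier X"
    and "v \<in> carrier V ==> w \<in> carrier W ==> v' \<in> carrier V ==> \<beta> (v \<oplus>\<^sub>V v') w = \<beta> v w \<oplus>\<^sub>X \<beta> v' w"
    and "v \<in> carrier V ==> w \<in> carrier W ==> w' \<in> carrier W ==> \<beta> v (w \<oplus>\<^sub>W w') = \<beta> v w \<oplus>\<^sub>X \<beta> v w'"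
    and "v \<in> carrier V ==> w \<in> carrier W ==> r \<in> carrier k ==> \<beta> (r \<odot>\<^sub>V v) w = r \<odot>\<^sub>X \<beta> v w"
    and "v \<in> carrier V ==> w \<in> carrier W ==> r \<in> carrier k ==> \<beta> v (r \<odot>\<^sub>W w) = r \<odot>\<^sub>X \<beta> v w"
  using assms by (simp_all add: bilin_def)

lemma bilin_left: "bilin k V W X \<beta> ==> w \<in> carrier W ==> klinear k V X (%v. \<beta> v w)"
  and bilin_right: "bilin k V W X \<beta> ==> v \<in> carrier V ==> klinear k W X (\<beta> v)" by (auto simp: bilin_def klinear_def)

definition tsum :: "('x, 'p) ring_scheme => ('v => 'w => 'x) => ('v \<times> 'w) list => 'x" where
  "tsum X \<beta> xs = foldr (%(v, w) s. \<beta> v w \<oplus>\<^sub>X s) xs \<zero>\<^sub>X"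

lemma tsum_simps [simp]:
  "tsum X \<beta> [] = \<zero>\<^sub>X" "tsum X \<beta> ((v, w) # xs) = \<beta> v w \<oplus>\<^sub>X tsum X \<beta> xs" by (simp_all add: tsum_def)

locale tens = V: gspace k V + W: gspace k W
  for k :: "'k ring" and V :: "('k, 'v, 'y) dgspace_scheme" and W :: "('k, 'w, 'z) dgspace_scheme"
begin

abbreviation "cVW \<equiv> carrier V \<times> carrier W"
abbreviation "teq \<equiv> tensor_eq k V W"
abbreviation "cls \<equiv> tensor_class k V W"
abbreviation "VW \<equiv> tensor k V W"
abbreviation "p \<equiv> pure k V W"

lemma teq_sub: "teq xs ys ==> set xs \<subseteq> cVW & set ys \<subseteq> cVW" by (induction rule: tensor_eq.induct) auto

lemma cls_eq: "set xs \<subseteq> cVW ==> cls xs = cls ys \<longleftrightarrow> teq xs ys" unfolding tensor_class_def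
  using tensor_eq.refl tensor_eq.sym tensor_eq.trans by blast

lemma cls_self: "set xs \<subseteq> cVW ==> xs \<in> cls xs" by (simp add: tensor_class_def tensor_eq.refl)

lemma mem_cls: "ys \<in> cls xs ==> teq xs ys" by (simp add: tensor_class_def)

lemma VW_simps:
  "carrier VW = cls ` {xs. set xs \<subseteq> cVW}"
  "\<zero>\<^sub>VW = cls []"
  "grade VW n = cls ` {xs. \<forall>(v, w)\<in>set xs. \<exists>i j. v \<in> grade V i & w \<in> grade W j & i + j = n}"
  by (simp_all add: tensor_def tensor_graded_def Let_def)

lemma cls_add: "set xs \<subseteq> cVW ==> set ys \<subseteq> cVW ==> cls xs \<oplus>\<^sub>VW cls ys = cls (xs @ ys)"
proof -
  assume a: "set xs \<subseteq> cVW" "set ys \<subseteq> cVW"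
  have "cls (xs' @ ys') = cls (xs @ ys)" if "xs' \<in> cls xs" "ys' \<in> cls ys" for xs' ys'
    using tensor_eq.app[OF mem_cls[OF that(1)] mem_cls[OF that(2)]] a cls_eq[of "xs @ ys" "xs' @ ys'"] by auto
  hence "(\<Union>xs\<in>cls xs. \<Union>ys\<in>cls ys. cls (xs @ ys)) = cls (xs @ ys)" using cls_self[OF a(1)] cls_self[OF a(2)] by blast
  thus ?thesis by (simp add: tensor_def tensor_graded_def Let_def)
qed

lemma teq_smult: "teq xs ys ==> r \<in> carrier k ==>
    teq (map (%(v, w). (r \<odot>\<^sub>V v, w)) xs) (map (%(v, w). (r \<odot>\<^sub>V v, w)) ys)"
proof (induction rule: tensor_eq.induct)
  case (refl xs) thus ?case by (intro tensor_eq.refl) auto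
next
  case (sym xs ys) thus ?case by (blast intro: tensor_eq.sym)
next
  case (trans xs ys zs) thus ?case by (blast intro: tensor_eq.trans)
next
  case (app xs xs' ys ys') thus ?case by (simp add: tensor_eq.app)
next
  case (comm xs ys)
  have "set (map (%(v, w). (r \<odot>\<^sub>V v, w)) xs) \<subseteq> cVW" "set (map (%(v, w). (r \<odot>\<^sub>V v, w)) ys) \<subseteq> cVW" using comm by auto
  thus ?case unfolding map_append by (rule tensor_eq.comm)
next
  case (zero w) thus ?case by (simp add: tensor_eq.zero)
next
  case (add_left v v' w) thus ?case by (simp add: V.smult_r_distr tensor_eq.add_left)
next
  case (add_right v w w') thus ?case by (simp add: tensor_eq.add_right)
next
  case (balanced s v w)
  hence "teq [(s \<odot>\<^sub>V (r \<odot>\<^sub>V v), w)] [(r \<odot>\<^sub>V v, s \<odot>\<^sub>W w)]" by (simp add: tensor_eq.balanced)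
  thus ?case using balanced by (simp add: V.smult_comm[of r s v])
qed

lemma cls_smult: "set xs \<subseteq> cVW ==> r \<in> carrier k ==>
    r \<odot>\<^sub>VW cls xs = cls (map (%(v, w). (r \<odot>\<^sub>V v, w)) xs)"
proof -
  assume a: "set xs \<subseteq> cVW" "r \<in> carrier k"
  let ?f = "map (%(v, w). (r \<odot>\<^sub>V v, w))"
  have "cls (?f xs') = cls (?f xs)" if "xs' \<in> cls xs" for xs'
  proof -
    have t: "teq (?f xs) (?f xs')" by (rule teq_smult[OF mem_cls[OF that] a(2)])
    thus ?thesis using cls_eq[of "?f xs" "?f xs'"] teq_sub[OF t] by simp
  qed
  hence "(\<Union>xs\<in>cls xs. cls (?f xs)) = cls (?f xs)" using cls_self[OF a(1)] by blast
  thus ?thesis by (simp add: tensor_def tensor_graded_def Let_def)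
qed

lemma car_cases: "t \<in> carrier VW ==> (!!xs. set xs \<subseteq> cVW ==> t = cls xs ==> thesis) ==> thesis" by (auto simp: VW_simps)

lemma cls_car: "set xs \<subseteq> cVW ==> cls xs \<in> carrier VW" by (auto simp: VW_simps)

lemma cls_cong: "teq xs ys ==> cls xs = cls ys" using cls_eq teq_sub by blast

lemma pure_car [simp]: "v \<in> carrier V ==> w \<in> carrier W ==> p v w \<in> carrier VW" unfolding pure_def by (rule cls_car) auto

lemma cls_Cons: "v \<in> carrier V ==> w \<in> carrier W ==> set xs \<subseteq> cVW ==> cls ((v, w) # xs) = p v w \<oplus>\<^sub>VW cls xs"
  unfolding pure_def by (subst cls_add) auto

lemma cls_induct [consumes 1, case_names Nil Cons]:
  assumes "set xs \<subseteq> cVW" "P []"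
    "!!v w xs. v \<in> carrier V ==> w \<in> carrier W ==> set xs \<subseteq> cVW ==> P xs ==> P ((v, w) # xs)"
  shows "P xs" using assms(1) by (induction xs) (auto intro: assms)

lemma abVW: "abelian_group VW"
proof (rule abelian_groupI)
  fix x y z assume x: "x \<in> carrier VW" and y: "y \<in> carrier VW" and z: "z \<in> carrier VW"
  obtain xs where xs: "set xs \<subseteq> cVW" "x = cls xs" using x by (rule car_cases)
  obtain ys where ys: "set ys \<subseteq> cVW" "y = cls ys" using y by (rule car_cases)
  obtain zs where zs: "set zs \<subseteq> cVW" "z = cls zs" using z by (rule car_cases)
  show "x \<oplus>\<^sub>VW y \<oplus>\<^sub>VW z = x \<oplus>\<^sub>VW (y \<oplus>\<^sub>VW z)" using xs ys zs by (simp add: cls_add)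
next
  fix x y assume x: "x \<in> carrier VW" and y: "y \<in> carrier VW"
  obtain xs where xs: "set xs \<subseteq> cVW" "x = cls xs" using x by (rule car_cases)
  obtain ys where ys: "set ys \<subseteq> cVW" "y = cls ys" using y by (rule car_cases)
  show "x \<oplus>\<^sub>VW y \<in> carrier VW" using xs ys by (simp add: cls_add cls_car)
  show "x \<oplus>\<^sub>VW y = y \<oplus>\<^sub>VW x" using xs ys cls_cong[OF tensor_eq.comm[OF xs(1) ys(1)]] by (simp add: cls_add)
next
  show "\<zero>\<^sub>VW \<in> carrier VW" using cls_car[of "[]"] by (simp add: VW_simps)
next
  fix x assume x: "x \<in> carrier VW"
  obtain xs where xs: "set xs \<subseteq> cVW" "x = cls xs" using x by (rule car_cases)
  show "\<zero>\<^sub>VW \<oplus>\<^sub>VW x = x" using xs by (simp add: VW_simps(2) cls_add)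
  \<comment> \<open>Negating the left entries inverts a formal sum: the pairs with left entries
    \<open>v\<close> and \<open>\<ominus>\<^sub>V v\<close> are brought together by commutativity
    and merge to a pair with left entry 0.\<close>
  let ?n = "map (%(v, w). (\<ominus>\<^sub>V v, w))"
  have "teq (?n ys @ ys) []" if "set ys \<subseteq> cVW" for ys using that
  proof (induction rule: cls_induct)
    case Nil thus ?case by (simp add: tensor_eq.refl)
  next
    case (Cons v w xs)
    have n: "set (?n xs) \<subseteq> cVW" using Cons by auto
    have "teq [(\<ominus>\<^sub>V v \<oplus>\<^sub>V v, w)] [(\<ominus>\<^sub>V v, w), (v, w)]" using Cons by (intro tensor_eq.add_left) auto
    hence 1: "teq [(\<ominus>\<^sub>V v, w), (v, w)] []" using Cons tensor_eq.zero[of w W k V] by (simp add: V.M.l_neg) (metis tensor_eq.sym tensor_eq.trans)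
    have "teq ([(\<ominus>\<^sub>V v, w)] @ (?n xs @ [(v, w)]) @ xs) ([(\<ominus>\<^sub>V v, w)] @ ([(v, w)] @ ?n xs) @ xs)"
      by (intro tensor_eq.app tensor_eq.comm tensor_eq.refl) (use Cons n in auto)
    moreover have "teq ([(\<ominus>\<^sub>V v, w), (v, w)] @ (?n xs @ xs)) ([] @ [])" by (intro tensor_eq.app 1 Cons)
    ultimately show ?case using tensor_eq.trans by fastforce
  qed
  from cls_cong[OF this[OF xs(1)]] have "cls (?n xs) \<oplus>\<^sub>VW x = \<zero>\<^sub>VW" using xs by (subst xs(2), subst cls_add) (auto simp: VW_simps)
  moreover have "cls (?n xs) \<in> carrier VW" using xs by (intro cls_car) auto
  ultimately show "\<exists>y\<in>carrier VW. y \<oplus>\<^sub>VW x = \<zero>\<^sub>VW" by blast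
qed

sublocale VW: abelian_group VW by (rule abVW)

lemma pure_add_left: "v \<in> carrier V ==> v' \<in> carrier V ==> w \<in> carrier W ==> p (v \<oplus>\<^sub>V v') w = p v w \<oplus>\<^sub>VW p v' w"
  using cls_cong[OF tensor_eq.add_left[of v V v' w W k]] unfolding pure_def by (subst cls_add) auto

lemma pure_add_right: "v \<in> carrier V ==> w' \<in> carrier W ==> w \<in> carrier W ==> p v (w \<oplus>\<^sub>W w') = p v w \<oplus>\<^sub>VW p v w'"
  using cls_cong[OF tensor_eq.add_right[of v V w W w' k]] unfolding pure_def by (subst cls_add) auto

lemma pure_smult_left: "v \<in> carrier V ==> w \<in> carrier W ==> r \<in> carrier k ==> p (r \<odot>\<^sub>V v) w = r \<odot>\<^sub>VW p v w"
  unfolding pure_def by (subst cls_smult) auto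

lemma pure_smult_right: "v \<in> carrier V ==> w \<in> carrier W ==> r \<in> carrier k ==> p v (r \<odot>\<^sub>W w) = r \<odot>\<^sub>VW p v w"
  using cls_cong[OF tensor_eq.balanced[of r k v V w W]] pure_smult_left unfolding pure_def by auto

lemma smult_closed_VW: "r \<in> carrier k ==> x \<in> carrier VW ==> r \<odot>\<^sub>VW x \<in> carrier VW"
  by (erule car_cases) (use V.smult_closed in \<open>fastforce simp: cls_smult intro!: cls_car\<close>)

lemma smult_add_VW: "r \<in> carrier k ==> x \<in> carrier VW ==> y \<in> carrier VW ==>
    r \<odot>\<^sub>VW (x \<oplus>\<^sub>VW y) = r \<odot>\<^sub>VW x \<oplus>\<^sub>VW r \<odot>\<^sub>VW y"
proof (erule car_cases, erule car_cases)
  fix xs ys assume r: "r \<in> carrier k" and "set xs \<subseteq> cVW" "x = cls xs" "set ys \<subseteq> cVW" "y = cls ys"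
  moreover from this have "set (map (%(v, w). (r \<odot>\<^sub>V v, w)) xs) \<subseteq> cVW"
    "set (map (%(v, w). (r \<odot>\<^sub>V v, w)) ys) \<subseteq> cVW" using V.smult_closed by auto
  ultimately show ?thesis by (simp add: cls_add cls_smult)
qed

lemma smult_zero_VW: "r \<in> carrier k ==> r \<odot>\<^sub>VW \<zero>\<^sub>VW = \<zero>\<^sub>VW" by (simp add: VW_simps cls_smult)

lemma t_induct [consumes 1, case_names zero pure]:
  assumes "t \<in> carrier VW" "P \<zero>\<^sub>VW"
    "!!v w t. v \<in> carrier V ==> w \<in> carrier W ==> t \<in> carrier VW ==> P t ==> P (p v w \<oplus>\<^sub>VW t)"
  shows "P t"
proof -
  obtain xs where xs: "set xs \<subseteq> cVW" "t = cls xs" using assms(1) by (rule car_cases)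
  from xs(1) have "P (cls xs)" by (induction rule: cls_induct) (use assms in \<open>auto simp: VW_simps(2) cls_Cons cls_car\<close>)
  thus ?thesis using xs by simp
qed

lemma modVW: "module k VW"
proof (rule moduleI)
  fix a b x assume a: "a \<in> carrier k" and b: "b \<in> carrier k" and x: "x \<in> carrier VW"
  show "(a \<oplus>\<^sub>k b) \<odot>\<^sub>VW x = a \<odot>\<^sub>VW x \<oplus>\<^sub>VW b \<odot>\<^sub>VW x" using x
  proof (induction rule: t_induct)
    case zero thus ?case using a b by (simp add: smult_zero_VW)
  next
    case (pure v w t)
    thus ?case using a b by (simp add: smult_add_VW pure_smult_left[symmetric] V.smult_l_distr pure_add_left
          smult_closed_VW VW.a_ac)
  qed
  show "(a \<otimes>\<^sub>k b) \<odot>\<^sub>VW x = a \<odot>\<^sub>VW (b \<odot>\<^sub>VW x)" using x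
  proof (induction rule: t_induct)
    case zero thus ?case using a b by (simp add: smult_zero_VW)
  next
    case (pure v w t)
    thus ?case using a b by (simp add: smult_add_VW pure_smult_left[symmetric] V.smult_assoc1 pure_add_left
          smult_closed_VW)
  qed
next
  fix x assume x: "x \<in> carrier VW"
  thus "\<one>\<^sub>k \<odot>\<^sub>VW x = x"
  proof (induction rule: t_induct)
    case zero thus ?case by (simp add: smult_zero_VW)
  next
    case (pure v w t)
    thus ?case by (simp add: smult_add_VW pure_smult_left[symmetric])
  qed
qed (simp_all add: V.R.cring_axioms abVW smult_closed_VW smult_add_VW)

sublocale VW: kmod k VW by (simp add: kmod_def modVW)

lemma tsum_closed: "abelian_group X ==> (!!v w. v \<in> carrier V ==> w \<in> carrier W ==> \<beta> v w \<in> carrier X) ==>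
    set xs \<subseteq> cVW ==> tsum X \<beta> xs \<in> carrier X"
proof -
  assume "abelian_group X" and b: "!!v w. v \<in> carrier V ==> w \<in> carrier W ==> \<beta> v w \<in> carrier X"
  then interpret X: abelian_group X by simp
  show "set xs \<subseteq> cVW ==> tsum X \<beta> xs \<in> carrier X" by (induction rule: cls_induct) (auto simp: b)
qed

lemma tsum_append: "abelian_group X ==> (!!v w. v \<in> carrier V ==> w \<in> carrier W ==> \<beta> v w \<in> carrier X) ==>
    set xs \<subseteq> cVW ==> set ys \<subseteq> cVW ==> tsum X \<beta> (xs @ ys) = tsum X \<beta> xs \<oplus>\<^sub>X tsum X \<beta> ys"
proof -
  assume "abelian_group X" and b: "!!v w. v \<in> carrier V ==> w \<in> carrier W ==> \<beta> v w \<in> carrier X" and ys: "set ys \<subseteq> cVW"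
  then interpret X: abelian_group X by simp
  note c = tsum_closed[OF X.abelian_group_axioms, of \<beta>, OF b]
  show "set xs \<subseteq> cVW ==> tsum X \<beta> (xs @ ys) = tsum X \<beta> xs \<oplus>\<^sub>X tsum X \<beta> ys"
    by (induction rule: cls_induct) (auto simp: b c ys X.a_assoc)
qed

text \<open>This is the universal property of the tensor product. The bilinear relations are
  respected by \<beta>, and the other rules of the congruence hold for sums in any commutative
  group.\<close>

lemma tsum_teq:
  assumes "module k X" "bilin k V W X \<beta>" "teq xs ys"
  shows "tsum X \<beta> xs = tsum X \<beta> ys"
proof -
  interpret X: kmod k X using assms(1) by (simp add: kmod_def)
  note b = bilinD[OF assms(2)]
  note c = tsum_closed[OF X.M.abelian_group_axioms, of \<beta>, OF b(1)]
  note a = tsum_append[OF X.M.abelian_group_axioms, of \<beta>, OF b(1)]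
  from assms(3) show ?thesis
  proof (induction rule: tensor_eq.induct)
    case (app xs xs' ys ys')
    thus ?case using teq_sub by (simp add: a)
  next
    case (comm xs ys) thus ?case by (simp add: a c X.a_comm)
  next
    case (zero w)
    have "\<beta> \<zero>\<^sub>V w = \<zero>\<^sub>X" using b(4)[of "\<zero>\<^sub>V" w "\<zero>\<^sub>k"] b(1)[of "\<zero>\<^sub>V" w] zero by simp
    thus ?case by simp
  qed (simp_all add: b X.a_ac)
qed

text \<open>The representative chosen by \<open>SOME\<close> does not matter, since all lists in a
  class have the same sum.\<close>

lemma tlift_cls:
  assumes "module k X" "bilin k V W X \<beta>" "set xs \<subseteq> cVW"
  shows "tlift X \<beta> (cls xs) = tsum X \<beta> xs"
proof -
  have "(SOME ys. ys \<in> cls xs) \<in> cls xs" using cls_self[OF assms(3)] by (rule someI)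
  from tsum_teq[OF assms(1,2) mem_cls[OF this]] show ?thesis by (simp add: tlift_def tsum_def)
qed

lemma tlift_pure:
  assumes "module k X" "bilin k V W X \<beta>" "v \<in> carrier V" "w \<in> carrier W"
  shows "tlift X \<beta> (p v w) = \<beta> v w"
proof -
  interpret X: kmod k X using assms(1) by (simp add: kmod_def)
  show ?thesis using assms bilinD(1)[OF assms(2)] by (simp add: pure_def tlift_cls)
qed

lemma tlift_additive:
  assumes "module k X" "bilin k V W X \<beta>"
  shows "additive VW X (tlift X \<beta>)"
proof -
  interpret X: kmod k X using assms(1) by (simp add: kmod_def)
  note b = bilinD[OF assms(2)]
  note c = tsum_closed[OF X.M.abelian_group_axioms, of \<beta>, OF b(1)]
  note a = tsum_append[OF X.M.abelian_group_axioms, of \<beta>, OF b(1)]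
  show ?thesis unfolding additive_def
  proof (intro conjI ballI Pi_I)
    fix x assume x: "x \<in> carrier VW"
    obtain xs where xs: "set xs \<subseteq> cVW" "x = cls xs" using x by (rule car_cases)
    show "tlift X \<beta> x \<in> carrier X" using xs by (simp add: tlift_cls[OF assms] c)
    fix y assume y: "y \<in> carrier VW"
    obtain ys where ys: "set ys \<subseteq> cVW" "y = cls ys" using y by (rule car_cases)
    show "tlift X \<beta> (x \<oplus>\<^sub>VW y) = tlift X \<beta> x \<oplus>\<^sub>X tlift X \<beta> y"
      using xs ys by (simp add: cls_add tlift_cls[OF assms] a)
  qed
qed

lemma t_additive_eqI:
  assumes "abelian_group X" "additive VW X f" "additive VW X g" "t \<in> carrier VW"
    "!!v w. v \<in> carrier V ==> w \<in> carrier W ==> f (p v w) = g (p v w)"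
  shows "f t = g t" using assms(4)
proof (induction rule: t_induct)
  case zero thus ?case using additive_zero[OF abVW assms(1)] assms(2,3) by metis
next
  case (pure v w t) thus ?case using assms(5) by (simp add: additiveD(2)[OF assms(2)] additiveD(2)[OF assms(3)])
qed

lemma tlift_klinear:
  assumes "module k X" "bilin k V W X \<beta>"
  shows "klinear k VW X (tlift X \<beta>)"
proof -
  interpret X: kmod k X using assms(1) by (simp add: kmod_def)
  note ad = additiveD[OF tlift_additive[OF assms]]
  have "tlift X \<beta> (r \<odot>\<^sub>VW t) = r \<odot>\<^sub>X tlift X \<beta> t" if r: "r \<in> carrier k" and t: "t \<in> carrier VW" for r t
    by (rule t_additive_eqI[OF X.M.abelian_group_axioms _ _ t])
      (use ad r in \<open>auto simp: additive_def VW.smult_r_distr X.smult_r_distr pure_smult_left[symmetric]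
        tlift_pure[OF assms] bilinD[OF assms(2)]\<close>)
  thus ?thesis using ad by (auto simp: klinear_def)
qed

end

section \<open>Maps out of tensor products prescribed on homogeneous elements\<close>

definition bifam :: "'k ring => ('k, 'v, 'y) dgspace_scheme => ('k, 'w, 'z) dgspace_scheme
    => ('k, 'x, 'p) dgspace_scheme => (int => int => 'v => 'w => 'x) => bool" where
  "bifam k V W X \<phi> \<longleftrightarrow> (\<forall>i j.
     (\<forall>v\<in>grade V i. \<forall>w\<in>grade W j. \<phi> i j v w \<in> carrier X
       & (\<forall>v'\<in>grade V i. \<phi> i j (v \<oplus>\<^sub>V v') w = \<phi> i j v w \<oplus>\<^sub>X \<phi> i j v' w)
       & (\<forall>w'\<in>grade W j. \<phi> i j v (w \<oplus>\<^sub>W w') = \<phi> i j v w \<oplus>\<^sub>X \<phi> i j v w')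
       & (\<forall>r\<in>carrier k. \<phi> i j (r \<odot>\<^sub>V v) w = r \<odot>\<^sub>X \<phi> i j v w & \<phi> i j v (r \<odot>\<^sub>W w) = r \<odot>\<^sub>X \<phi> i j v w)))"

lemma bifamD:
  assumes "bifam k V W X \<phi>" "v \<in> grade V i" "w \<in> grade W j"
  shows "\<phi> i j v w \<in> carrier X"
    and "v' \<in> grade V i ==> \<phi> i j (v \<oplus>\<^sub>V v') w = \<phi> i j v w \<oplus>\<^sub>X \<phi> i j v' w"
    and "w' \<in> grade W j ==> \<phi> i j v (w \<oplus>\<^sub>W w') = \<phi> i j v w \<oplus>\<^sub>X \<phi> i j v w'"
    and "r \<in> carrier k ==> \<phi> i j (r \<odot>\<^sub>V v) w = r \<odot>\<^sub>X \<phi> i j v w"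
    and "r \<in> carrier k ==> \<phi> i j v (r \<odot>\<^sub>W w) = r \<odot>\<^sub>X \<phi> i j v w" using assms by (simp_all add: bifam_def)

context tens begin

abbreviation hbil :: "('k, 'x, 'p) dgspace_scheme => (int => int => 'v => 'w => 'x) => 'v => 'w => 'x" where
  "hbil X \<phi> \<equiv> %v w. hsum V X (%i v'. hsum W X (%j w'. \<phi> i j v' w') w) v"

text \<open>Bilinearity is verified one argument at a time on homogeneous elements, where an
  extension has a single term. This makes sense of formulas with signs in both degrees.\<close>

lemma hbil:
  assumes m: "module k X" and b: "bifam k V W X \<phi>"
  shows hbil_bilin: "bilin k V W X (hbil X \<phi>)"
    and hbil_hom: "v \<in> grade V i ==> w \<in> grade W j ==> hbil X \<phi> v w = \<phi> i j v w"
proof -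
  interpret X: kmod k X using m by (simp add: kmod_def)
  note abX = X.M.abelian_group_axioms
  have in_add: "addfam W X (%j w'. \<phi> i j v' w')" if "v' \<in> grade V i" for i v' using bifamD[OF b that] by (auto simp: addfam_def)
  note inner = additiveD[OF W.hsum_additive[OF abX in_add]]
  have in_lin: "hsum W X (%j w'. \<phi> i j (v \<oplus>\<^sub>V v') w') w
      = hsum W X (%j w'. \<phi> i j v w') w \<oplus>\<^sub>X hsum W X (%j w'. \<phi> i j v' w') w"
    if "v \<in> grade V i" "v' \<in> grade V i" "w \<in> carrier W" for i v v' w using that(3) by (rule W.additive_eqI[OF abX, rotated 2])
      (use that inner in \<open>auto simp: additive_def X.a_ac W.hsum_hom[OF abX in_add] bifamD[OF b]\<close>)
  have in_sm: "hsum W X (%j w'. \<phi> i j (r \<odot>\<^sub>V v) w') w = r \<odot>\<^sub>X hsum W X (%j w'. \<phi> i j v w') w"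
    if "v \<in> grade V i" "r \<in> carrier k" "w \<in> carrier W" for i v r w using that(3) by (rule W.additive_eqI[OF abX, rotated 2])
      (use that inner in \<open>auto simp: additive_def X.smult_r_distr W.hsum_hom[OF abX in_add] bifamD[OF b]\<close>)
  have in_smr: "hsum W X (%j w'. \<phi> i j v w') (r \<odot>\<^sub>W w) = r \<odot>\<^sub>X hsum W X (%j w'. \<phi> i j v w') w"
    if "v \<in> grade V i" "r \<in> carrier k" "w \<in> carrier W" for i v r w by (rule W.hsum_smult[OF m in_add]) (use that bifamD[OF b] in auto)
  have out_add: "addfam V X (%i v'. hsum W X (%j w'. \<phi> i j v' w') w)" if "w \<in> carrier W" for w using that inner(1) in_lin by (auto simp: addfam_def)
  note outer = additiveD[OF V.hsum_additive[OF abX out_add]]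
  show "bilin k V W X (hbil X \<phi>)" unfolding bilin_def
  proof (intro ballI conjI)
    fix v w assume v: "v \<in> carrier V" and w: "w \<in> carrier W"
    show "hbil X \<phi> v w \<in> carrier X" using outer v w by simp
    show "hbil X \<phi> (v \<oplus>\<^sub>V v') w = hbil X \<phi> v w \<oplus>\<^sub>X hbil X \<phi> v' w" if "v' \<in> carrier V" for v'
      using outer(2)[OF w v that] .
    show "hbil X \<phi> v (w \<oplus>\<^sub>W w') = hbil X \<phi> v w \<oplus>\<^sub>X hbil X \<phi> v w'" if w': "w' \<in> carrier W" for w' using v
      by (rule V.additive_eqI[OF abX, rotated 2]) (use w w' outer in \<open>auto simp: additive_def X.a_ac V.hsum_hom[OF abX out_add] inner\<close>)
    fix r assume r: "r \<in> carrier k"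
    show "hbil X \<phi> (r \<odot>\<^sub>V v) w = r \<odot>\<^sub>X hbil X \<phi> v w" by (rule V.hsum_smult[OF m out_add]) (use v w r in_sm in auto)
    show "hbil X \<phi> v (r \<odot>\<^sub>W w) = r \<odot>\<^sub>X hbil X \<phi> v w" using v by (rule V.additive_eqI[OF abX, rotated 2])
        (use w r outer in \<open>auto simp: additive_def X.smult_r_distr V.hsum_hom[OF abX out_add] in_smr\<close>)
  qed
  show "v \<in> grade V i ==> w \<in> grade W j ==> hbil X \<phi> v w = \<phi> i j v w"
    using W.gcar by (simp add: V.hsum_hom[OF abX out_add] W.hsum_hom[OF abX in_add])
qed

lemma th_klinear:
  assumes "module k X" "bifam k V W X \<phi>"
  shows "klinear k VW X (tlift_hom V W X \<phi>)" unfolding tlift_hom_def using assms(1) hbil_bilin[OF assms] by (rule tlift_klinear)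

lemma th_pure:
  assumes "module k X" "bifam k V W X \<phi>" "v \<in> grade V i" "w \<in> grade W j"
  shows "tlift_hom V W X \<phi> (p v w) = \<phi> i j v w" unfolding tlift_hom_def using assms V.gcar W.gcar
  by (simp add: tlift_pure[OF assms(1) hbil_bilin[OF assms(1,2)]] hbil_hom[OF assms(1,2)])

lemma pure_grade: "v \<in> grade V i ==> w \<in> grade W j ==> p v w \<in> grade VW (i + j)" unfolding VW_simps pure_def by (rule imageI) auto

lemma pure_bilin: "bilin k V W VW p" unfolding bilin_def by (auto simp: pure_add_left pure_add_right pure_smult_left pure_smult_right)

lemma grade_induct [consumes 1, case_names zero pure]:
  assumes "t \<in> grade VW n" "P \<zero>\<^sub>VW"
    "!!i j v w t. v \<in> grade V i ==> w \<in> grade W j ==> i + j = n ==> t \<in> grade VW n ==> P t ==> P (p v w \<oplus>\<^sub>VW t)"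
  shows "P t"
proof -
  let ?h = "%xs. \<forall>(v, w)\<in>set xs. \<exists>i j. v \<in> grade V i & w \<in> grade W j & i + j = n"
  have sub: "?h xs ==> set xs \<subseteq> cVW" for xs using V.gcar W.gcar by fastforce
  obtain xs where xs: "?h xs" "t = cls xs" using assms(1) by (auto simp: VW_simps)
  from xs(1) have "P (cls xs)"
  proof (induction xs)
    case Nil thus ?case using assms(2) by (simp add: VW_simps)
  next
    case (Cons a xs)
    obtain v w where a: "a = (v, w)" by force
    obtain i j where ij: "v \<in> grade V i" "w \<in> grade W j" "i + j = n" using Cons.prems a by auto
    have "?h xs" using Cons.prems by simp
    hence "cls xs \<in> grade VW n" "P (cls xs)" using Cons.IH by (auto simp: VW_simps)
    thus ?case using assms(3)[OF ij] sub[OF \<open>?h xs\<close>] a cls_Cons[of v w xs] V.gcar[OF ij(1)] W.gcar[OF ij(2)] by simp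
  qed
  thus ?thesis using xs by simp
qed

lemma hom_induct [consumes 1, case_names zero pure]:
  assumes "t \<in> carrier VW" "P \<zero>\<^sub>VW"
    "!!i j v w t. v \<in> grade V i ==> w \<in> grade W j ==> t \<in> carrier VW ==> P t ==> P (p v w \<oplus>\<^sub>VW t)"
  shows "P t" using assms(1)
proof (induction rule: t_induct)
  case zero thus ?case by (rule assms(2))
next
  case (pure v w t)
  have "\<forall>t. t \<in> carrier VW --> P t --> P (p v w \<oplus>\<^sub>VW t)" using pure(1)
  proof (induction rule: V.graded_induct)
    case (hom i v)
    show ?case using pure(2)
    proof (induction rule: W.graded_induct)
      case (hom j w) thus ?case using assms(3) \<open>v \<in> grade V i\<close> by blast
    next
      case (add w w')
      thus ?case using V.gcar[OF hom] by (auto simp: pure_add_right VW.a_assoc)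
    qed
  next
    case (add v v')
    thus ?case using pure(2) by (auto simp: pure_add_left VW.a_assoc)
  qed
  thus ?case using pure by blast
qed

lemma th_additive_eqI:
  assumes "abelian_group X" "additive VW X f" "additive VW X g" "t \<in> carrier VW"
    "!!i j v w. v \<in> grade V i ==> w \<in> grade W j ==> f (p v w) = g (p v w)"
  shows "f t = g t" using assms(4)
proof (induction rule: hom_induct)
  case zero thus ?case using additive_zero[OF abVW assms(1)] assms(2,3) by metis
next
  case (pure i j v w t)
  thus ?case using assms(5) V.gcar W.gcar by (simp add: additiveD(2)[OF assms(2)] additiveD(2)[OF assms(3)])
qed

lemma grade_car: "t \<in> grade VW n ==> t \<in> carrier VW" by (induction rule: grade_induct) (auto simp: V.gcar W.gcar)

lemma grade_sub: "submodule (grade VW n) k VW"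
proof (rule VW.submI)
  show "grade VW n \<subseteq> carrier VW" using grade_car by blast
  show z: "\<zero>\<^sub>VW \<in> grade VW n" by (auto simp: VW_simps)
  have pp: "p v w \<oplus>\<^sub>VW t \<in> grade VW n" if a: "v \<in> grade V i" "w \<in> grade W j" "i + j = n" "t \<in> grade VW n" for i j v w t
  proof -
    let ?h = "%xs. \<forall>(v, w)\<in>set xs. \<exists>i j. v \<in> grade V i & w \<in> grade W j & i + j = n"
    obtain xs where xs: "?h xs" "t = cls xs" using a(4) by (auto simp: VW_simps)
    have "set xs \<subseteq> cVW" using xs(1) V.gcar W.gcar by fastforce
    hence "p v w \<oplus>\<^sub>VW t = cls ((v, w) # xs)" using xs(2) cls_Cons V.gcar[OF a(1)] W.gcar[OF a(2)] by simp
    moreover have "?h ((v, w) # xs)" using a xs(1) by auto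
    ultimately show ?thesis unfolding VW_simps by blast
  qed
  show add: "a \<oplus>\<^sub>VW b \<in> grade VW n" if "a \<in> grade VW n" "b \<in> grade VW n" for a b using that(1)
  proof (induction rule: grade_induct)
    case zero thus ?case using that(2) grade_car[OF that(2)] by simp
  next
    case (pure i j v w t)
    thus ?case using pp[OF pure(1,2,3,5)] grade_car[OF that(2)] by (simp add: VW.a_assoc V.gcar[OF pure(1)] W.gcar[OF pure(2)] grade_car[OF pure(4)])
  qed
  show sm: "r \<odot>\<^sub>VW a \<in> grade VW n" if "r \<in> carrier k" "a \<in> grade VW n" for r a using that(2)
  proof (induction rule: grade_induct)
    case zero thus ?case using that(1) by (simp add: z)
  next
    case (pure i j v w t)
    thus ?case using pp[OF V.g_smult[OF that(1) pure(1)] pure(2,3,5)] that(1)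
      by (simp add: VW.smult_r_distr V.gcar[OF pure(1)] W.gcar[OF pure(2)] grade_car[OF pure(4)]
          pure_smult_left[symmetric])
  qed
qed

lemma gsVW: "graded_space k VW"
proof (rule graded_spaceI)
  show "module k VW" by (rule modVW)
  show "submodule (grade VW i) k VW" for i by (rule grade_sub)
  have "t \<in> VW.gsums (grade VW)" if "t \<in> carrier VW" for t using that
  proof (induction rule: hom_induct)
    case zero show ?case by (rule VW.subm_zero[OF VW.gsums_subm[OF grade_sub]])
  next
    case (pure i j v w t)
    show ?case by (rule VW.subm_add[OF VW.gsums_subm[OF grade_sub] VW.gsums_member[where G = "grade VW", OF grade_sub pure_grade[OF pure(1,2)]] pure(4)])
  qed
  thus "\<exists>N u. finite N & (\<forall>n\<in>N. u n \<in> grade VW n) & t = (\<Oplus>\<^sub>VW n\<in>N. u n)" if "t \<in> carrier VW" for t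
    using that by blast
  \<comment> \<open>Projection to degree \<open>n\<close>. It is well defined because its formula on
    homogeneous pure tensors is bilinear. Applied to a vanishing sum it isolates one summand, which
    gives independence of the graded pieces.\<close>
  define pr where "pr = (%n. tlift_hom V W VW (%i j v w. if i + j = n then p v w else \<zero>\<^sub>VW))"
  have bf: "bifam k V W VW (%i j v w. if i + j = n then p v w else \<zero>\<^sub>VW)" for n
    unfolding bifam_def by (auto simp: V.gcar W.gcar pure_add_left pure_add_right pure_smult_left pure_smult_right)
  have pra: "additive VW VW (pr n)" for n unfolding pr_def by (rule klinear_additive[OF th_klinear[OF modVW bf]])
  have prg: "t \<in> grade VW m ==> pr n t = (if m = n then t else \<zero>\<^sub>VW)" for t m n
  proof (induction rule: grade_induct)
    case zero thus ?case using additive_zero[OF abVW abVW pra] by simp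
  next
    case (pure i j v w t)
    hence "pr n (p v w) = (if m = n then p v w else \<zero>\<^sub>VW)" unfolding pr_def by (simp add: th_pure[OF modVW bf])
    thus ?case using pure V.gcar W.gcar grade_car by (simp add: additiveD(2)[OF pra])
  qed
  show "u n = \<zero>\<^sub>VW" if N: "finite N" and u: "!!i. u i \<in> grade VW i" and z: "(\<Oplus>\<^sub>VW i\<in>N. u i) = \<zero>\<^sub>VW" and n: "n \<in> N" for N u n
  proof -
    have uc: "u i \<in> carrier VW" for i using u grade_car by blast
    have "\<zero>\<^sub>VW = pr n (\<Oplus>\<^sub>VW i\<in>N. u i)" using z additive_zero[OF abVW abVW pra] by simp
    also have "... = (\<Oplus>\<^sub>VW i\<in>N. pr n (u i))" using uc by (intro additive_finsum[OF abVW abVW pra N]) auto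
    also have "... = (\<Oplus>\<^sub>VW i\<in>N. if n = i then u i else \<zero>\<^sub>VW)" using uc by (intro VW.finsum_cong') (auto simp: prg[OF u])
    also have "... = u n" using VW.finsum_singleton[OF n N, of u] uc by simp
    finally show ?thesis by simp
  qed
qed

sublocale VW: gspace k VW using gsVW by (rule gspaceI)

lemma th_deg_linear:
  assumes "gspace k X" "bifam k V W X \<phi>"
    "!!i j v w. v \<in> grade V i ==> w \<in> grade W j ==> \<phi> i j v w \<in> grade X (i + j + n)"
  shows "deg_linear k VW X n (tlift_hom V W X \<phi>)"
proof -
  interpret X: gspace k X by fact
  have m: "module k X" by (rule X.module_axioms)
  note l = th_klinear[OF m assms(2)]
  have "t \<in> grade VW i ==> tlift_hom V W X \<phi> t \<in> grade X (i + n)" for t i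
  proof (induction rule: grade_induct)
    case zero thus ?case using additive_zero[OF abVW X.ab klinear_additive[OF l]] by simp
  next
    case (pure a b v w t)
    thus ?case using assms(3)[OF pure(1,2)] by (simp add: klinearD(2)[OF l] V.gcar W.gcar VW.gcar th_pure[OF m assms(2)])
  qed
  thus ?thesis using l VW.deg_linearI[OF m] by blast
qed

lemma diff_VW_bifam:
  assumes dV: "klinear k V V (diff V)" and dW: "klinear k W W (diff W)"
  shows "bifam k V W VW (%i j v w. p (diff V v) w \<oplus>\<^sub>VW ksgn k i \<odot>\<^sub>VW p v (diff W w))" unfolding bifam_def
  by (auto simp: V.gcar W.gcar pure_add_left pure_add_right pure_smult_left pure_smult_right
      klinearD[OF dV] klinearD[OF dW] VW.smult_r_distr VW.a_ac VW.smult_comm)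

text \<open>The definition forms the differential inside the record that does not yet have one; sums
  there agree with sums in \<open>VW\<close>.\<close>

lemma diff_VW_eq: "diff VW = tlift_hom V W VW (%i j v w. p (diff V v) w \<oplus>\<^sub>VW ksgn k i \<odot>\<^sub>VW p v (diff W w))"
proof -
  have eqs: "carrier VW = carrier (tensor_graded k V W)" "\<zero>\<^sub>VW = \<zero>\<^bsub>tensor_graded k V W\<^esub>"
    "add VW = add (tensor_graded k V W)" "smult VW = smult (tensor_graded k V W)" by (simp_all add: tensor_def Let_def)
  show ?thesis unfolding tlift_hom_def eqs tlift_cong_struct[OF eqs(3,2)] hsum_cong_struct[OF eqs(1,3,2)] by (simp add: tensor_def Let_def tlift_hom_def)
qed

text \<open>Only the degree of \<open>v\<close> enters the sign, so the product rule extends by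
  additivity to inhomogeneous \<open>w\<close>.\<close>

lemma diff_VW:
  assumes dV: "klinear k V V (diff V)" and dW: "klinear k W W (diff W)"
  shows diff_VW_klinear: "klinear k VW VW (diff VW)"
    and diff_VW_pure: "v \<in> grade V i ==> w \<in> carrier W ==>
      diff VW (p v w) = p (diff V v) w \<oplus>\<^sub>VW ksgn k i \<odot>\<^sub>VW p v (diff W w)"
proof -
  show l: "klinear k VW VW (diff VW)" unfolding diff_VW_eq by (rule th_klinear[OF modVW diff_VW_bifam[OF assms]])
  assume v: "v \<in> grade V i" and w: "w \<in> carrier W"
  have vc: "v \<in> carrier V" using v by (rule V.gcar)
  show "diff VW (p v w) = p (diff V v) w \<oplus>\<^sub>VW ksgn k i \<odot>\<^sub>VW p v (diff W w)" using w
  proof (rule W.additive_eqI[OF abVW, rotated 2])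
    show "additive W VW (%w. diff VW (p v w))" using vc by (auto simp: additive_def klinearD[OF l] pure_add_right)
    show "additive W VW (%w. p (diff V v) w \<oplus>\<^sub>VW ksgn k i \<odot>\<^sub>VW p v (diff W w))"
      using vc by (auto simp: additive_def klinearD[OF dV] klinearD[OF dW] pure_add_right VW.smult_r_distr VW.a_ac)
    show "diff VW (p v w) = p (diff V v) w \<oplus>\<^sub>VW ksgn k i \<odot>\<^sub>VW p v (diff W w)" if "w \<in> grade W j" for j w
      using v that by (subst diff_VW_eq) (simp add: th_pure[OF modVW diff_VW_bifam[OF assms]])
  qed
qed

end

section \<open>Triple tensor products\<close>

text \<open>The formulas to be extended have signs in the first two degrees only, so the third
  argument is treated linearly and carries no degree index.\<close>

definition trifam :: "'k ring => ('k, 'v, 'y) dgspace_scheme => ('k, 'w, 'z) dgspace_scheme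
    => ('k, 'u, 'q) dgspace_scheme => ('k, 'x, 'p) dgspace_scheme
    => (int => int => 'v => 'w => 'u => 'x) => bool" where
  "trifam k V W U X \<phi> \<longleftrightarrow> (\<forall>u\<in>carrier U. bifam k V W X (%i j v w. \<phi> i j v w u))
     & (\<forall>i j. \<forall>v\<in>grade V i. \<forall>w\<in>grade W j. klinear k U X (\<phi> i j v w))"

lemma trifamD:
  assumes "trifam k V W U X \<phi>"
  shows "u \<in> carrier U ==> bifam k V W X (%i j v w. \<phi> i j v w u)"
    and "v \<in> grade V i ==> w \<in> grade W j ==> klinear k U X (\<phi> i j v w)" using assms by (auto simp: trifam_def)

definition tl3 :: "('k, 'v, 'y) dgspace_scheme => ('k, 'w, 'z) dgspace_scheme
    => ('x, 'p) ring_scheme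
    => (int => int => 'v => 'w => 'u => 'x) => (('v \<times> 'w) list set \<times> 'u) list set => 'x" where
  "tl3 V W X \<phi> = tlift X (%t u. tlift_hom V W X (%i j v w. \<phi> i j v w u) t)"

locale tens3 = L: tens k V W + T: tens k "tensor k V W" U
  for k :: "'k ring" and V :: "('k, 'v, 'y) dgspace_scheme" and W :: "('k, 'w, 'z) dgspace_scheme"
    and U :: "('k, 'u, 'q) dgspace_scheme"
begin

abbreviation "VWU \<equiv> tensor k (tensor k V W) U"
abbreviation "pp v w u \<equiv> pure k (tensor k V W) U (pure k V W v w) u"

lemma pp_grade: "v \<in> grade V i ==> w \<in> grade W j ==> u \<in> grade U l ==> pp v w u \<in> grade VWU (i + j + l)" by (intro T.pure_grade L.pure_grade)

lemma pp_lin: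
  assumes "v \<in> carrier V" "w \<in> carrier W" "u \<in> carrier U"
  shows "v' \<in> carrier V ==> pp (v \<oplus>\<^sub>V v') w u = pp v w u \<oplus>\<^sub>VWU pp v' w u"
    and "w' \<in> carrier W ==> pp v (w \<oplus>\<^sub>W w') u = pp v w u \<oplus>\<^sub>VWU pp v w' u"
    and "u' \<in> carrier U ==> pp v w (u \<oplus>\<^sub>U u') = pp v w u \<oplus>\<^sub>VWU pp v w u'"
    and "r \<in> carrier k ==> pp (r \<odot>\<^sub>V v) w u = r \<odot>\<^sub>VWU pp v w u"
    and "r \<in> carrier k ==> pp v (r \<odot>\<^sub>W w) u = r \<odot>\<^sub>VWU pp v w u"
    and "r \<in> carrier k ==> pp v w (r \<odot>\<^sub>U u) = r \<odot>\<^sub>VWU pp v w u"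
  using assms by (simp_all add: L.pure_add_left L.pure_add_right L.pure_smult_left L.pure_smult_right
      T.pure_add_left T.pure_add_right T.pure_smult_left T.pure_smult_right)

lemma inner_bilin:
  assumes m: "module k X" and t: "trifam k V W U X \<phi>"
  shows "bilin k (tensor k V W) U X (%t u. tlift_hom V W X (%i j v w. \<phi> i j v w u) t)"
proof -
  interpret X: kmod k X using m by (simp add: kmod_def)
  note l = klinearD[OF L.th_klinear[OF m trifamD(1)[OF t]]]
  have a: "additive (tensor k V W) X (tlift_hom V W X (%i j v w. \<phi> i j v w u))" if "u \<in> carrier U" for u using l that by (auto simp: additive_def)
  note e = L.th_pure[OF m trifamD(1)[OF t]]
  note d = klinearD[OF trifamD(2)[OF t]]
  show ?thesis unfolding bilin_def
  proof (intro ballI conjI)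
    fix s u assume s: "s \<in> carrier (tensor k V W)" and u: "u \<in> carrier U"
    show "tlift_hom V W X (%i j v w. \<phi> i j v w (u \<oplus>\<^sub>U u')) s
       = tlift_hom V W X (%i j v w. \<phi> i j v w u) s \<oplus>\<^sub>X tlift_hom V W X (%i j v w. \<phi> i j v w u') s"
      if u': "u' \<in> carrier U" for u' by (rule L.th_additive_eqI[OF X.M.abelian_group_axioms _ _ s])
        (use u u' l in \<open>auto simp: additive_def X.a_ac e d\<close>)
    fix r assume r: "r \<in> carrier k"
    show "tlift_hom V W X (%i j v w. \<phi> i j v w (r \<odot>\<^sub>U u)) s
       = r \<odot>\<^sub>X tlift_hom V W X (%i j v w. \<phi> i j v w u) s" by (rule L.th_additive_eqI[OF X.M.abelian_group_axioms _ _ s])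
        (use u r l in \<open>auto simp: additive_def X.smult_r_distr e d\<close>)
  qed (use l in auto)
qed

lemma tl3_klinear:
  assumes "module k X" "trifam k V W U X \<phi>" shows "klinear k VWU X (tl3 V W X \<phi>)"
  unfolding tl3_def using assms(1) inner_bilin[OF assms] by (rule T.tlift_klinear)

lemma tl3_pp:
  assumes "module k X" "trifam k V W U X \<phi>" "v \<in> grade V i" "w \<in> grade W j" "u \<in> carrier U"
  shows "tl3 V W X \<phi> (pp v w u) = \<phi> i j v w u" unfolding tl3_def using assms L.V.gcar L.W.gcar
  by (simp add: T.tlift_pure[OF assms(1) inner_bilin[OF assms(1,2)]] L.th_pure[OF assms(1) trifamD(1)])

lemma h_induct [consumes 1, case_names zero pure]:
  assumes "t \<in> carrier VWU" "P \<zero>\<^sub>VWU"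
    "!!i j l v w u t. v \<in> grade V i ==> w \<in> grade W j ==> u \<in> grade U l ==> t \<in> carrier VWU ==> P t ==>
       P (pp v w u \<oplus>\<^sub>VWU t)"
  shows "P t" using assms(1)
proof (induction rule: T.hom_induct)
  case zero thus ?case by (rule assms(2))
next
  case (pure i l s u t)
  have "\<forall>t. t \<in> carrier VWU --> P t --> P (pure k (tensor k V W) U s u \<oplus>\<^sub>VWU t)" using pure(1)
  proof (induction rule: L.grade_induct)
    case zero
    have "pure k (tensor k V W) U \<zero>\<^bsub>tensor k V W\<^esub> u = \<zero>\<^sub>VWU"
      using additive_zero[OF L.VW.ab T.abVW klinear_additive[OF bilin_left[OF T.pure_bilin]]] T.W.gcar[OF pure(2)] .
    thus ?case by simp
  next
    case (pure a b v w s)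
    thus ?case using assms(3)[OF pure(1,2) \<open>u \<in> grade U l\<close>] L.V.gcar[OF pure(1)] L.W.gcar[OF pure(2)]
        L.VW.gcar[OF pure(4)] T.W.gcar[OF \<open>u \<in> grade U l\<close>] by (simp add: T.pure_add_left T.VW.a_assoc)
  qed
  thus ?case using pure by blast
qed

lemma additive_eqI3:
  assumes "abelian_group X" "additive VWU X f" "additive VWU X g" "t \<in> carrier VWU"
    "!!i j l v w u. v \<in> grade V i ==> w \<in> grade W j ==> u \<in> grade U l ==> f (pp v w u) = g (pp v w u)"
  shows "f t = g t" using assms(4)
proof (induction rule: h_induct)
  case zero thus ?case using additive_zero[OF T.abVW assms(1)] assms(2,3) by metis
next
  case (pure i j l v w u t)
  thus ?case using assms(5) L.V.gcar[OF pure(1)] L.W.gcar[OF pure(2)] T.W.gcar[OF pure(3)] by (simp add: additiveD(2)[OF assms(2)] additiveD(2)[OF assms(3)])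
qed

lemma grade_induct3 [consumes 1, case_names zero pure]:
  assumes "t \<in> grade VWU n" "P \<zero>\<^sub>VWU"
    "!!i j l v w u t. v \<in> grade V i ==> w \<in> grade W j ==> u \<in> grade U l ==> i + j + l = n ==>
       t \<in> grade VWU n ==> P t ==> P (pp v w u \<oplus>\<^sub>VWU t)"
  shows "P t" using assms(1)
proof (induction rule: T.grade_induct)
  case zero thus ?case by (rule assms(2))
next
  case (pure i l s u t)
  have "\<forall>t. t \<in> grade VWU n --> P t --> P (pure k (tensor k V W) U s u \<oplus>\<^sub>VWU t)" using pure(1)
  proof (induction rule: L.grade_induct)
    case zero
    have "pure k (tensor k V W) U \<zero>\<^bsub>tensor k V W\<^esub> u = \<zero>\<^sub>VWU"
      using additive_zero[OF L.VW.ab T.abVW klinear_additive[OF bilin_left[OF T.pure_bilin]]] T.W.gcar[OF pure(2)] .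
    thus ?case using T.VW.gcar by simp
  next
    case (pure a b v w s)
    have su: "pure k (tensor k V W) U s u \<in> grade VWU n" using T.pure_grade[OF pure(4) \<open>u \<in> grade U l\<close>] \<open>i + l = n\<close> by simp
    show ?case
    proof (intro allI impI)
      fix t assume t: "t \<in> grade VWU n" "P t"
      have "P (pp v w u \<oplus>\<^sub>VWU (pure k (tensor k V W) U s u \<oplus>\<^sub>VWU t))"
        using pure(3,5) t \<open>i + l = n\<close> su by (intro assms(3)[OF pure(1,2) \<open>u \<in> grade U l\<close>]) auto
      thus "P (pure k (tensor k V W) U (pure k V W v w \<oplus>\<^bsub>tensor k V W\<^esub> s) u \<oplus>\<^sub>VWU t)"
        using L.V.gcar[OF pure(1)] L.W.gcar[OF pure(2)]
          L.VW.gcar[OF pure(4)] T.W.gcar[OF \<open>u \<in> grade U l\<close>] T.VW.gcar[OF t(1)] by (simp add: T.pure_add_left T.VW.a_assoc)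
    qed
  qed
  thus ?case using pure by blast
qed

lemma diff_pp:
  assumes dV: "deg_linear k V V 1 (diff V)" and dW: "deg_linear k W W 1 (diff W)" and dU: "deg_linear k U U 1 (diff U)"
    and "v \<in> grade V i" "w \<in> grade W j" "u \<in> carrier U"
  shows "diff VWU (pp v w u) = pp (diff V v) w u \<oplus>\<^sub>VWU ksgn k i \<odot>\<^sub>VWU pp v (diff W w) u
    \<oplus>\<^sub>VWU ksgn k (i + j) \<odot>\<^sub>VWU pp v w (diff U u)"
proof -
  note kl = dV[THEN deg_klinear] dW[THEN deg_klinear] dU[THEN deg_klinear]
  have vw: "v \<in> carrier V" "w \<in> carrier W" using assms L.V.gcar L.W.gcar by auto
  have "pure k V W v w \<in> grade (tensor k V W) (i + j)" using assms by (intro L.pure_grade)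
  thus ?thesis using assms(4-) vw by (simp add: T.diff_VW_pure[OF L.diff_VW_klinear[OF kl(1,2)] kl(3)] L.diff_VW_pure[OF kl(1,2)]
        klinearD[OF kl(1)] klinearD[OF kl(2)] klinearD[OF kl(3)] T.pure_add_left T.pure_smult_left)
qed

end

section \<open>Sweedler calculus\<close>

lemma bifamI:
  assumes "gspace k V" "gspace k W"
    and "!!i j v w. v \<in> grade V i ==> v \<in> carrier V ==> w \<in> grade W j ==> w \<in> carrier W ==> \<phi> i j v w \<in> carrier X"
    and "!!i j v v' w. v \<in> grade V i ==> v \<in> carrier V ==> v' \<in> grade V i ==> v' \<in> carrier V ==> w \<in> grade W j ==> w \<in> carrier W
       ==> \<phi> i j (v \<oplus>\<^sub>V v') w = \<phi> i j v w \<oplus>\<^sub>X \<phi> i j v' w"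
    and "!!i j v w w'. v \<in> grade V i ==> v \<in> carrier V ==> w' \<in> grade W j ==> w' \<in> carrier W ==> w \<in> grade W j ==> w \<in> carrier W
       ==> \<phi> i j v (w \<oplus>\<^sub>W w') = \<phi> i j v w \<oplus>\<^sub>X \<phi> i j v w'"
    and "!!i j v w r. v \<in> grade V i ==> v \<in> carrier V ==> w \<in> grade W j ==> w \<in> carrier W ==> r \<in> carrier k
       ==> \<phi> i j (r \<odot>\<^sub>V v) w = r \<odot>\<^sub>X \<phi> i j v w"
    and "!!i j v w r. v \<in> grade V i ==> v \<in> carrier V ==> w \<in> grade W j ==> w \<in> carrier W ==> r \<in> carrier k
       ==> \<phi> i j v (r \<odot>\<^sub>W w) = r \<odot>\<^sub>X \<phi> i j v w"
  shows "bifam k V W X \<phi>" unfolding bifam_def by (intro allI ballI conjI)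
    (rule assms(3-7), (assumption | erule gspace.gcar[OF assms(1)] | erule gspace.gcar[OF assms(2)])+)+

lemma bifam_bilin:
  assumes "gspace k V" "gspace k W" "bilin k V' W' X B" "klinear k V V' f" "klinear k W W' g"
  shows "bifam k V W X (%i j v w. B (f v) (g w))"
  by (rule bifamI[OF assms(1,2)]) (simp_all add: bilinD[OF assms(3)] klinearD[OF assms(4)] klinearD[OF assms(5)])

lemma bifam_add:
  assumes "gspace k V" "gspace k W" "module k X" "bifam k V W X \<phi>" "bifam k V W X \<psi>"
  shows "bifam k V W X (%i j v w. \<phi> i j v w \<oplus>\<^sub>X \<psi> i j v w)"
proof -
  interpret X: kmod k X using assms(3) by (simp add: kmod_def)
  show ?thesis by (rule bifamI[OF assms(1,2)]) (simp_all add: bifamD[OF assms(4)] bifamD[OF assms(5)] X.a_ac X.smult_r_distr)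
qed

lemma bifam_smult:
  assumes "gspace k V" "gspace k W" "module k X" "bifam k V W X \<phi>" "!!i j. r i j \<in> carrier k"
  shows "bifam k V W X (%i j v w. r i j \<odot>\<^sub>X \<phi> i j v w)"
proof -
  interpret X: kmod k X using assms(3) by (simp add: kmod_def)
  show ?thesis by (rule bifamI[OF assms(1,2)]) (simp_all add: bifamD[OF assms(4)] assms(5) X.smult_r_distr X.smult_comm)
qed

lemma bifam_minus:
  assumes "gspace k V" "gspace k W" "module k X" "bifam k V W X \<phi>" "bifam k V W X \<psi>"
  shows "bifam k V W X (%i j v w. \<phi> i j v w \<ominus>\<^sub>X \<psi> i j v w)"
proof -
  interpret X: kmod k X using assms(3) by (simp add: kmod_def)
  show ?thesis by (rule bifamI[OF assms(1,2)]) (simp_all add: a_minus_def bifamD[OF assms(4)] bifamD[OF assms(5)] X.a_ac X.smult_r_distr X.M.minus_add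
        X.smult_r_minus)
qed

lemma bifam_lin:
  assumes "gspace k V" "gspace k W" "bifam k V W X \<phi>" "klinear k X Y h"
  shows "bifam k V W Y (%i j v w. h (\<phi> i j v w))" by (rule bifamI[OF assms(1,2)]) (simp_all add: bifamD[OF assms(3)] klinearD[OF assms(4)])

lemma bifam_cong:
  assumes "gspace k V" "gspace k W" "bifam k V W X \<psi>" "!!i j v w. v \<in> grade V i ==> w \<in> grade W j ==> \<phi> i j v w = \<psi> i j v w"
  shows "bifam k V W X \<phi>"
proof -
  interpret V: gspace k V by fact
  interpret W: gspace k W by fact
  show ?thesis using assms(3) by (simp add: bifam_def assms(4))
qed

lemma bifam_arg:
  assumes "gspace k V" "gspace k W" "bifam k V W X \<phi>" "deg_linear k V V m f" "deg_linear k W W n g"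
  shows "bifam k V W X (%i j v w. \<phi> (i + m) (j + n) (f v) (g w))" by (rule bifamI[OF assms(1,2)])
   (simp_all add: bifamD[OF assms(3)] klinearD[OF assms(4)[THEN deg_klinear]]
      klinearD[OF assms(5)[THEN deg_klinear]] deg_linear_grade[OF assms(4)] deg_linear_grade[OF assms(5)])

lemma deg_linear_id: "graded_space k V ==> deg_linear k V V 0 (%x. x)" by (auto simp: deg_linear_def klinear_def)

lemmas (in gspace) id_kl = deg_klinear[OF deg_linear_id[OF gs]]

lemma trifam_left:
  assumes "gspace k V" "gspace k W" "gspace k U" "bilin k V' U' X B" "bilin k V W V' \<beta>" "klinear k U U' h"
  shows "trifam k V W U X (%i j v w u. B (\<beta> v w) (h u))"
proof -
  interpret V: gspace k V by fact
  interpret W: gspace k W by fact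
  show ?thesis unfolding trifam_def
  proof (intro conjI ballI allI)
    show "bifam k V W X (%i j v w. B (\<beta> v w) (h u))" if "u \<in> carrier U" for u
      by (rule bifamI[OF assms(1,2)]) (simp_all add: that bilinD[OF assms(4)] bilinD[OF assms(5)] klinearD[OF assms(6)])
    show "klinear k U X (%u. B (\<beta> v w) (h u))" if "v \<in> grade V i" "w \<in> grade W j" for v w i j
      using V.gcar[OF that(1)] W.gcar[OF that(2)] bilinD[OF assms(4)] bilinD[OF assms(5)] klinearD[OF assms(6)] unfolding klinear_def by simp
  qed
qed

lemma trifam_right:
  assumes "gspace k V" "gspace k W" "gspace k U" "bilin k V' W' X B" "klinear k V V' h" "bilin k W U W' \<beta>"
  shows "trifam k V W U X (%i j v w u. B (h v) (\<beta> w u))"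
proof -
  interpret V: gspace k V by fact
  interpret W: gspace k W by fact
  show ?thesis unfolding trifam_def
  proof (intro conjI ballI allI)
    show "bifam k V W X (%i j v w. B (h v) (\<beta> w u))" if "u \<in> carrier U" for u
      by (rule bifamI[OF assms(1,2)]) (simp_all add: that bilinD[OF assms(4)] bilinD[OF assms(6)] klinearD[OF assms(5)])
    show "klinear k U X (%u. B (h v) (\<beta> w u))" if "v \<in> grade V i" "w \<in> grade W j" for v w i j
      using V.gcar[OF that(1)] W.gcar[OF that(2)] bilinD[OF assms(4)] bilinD[OF assms(6)] klinearD[OF assms(5)] unfolding klinear_def by simp
  qed
qed

lemma trifam_smult:
  assumes "gspace k V" "gspace k W" "module k X" "trifam k V W U X \<phi>" "!!i j. r i j \<in> carrier k"
  shows "trifam k V W U X (%i j v w u. r i j \<odot>\<^sub>X \<phi> i j v w u)"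
proof -
  interpret X: kmod k X using assms(3) by (simp add: kmod_def)
  show ?thesis unfolding trifam_def
  proof (intro conjI ballI allI)
    show "bifam k V W X (%i j v w. r i j \<odot>\<^sub>X \<phi> i j v w u)" if "u \<in> carrier U" for u
      by (rule bifam_smult[OF assms(1-3) trifamD(1)[OF assms(4) that] assms(5)])
    show "klinear k U X (%u. r i j \<odot>\<^sub>X \<phi> i j v w u)" if "v \<in> grade V i" "w \<in> grade W j" for v w i j
      using klinearD[OF trifamD(2)[OF assms(4) that]] assms(5) unfolding klinear_def by (simp add: X.smult_r_distr X.smult_comm)
  qed
qed

lemma bilin_comp:
  assumes "bilin k V' W' X B" "klinear k V V' f" "klinear k W W' g"
  shows "bilin k V W X (%v w. B (f v) (g w))" unfolding bilin_def by (simp add: bilinD[OF assms(1)] klinearD[OF assms(2)] klinearD[OF assms(3)])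

lemma bilin_flip: "bilin k V W X B ==> bilin k W V X (%w v. B v w)" unfolding bilin_def by simp

lemma bilin_scalar:
  assumes "module k X" "deg_form k C n e"
  shows "bilin k C X X (%c x. e c \<odot>\<^sub>X x)"
proof -
  interpret X: kmod k X using assms(1) by (simp add: kmod_def)
  show ?thesis using assms(2) unfolding bilin_def deg_form_def by (auto simp: Pi_iff X.smult_r_distr X.smult_l_distr X.smult_assoc1 X.smult_comm)
qed

section \<open>Sweedler sums over a curved coalgebra\<close>

locale coal =
  fixes k :: "'k ring" and C :: "('k, 'c) coalg"
  assumes cring: "cring k" and cdg: "curved_dg_coalgebra k C"

sublocale coal \<subseteq> C: gspace k C using cdg by (intro gspaceI) (simp add: curved_dg_coalgebra_def graded_coalgebra_def)

lemma tensI: "gspace k V ==> gspace k W ==> tens k V W" by (rule tens.intro)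

lemma tens3I: "gspace k V ==> gspace k W ==> gspace k U ==> tens3 k V W U" by (intro tens3.intro tensI gspaceI[OF tens.gsVW])

sublocale coal \<subseteq> CC: tens3 k C C C by (rule tens3I[OF C.gspace_axioms C.gspace_axioms C.gspace_axioms])

context coal begin

lemma gC: "gspace k C" and mC: "module k C" by unfold_locales

lemma comult_deg: "deg_linear k C (tensor k C C) 0 (comult C)" using cdg by (simp add: curved_dg_coalgebra_def graded_coalgebra_def)

lemma d_deg: "deg_linear k C C 1 (diff C)" using cdg by (simp add: curved_dg_coalgebra_def)

lemmas d_lin = klinearD[OF d_deg[THEN deg_klinear]]

lemma counit_form: "deg_form k C 0 (counit C)" and curv_form: "deg_form k C 2 (curv C)"
  using cdg by (simp_all add: curved_dg_coalgebra_def graded_coalgebra_def)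

lemma sw_klinear:
  assumes "module k X" "bifam k C C X \<phi>" shows "klinear k C X (sweedler C X \<phi>)"
  unfolding sweedler_def[abs_def] by (rule klinear_compose[OF deg_klinear[OF comult_deg] CC.L.th_klinear[OF assms]])

lemma sw_deg:
  assumes "gspace k X" "bifam k C C X \<phi>"
    "!!i j v w. v \<in> grade C i ==> w \<in> grade C j ==> \<phi> i j v w \<in> grade X (i + j + n)"
  shows "deg_linear k C X n (sweedler C X \<phi>)" unfolding sweedler_def[abs_def] using deg_linear_compose[OF comult_deg CC.L.th_deg_linear[OF assms]] by simp

lemmas sw_closed = klinearD(1)[OF sw_klinear]

lemma cm_car: "c \<in> carrier C ==> comult C c \<in> carrier (tensor k C C)" by (rule deg_linearD(1)[OF comult_deg])

lemma sw_cong: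
  assumes m: "module k X" "bifam k C C X \<psi>" and c: "c \<in> carrier C"
    and e: "!!p q x y. x \<in> grade C p ==> y \<in> grade C q ==> \<phi> p q x y = \<psi> p q x y"
  shows "sweedler C X \<phi> c = sweedler C X \<psi> c"
proof -
  interpret X: kmod k X using assms(1) by (simp add: kmod_def)
  have b: "bifam k C C X \<phi>" by (rule bifam_cong[OF gC gC m(2) e])
  show ?thesis unfolding sweedler_def by (rule CC.L.th_additive_eqI[OF X.M.abelian_group_axioms _ _ cm_car[OF c]])
      (use e in \<open>simp_all add: klinear_additive[OF CC.L.th_klinear] m b CC.L.th_pure\<close>)
qed

text \<open>Since \<open>comult\<close> preserves degree, only terms with p + q = n occur. This
  matters for signs that agree under this condition alone.\<close>

lemma sw_cong_grade:
  assumes m: "module k X" "bifam k C C X \<phi>" "bifam k C C X \<psi>" and c: "c \<in> grade C n"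
    and e: "!!p q x y. p + q = n ==> x \<in> grade C p ==> y \<in> grade C q ==> \<phi> p q x y = \<psi> p q x y"
  shows "sweedler C X \<phi> c = sweedler C X \<psi> c"
proof -
  interpret X: kmod k X using assms(1) by (simp add: kmod_def)
  have "comult C c \<in> grade (tensor k C C) n" using deg_linear_grade[OF comult_deg c] by simp
  thus ?thesis unfolding sweedler_def
  proof (induction rule: CC.L.grade_induct)
    case zero thus ?case using additive_zero[OF CC.L.abVW X.M.abelian_group_axioms klinear_additive[OF CC.L.th_klinear[OF m(1)]]] m by simp
  next
    case (pure i j v w t)
    thus ?case using e by (simp add: klinearD(2)[OF CC.L.th_klinear] m CC.L.th_pure C.gcar CC.L.VW.gcar)
  qed
qed

lemma sw_additive_eq:
  assumes m: "module k X" "bifam k C C X \<phi>" and f: "additive (tensor k C C) X f" and c: "c \<in> carrier C"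
    and e: "!!p q x y. x \<in> grade C p ==> y \<in> grade C q ==> \<phi> p q x y = f (pure k C C x y)"
  shows "sweedler C X \<phi> c = f (comult C c)"
proof -
  interpret X: kmod k X using assms(1) by (simp add: kmod_def)
  show ?thesis unfolding sweedler_def by (rule CC.L.th_additive_eqI[OF X.M.abelian_group_axioms _ _ cm_car[OF c]])
      (use e f in \<open>simp_all add: klinear_additive[OF CC.L.th_klinear] m CC.L.th_pure\<close>)
qed

lemma sw_lin:
  assumes m: "module k X" "bifam k C C X \<phi>" "module k Y" "klinear k X Y h" and c: "c \<in> carrier C"
  shows "h (sweedler C X \<phi> c) = sweedler C Y (%i j x y. h (\<phi> i j x y)) c"
proof -
  have b: "bifam k C C Y (%i j x y. h (\<phi> i j x y))" by (rule bifam_lin[OF _ _ m(2,4)]) unfold_locales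
  have a: "additive (tensor k C C) Y (%t. h (tlift_hom C C X \<phi> t))" by (rule klinear_additive[OF klinear_compose[OF CC.L.th_klinear[OF m(1,2)] m(4)]])
  have "sweedler C Y (%i j x y. h (\<phi> i j x y)) c = h (tlift_hom C C X \<phi> (comult C c))"
    by (rule sw_additive_eq[OF m(3) b a c]) (simp add: CC.L.th_pure[OF m(1,2)])
  thus ?thesis by (simp add: sweedler_def)
qed

lemma sw_map:
  assumes "module k X" "bifam k C C X \<phi>" "module k Y" "klinear k X Y h" "bifam k C C Y \<psi>" "c \<in> carrier C"
    and "!!p q x y. x \<in> grade C p ==> y \<in> grade C q ==> h (\<phi> p q x y) = \<psi> p q x y"
  shows "h (sweedler C X \<phi> c) = sweedler C Y \<psi> c" unfolding sw_lin[OF assms(1-4,6)] by (rule sw_cong[OF assms(3,5-7)])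

lemma sw_map_grade:
  assumes "module k X" "bifam k C C X \<phi>" "module k Y" "klinear k X Y h" "bifam k C C Y \<psi>" "c \<in> grade C n"
    and "!!p q x y. p + q = n ==> x \<in> grade C p ==> y \<in> grade C q ==> h (\<phi> p q x y) = \<psi> p q x y"
  shows "h (sweedler C X \<phi> c) = sweedler C Y \<psi> c" unfolding sw_lin[OF assms(1-4) C.gcar[OF assms(6)]]
  by (rule sw_cong_grade[OF assms(3) bifam_lin[OF gC gC assms(2,4)] assms(5-7)])

lemma sw_add:
  assumes m: "module k X" "bifam k C C X a" "bifam k C C X b" and c: "c \<in> carrier C"
    and e: "!!p q x y. x \<in> grade C p ==> y \<in> grade C q ==> \<phi> p q x y = a p q x y \<oplus>\<^sub>X b p q x y"
  shows "sweedler C X \<phi> c = sweedler C X a c \<oplus>\<^sub>X sweedler C X b c"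
proof -
  interpret X: kmod k X using assms(1) by (simp add: kmod_def)
  have s: "bifam k C C X \<phi>" by (rule bifam_cong[OF gC gC bifam_add[OF gC gC m] e])
  note l = klinearD[OF CC.L.th_klinear[OF m(1,2)]] klinearD[OF CC.L.th_klinear[OF m(1,3)]]
  have ad: "additive (tensor k C C) X (%t. tlift_hom C C X a t \<oplus>\<^sub>X tlift_hom C C X b t)" using l by (auto simp: additive_def X.a_ac)
  show ?thesis using sw_additive_eq[OF m(1) s ad c] CC.L.th_pure[OF m(1,2)] CC.L.th_pure[OF m(1,3)] e by (simp add: sweedler_def)
qed

lemma sw_add3:
  assumes m: "module k X" "bifam k C C X a" "bifam k C C X b" "bifam k C C X d" and c: "c \<in> carrier C"
    and e: "!!p q x y. x \<in> grade C p ==> y \<in> grade C q ==> \<phi> p q x y = a p q x y \<oplus>\<^sub>X (b p q x y \<oplus>\<^sub>X d p q x y)"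
  shows "sweedler C X \<phi> c = sweedler C X a c \<oplus>\<^sub>X (sweedler C X b c \<oplus>\<^sub>X sweedler C X d c)"
  unfolding sw_add[OF m(1,3,4) c HOL.refl, symmetric] by (rule sw_add[OF m(1,2) bifam_add[OF gC gC m(1,3,4)] c e])

lemma sw_add4:
  assumes m: "module k X" "bifam k C C X a" "bifam k C C X b" "bifam k C C X d" "bifam k C C X f" and c: "c \<in> carrier C"
    and e: "!!p q x y. x \<in> grade C p ==> y \<in> grade C q ==> \<phi> p q x y = a p q x y \<oplus>\<^sub>X (b p q x y \<oplus>\<^sub>X (d p q x y \<oplus>\<^sub>X f p q x y))"
  shows "sweedler C X \<phi> c = sweedler C X a c \<oplus>\<^sub>X (sweedler C X b c \<oplus>\<^sub>X (sweedler C X d c \<oplus>\<^sub>X sweedler C X f c))"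
  unfolding sw_add[OF m(1,4,5) c HOL.refl, symmetric] by (rule sw_add3[OF m(1-3) bifam_add[OF gC gC m(1,4,5)] c e])

lemma sw_smult:
  assumes m: "module k X" "bifam k C C X \<psi>" "r \<in> carrier k" and c: "c \<in> carrier C"
    and e: "!!p q x y. x \<in> grade C p ==> y \<in> grade C q ==> \<phi> p q x y = r \<odot>\<^sub>X \<psi> p q x y"
  shows "sweedler C X \<phi> c = r \<odot>\<^sub>X sweedler C X \<psi> c"
proof -
  interpret X: kmod k X using assms(1) by (simp add: kmod_def)
  have h: "klinear k X X (%x. r \<odot>\<^sub>X x)" using m(3) by (auto simp: klinear_def X.smult_r_distr X.smult_comm)
  show ?thesis by (rule sw_map[OF m(1,2,1) h _ c, symmetric]) (auto simp: e intro: bifam_cong[OF gC gC bifam_lin[OF gC gC m(2) h]])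
qed

lemma sw_minus:
  assumes m: "module k X" "bifam k C C X a" "bifam k C C X b" and c: "c \<in> carrier C"
    and e: "!!p q x y. x \<in> grade C p ==> y \<in> grade C q ==> \<phi> p q x y = a p q x y \<ominus>\<^sub>X b p q x y"
  shows "sweedler C X \<phi> c = sweedler C X a c \<ominus>\<^sub>X sweedler C X b c"
proof -
  interpret X: kmod k X using assms(1) by (simp add: kmod_def)
  have s: "ksgn k 1 \<in> carrier k" by simp
  have b': "bifam k C C X (%i j x y. ksgn k 1 \<odot>\<^sub>X b i j x y)" by (rule bifam_smult[OF gC gC m(1,3)]) simp
  have "sweedler C X \<phi> c = sweedler C X a c \<oplus>\<^sub>X sweedler C X (%i j x y. ksgn k 1 \<odot>\<^sub>X b i j x y) c"
    by (rule sw_add[OF m(1,2) b' c]) (simp add: e a_minus_def X.minus_as_ksgn bifamD(1)[OF m(3)])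
  thus ?thesis by (simp add: sw_smult[OF m(1,3) s c HOL.refl] a_minus_def X.minus_as_ksgn sw_closed[OF m(1,3) c])
qed

lemma bifam_sw_left:
  assumes W: "gspace k W" and m: "module k X" "trifam k C C W X \<psi>"
  shows "bifam k C W X (%i j x y. sweedler C X (%p q u v. \<psi> p q u v y) x)"
proof -
  interpret X: kmod k X using m(1) by (simp add: kmod_def)
  interpret W: gspace k W by fact
  note b = trifamD(1)[OF m(2)]
  note l = klinearD[OF sw_klinear[OF m(1) b]]
  note d = klinearD[OF trifamD(2)[OF m(2)]]
  show ?thesis
  proof (rule bifamI[OF gC W])
    show "sweedler C X (%p q u v. \<psi> p q u v (y \<oplus>\<^sub>W y')) x
       = sweedler C X (%p q u v. \<psi> p q u v y) x \<oplus>\<^sub>X sweedler C X (%p q u v. \<psi> p q u v y') x"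
      if "y \<in> carrier W" "y' \<in> carrier W" "x \<in> carrier C" for y y' x by (rule sw_add[OF m(1) b b]) (use that d in auto)
    show "sweedler C X (%p q u v. \<psi> p q u v (r \<odot>\<^sub>W y)) x = r \<odot>\<^sub>X sweedler C X (%p q u v. \<psi> p q u v y) x"
      if "y \<in> carrier W" "x \<in> carrier C" "r \<in> carrier k" for y x r by (rule sw_smult[OF m(1) b]) (use that d in auto)
  qed (simp_all add: l)
qed

lemma trifam_inner_right:
  assumes m: "trifam k W C C X \<psi>" and y: "y \<in> grade W i"
  shows "bifam k C C X (%p q u v. \<psi> i p y u v)" by (rule bifamI[OF gC gC]) (simp_all add: bifamD[OF trifamD(1)[OF m] y] klinearD[OF trifamD(2)[OF m y]])

lemma bifam_sw_right:
  assumes W: "gspace k W" and m: "module k X" "trifam k W C C X \<psi>"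
  shows "bifam k W C X (%i j x y. sweedler C X (%p q u v. \<psi> i p x u v) y)"
proof -
  interpret X: kmod k X using m(1) by (simp add: kmod_def)
  interpret W: gspace k W by fact
  note b = trifam_inner_right[OF m(2)]
  note l = klinearD[OF sw_klinear[OF m(1) b]]
  note d = bifamD[OF trifamD(1)[OF m(2)]]
  show ?thesis
  proof (rule bifamI[OF W gC])
    show "sweedler C X (%p q u v. \<psi> i p (y \<oplus>\<^sub>W y') u v) x
       = sweedler C X (%p q u v. \<psi> i p y u v) x \<oplus>\<^sub>X sweedler C X (%p q u v. \<psi> i p y' u v) x"
      if y: "y \<in> grade W i" "y' \<in> grade W i" and x: "x \<in> carrier C" for i y y' x
      by (rule sw_add[OF m(1) b[OF y(1)] b[OF y(2)] x]) (use y d(2) C.gcar in blast)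
    show "sweedler C X (%p q u v. \<psi> i p (r \<odot>\<^sub>W y) u v) x = r \<odot>\<^sub>X sweedler C X (%p q u v. \<psi> i p y u v) x"
      if y: "y \<in> grade W i" and x: "x \<in> carrier C" and r: "r \<in> carrier k" for i y x r
      by (rule sw_smult[OF m(1) b[OF y] r x]) (use y r d(4) C.gcar in blast)
  qed (simp_all add: l)
qed

text \<open>The axiom takes its values in C (x) C (x) C; composing with the linear map
  \<open>tl3 C C X \<psi>\<close> transports it to every trilinear expression, signs in the first
  two degrees included. \<open>\<Phi>\<close> and \<open>\<Psi>\<close> are separate arguments so
  that the nested sums may be given in simplified form.\<close>

lemma sw_coassoc:
  assumes m: "module k X" "trifam k C C C X \<psi>" and c: "c \<in> carrier C"
    and l: "!!i j x y. x \<in> grade C i ==> y \<in> grade C j ==> \<Phi> i j x y = sweedler C X (%p q u v. \<psi> p q u v y) x"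
    and r: "!!i j x y. x \<in> grade C i ==> y \<in> grade C j ==> \<Psi> i j x y = sweedler C X (%p q u v. \<psi> i p x u v) y"
  shows "sweedler C X \<Phi> c = sweedler C X \<Psi> c"
proof -
  let ?T = "tensor k (tensor k C C) C"
  have mT: "module k ?T" by (rule CC.T.modVW)
  let ?pp = "%u v y. pure k (tensor k C C) C (pure k C C u v) y"
  have tpp: "trifam k C C C ?T (%_ _. ?pp)" unfolding trifam_def by (intro conjI ballI allI bifamI[OF gC gC]) (auto simp: klinear_def C.gcar CC.pp_lin)
  let ?h = "tl3 C C X \<psi>"
  have h: "klinear k ?T X ?h" by (rule CC.tl3_klinear[OF m])
  have hp: "?h (?pp u v y) = \<psi> p q u v y" if "u \<in> grade C p" "v \<in> grade C q" "y \<in> carrier C" for p q u v y using that by (rule CC.tl3_pp[OF m])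
  have "?h (sweedler C ?T (%_ _ x y. sweedler C ?T (%_ _ u v. ?pp u v y) x) c)
     = sweedler C X (%i j x y. sweedler C X (%p q u v. \<psi> p q u v y) x) c"
  proof (rule sw_map[OF mT bifam_sw_left[OF gC mT tpp] m(1) h bifam_sw_left[OF gC m] c])
    fix p q x y assume x: "x \<in> grade C p" and y: "y \<in> grade C q"
    note yc = C.gcar[OF y]
    show "?h (sweedler C ?T (%_ _ u v. ?pp u v y) x) = sweedler C X (%p q u v. \<psi> p q u v y) x"
      by (rule sw_map[OF mT trifamD(1)[OF tpp yc] m(1) h trifamD(1)[OF m(2) yc] C.gcar[OF x] hp[OF _ _ yc]])
  qed
  moreover have "?h (sweedler C ?T (%_ _ x y. sweedler C ?T (%_ _ u v. ?pp x u v) y) c)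
     = sweedler C X (%i j x y. sweedler C X (%p q u v. \<psi> i p x u v) y) c"
  proof (rule sw_map[OF mT bifam_sw_right[OF gC mT tpp] m(1) h bifam_sw_right[OF gC m] c])
    fix i q x y assume x: "x \<in> grade C i" and y: "y \<in> grade C q"
    show "?h (sweedler C ?T (%_ _ u v. ?pp x u v) y) = sweedler C X (%p q u v. \<psi> i p x u v) y"
      by (rule sw_map[OF mT trifam_inner_right[OF tpp x] m(1) h trifam_inner_right[OF m(2) x] C.gcar[OF y] hp[OF x _ C.gcar]])
  qed
  moreover have "sweedler C ?T (%_ _ x y. sweedler C ?T (%_ _ u v. ?pp u v y) x) c
     = sweedler C ?T (%_ _ x y. sweedler C ?T (%_ _ u v. ?pp x u v) y) c" using cdg c by (simp add: curved_dg_coalgebra_def graded_coalgebra_def Let_def)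
  ultimately show ?thesis using sw_cong[OF m(1) bifam_sw_left[OF gC m] c l] sw_cong[OF m(1) bifam_sw_right[OF gC m] c r] by simp
qed

text \<open>The coderivation property, read through an arbitrary bilinear family. The sign comes
  from moving the differential past the left factor.\<close>

lemma sw_diff:
  assumes m: "module k X" "bifam k C C X \<phi>" and c: "c \<in> carrier C"
  shows "sweedler C X \<phi> (diff C c) = sweedler C X (%p q x y. \<phi> (p + 1) q (diff C x) y \<oplus>\<^sub>X ksgn k p \<odot>\<^sub>X \<phi> p (q + 1) x (diff C y)) c"
proof -
  interpret X: kmod k X using assms(1) by (simp add: kmod_def)
  note idl = deg_linear_id[OF C.gs]
  have b1: "bifam k C C X (%p q x y. \<phi> (p + 1) q (diff C x) y)" using bifam_arg[OF gC gC m(2) d_deg idl] by simp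
  have b2: "bifam k C C X (%p q x y. ksgn k p \<odot>\<^sub>X \<phi> p (q + 1) x (diff C y))"
    using bifam_arg[OF gC gC m(2) idl d_deg] by (intro bifam_smult[OF gC gC m(1)]) auto
  note b = bifam_add[OF gC gC m(1) b1 b2]
  have dl: "klinear k C C (diff C)" by (rule deg_klinear[OF d_deg])
  have a: "additive (tensor k C C) X (%t. tlift_hom C C X \<phi> (diff (tensor k C C) t))"
    by (rule klinear_additive[OF klinear_compose[OF CC.L.diff_VW_klinear[OF dl dl] CC.L.th_klinear[OF m]]])
  note th = klinearD[OF CC.L.th_klinear[OF m]]
  have "sweedler C X (%p q x y. \<phi> (p + 1) q (diff C x) y \<oplus>\<^sub>X ksgn k p \<odot>\<^sub>X \<phi> p (q + 1) x (diff C y)) c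
     = tlift_hom C C X \<phi> (diff (tensor k C C) (comult C c))"
  proof (rule sw_additive_eq[OF m(1) b a c])
    fix p q x y assume x: "x \<in> grade C p" and y: "y \<in> grade C q"
    thus "\<phi> (p + 1) q (diff C x) y \<oplus>\<^sub>X ksgn k p \<odot>\<^sub>X \<phi> p (q + 1) x (diff C y) =
       tlift_hom C C X \<phi> (diff (tensor k C C) (pure k C C x y))" using C.gcar[OF x] C.gcar[OF y] by (simp add: CC.L.diff_VW_pure[OF dl dl] d_lin th
          CC.L.th_pure[OF m deg_linear_grade[OF d_deg x] y] CC.L.th_pure[OF m x deg_linear_grade[OF d_deg y]])
  qed
  moreover have "comult C (diff C c) = diff (tensor k C C) (comult C c)" using cdg c by (simp add: curved_dg_coalgebra_def)
  ultimately show ?thesis by (simp add: sweedler_def)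
qed

lemma bifam_form:
  assumes m: "module k X" "klinear k C X h" and e: "deg_form k C n e"
  shows "bifam k C C X (%_ _ x y. e x \<odot>\<^sub>X h y)" "bifam k C C X (%_ _ x y. e y \<odot>\<^sub>X h x)"
  using bifam_bilin[OF gC gC bilin_scalar[OF m(1) e] C.id_kl m(2)] bifam_bilin[OF gC gC bilin_flip[OF bilin_scalar[OF m(1) e]] m(2) C.id_kl] by simp_all

lemma sw_counit:
  assumes m: "module k X" "klinear k C X h" and c: "c \<in> carrier C"
  shows "sweedler C X (%_ _ x y. counit C x \<odot>\<^sub>X h y) c = h c"
    and "sweedler C X (%_ _ x y. counit C y \<odot>\<^sub>X h x) c = h c"
proof -
  have ec: "counit C x \<in> carrier k" if "x \<in> carrier C" for x using counit_form that by (auto simp: deg_form_def)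
  note b = bifam_form[OF mC C.id_kl counit_form] and b' = bifam_form[OF m counit_form]
  have "sweedler C C (%_ _ x y. counit C x \<odot>\<^sub>C y) c = c" "sweedler C C (%_ _ x y. counit C y \<odot>\<^sub>C x) c = c"
    using cdg c by (simp_all add: curved_dg_coalgebra_def graded_coalgebra_def)
  thus "sweedler C X (%_ _ x y. counit C x \<odot>\<^sub>X h y) c = h c" "sweedler C X (%_ _ x y. counit C y \<odot>\<^sub>X h x) c = h c"
    using sw_map[OF mC b(1) m b'(1) c] sw_map[OF mC b(2) m b'(2) c] by (simp_all add: klinearD[OF m(2)] ec C.gcar)
qed

text \<open>The equation for the square of \<open>diff C\<close>, read through a linear map
  \<open>h\<close>, so that its curvature terms can be compared with those of the twisting
  equation.\<close>

lemma sw_curv: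
  assumes m: "module k X" "klinear k C X h" and c: "c \<in> carrier C"
  shows "h (diff C (diff C c)) = sweedler C X (%_ _ x y. curv C x \<odot>\<^sub>X h y) c \<ominus>\<^sub>X sweedler C X (%_ _ x y. curv C y \<odot>\<^sub>X h x) c"
proof -
  interpret X: kmod k X using assms(1) by (simp add: kmod_def)
  have ec: "curv C x \<in> carrier k" if "x \<in> carrier C" for x using curv_form that by (auto simp: deg_form_def)
  note b = bifam_minus[OF gC gC mC bifam_form[OF mC C.id_kl curv_form]] and b' = bifam_form[OF m curv_form]
  have "diff C (diff C c) = sweedler C C (%_ _ x y. curv C x \<odot>\<^sub>C y \<ominus>\<^sub>C curv C y \<odot>\<^sub>C x) c"
    using cdg c by (simp add: curved_dg_coalgebra_def)
  thus ?thesis using sw_lin[OF mC b m c] by (simp, intro sw_minus[OF m(1) b' c])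
      (simp add: klinearD[OF m(2)] ec C.gcar additive_diff[OF C.ab X.M.abelian_group_axioms klinear_additive[OF m(2)]])
qed

end

section \<open>Hom complexes\<close>

text \<open>One locale serves for linear maps and for bimodule maps: \<open>G n\<close> is any
  suitable space of degree n maps.\<close>

locale homs = V: gspace k V + W: gspace k W
  for k :: "'k ring" and V :: "('k, 'v, 'y) dgspace_scheme" and W :: "('k, 'w, 'z) dgspace_scheme" +
  fixes G :: "int => ('v => 'w) set"
  assumes G_ext: "f \<in> G n ==> f \<in> extensional (carrier V)"
    and G_deg: "f \<in> G n ==> deg_linear k V W n f"
    and G_zero: "(\<lambda>v\<in>carrier V. \<zero>\<^sub>W) \<in> G n"
    and G_add: "f \<in> G n ==> g \<in> G n ==> (\<lambda>v\<in>carrier V. f v \<oplus>\<^sub>W g v) \<in> G n"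
    and G_smult: "r \<in> carrier k ==> f \<in> G n ==> (\<lambda>v\<in>carrier V. r \<odot>\<^sub>W f v) \<in> G n"
begin

abbreviation "H \<equiv> hom_graded V W G"

text \<open>The ambient module of all maps, in which the graded pieces \<open>G n\<close> are summed.\<close>

definition "F = H\<lparr>carrier := (carrier V \<rightarrow>\<^sub>E carrier W)\<rparr>"

lemma H_simps:
  "\<zero>\<^sub>H = (\<lambda>v\<in>carrier V. \<zero>\<^sub>W)"
  "f \<oplus>\<^sub>H g = (\<lambda>v\<in>carrier V. f v \<oplus>\<^sub>W g v)"
  "r \<odot>\<^sub>H f = (\<lambda>v\<in>carrier V. r \<odot>\<^sub>W f v)"
  "grade H = G" by (simp_all add: hom_graded_def)

lemma F_simps:
  "\<zero>\<^sub>F = (\<lambda>v\<in>carrier V. \<zero>\<^sub>W)"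
  "f \<oplus>\<^sub>F g = (\<lambda>v\<in>carrier V. f v \<oplus>\<^sub>W g v)"
  "r \<odot>\<^sub>F f = (\<lambda>v\<in>carrier V. r \<odot>\<^sub>W f v)" by (simp_all add: F_def H_simps)

lemma mem_F: "f \<in> carrier F \<longleftrightarrow> f \<in> extensional (carrier V) & (\<forall>v\<in>carrier V. f v \<in> carrier W)"
  by (auto simp: PiE_def F_def)

lemma F_eqI: "f \<in> carrier F ==> g \<in> carrier F ==> (!!v. v \<in> carrier V ==> f v = g v) ==> f = g"
  unfolding mem_F by (auto intro: extensionalityI[of _ "carrier V"])

lemma modF: "module k F"
proof (rule moduleI)
  show "abelian_group F"
  proof (rule abelian_groupI)
    fix f assume f: "f \<in> carrier F"
    have "(\<lambda>v\<in>carrier V. \<ominus>\<^sub>W f v) \<in> carrier F" using f by (simp add: mem_F)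
    moreover have "(\<lambda>v\<in>carrier V. \<ominus>\<^sub>W f v) \<oplus>\<^sub>F f = \<zero>\<^sub>F"
      using f by (simp add: F_simps mem_F W.M.l_neg cong: restrict_cong)
    ultimately show "\<exists>g\<in>carrier F. g \<oplus>\<^sub>F f = \<zero>\<^sub>F" by blast
  qed (auto simp: F_simps W.M.a_ac mem_F intro!: extensionalityI[of _ "carrier V"])
qed (auto simp: F_simps W.smult_l_distr W.smult_r_distr W.smult_assoc1 V.R.cring_axioms mem_F intro!: extensionalityI[of _ "carrier V"])

sublocale F: kmod k F by (simp add: kmod_def modF)

lemma G_F: "f \<in> G n ==> f \<in> carrier F" using G_ext deg_linearD(1)[OF G_deg] by (simp add: mem_F)

lemma F_finsum: "(!!n. n \<in> N ==> u n \<in> carrier F) ==> finite N ==> v \<in> carrier V ==>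
    (\<Oplus>\<^sub>F n\<in>N. u n) v = (\<Oplus>\<^sub>W n\<in>N. u n v)"
proof -
  assume u: "!!n. n \<in> N ==> u n \<in> carrier F" "finite N" and v: "v \<in> carrier V"
  have a: "additive F W (%f. f v)" using v by (simp add: additive_def F_simps mem_F)
  show ?thesis using additive_finsum[OF F.M.abelian_group_axioms W.ab a u(2), of u] u(1) by (auto simp: Pi_def)
qed

text \<open>Padding by zero maps makes \<open>u n\<close> a member of \<open>G n\<close> for every
  n, so the carrier is the sum of the \<open>G n\<close> inside \<open>F\<close>, in the form
  required by \<open>gsums_subm\<close>.\<close>

lemma carrier_H: "f \<in> carrier H \<longleftrightarrow> (\<exists>N u. finite N & (\<forall>n. u n \<in> G n) & f = (\<Oplus>\<^sub>F n\<in>N. u n))"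
proof
  assume "f \<in> carrier H"
  then obtain N g where g: "finite N" "\<forall>n\<in>N. g n \<in> G n" "\<forall>v\<in>carrier V. f v = (\<Oplus>\<^sub>W n\<in>N. g n v)"
    and fe: "f \<in> extensional (carrier V)" by (auto simp: hom_graded_def)
  let ?u = "%n. if n \<in> N then g n else \<zero>\<^sub>H"
  have u: "\<forall>n. ?u n \<in> G n" using g G_zero by (simp add: H_simps)
  have s: "(\<Oplus>\<^sub>F n\<in>N. ?u n) \<in> carrier F" using u G_F by (intro F.M.finsum_closed) blast
  have "f = (\<Oplus>\<^sub>F n\<in>N. ?u n)"
  proof (rule extensionalityI[OF fe])
    show "(\<Oplus>\<^sub>F n\<in>N. ?u n) \<in> extensional (carrier V)" using s by (simp add: mem_F)
    fix v assume v: "v \<in> carrier V"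
    have "(\<Oplus>\<^sub>F n\<in>N. ?u n) v = (\<Oplus>\<^sub>W n\<in>N. ?u n v)" using u G_F g(1) v by (intro F_finsum) blast+
    also have "... = (\<Oplus>\<^sub>W n\<in>N. g n v)" using g(2) G_F v by (intro W.M.finsum_cong') (fastforce simp: mem_F)+
    finally show "f v = (\<Oplus>\<^sub>F n\<in>N. ?u n) v" using g v by simp
  qed
  thus "\<exists>N u. finite N & (\<forall>n. u n \<in> G n) & f = (\<Oplus>\<^sub>F n\<in>N. u n)" using u g(1) by (intro exI[of _ N] exI[of _ ?u]) simp
next
  assume "\<exists>N u. finite N & (\<forall>n. u n \<in> G n) & f = (\<Oplus>\<^sub>F n\<in>N. u n)"
  then obtain N u where u: "finite N" "\<forall>n. u n \<in> G n" "f = (\<Oplus>\<^sub>F n\<in>N. u n)" by blast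
  have s: "(\<Oplus>\<^sub>F n\<in>N. u n) \<in> carrier F" using u G_F by (intro F.M.finsum_closed) blast
  hence "f \<in> extensional (carrier V)" using u(3) by (simp add: mem_F)
  moreover have "f v = (\<Oplus>\<^sub>W n\<in>N. u n v)" if "v \<in> carrier V" for v unfolding u(3) using u G_F that by (intro F_finsum) blast+
  ultimately have "f \<in> extensional (carrier V) & (\<exists>N g. finite N & (\<forall>n\<in>N. g n \<in> G n)
      & (\<forall>v\<in>carrier V. f v = (\<Oplus>\<^sub>W n\<in>N. g n v)))" by (intro conjI exI[of _ N] exI[of _ u] ballI) (simp_all only: u(1,2) simp_thms)
  thus "f \<in> carrier H" unfolding hom_graded_def by simp
qed

lemma G_subm: "F.subm (G n)"
proof (rule F.submI)
  show "G n \<subseteq> carrier F" using G_F by blast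
qed (use G_zero G_add G_smult in \<open>auto simp: F_simps\<close>)

lemma subH: "F.subm (carrier H)"
proof -
  have "carrier H = F.gsums G" using carrier_H by blast
  thus ?thesis by (simp only: F.gsums_subm[OF G_subm])
qed

lemmas H_F = F.subm_car[OF subH]

lemma FH: "F\<lparr>carrier := carrier H\<rparr> = H" by (simp add: F_def)

lemma modH: "module k H" using submodule.submodule_is_module[OF subH modF] by (simp add: FH)

lemma G_H: "f \<in> G n ==> f \<in> carrier H" using F.gsums_member[where G = G, OF G_subm] carrier_H by blast

sublocale H: kmod k H by (simp add: kmod_def modH)

lemma finsum_H: "(!!n. n \<in> N ==> u n \<in> carrier H) ==> finite N ==> (\<Oplus>\<^sub>H n\<in>N. u n) = (\<Oplus>\<^sub>F n\<in>N. u n)"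
proof -
  assume u: "!!n. n \<in> N ==> u n \<in> carrier H" "finite N"
  have "additive H F (%x. x)" using H_F by (auto simp: additive_def H_simps F_simps)
  from additive_finsum[OF H.M.abelian_group_axioms F.M.abelian_group_axioms this u(2), of u] u(1)
  show ?thesis by auto
qed

lemma H_finsum: "(!!n. n \<in> N ==> u n \<in> carrier H) ==> finite N ==> v \<in> carrier V ==>
    (\<Oplus>\<^sub>H n\<in>N. u n) v = (\<Oplus>\<^sub>W n\<in>N. u n v)" by (subst finsum_H; (subst F_finsum)?) (use H_F in blast)+

lemma gsH: "graded_space k H"
proof (rule graded_spaceI[OF modH])
  show "submodule (grade H i) k H" for i unfolding H_simps
  proof (rule H.submI)
    show "G i \<subseteq> carrier H" using G_H by blast
  qed (use G_zero G_add G_smult in \<open>auto simp: H_simps\<close>)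
  show "\<exists>N u. finite N & (\<forall>n\<in>N. u n \<in> grade H n) & v = (\<Oplus>\<^sub>H n\<in>N. u n)" if "v \<in> carrier H" for v
  proof -
    obtain N u where u: "finite N" "\<forall>n. u n \<in> G n" "v = (\<Oplus>\<^sub>F n\<in>N. u n)" using \<open>v \<in> carrier H\<close> unfolding carrier_H by blast
    moreover have "(\<Oplus>\<^sub>F n\<in>N. u n) = (\<Oplus>\<^sub>H n\<in>N. u n)" by (rule finsum_H[symmetric]) (use u G_H in blast)+
    ultimately show ?thesis by (auto simp: H_simps)
  qed
  show "u n = \<zero>\<^sub>H" if N: "finite N" and u: "!!i. u i \<in> grade H i" and z: "(\<Oplus>\<^sub>H i\<in>N. u i) = \<zero>\<^sub>H" and n: "n \<in> N" for N u n
  proof -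
    have uG: "u i \<in> G i" for i using u by (simp add: H_simps)
    note l = G_deg[OF uG]
    have "u n v = \<zero>\<^sub>W" if "v \<in> carrier V" for v using that
    proof (induction rule: V.graded_induct)
      case (hom j v)
      have vc: "v \<in> carrier V" using hom by (rule V.gcar)
      have g: "u i v \<in> grade W (j + i)" for i using deg_linear_grade[OF l hom] .
      have "\<zero>\<^sub>W = (\<Oplus>\<^sub>H i\<in>N. u i) v" using z vc by (simp add: H_simps)
      also have "... = (\<Oplus>\<^sub>W i\<in>N. u i v)" using uG G_H N vc by (intro H_finsum) auto
      \<comment> \<open>For homogeneous \<open>v\<close> of degree j the values \<open>u i v\<close>
        lie in the different degrees j + i. Reindexing by these degrees lets uniqueness of
        homogeneous components in W annihilate each value.\<close>
      also have "... = (\<Oplus>\<^sub>W i\<in>(%i. j + i) ` N. u (i - j) v)" using g W.gcar by (subst W.M.finsum_reindex) (auto simp: inj_on_def)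
      finally have "(\<Oplus>\<^sub>W i\<in>(%i. j + i) ` N. u (i - j) v) = \<zero>\<^sub>W" by simp
      moreover have "hcomp W (j + n) (\<Oplus>\<^sub>W i\<in>(%i. j + i) ` N. u (i - j) v)
          = (if j + n \<in> (%i. j + i) ` N then u ((j + n) - j) v else \<zero>\<^sub>W)"
      proof (rule W.hcomp_of_sum)
        fix i show "u (i - j) v \<in> grade W i" using g[of "i - j"] by simp
      qed (use N in simp)
      ultimately show ?case using n W.hcomp_hom[OF W.g_zero] by simp
    next
      case (add x y)
      thus ?case using deg_linearD[OF l] by simp
    qed
    thus ?thesis using G_ext[OF uG] by (auto simp: H_simps intro!: extensionalityI[of _ "carrier V"])
  qed
qed

sublocale H: gspace k H using gsH by (rule gspaceI)

lemma H_klinear: "f \<in> carrier H ==> klinear k V W f"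
proof (induction rule: H.graded_induct)
  case (hom i x) thus ?case using deg_klinear[OF G_deg] by (simp add: H_simps)
next
  case (add x y)
  note k = klinearD[OF add(3)] klinearD[OF add(4)]
  show ?case unfolding klinear_def by (auto simp: H_simps k W.M.a_ac W.smult_r_distr)
qed

lemma H_eqI: "f \<in> carrier H ==> g \<in> carrier H ==> (!!v. v \<in> carrier V ==> f v = g v) ==> f = g" using H_F F_eqI by simp

lemma H_minus: "f \<in> carrier H ==> g \<in> carrier H ==> v \<in> carrier V ==> (f \<ominus>\<^sub>H g) v = f v \<ominus>\<^sub>W g v"
  using H_F[of f] H_F[of g] by (simp add: a_minus_def H.minus_as_ksgn H_simps W.minus_as_ksgn mem_F)

end

lemma hom_simps:
  "carrier (hom_complex k V W G) = carrier (hom_graded V W G)"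
  "\<zero>\<^bsub>hom_complex k V W G\<^esub> = \<zero>\<^bsub>hom_graded V W G\<^esub>"
  "add (hom_complex k V W G) = add (hom_graded V W G)"
  "smult (hom_complex k V W G) = smult (hom_graded V W G)"
  "grade (hom_complex k V W G) = grade (hom_graded V W G)" by (simp_all add: hom_complex_def Let_def)

section \<open>Structure carried over between records with equal data\<close>

lemma module_cong:
  assumes "module k V" "carrier W = carrier V" "zero W = zero V" "add W = add V" "smult W = smult V"
  shows "module k W"
proof -
  interpret V: module k V by fact
  show ?thesis by (intro moduleI abelian_groupI) (auto simp: assms(2-) V.R.cring_axioms V.smult_l_distr V.smult_r_distr V.smult_assoc1 V.M.a_ac
        intro: bexI[of _ "\<ominus>\<^sub>V _"] V.M.l_neg)
qed

lemma submodule_cong: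
  assumes "submodule S k V" "module k V" "carrier W = carrier V" "zero W = zero V" "add W = add V" "smult W = smult V"
  shows "submodule S k W"
proof -
  interpret V: module k V by fact
  interpret W: module k W by (rule module_cong[OF assms(2-)])
  show ?thesis using V.submoduleE[OF assms(1)] a_inv_cong_struct[OF assms(3,5,4)] assms(3-)
    by (intro W.submoduleI) (auto simp: V.M.r_neg, metis V.M.r_neg subsetD)
qed

lemma graded_space_cong:
  assumes "graded_space k V" "carrier W = carrier V" "zero W = zero V" "add W = add V" "smult W = smult V" "grade W = grade V"
  shows "graded_space k W"
proof -
  have m: "module k V" and s: "!!i. submodule (grade V i) k V" using assms(1) by (auto simp: graded_space_def)
  have "hdecomp W v u = hdecomp V v u" for v u unfolding hdecomp_def assms(2-) finsum_cong_struct[OF assms(2,4,3)] ..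
  thus ?thesis using assms(1) module_cong[OF m assms(2-5)] submodule_cong[OF s m assms(2-5)] assms(2,6) by (simp add: graded_space_def)
qed

section \<open>The differential of a Hom complex\<close>

locale homc = homs k V W G
  for k :: "'k ring" and V :: "('k, 'v, 'y) dgspace_scheme" and W :: "('k, 'w, 'z) dgspace_scheme" and G +
  assumes dV: "deg_linear k V V 1 (diff V)" and dW: "deg_linear k W W 1 (diff W)"
    and G_diff: "f \<in> G n ==> (\<lambda>v\<in>carrier V. diff W (f v) \<ominus>\<^sub>W ksgn k n \<odot>\<^sub>W f (diff V v)) \<in> G (n + 1)"
begin

abbreviation "HC \<equiv> hom_complex k V W G"

lemmas dV_lin = klinearD[OF dV[THEN deg_klinear]]
lemmas dW_lin = klinearD[OF dW[THEN deg_klinear]]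

lemma gsHC: "graded_space k HC" by (rule graded_space_cong[OF gsH]) (simp_all add: hom_simps)

sublocale HC: gspace k HC using gsHC by (rule gspaceI)

lemma HC_minus: "f \<ominus>\<^sub>HC g = f \<ominus>\<^sub>H g" by (rule a_minus_cong_struct) (simp_all add: hom_simps)

lemma D_addfam: "addfam H H (%n f. \<lambda>v\<in>carrier V. diff W (f v) \<ominus>\<^sub>W ksgn k n \<odot>\<^sub>W f (diff V v))"
proof -
  { fix n f g assume f: "f \<in> G n" and g: "g \<in> G n"
    note l = klinearD[OF G_deg[OF f, THEN deg_klinear]] klinearD[OF G_deg[OF g, THEN deg_klinear]]
    have "(\<lambda>v\<in>carrier V. diff W ((f \<oplus>\<^sub>H g) v) \<ominus>\<^sub>W ksgn k n \<odot>\<^sub>W (f \<oplus>\<^sub>H g) (diff V v))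
       = (\<lambda>v\<in>carrier V. diff W (f v) \<ominus>\<^sub>W ksgn k n \<odot>\<^sub>W f (diff V v)) \<oplus>\<^sub>H
         (\<lambda>v\<in>carrier V. diff W (g v) \<ominus>\<^sub>W ksgn k n \<odot>\<^sub>W g (diff V v))"
      by (auto simp: H_simps l dW_lin dV_lin a_minus_def W.smult_r_distr W.M.minus_add W.M.a_ac intro!: restrict_ext)
  } thus ?thesis unfolding addfam_def H_simps(4) using G_diff G_H by blast
qed

lemma HC_diff: "f \<in> G n ==> v \<in> carrier V ==> diff HC f v = diff W (f v) \<ominus>\<^sub>W ksgn k n \<odot>\<^sub>W f (diff V v)"
  using H.hsum_hom[OF H.ab D_addfam, of f n] by (simp add: hom_complex_def Let_def H_simps)

lemma HC_diff_G: "f \<in> G n ==> diff HC f \<in> G (n + 1)" using H.hsum_hom[OF H.ab D_addfam, of f n] G_diff[of f n]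
  by (simp add: hom_complex_def Let_def H_simps)

lemma HC_diff_klinear: "klinear k HC HC (diff HC)"
proof -
  have e: "diff HC = hsum H H (%n f. \<lambda>v\<in>carrier V. diff W (f v) \<ominus>\<^sub>W ksgn k n \<odot>\<^sub>W f (diff V v))"
    by (simp add: hom_complex_def Let_def)
  note ad = additiveD[OF H.hsum_additive[OF H.ab D_addfam]]
  have "diff HC (r \<odot>\<^sub>H f) = r \<odot>\<^sub>H diff HC f" if "f \<in> carrier H" "r \<in> carrier k" for r f unfolding e
  proof (rule H.hsum_smult[OF modH D_addfam that])
    fix n f assume "f \<in> grade H n"
    hence f: "f \<in> G n" by (simp add: H_simps)
    note l = klinearD[OF G_deg[OF f, THEN deg_klinear]]
    show "(\<lambda>v\<in>carrier V. diff W ((r \<odot>\<^sub>H f) v) \<ominus>\<^sub>W ksgn k n \<odot>\<^sub>W (r \<odot>\<^sub>H f) (diff V v)) =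
       r \<odot>\<^sub>H (\<lambda>v\<in>carrier V. diff W (f v) \<ominus>\<^sub>W ksgn k n \<odot>\<^sub>W f (diff V v))" using that(2)
      by (auto simp: H_simps l dW_lin dV_lin a_minus_def W.smult_r_distr W.smult_r_minus W.smult_comm intro!: restrict_ext)
  qed
  thus ?thesis using ad unfolding klinear_def hom_simps by (simp add: e)
qed

lemma HC_diff_deg: "deg_linear k HC HC 1 (diff HC)" unfolding deg_linear_def using HC_diff_klinear HC_diff_G by (auto simp: hom_simps H_simps)

text \<open>The squares of the two given differentials vanish, and the two mixed terms
  \<open>diff W (f (diff V v))\<close> come with signs of opposite parity.\<close>

lemma HC_dg_space:
  assumes "!!v. v \<in> carrier V ==> diff V (diff V v) = \<zero>\<^sub>V" "!!w. w \<in> carrier W ==> diff W (diff W w) = \<zero>\<^sub>W"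
  shows "dg_space k HC"
proof -
  have "diff HC (diff HC f) = \<zero>\<^sub>HC" if "f \<in> carrier HC" for f using that
  proof (induction rule: HC.graded_induct)
    case (hom n f)
    hence f: "f \<in> G n" by (simp add: hom_simps H_simps)
    note l = klinearD[OF G_deg[OF f, THEN deg_klinear]]
    have z: "f \<zero>\<^sub>V = \<zero>\<^sub>W" by (rule additive_zero[OF V.ab W.ab klinear_additive[OF G_deg[OF f, THEN deg_klinear]]])
    note mn = additive_diff[OF W.ab W.ab klinear_additive[OF dW[THEN deg_klinear]]]
    show ?case
    proof (rule H_eqI)
      show "diff HC (diff HC f) \<in> carrier H" using HC_diff_G[OF HC_diff_G[OF f]] by (rule G_H)
      show "\<zero>\<^sub>HC \<in> carrier H" by (simp add: hom_simps)
      fix v assume v: "v \<in> carrier V"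
      show "diff HC (diff HC f) v = \<zero>\<^sub>HC v" using v l dV_lin dW_lin
        by (simp add: HC_diff[OF HC_diff_G[OF f]] HC_diff[OF f] hom_simps H_simps mn assms z a_minus_def
          W.minus_as_ksgn W.ksgn_ksgn W.smult_r_distr W.ksgn_add_zero)
    qed
  next
    case (add x y)
    thus ?case using klinearD[OF HC_diff_klinear] by simp
  qed
  thus ?thesis unfolding dg_space_def using gsHC HC_diff_deg by blast
qed

end

section \<open>Bimodules over a dg algebra\<close>

locale dga =
  fixes k :: "'k ring" and A :: "('k, 'a) dgspace"
  assumes dgA: "dg_algebra k A"

sublocale dga \<subseteq> A: gspace k A using dgA by (intro gspaceI) (simp add: dg_algebra_def graded_algebra_def)

sublocale dga \<subseteq> AR: ring A using dgA by (simp add: dg_algebra_def graded_algebra_def)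

context dga begin

lemma A_smult_l: "r \<in> carrier k ==> x \<in> carrier A ==> y \<in> carrier A ==> (r \<odot>\<^sub>A x) \<otimes>\<^sub>A y = r \<odot>\<^sub>A (x \<otimes>\<^sub>A y)"
  and A_smult_r: "r \<in> carrier k ==> x \<in> carrier A ==> y \<in> carrier A ==> x \<otimes>\<^sub>A (r \<odot>\<^sub>A y) = r \<odot>\<^sub>A (x \<otimes>\<^sub>A y)"
  and one_g: "\<one>\<^sub>A \<in> grade A 0"
  and mult_g: "x \<in> grade A i ==> y \<in> grade A j ==> x \<otimes>\<^sub>A y \<in> grade A (i + j)"
  and dA_deg: "deg_linear k A A 1 (diff A)"
  and ddA: "x \<in> carrier A ==> diff A (diff A x) = \<zero>\<^sub>A"
  and leibA: "x \<in> grade A i ==> y \<in> carrier A ==> diff A (x \<otimes>\<^sub>A y) = diff A x \<otimes>\<^sub>A y \<oplus>\<^sub>A ksgn k i \<odot>\<^sub>A (x \<otimes>\<^sub>A diff A y)"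
  using dgA unfolding dg_algebra_def graded_algebra_def dg_space_def by blast+

lemma A_dg: "dg_space k A" using dgA unfolding dg_algebra_def by blast

lemmas dA_lin = klinearD[OF dA_deg[THEN deg_klinear]]
lemmas dA_g = deg_linear_grade[OF dA_deg]

lemma mult_bilin: "bilin k A A A (mult A)" unfolding bilin_def by (simp add: AR.l_distr AR.r_distr A_smult_l A_smult_r)

text \<open>The product rule for 1 = 1 1 gives d(1) = d(1) + d(1).\<close>

lemma dA_one: "diff A \<one>\<^sub>A = \<zero>\<^sub>A"
proof -
  have c: "diff A \<one>\<^sub>A \<in> carrier A" by (simp add: dA_lin)
  hence "diff A \<one>\<^sub>A = diff A \<one>\<^sub>A \<oplus>\<^sub>A diff A \<one>\<^sub>A" using leibA[OF one_g AR.one_closed] by simp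
  thus ?thesis using c by simp
qed

end

section \<open>Graded bimodules and bimodule maps\<close>

locale gbim = dga k A for k :: "'k ring" and A :: "('k, 'a) dgspace" +
  fixes M :: "('k, 'a, 'm) dgbimod"
  assumes gb: "graded_bimodule k A M"

sublocale gbim \<subseteq> M: gspace k M using gb by (intro gspaceI) (simp add: graded_bimodule_def)

context gbim begin

lemma la_bilin: "bilin k A M M (lact M)" and ra_bilin: "bilin k M A M (ract M)"
  using gb unfolding graded_bimodule_def bilin_def klinear_def by (auto simp: Pi_iff)

lemmas la = bilinD[OF la_bilin] and ra = bilinD[OF ra_bilin]

lemma la_one: "m \<in> carrier M ==> lact M \<one>\<^sub>A m = m"
  and ra_one: "m \<in> carrier M ==> ract M m \<one>\<^sub>A = m"
  and la_assoc: "a \<in> carrier A ==> b \<in> carrier A ==> m \<in> carrier M ==> lact M (a \<otimes>\<^sub>A b) m = lact M a (lact M b m)"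
  and ra_assoc: "a \<in> carrier A ==> b \<in> carrier A ==> m \<in> carrier M ==> ract M m (a \<otimes>\<^sub>A b) = ract M (ract M m a) b"
  and lra: "a \<in> carrier A ==> b \<in> carrier A ==> m \<in> carrier M ==> ract M (lact M a m) b = lact M a (ract M m b)"
  and la_g: "a \<in> grade A i ==> m \<in> grade M j ==> lact M a m \<in> grade M (i + j)"
  and ra_g0: "a \<in> grade A i ==> m \<in> grade M j ==> ract M m a \<in> grade M (i + j)" using gb by (simp_all add: graded_bimodule_def)

lemma ra_g: "m \<in> grade M j ==> a \<in> grade A i ==> ract M m a \<in> grade M (j + i)" using ra_g0[of a i m j] by (simp add: add.commute)

lemma la_zero: "m \<in> carrier M ==> lact M \<zero>\<^sub>A m = \<zero>\<^sub>M"
  and la_zero2: "a \<in> carrier A ==> lact M a \<zero>\<^sub>M = \<zero>\<^sub>M"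
  and ra_zero: "m \<in> carrier M ==> ract M m \<zero>\<^sub>A = \<zero>\<^sub>M"
  and ra_zero2: "a \<in> carrier A ==> ract M \<zero>\<^sub>M a = \<zero>\<^sub>M"
  using additive_zero[OF A.ab M.ab klinear_additive[OF bilin_left[OF la_bilin]]]
    additive_zero[OF M.ab M.ab klinear_additive[OF bilin_right[OF la_bilin]]]
    additive_zero[OF A.ab M.ab klinear_additive[OF bilin_right[OF ra_bilin]]]
    additive_zero[OF M.ab M.ab klinear_additive[OF bilin_left[OF ra_bilin]]] by blast+

end

lemma bimod_linearD:
  assumes "bimod_linear k A M N n f"
  shows "deg_linear k M N n f"
    and "a \<in> grade A i ==> m \<in> carrier M ==> b \<in> carrier A ==>
      f (lact M a (ract M m b)) = ksgn k (n * i) \<odot>\<^sub>N lact N a (ract N (f m) b)" using assms by (auto simp: bimod_linear_def)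

locale gbim2 = M: gbim k A M + N: gbim k A N
  for k :: "'k ring" and A :: "('k, 'a) dgspace" and M :: "('k, 'a, 'm) dgbimod" and N :: "('k, 'a, 'n) dgbimod"
begin

abbreviation "BL n \<equiv> {f \<in> extensional (carrier M). bimod_linear k A M N n f}"

lemma bl_lin: "bimod_linear k A M N n f ==> klinear k M N f" using bimod_linearD(1) deg_klinear by blast

lemmas bl = klinearD[OF bl_lin]

lemma bl_l: "bimod_linear k A M N n f ==> a \<in> grade A i ==> m \<in> carrier M ==>
    f (lact M a m) = ksgn k (n * i) \<odot>\<^sub>N lact N a (f m)" using bimod_linearD(2)[of k A M N n f a i m "\<one>\<^sub>A"] bl(1)
  by (simp add: M.ra_one N.ra_one)

lemma bl_r: "bimod_linear k A M N n f ==> m \<in> carrier M ==> b \<in> carrier A ==>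
    f (ract M m b) = ract N (f m) b" using bimod_linearD(2)[of k A M N n f "\<one>\<^sub>A" 0 m b] bl(1)[of n f m] M.one_g
  by (simp add: M.la_one N.la_one M.ra N.ra)

lemma bimod_linearI:
  assumes "deg_linear k M N n f"
    and "!!a i m. a \<in> grade A i ==> m \<in> carrier M ==> f (lact M a m) = ksgn k (n * i) \<odot>\<^sub>N lact N a (f m)"
    and "!!m b. m \<in> carrier M ==> b \<in> carrier A ==> f (ract M m b) = ract N (f m) b"
  shows "bimod_linear k A M N n f" using assms M.ra(1) by (simp add: bimod_linear_def)

end

sublocale gbim2 \<subseteq> homs k M N "%n. BL n"
proof
  fix n :: int
  note z = M.A.gcar
  show "(\<lambda>v\<in>carrier M. \<zero>\<^sub>N) \<in> BL n"
    by (auto intro!: bimod_linearI simp: deg_linear_def klinear_def M.M.gcar M.la M.ra z N.la_zero2 N.ra_zero2)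
  fix f assume "f \<in> BL n"
  hence f: "bimod_linear k A M N n f" by simp
  note lf = bl[OF f]
  have gf: "v \<in> grade M i ==> f v \<in> grade N (i + n)" for v i using deg_linear_grade[OF bimod_linearD(1)[OF f]] .
  { fix g assume "g \<in> BL n"
    hence g: "bimod_linear k A M N n g" by simp
    note lg = bl[OF g]
    have gg: "v \<in> grade M i ==> g v \<in> grade N (i + n)" for v i using deg_linear_grade[OF bimod_linearD(1)[OF g]] .
    have "bimod_linear k A M N n (\<lambda>v\<in>carrier M. f v \<oplus>\<^sub>N g v)"
    proof (rule bimod_linearI)
      show "deg_linear k M N n (\<lambda>v\<in>carrier M. f v \<oplus>\<^sub>N g v)"
        by (auto simp: deg_linear_def klinear_def lf lg gf gg M.M.gcar N.M.a_ac N.M.smult_r_distr)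
    qed (simp_all add: lf lg M.la M.ra z N.la N.ra bl_l[OF f] bl_l[OF g] bl_r[OF f] bl_r[OF g] N.M.smult_r_distr)
    thus "(\<lambda>v\<in>carrier M. f v \<oplus>\<^sub>N g v) \<in> BL n" by simp }
  { fix r assume r: "r \<in> carrier k"
    have "bimod_linear k A M N n (\<lambda>v\<in>carrier M. r \<odot>\<^sub>N f v)"
    proof (rule bimod_linearI)
      show "deg_linear k M N n (\<lambda>v\<in>carrier M. r \<odot>\<^sub>N f v)"
        using r by (auto simp: deg_linear_def klinear_def lf gf M.M.gcar N.M.smult_r_distr N.M.smult_comm)
    qed (simp_all add: r lf M.la M.ra z N.la N.ra bl_l[OF f] bl_r[OF f] N.M.smult_comm)
    thus "(\<lambda>v\<in>carrier M. r \<odot>\<^sub>N f v) \<in> BL n" by simp }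
qed (auto simp: bimod_linear_def)

locale dbim = gbim k A M for k :: "'k ring" and A :: "('k, 'a) dgspace" and M :: "('k, 'a, 'm) dgbimod" +
  assumes dgM: "dg_bimodule k A M"
begin

lemma d_deg: "deg_linear k M M 1 (diff M)"
  and dd: "m \<in> carrier M ==> diff M (diff M m) = \<zero>\<^sub>M"
  and leib_l: "a \<in> grade A i ==> m \<in> carrier M ==>
     diff M (lact M a m) = lact M (diff A a) m \<oplus>\<^sub>M ksgn k i \<odot>\<^sub>M lact M a (diff M m)"
  and leib_r: "m \<in> grade M i ==> a \<in> carrier A ==>
     diff M (ract M m a) = ract M (diff M m) a \<oplus>\<^sub>M ksgn k i \<odot>\<^sub>M ract M m (diff A a)"
  using dgM unfolding dg_bimodule_def dg_space_def by blast+

lemmas d_lin = klinearD[OF d_deg[THEN deg_klinear]]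
lemmas d_g = deg_linear_grade[OF d_deg]

end

lemma dbimI: "dga k A ==> dg_bimodule k A M ==> dbim k A M" by (simp add: dbim_def dbim_axioms_def gbim_def gbim_axioms_def dg_bimodule_def)

lemma gbimI: "dga k A ==> graded_bimodule k A M ==> gbim k A M" by (simp add: gbim_def gbim_axioms_def)

locale dbim2 = M: dbim k A M + N: dbim k A N
  for k :: "'k ring" and A :: "('k, 'a) dgspace" and M :: "('k, 'a, 'm) dgbimod" and N :: "('k, 'a, 'n) dgbimod"

sublocale dbim2 \<subseteq> gbim2 k A M N ..

text \<open>The Hom differential preserves bimodule linearity: on either side, the terms that
  contain the differential of the algebra element cancel.\<close>

sublocale dbim2 \<subseteq> homc k M N "%n. {f \<in> extensional (carrier M). bimod_linear k A M N n f}"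
proof
  show "deg_linear k M M 1 (diff M)" by (rule M.d_deg)
  show "deg_linear k N N 1 (diff N)" by (rule N.d_deg)
  fix f n assume "f \<in> BL n"
  hence f: "bimod_linear k A M N n f" by simp
  note lf = bl[OF f]
  note z = M.A.gcar
  have gf: "v \<in> grade M i ==> f v \<in> grade N (i + n)" for v i using deg_linear_grade[OF bimod_linearD(1)[OF f]] .
  let ?D = "\<lambda>v\<in>carrier M. diff N (f v) \<ominus>\<^sub>N ksgn k n \<odot>\<^sub>N f (diff M v)"
  have lin: "klinear k M N ?D" unfolding klinear_def by (simp add: lf M.d_lin N.d_lin a_minus_def N.M.smult_r_distr N.M.minus_as_ksgn N.M.a_ac
        N.M.smult_comm)
  have deg: "deg_linear k M N (n + 1) ?D"
  proof (rule M.M.deg_linearI[OF _ lin])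
    show "?D v \<in> grade N (i + (n + 1))" if v: "v \<in> grade M i" for v i
      using N.d_g[OF gf[OF v]] gf[OF M.d_g[OF v]] M.M.gcar[OF v] by (simp add: algebra_simps)
  qed unfold_locales
  have "bimod_linear k A M N (n + 1) ?D"
  proof (rule bimod_linearI[OF deg])
    fix a i m assume a: "a \<in> grade A i" and m: "m \<in> carrier M"
    have da: "diff A a \<in> grade A (i + 1)" using M.dA_g[OF a] .
    let ?X = "lact N (diff A a) (f m)" and ?Y = "lact N a (diff N (f m))" and ?Z = "lact N a (f (diff M m))"
    have c: "?X \<in> carrier N" "?Y \<in> carrier N" "?Z \<in> carrier N" "lact N a (f m) \<in> carrier N"
      using z[OF a] z[OF da] m by (simp_all add: lf M.d_lin N.d_lin N.la)
    have "?D (lact M a m) = (ksgn k (n * i) \<odot>\<^sub>N ?X \<oplus>\<^sub>N ksgn k (1 + n + n * (i + 1)) \<odot>\<^sub>N ?X) \<oplus>\<^sub>N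
       (ksgn k (n * i + i) \<odot>\<^sub>N ?Y \<oplus>\<^sub>N ksgn k (1 + n + i + n * i) \<odot>\<^sub>N ?Z)"
      using a m z[OF a] z[OF da] c by (simp add: lf M.d_lin N.d_lin M.la M.leib_l N.leib_l[OF a] bl_l[OF f a] bl_l[OF f da] a_minus_def
          N.M.minus_as_ksgn N.M.smult_r_distr N.M.ksgn_ksgn N.M.a_ac algebra_simps)
    also have "... = ksgn k (n * i + i) \<odot>\<^sub>N ?Y \<oplus>\<^sub>N ksgn k (1 + n + i + n * i) \<odot>\<^sub>N ?Z"
    proof -
      \<comment> \<open>The term in \<open>diff A a\<close> comes once with the sign of moving f
        past \<open>a\<close>, and once with that of moving f past \<open>diff A a\<close>, which
        has degree i + 1.\<close>
      have "odd (n * i + (1 + n + n * (i + 1)))" by auto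
      thus ?thesis using c by (subst N.M.ksgn_add_zero[OF c(1)]) simp_all
    qed
    also have "... = ksgn k ((n + 1) * i) \<odot>\<^sub>N lact N a (?D m)" using a m z[OF a] c by (simp add: lf M.d_lin N.d_lin N.la a_minus_def
          N.M.minus_as_ksgn N.M.smult_r_distr N.M.ksgn_ksgn algebra_simps)
    finally show "?D (lact M a m) = ksgn k ((n + 1) * i) \<odot>\<^sub>N lact N a (?D m)" .
  next
    fix m b assume m: "m \<in> carrier M" and b: "b \<in> carrier A"
    \<comment> \<open>The product rule for the right action has the sign of \<open>m\<close>, so
      \<open>m\<close> is taken homogeneous first.\<close>
    from m show "?D (ract M m b) = ract N (?D m) b"
    proof (induction rule: M.M.graded_induct)
      case (hom i m)
      note mc = M.M.gcar[OF hom]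
      let ?X = "ract N (diff N (f m)) b" and ?Y = "ract N (f (diff M m)) b" and ?Z = "ract N (f m) (diff A b)"
      have c: "?X \<in> carrier N" "?Y \<in> carrier N" "?Z \<in> carrier N" using b mc by (simp_all add: lf M.d_lin N.d_lin N.ra M.dA_lin)
      have "?D (ract M m b) = (?X \<oplus>\<^sub>N ksgn k (1 + n) \<odot>\<^sub>N ?Y) \<oplus>\<^sub>N
         (ksgn k (i + n) \<odot>\<^sub>N ?Z \<oplus>\<^sub>N ksgn k (1 + n + i) \<odot>\<^sub>N ?Z)"
        using b mc c by (simp add: lf M.d_lin N.d_lin M.ra M.dA_lin M.leib_r[OF hom] N.leib_r[OF gf[OF hom]] bl_r[OF f] a_minus_def
          N.M.minus_as_ksgn N.M.smult_r_distr N.M.ksgn_ksgn N.M.a_ac algebra_simps)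
      also have "... = ?X \<oplus>\<^sub>N ksgn k (1 + n) \<odot>\<^sub>N ?Y"
      proof -
        have "odd ((i + n) + (1 + n + i))" by auto
        thus ?thesis using c by (subst N.M.ksgn_add_zero[OF c(3)]) simp_all
      qed
      also have "... = ract N (?D m) b" using b mc c by (simp add: lf M.d_lin N.d_lin N.ra a_minus_def
          N.M.minus_as_ksgn N.M.smult_r_distr N.M.ksgn_ksgn)
      finally show ?case .
    next
      case (add x y)
      note D = klinearD[OF lin]
      have "?D (ract M (x \<oplus>\<^sub>M y) b) = ?D (ract M x b \<oplus>\<^sub>M ract M y b)" using add(1,2) b by (simp only: M.ra)
      also have "... = ?D (ract M x b) \<oplus>\<^sub>N ?D (ract M y b)" using add(1,2) b by (intro D) (simp_all add: M.ra)
      also have "... = ract N (?D x) b \<oplus>\<^sub>N ract N (?D y) b" by (simp only: add(3,4))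
      also have "... = ract N (?D x \<oplus>\<^sub>N ?D y) b" by (rule N.ra(2)[symmetric, OF D(1)[OF add(1)] b D(1)[OF add(2)]])
      also have "... = ract N (?D (x \<oplus>\<^sub>M y)) b" by (simp only: D(2)[OF add(1,2)])
      finally show ?case .
    qed
  qed
  thus "?D \<in> BL (n + 1)" by simp
qed

lemma dg_space_cong:
  assumes "dg_space k V" "carrier W = carrier V" "zero W = zero V" "add W = add V" "smult W = smult V"
    "grade W = grade V" "diff W = diff V"
  shows "dg_space k W" using assms graded_space_cong[OF _ assms(2-6), of k] unfolding dg_space_def deg_linear_def klinear_def by simp

section \<open>The endomorphism algebra of a dg bimodule\<close>

locale dbim_end = dbim2 k A M M for k :: "'k ring" and A :: "('k, 'a) dgspace" and M :: "('k, 'a, 'm) dgbimod"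
begin

abbreviation "E \<equiv> End_bimod k A M"

lemma E_simps:
  "carrier E = carrier H" "\<zero>\<^sub>E = \<zero>\<^sub>H" "add E = add H" "smult E = smult H" "grade E = grade H"
  "diff E = diff HC" "\<one>\<^sub>E = (\<lambda>m\<in>carrier M. m)" "f \<otimes>\<^sub>E g = compose (carrier M) f g"
  by (simp_all add: End_bimod_def Hom_bimod_def hom_simps)

lemma E_dg: "dg_space k E" by (rule dg_space_cong[OF HC_dg_space[OF M.dd M.dd]]) (simp_all add: E_simps hom_simps)

lemma E_cl: "f \<in> carrier H ==> v \<in> carrier M ==> f v \<in> carrier M" using klinearD(1)[OF H_klinear] .

lemma E_eqI: "f \<in> carrier E ==> g \<in> carrier E ==> (!!v. v \<in> carrier M ==> f v = g v) ==> f = g" unfolding E_simps by (rule H_eqI)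

lemma E_mult_g: "f \<in> BL m ==> g \<in> BL n ==> compose (carrier M) f g \<in> BL (m + n)"
proof -
  assume "f \<in> BL m" and "g \<in> BL n"
  hence f: "bimod_linear k A M M m f" and g: "bimod_linear k A M M n g" by auto
  note lf = bl[OF f] and lg = bl[OF g]
  have "bimod_linear k A M M (m + n) (compose (carrier M) f g)"
  proof (rule bimod_linearI)
    show "deg_linear k M M (m + n) (compose (carrier M) f g)"
    proof (rule M.M.deg_linearI)
      show "klinear k M M (compose (carrier M) f g)" by (simp add: klinear_def compose_def lf lg)
      show "compose (carrier M) f g x \<in> grade M (i + (m + n))" if x: "x \<in> grade M i" for i x
        using deg_linear_grade[OF bimod_linearD(1)[OF f] deg_linear_grade[OF bimod_linearD(1)[OF g] x]] M.M.gcar[OF x] by (simp add: compose_def algebra_simps)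
    qed unfold_locales
    show "compose (carrier M) f g (lact M a v) = ksgn k ((m + n) * i) \<odot>\<^sub>M lact M a (compose (carrier M) f g v)"
      if a: "a \<in> grade A i" and v: "v \<in> carrier M" for a i v using v M.A.gcar[OF a]
      by (simp add: compose_def lf lg M.la bl_l[OF f a] bl_l[OF g a] M.M.ksgn_ksgn algebra_simps)
    show "compose (carrier M) f g (ract M v b) = ract M (compose (carrier M) f g v) b"
      if "v \<in> carrier M" "b \<in> carrier A" for v b using that by (simp add: compose_def lf lg M.ra bl_r[OF f] bl_r[OF g])
  qed
  thus ?thesis by simp
qed

lemma E_mult_cl: "f \<in> carrier H ==> g \<in> carrier H ==> compose (carrier M) f g \<in> carrier H"
proof (induction rule: H.graded_induct)
  case (hom m f)
  hence f: "f \<in> BL m" by (simp add: H_simps)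
  have lf: "klinear k M M f" using f bl_lin by blast
  from hom(2) show ?case
  proof (induction rule: H.graded_induct)
    case (hom n g)
    thus ?case using E_mult_g[OF f] by (intro G_H) (simp add: H_simps)
  next
    case (add g h)
    have "compose (carrier M) f (g \<oplus>\<^sub>H h) = compose (carrier M) f g \<oplus>\<^sub>H compose (carrier M) f h"
      using klinearD[OF lf] E_cl[OF add(1)] E_cl[OF add(2)] by (simp add: compose_def H_simps cong: restrict_cong)
    thus ?case using add by simp
  qed
next
  case (add f h)
  have "compose (carrier M) (f \<oplus>\<^sub>H h) g = compose (carrier M) f g \<oplus>\<^sub>H compose (carrier M) h g"
    using E_cl[OF add(5)] by (simp add: compose_def H_simps cong: restrict_cong)
  thus ?case using add by simp
qed

lemma E_one: "(\<lambda>m\<in>carrier M. m) \<in> BL 0" by (auto intro!: bimod_linearI simp: M.M.gcar M.la M.ra M.A.gcar deg_linear_def klinear_def)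

lemma E_ring: "ring E"
proof (rule ringI)
  interpret Es: gspace k E using E_dg by (intro gspaceI) (simp add: dg_space_def)
  show "abelian_group E" by (rule Es.ab)
  show "monoid E"
  proof (rule monoidI)
    have cl: "f \<otimes>\<^sub>E g \<in> carrier E" if "f \<in> carrier E" "g \<in> carrier E" for f g using that E_mult_cl by (simp add: E_simps)
    show one: "\<one>\<^sub>E \<in> carrier E" using G_H[OF E_one] by (simp add: E_simps)
    fix f g h assume f: "f \<in> carrier E" and g: "g \<in> carrier E"
    show "f \<otimes>\<^sub>E g \<in> carrier E" using f g by (rule cl)
    have fc: "f v \<in> carrier M" if "v \<in> carrier M" for v using E_cl f that by (simp add: E_simps)
    show "\<one>\<^sub>E \<otimes>\<^sub>E f = f" by (rule E_eqI[OF cl[OF one f] f]) (simp add: E_simps compose_def fc)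
    show "f \<otimes>\<^sub>E \<one>\<^sub>E = f" by (rule E_eqI[OF cl[OF f one] f]) (simp add: E_simps compose_def)
    assume h: "h \<in> carrier E"
    show "f \<otimes>\<^sub>E g \<otimes>\<^sub>E h = f \<otimes>\<^sub>E (g \<otimes>\<^sub>E h)"
    proof (rule E_eqI[OF cl[OF cl[OF f g] h] cl[OF f cl[OF g h]]])
      fix v assume v: "v \<in> carrier M"
      have "h v \<in> carrier M" using E_cl h v by (simp add: E_simps)
      thus "(f \<otimes>\<^sub>E g \<otimes>\<^sub>E h) v = (f \<otimes>\<^sub>E (g \<otimes>\<^sub>E h)) v" using v by (simp add: E_simps compose_def)
    qed
  qed
  fix f g h assume "f \<in> carrier E" "g \<in> carrier E" "h \<in> carrier E"
  hence f: "f \<in> carrier H" and g: "g \<in> carrier H" and h: "h \<in> carrier H" by (simp_all add: E_simps)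
  show "(f \<oplus>\<^sub>E g) \<otimes>\<^sub>E h = f \<otimes>\<^sub>E h \<oplus>\<^sub>E g \<otimes>\<^sub>E h"
    using E_cl[OF h] by (simp add: E_simps compose_def H_simps cong: restrict_cong)
  show "h \<otimes>\<^sub>E (f \<oplus>\<^sub>E g) = h \<otimes>\<^sub>E f \<oplus>\<^sub>E h \<otimes>\<^sub>E g"
    using E_cl[OF f] E_cl[OF g] klinearD[OF H_klinear[OF h]] by (simp add: E_simps compose_def H_simps cong: restrict_cong)
qed

text \<open>For homogeneous \<open>g\<close> the two terms \<open>f (diff M (g v))\<close> on the
  right cancel; additivity then covers all \<open>g\<close>.\<close>

lemma E_leib:
  assumes f: "f \<in> BL m" and g: "g \<in> carrier H"
  shows "diff E (f \<otimes>\<^sub>E g) = diff E f \<otimes>\<^sub>E g \<oplus>\<^sub>E ksgn k m \<odot>\<^sub>E (f \<otimes>\<^sub>E diff E g)"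
proof -
  interpret Es: gspace k E using E_dg by (intro gspaceI) (simp add: dg_space_def)
  interpret Er: ring E by (rule E_ring)
  have dl: "klinear k E E (diff E)" using E_dg unfolding dg_space_def deg_linear_def by blast
  have fc: "f \<in> carrier E" using G_H[OF f] by (simp add: E_simps)
  have "g \<in> carrier E" using g by (simp add: E_simps)
  thus ?thesis
  proof (induction rule: Es.graded_induct)
    case (hom n g)
    hence g: "g \<in> BL n" by (simp add: E_simps H_simps)
    have gc: "g \<in> carrier E" using G_H[OF g] by (simp add: E_simps)
    have fl: "bimod_linear k A M M m f" and gl: "bimod_linear k A M M n g" using f g by auto
    note lf = bl[OF fl] and lg = bl[OF gl]
    show ?case
    proof (rule E_eqI)
      show "diff E (f \<otimes>\<^sub>E g) \<in> carrier E" using klinearD(1)[OF dl] fc gc by simp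
      show "diff E f \<otimes>\<^sub>E g \<oplus>\<^sub>E ksgn k m \<odot>\<^sub>E (f \<otimes>\<^sub>E diff E g) \<in> carrier E"
        using klinearD(1)[OF dl] fc gc by simp
      fix v assume v: "v \<in> carrier M"
      let ?X = "diff M (f (g v))" and ?Y = "f (diff M (g v))" and ?Z = "f (g (diff M v))"
      have c: "?X \<in> carrier M" "?Y \<in> carrier M" "?Z \<in> carrier M" using v by (simp_all add: lf lg M.d_lin)
      have "diff E (f \<otimes>\<^sub>E g) v = ?X \<oplus>\<^sub>M ksgn k (1 + (m + n)) \<odot>\<^sub>M ?Z"
        using v c by (simp add: E_simps HC_diff[OF E_mult_g[OF f g]] compose_eq M.d_lin a_minus_def M.M.minus_as_ksgn M.M.ksgn_ksgn)
      moreover have "(diff E f \<otimes>\<^sub>E g \<oplus>\<^sub>E ksgn k m \<odot>\<^sub>E (f \<otimes>\<^sub>E diff E g)) v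
         = ?X \<oplus>\<^sub>M ((ksgn k (1 + m) \<odot>\<^sub>M ?Y \<oplus>\<^sub>M ksgn k m \<odot>\<^sub>M ?Y) \<oplus>\<^sub>M ksgn k (1 + (m + n)) \<odot>\<^sub>M ?Z)"
        using v c by (simp add: E_simps HC_diff[OF f] HC_diff[OF g] H_simps compose_def lf lg M.d_lin a_minus_def M.M.minus_as_ksgn
          M.M.ksgn_ksgn M.M.smult_r_distr M.M.a_ac algebra_simps)
      moreover have "odd ((1 + m) + m)" by auto
      ultimately show "diff E (f \<otimes>\<^sub>E g) v = (diff E f \<otimes>\<^sub>E g \<oplus>\<^sub>E ksgn k m \<odot>\<^sub>E (f \<otimes>\<^sub>E diff E g)) v"
        using c by (simp only: M.M.ksgn_add_zero not_False_eq_True simp_thms) simp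
    qed
  next
    case (add x y)
    have s: "diff E x \<in> carrier E" "diff E y \<in> carrier E" "diff E f \<in> carrier E" using klinearD(1)[OF dl] add fc by auto
    show ?case using add fc s by (simp add: klinearD[OF dl] Er.r_distr Es.smult_r_distr Es.M.a_ac)
  qed
qed

lemma E_dga: "dg_algebra k E"
proof -
  interpret Es: gspace k E using E_dg by (intro gspaceI) (simp add: dg_space_def)
  have "graded_algebra k E" unfolding graded_algebra_def
  proof (intro conjI allI ballI)
    show "graded_space k E" by (rule Es.gs)
    show "ring E" by (rule E_ring)
    show "\<one>\<^sub>E \<in> grade E 0" using E_one by (simp add: E_simps H_simps)
    show "x \<otimes>\<^sub>E y \<in> grade E (i + j)" if "x \<in> grade E i" "y \<in> grade E j" for i j x y
      using E_mult_g that unfolding E_simps H_simps by blast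
    fix r f g assume r: "r \<in> carrier k" and "f \<in> carrier E" "g \<in> carrier E"
    hence f: "f \<in> carrier H" and g: "g \<in> carrier H" by (simp_all add: E_simps)
    show "(r \<odot>\<^sub>E f) \<otimes>\<^sub>E g = r \<odot>\<^sub>E (f \<otimes>\<^sub>E g)"
      using E_cl[OF g] by (simp add: E_simps compose_def H_simps cong: restrict_cong)
    show "f \<otimes>\<^sub>E (r \<odot>\<^sub>E g) = r \<odot>\<^sub>E (f \<otimes>\<^sub>E g)"
      using E_cl[OF g] klinearD[OF H_klinear[OF f]] r by (simp add: E_simps compose_def H_simps cong: restrict_cong)
  qed
  thus ?thesis unfolding dg_algebra_def
  proof (intro conjI allI ballI)
    show "dg_space k E" by (rule E_dg)
    fix i f g assume f: "f \<in> grade E i" and g: "g \<in> carrier E"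
    show "diff E (f \<otimes>\<^sub>E g) = diff E f \<otimes>\<^sub>E g \<oplus>\<^sub>E ksgn k i \<odot>\<^sub>E (f \<otimes>\<^sub>E diff E g)"
      by (rule E_leib) (use f g in \<open>simp_all only: E_simps H_simps\<close>)
  qed
qed

end

section \<open>The regular bimodule\<close>

lemma regular_simps:
  "carrier (regular_bimodule A) = carrier A" "\<zero>\<^bsub>regular_bimodule A\<^esub> = \<zero>\<^sub>A"
  "add (regular_bimodule A) = add A" "smult (regular_bimodule A) = smult A"
  "grade (regular_bimodule A) = grade A" "diff (regular_bimodule A) = diff A"
  "lact (regular_bimodule A) = mult A" "ract (regular_bimodule A) = mult A" by (simp_all add: regular_bimodule_def dgspace.defs dgbimod.defs)

lemma klinear_cong:
  assumes "carrier V' = carrier V" "add V' = add V" "smult V' = smult V"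
    "carrier W' = carrier W" "add W' = add W" "smult W' = smult W"
  shows "klinear k V' W' = klinear k V W" using assms by (intro ext) (simp add: klinear_def)

lemma (in dga) regular_dg: "dg_bimodule k A (regular_bimodule A)"
proof -
  let ?R = "regular_bimodule A"
  have d: "dg_space k ?R" by (rule dg_space_cong[OF A_dg]) (simp_all add: regular_simps)
  have "graded_bimodule k A ?R" unfolding graded_bimodule_def
  proof (intro conjI allI ballI)
    show "graded_space k ?R" using d by (simp add: dg_space_def)
    fix i j a m assume "a \<in> grade A i" "m \<in> grade ?R j"
    thus "lact ?R a m \<in> grade ?R (i + j)" "ract ?R m a \<in> grade ?R (i + j)"
      using mult_g[of a i m j] mult_g[of m j a i] by (simp_all add: regular_simps add.commute)
  qed (auto simp: klinear_def regular_simps AR.l_distr AR.r_distr A_smult_l A_smult_r AR.m_assoc)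
  thus ?thesis unfolding dg_bimodule_def using d by (intro conjI allI ballI) (simp_all add: regular_simps leibA leibA[OF _ A.gcar])
qed

section \<open>The twisted tensor product\<close>

context tens3 begin

lemma trifam_cong:
  assumes "trifam k V W U X \<psi>"
    and e: "!!i j v w u. v \<in> grade V i ==> w \<in> grade W j ==> u \<in> carrier U ==> \<phi> i j v w u = \<psi> i j v w u"
  shows "trifam k V W U X \<phi>" unfolding trifam_def
proof (intro conjI ballI allI)
  fix u assume u: "u \<in> carrier U"
  show "bifam k V W X (%i j v w. \<phi> i j v w u)" by (rule bifamI[OF L.V.gspace_axioms L.W.gspace_axioms])
      (simp_all add: e u bifamD[OF trifamD(1)[OF assms(1) u]])
next
  fix i j v w assume v: "v \<in> grade V i" and w: "w \<in> grade W j"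
  show "klinear k U X (\<phi> i j v w)" using klinearD[OF trifamD(2)[OF assms(1) v w]] unfolding klinear_def by (simp add: e[OF v w])
qed

text \<open>For a formula without degree-dependent signs, the value on pure tensors extends to
  inhomogeneous entries by additivity. The two outer actions of A are of this kind.\<close>

lemma tl3_total:
  assumes m: "module k X" and lin: "!!v. v \<in> carrier V ==> bilin k W U X (\<phi> v)"
    "!!w u. w \<in> carrier W ==> u \<in> carrier U ==> klinear k V X (%v. \<phi> v w u)"
  shows tl3_total_trifam: "trifam k V W U X (%_ _. \<phi>)"
    and tl3_total_pp: "v \<in> carrier V ==> w \<in> carrier W ==> u \<in> carrier U ==> tl3 V W X (%_ _. \<phi>) (pp v w u) = \<phi> v w u"
proof -
  interpret X: kmod k X using m by (simp add: kmod_def)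
  note b = bilinD[OF lin(1)] and l = klinearD[OF lin(2)]
  show t: "trifam k V W U X (%_ _. \<phi>)" unfolding trifam_def by (intro conjI ballI allI bifamI[OF L.V.gspace_axioms L.W.gspace_axioms])
      (auto simp: klinear_def L.V.gcar L.W.gcar b l)
  note k = klinearD[OF tl3_klinear[OF m t]]
  assume v: "v \<in> carrier V" and w: "w \<in> carrier W" and u: "u \<in> carrier U"
  show "tl3 V W X (%_ _. \<phi>) (pp v w u) = \<phi> v w u" using v
  proof (induction rule: L.V.graded_induct)
    case (hom i v)
    note vc = L.V.gcar[OF hom]
    show ?case using w
    proof (induction rule: L.W.graded_induct)
      case (hom j w) thus ?case using tl3_pp[OF m t \<open>v \<in> grade V i\<close> hom u] by simp
    next
      case (add x y) thus ?case using vc u by (simp add: pp_lin k b)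
    qed
  next
    case (add x y) thus ?case using w u by (simp add: pp_lin k l)
  qed
qed

end

locale tw = dga k A + coal k C for k :: "'k ring" and A :: "('k, 'a) dgspace" and C :: "('k, 'c) coalg" +
  fixes \<pi> :: "'c => 'a"
  assumes tc: "twisting_cochain k C A \<pi>"

sublocale tw \<subseteq> T3: tens3 k A C A by (rule tens3I[OF A.gspace_axioms C.gspace_axioms A.gspace_axioms])

lemma lift3_tl3: "lift3 A C X \<phi> = tl3 A C X \<phi>" by (simp add: lift3_def tl3_def)

context tw begin

abbreviation "T \<equiv> ACA k A C"
abbreviation "K \<equiv> twisted_tensor k A C \<pi>"
abbreviation "pt \<equiv> pure3 k A C"

lemma pt_pp: "pt a c b = T3.pp a c b" by (simp add: pure3_def)

lemma pi_deg: "deg_linear k C A 1 \<pi>" and pi_ext: "\<pi> \<in> extensional (carrier C)" using tc by (simp_all add: twisting_cochain_def)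

lemmas pi_kl = pi_deg[THEN deg_klinear]
lemmas pi_lin = klinearD[OF pi_kl]
lemmas pi_g = deg_linear_grade[OF pi_deg]

lemma K_simps:
  "carrier K = carrier T" "\<zero>\<^sub>K = \<zero>\<^sub>T" "add K = add T" "smult K = smult T" "grade K = grade T"
  by (simp_all add: twisted_tensor_def Let_def dgspace.defs)

lemma gsK: "graded_space k K" by (rule graded_space_cong[OF T3.T.VW.gs]) (simp_all add: K_simps)

end

sublocale tw \<subseteq> K: gspace k K using gsK by (rule gspaceI)

context tw begin

lemma mK: "module k K" ..
lemma mA: "module k A" ..
lemma gA: "gspace k A" ..
lemma gK: "gspace k K" ..

lemma sw_KT: "sweedler C T \<phi> c = sweedler C K \<phi> c" unfolding sweedler_def tlift_hom_def
  by (subst tlift_cong_struct[of T K]) (simp_all add: K_simps hsum_cong_struct[of T K])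

lemma tl3_KT: "tl3 A C T \<phi> = tl3 A C K \<phi>" unfolding tl3_def tlift_hom_def by (rule ext, subst tlift_cong_struct[of T K])
    (simp_all add: K_simps hsum_cong_struct[of T K] tlift_cong_struct[of T K])

lemma minus_KT: "x \<ominus>\<^sub>T y = x \<ominus>\<^sub>K y" by (rule a_minus_cong_struct) (simp_all add: K_simps)

lemma klinear_KT: "klinear k T X = klinear k K X" "klinear k X T = klinear k X K" by (rule klinear_cong; simp add: K_simps)+

lemma lact_K: "lact K a' = tl3 A C K (%_ _ a c b. pt (a' \<otimes>\<^sub>A a) c b)"
  and ract_K: "ract K t b' = tl3 A C K (%_ _ a c b. pt a c (b \<otimes>\<^sub>A b')) t"
proof -
  have "lact K a' = tl3 A C T (%_ _ a c b. pt (a' \<otimes>\<^sub>A a) c b)" "ract K t b' = tl3 A C T (%_ _ a c b. pt a c (b \<otimes>\<^sub>A b')) t"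
    by (simp_all add: twisted_tensor_def Let_def dgbimod.defs dgspace.defs lift3_tl3)
  thus "lact K a' = tl3 A C K (%_ _ a c b. pt (a' \<otimes>\<^sub>A a) c b)"
    "ract K t b' = tl3 A C K (%_ _ a c b. pt a c (b \<otimes>\<^sub>A b')) t" unfolding tl3_KT by blast+
qed

lemma pt_cl [simp]: "a \<in> carrier A ==> c \<in> carrier C ==> b \<in> carrier A ==> pt a c b \<in> carrier K" by (simp add: pt_pp K_simps)

lemmas pt_lin = T3.pp_lin[folded pt_pp K_simps]

lemma pt_g: "a \<in> grade A i ==> c \<in> grade C j ==> b \<in> grade A l ==> pt a c b \<in> grade K (i + j + l)" by (simp add: pt_pp K_simps T3.pp_grade)

lemma lact_pt: "a' \<in> carrier A ==> a \<in> carrier A ==> c \<in> carrier C ==> b \<in> carrier A ==>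
    lact K a' (pt a c b) = pt (a' \<otimes>\<^sub>A a) c b"
  and lact_kl: "a' \<in> carrier A ==> klinear k K K (lact K a')"
proof -
  assume a': "a' \<in> carrier A"
  have 1: "bilin k C A K (%c b. pt (a' \<otimes>\<^sub>A v) c b)" if "v \<in> carrier A" for v using a' that by (simp add: bilin_def pt_lin)
  have 2: "klinear k A K (%v. pt (a' \<otimes>\<^sub>A v) c b)" if "c \<in> carrier C" "b \<in> carrier A" for c b
    using a' that by (simp add: klinear_def pt_lin AR.r_distr A_smult_r)
  show "a \<in> carrier A ==> c \<in> carrier C ==> b \<in> carrier A ==> lact K a' (pt a c b) = pt (a' \<otimes>\<^sub>A a) c b"
    using T3.tl3_total_pp[OF mK 1 2, of a c b] by (simp add: lact_K pt_pp)
  show "klinear k K K (lact K a')" using T3.tl3_klinear[OF mK T3.tl3_total_trifam[OF mK 1 2]] by (simp add: lact_K klinear_KT)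
qed

lemma ract_pt: "a \<in> carrier A ==> c \<in> carrier C ==> b \<in> carrier A ==> b' \<in> carrier A ==>
    ract K (pt a c b) b' = pt a c (b \<otimes>\<^sub>A b')"
  and ract_kl: "b' \<in> carrier A ==> klinear k K K (%t. ract K t b')"
proof -
  assume b': "b' \<in> carrier A"
  have 1: "bilin k C A K (%c b. pt v c (b \<otimes>\<^sub>A b'))" if "v \<in> carrier A" for v
    using b' that by (simp add: bilin_def pt_lin AR.l_distr A_smult_l)
  have 2: "klinear k A K (%v. pt v c (b \<otimes>\<^sub>A b'))" if "c \<in> carrier C" "b \<in> carrier A" for c b
    using b' that by (simp add: klinear_def pt_lin)
  show "klinear k K K (%t. ract K t b')" using T3.tl3_klinear[OF mK T3.tl3_total_trifam[OF mK 1 2]] by (simp add: ract_K klinear_KT)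
  show "a \<in> carrier A ==> c \<in> carrier C ==> b \<in> carrier A ==> ract K (pt a c b) b' = pt a c (b \<otimes>\<^sub>A b')"
    using T3.tl3_total_pp[OF mK 1 2, of a c b] by (simp add: ract_K pt_pp)
qed

lemmas lactD = klinearD[OF lact_kl] and ractD = klinearD[OF ract_kl]

lemma K_eqI:
  assumes "abelian_group X" "additive K X f" "additive K X g" "t \<in> carrier K"
    "!!i j l a c b. a \<in> grade A i ==> c \<in> grade C j ==> b \<in> grade A l ==> a \<in> carrier A ==> c \<in> carrier C ==> b \<in> carrier A
      ==> f (pt a c b) = g (pt a c b)"
  shows "f t = g t"
proof (rule T3.additive_eqI3[OF assms(1)])
  show "additive T X f" "additive T X g" using assms(2,3) by (simp_all add: additive_def K_simps)
  show "t \<in> carrier T" using assms(4) by (simp add: K_simps)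
qed (use assms(5) in \<open>simp add: pt_pp A.gcar C.gcar\<close>)

lemma K_grade:
  assumes "klinear k K X f" "gspace k X"
    "!!i j l a c b. a \<in> grade A i ==> c \<in> grade C j ==> b \<in> grade A l ==> f (pt a c b) \<in> grade X (i + j + l + n)"
  shows "deg_linear k K X n f"
proof -
  interpret X: gspace k X by fact
  note kf = klinearD[OF assms(1)]
  have "f t \<in> grade X (i + n)" if "t \<in> grade T i" for t i using that
  proof (induction rule: T3.grade_induct3)
    case zero
    have "f \<zero>\<^sub>K = \<zero>\<^sub>X" by (rule additive_zero[OF K.ab X.ab klinear_additive[OF assms(1)]])
    thus ?case by (simp add: K_simps)
  next
    case (pure a b c v w u t)
    have "pt v w u \<in> carrier K" using A.gcar C.gcar pure by simp
    moreover have "t \<in> carrier K" using pure K.gcar by (simp add: K_simps)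
    ultimately have "f (pt v w u \<oplus>\<^sub>K t) = f (pt v w u) \<oplus>\<^sub>X f t" by (rule kf(2))
    thus ?case using assms(3)[OF pure(1-3)] pure(4,6) by (simp add: K_simps pt_pp)
  qed
  thus ?thesis using assms(1) by (auto simp: deg_linear_def K_simps)
qed

lemma K_gbim: "graded_bimodule k A K" unfolding graded_bimodule_def
proof (intro conjI allI ballI)
  show "graded_space k K" by (rule gsK)
  show "klinear k K K (lact K a)" if "a \<in> carrier A" for a using that by (rule lact_kl)
  show "klinear k K K (%m. ract K m a)" if "a \<in> carrier A" for a using that by (rule ract_kl)
  note ab = K.ab
  have adl: "additive K K (lact K a)" "additive K K (%m. ract K m a)" if "a \<in> carrier A" for a using lact_kl ract_kl that klinear_additive by blast+
  fix m assume m: "m \<in> carrier K"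
  show "klinear k A K (%a. lact K a m)" unfolding klinear_def
  proof (intro conjI ballI Pi_I)
    fix a assume a: "a \<in> carrier A"
    show "lact K a m \<in> carrier K" using lactD(1) a m .
    show "lact K (a \<oplus>\<^sub>A b) m = lact K a m \<oplus>\<^sub>K lact K b m" if b: "b \<in> carrier A" for b
      by (rule K_eqI[OF ab _ _ m]) (use a b in \<open>simp_all add: additive_def lactD K.M.a_ac lact_pt AR.l_distr pt_lin\<close>)
    show "lact K (r \<odot>\<^sub>A a) m = r \<odot>\<^sub>K lact K a m" if r: "r \<in> carrier k" for r
      by (rule K_eqI[OF ab _ _ m]) (use a r in \<open>simp_all add: additive_def lactD K.smult_r_distr lact_pt A_smult_l pt_lin\<close>)
  qed
  show "klinear k A K (ract K m)" unfolding klinear_def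
  proof (intro conjI ballI Pi_I)
    fix a assume a: "a \<in> carrier A"
    show "ract K m a \<in> carrier K" using ractD(1) a m .
    show "ract K m (a \<oplus>\<^sub>A b) = ract K m a \<oplus>\<^sub>K ract K m b" if b: "b \<in> carrier A" for b
      by (rule K_eqI[OF ab _ _ m]) (use a b in \<open>simp_all add: additive_def ractD K.M.a_ac ract_pt AR.r_distr pt_lin\<close>)
    show "ract K m (r \<odot>\<^sub>A a) = r \<odot>\<^sub>K ract K m a" if r: "r \<in> carrier k" for r
      by (rule K_eqI[OF ab _ _ m]) (use a r in \<open>simp_all add: additive_def ractD K.smult_r_distr ract_pt A_smult_r pt_lin\<close>)
  qed
  show "lact K \<one>\<^sub>A m = m" by (rule K_eqI[OF ab _ _ m]) (simp_all add: additive_def lactD lact_pt)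
  show "ract K m \<one>\<^sub>A = m" by (rule K_eqI[OF ab _ _ m]) (simp_all add: additive_def ractD ract_pt)
next
  note ab = K.ab
  fix a b m assume a: "a \<in> carrier A" and b: "b \<in> carrier A" and m: "m \<in> carrier K"
  show "lact K (a \<otimes>\<^sub>A b) m = lact K a (lact K b m)"
    by (rule K_eqI[OF ab _ _ m]) (use a b in \<open>simp_all add: additive_def lactD lact_pt AR.m_assoc\<close>)
  show "ract K m (a \<otimes>\<^sub>A b) = ract K (ract K m a) b"
    by (rule K_eqI[OF ab _ _ m]) (use a b in \<open>simp_all add: additive_def ractD ract_pt AR.m_assoc\<close>)
  show "ract K (lact K a m) b = lact K a (ract K m b)"
    by (rule K_eqI[OF ab _ _ m]) (use a b in \<open>simp_all add: additive_def lactD ractD ract_pt lact_pt AR.m_assoc\<close>)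
next
  fix i j a m assume a: "a \<in> grade A i" and m: "m \<in> grade K j"
  note ac = A.gcar[OF a]
  have "deg_linear k K K i (lact K a)"
  proof (rule K_grade[OF lact_kl[OF ac] gK])
    fix i' j' l' a' c b assume h: "a' \<in> grade A i'" "c \<in> grade C j'" "b \<in> grade A l'"
    show "lact K a (pt a' c b) \<in> grade K (i' + j' + l' + i)" using pt_g[OF mult_g[OF a h(1)] h(2,3)] ac h by (simp add: lact_pt A.gcar C.gcar algebra_simps)
  qed
  from deg_linear_grade[OF this m] show "lact K a m \<in> grade K (i + j)" by (simp add: add.commute)
  have "deg_linear k K K i (%m. ract K m a)"
  proof (rule K_grade[OF ract_kl[OF ac] gK])
    fix i' j' l' a' c b assume h: "a' \<in> grade A i'" "c \<in> grade C j'" "b \<in> grade A l'"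
    show "ract K (pt a' c b) a \<in> grade K (i' + j' + l' + i)" using pt_g[OF h(1,2) mult_g[OF h(3) a]] ac h by (simp add: ract_pt A.gcar C.gcar algebra_simps)
  qed
  from deg_linear_grade[OF this m] show "ract K m a \<in> grade K (i + j)" by (simp add: add.commute)
qed

end

sublocale tw \<subseteq> KB: gbim k A "twisted_tensor k A C \<pi>" by (rule gbimI[OF dga_axioms K_gbim])

context tw begin

section \<open>Generators of the twisted tensor product and its differential\<close>

definition gen :: "'c => (('a \<times> 'c) list set \<times> 'a) list set" where
  "gen c = pt \<one>\<^sub>A c \<one>\<^sub>A"

lemma gen_deg: "deg_linear k C K 0 gen"
proof -
  have "klinear k C K gen" by (simp add: klinear_def gen_def pt_lin)
  thus ?thesis using pt_g[OF one_g _ one_g] by (auto simp: deg_linear_def gen_def)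
qed

lemmas gen_kl = gen_deg[THEN deg_klinear]
lemmas gen_lin = klinearD[OF gen_kl]

lemma gen_g: "c \<in> grade C n ==> gen c \<in> grade K n" using deg_linear_grade[OF gen_deg] by simp

lemma pt_gen: "a \<in> carrier A ==> c \<in> carrier C ==> b \<in> carrier A ==> pt a c b = lact K a (ract K (gen c) b)" by (simp add: gen_def ract_pt lact_pt)

lemmas KBx = KB.gbim_axioms

text \<open>
  Summands of Sweedler sums with a Koszul sign in the degree of the left factor; a name ending in \<open>0\<close>
  stands for the version without sign.
\<close>

abbreviation "FL N r f g \<equiv> %p _ x y. ksgn k (r p) \<odot>\<^sub>N lact N (f x) (g y)"
abbreviation "FR N r f g \<equiv> %p _ x y. ksgn k (r p) \<odot>\<^sub>N ract N (f x) (g y)"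
abbreviation "FL0 N f g \<equiv> %_ _ x y. lact N (f x) (g y)"
abbreviation "FR0 N f g \<equiv> %_ _ x y. ract N (f x) (g y)"
abbreviation "FA w g h \<equiv> %p _ x y. ksgn k (w p) \<odot>\<^sub>A (g x \<otimes>\<^sub>A h y)"
abbreviation "SL N r f g \<equiv> sweedler C N (FL N r f g)"
abbreviation "SR N r f g \<equiv> sweedler C N (FR N r f g)"
abbreviation "SL0 N f g \<equiv> sweedler C N (FL0 N f g)"
abbreviation "SR0 N f g \<equiv> sweedler C N (FR0 N f g)"
abbreviation "SA w g h \<equiv> sweedler C A (FA w g h)"

lemma bla0: "gbim k A N ==> klinear k C A f ==> klinear k C N g ==> bifam k C C N (FL0 N f g)"
  and bra0: "gbim k A N ==> klinear k C N g ==> klinear k C A f ==> bifam k C C N (FR0 N g f)"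
  by (rule bifam_bilin[OF gC gC gbim.la_bilin] bifam_bilin[OF gC gC gbim.ra_bilin]; assumption)+

lemma gbim_mod: "gbim k A N ==> module k N" using gbim.gb[of k A N] by (simp add: graded_bimodule_def graded_space_def)

lemma bla: "gbim k A N ==> klinear k C A f ==> klinear k C N g ==> bifam k C C N (FL N r f g)"
  and bra: "gbim k A N ==> klinear k C N g ==> klinear k C A f ==> bifam k C C N (FR N r g f)"
  by (rule bifam_smult[OF gC gC gbim_mod bla0] bifam_smult[OF gC gC gbim_mod bra0]; assumption?; simp)+

lemma bmul: "klinear k C A g ==> klinear k C A h ==> bifam k C C A (FA w g h)" by (rule bifam_smult[OF gC gC mA bifam_bilin[OF gC gC mult_bilin]]) simp_all

lemmas bL = bla0[OF KBx pi_kl gen_kl] and bR = bra[OF KBx gen_kl pi_kl, of "%p. p"]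

lemma op_kl:
  "a \<in> carrier A ==> klinear k K K (%m. ksgn k i \<odot>\<^sub>K lact K a m)"
  "a \<in> carrier A ==> klinear k K K (%m. ksgn k i \<odot>\<^sub>K ract K m a)"
  "m \<in> carrier K ==> klinear k A K (%a. ksgn k i \<odot>\<^sub>K lact K a m)"
  "m \<in> carrier K ==> klinear k A K (%a. ksgn k i \<odot>\<^sub>K ract K m a)"
  "a \<in> carrier A ==> b \<in> carrier A ==> klinear k K K (%m. ksgn k i \<odot>\<^sub>K lact K a (ract K m b))"
  by (simp_all add: klinear_def KB.la KB.ra K.smult_r_distr K.smult_comm)

definition gL :: "'c => (('a \<times> 'c) list set \<times> 'a) list set" where
  "gL = SL0 K \<pi> gen"

definition gR :: "'c => (('a \<times> 'c) list set \<times> 'a) list set" where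
  "gR = SR K (%p. p) gen \<pi>"

text \<open>This is what the differential of \<open>gen c\<close> turns out to be. Its twisting
  terms \<open>gL\<close> and \<open>gR\<close> are kept apart because they enter coassociativity in
  different ways.\<close>

definition dgen :: "'c => (('a \<times> 'c) list set \<times> 'a) list set" where
  "dgen c = gen (diff C c) \<oplus>\<^sub>K (gL c \<ominus>\<^sub>K gR c)"

lemma gL_kl: "klinear k C K gL" unfolding gL_def by (rule sw_klinear[OF mK bL])
lemma gR_kl: "klinear k C K gR" unfolding gR_def by (rule sw_klinear[OF mK bR])
lemmas gL_lin = klinearD[OF gL_kl] and gR_lin = klinearD[OF gR_kl]

lemma gL_g: "c \<in> grade C n ==> gL c \<in> grade K (n + 1)"
proof -
  have "deg_linear k C K 1 gL" unfolding gL_def by (rule sw_deg[OF gK bL]) (use KB.la_g[OF pi_g gen_g] in \<open>simp add: algebra_simps\<close>)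
  thus "c \<in> grade C n ==> gL c \<in> grade K (n + 1)" by (rule deg_linear_grade)
qed

lemma gR_g: "c \<in> grade C n ==> gR c \<in> grade K (n + 1)"
proof -
  have "deg_linear k C K 1 gR" unfolding gR_def by (rule sw_deg[OF gK bR]) (use KB.ra_g[OF gen_g pi_g] in \<open>simp add: algebra_simps\<close>)
  thus "c \<in> grade C n ==> gR c \<in> grade K (n + 1)" by (rule deg_linear_grade)
qed

lemma dgen_g: "c \<in> grade C n ==> dgen c \<in> grade K (n + 1)" using gL_g gR_g gen_g[OF deg_linear_grade[OF d_deg]] by (simp add: dgen_def)

lemma dgen_kl: "klinear k C K dgen" unfolding klinear_def
  by (simp add: dgen_def a_minus_def gL_lin gR_lin gen_lin d_lin K.smult_r_distr K.M.minus_add K.M.a_ac K.smult_r_minus)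

lemmas dgen_lin = klinearD[OF dgen_kl]

definition tdiff :: "int => int => 'a => 'c => 'a => (('a \<times> 'c) list set \<times> 'a) list set" where
  "tdiff i j a c b = sweedler C T (%p q x y. ksgn k i \<odot>\<^sub>T pure3 k A C (a \<otimes>\<^sub>A \<pi> x) y b) c
          \<ominus>\<^sub>T sweedler C T (%p q x y. ksgn k (i + p) \<odot>\<^sub>T pure3 k A C a x (\<pi> y \<otimes>\<^sub>A b)) c"

text \<open>Writing the twisting part through the outer actions reduces every statement about it to
  \<open>gL c\<close> and \<open>gR c\<close>.\<close>

lemma tdiff_eq:
  assumes "a \<in> carrier A" "c \<in> carrier C" "b \<in> carrier A"
  shows "tdiff i j a c b = ksgn k i \<odot>\<^sub>K lact K a (ract K (gL c \<ominus>\<^sub>K gR c) b)"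
proof -
  let ?h = "%m. ksgn k i \<odot>\<^sub>K lact K a (ract K m b)"
  note h = op_kl(5)[OF assms(1,3), of i]
  have 1: "?h (gL c) = sweedler C K (%p q x y. ksgn k i \<odot>\<^sub>K pt (a \<otimes>\<^sub>A \<pi> x) y b) c"
  proof -
    have "klinear k C A (%x. a \<otimes>\<^sub>A \<pi> x)" using assms by (simp add: klinear_def pi_lin AR.r_distr A_smult_r)
    moreover have "bilin k A C K (%a c. pt a c b)" using assms by (simp add: bilin_def pt_lin)
    ultimately have b1: "bifam k C C K (%p q x y. pt (a \<otimes>\<^sub>A \<pi> x) y b)"
      using bifam_bilin[OF gC gC, where f = "%x. a \<otimes>\<^sub>A \<pi> x" and g = "%x. x" and B = "%a c. pt a c b"] C.id_kl by blast
    show ?thesis unfolding gL_def by (rule sw_map[OF mK bL mK h bifam_smult[OF gC gC mK b1] assms(2)])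
        (use assms in \<open>simp_all add: C.gcar pi_lin gen_def lact_pt ract_pt\<close>)
  qed
  have 2: "?h (gR c) = sweedler C K (%p q x y. ksgn k (i + p) \<odot>\<^sub>K pt a x (\<pi> y \<otimes>\<^sub>A b)) c"
  proof -
    have "klinear k C A (%y. \<pi> y \<otimes>\<^sub>A b)" using assms by (simp add: klinear_def pi_lin AR.l_distr A_smult_l)
    moreover have "bilin k C A K (%c b. pt a c b)" using assms by (simp add: bilin_def pt_lin)
    ultimately have b1: "bifam k C C K (%p q x y. pt a x (\<pi> y \<otimes>\<^sub>A b))"
      using bifam_bilin[OF gC gC, where g = "%y. \<pi> y \<otimes>\<^sub>A b" and f = "%x. x" and B = "%c b. pt a c b"] C.id_kl by blast
    show ?thesis unfolding gR_def by (rule sw_map[OF mK bR mK h bifam_smult[OF gC gC mK b1] assms(2)])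
        (use assms in \<open>simp_all add: C.gcar pi_lin gen_def lact_pt ract_pt ractD lactD K.ksgn_ksgn\<close>)
  qed
  have "tdiff i j a c b = ?h (gL c) \<ominus>\<^sub>K ?h (gR c)" unfolding tdiff_def minus_KT sw_KT unfolding K_simps(4)[symmetric] 1 2 ..
  thus ?thesis using additive_diff[OF K.ab K.ab klinear_additive[OF h]] gL_lin(1) gR_lin(1) assms by simp
qed

lemma diff_K: "diff K t = diff T t \<oplus>\<^sub>K tl3 A C K tdiff t"
proof -
  have "diff K t = diff T t \<oplus>\<^sub>T tl3 A C T tdiff t" by (simp add: twisted_tensor_def Let_def dgspace.defs lift3_tl3 tdiff_def[abs_def])
  thus ?thesis unfolding tl3_KT K_simps(3) .
qed

lemma tdiff_trifam: "trifam k A C A K tdiff"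
proof (rule T3.trifam_cong)
  let ?\<psi> = "%i j a c b. ksgn k i \<odot>\<^sub>K lact K a (ract K (gL c \<ominus>\<^sub>K gR c) b)"
  have "klinear k C K (%c. gL c \<ominus>\<^sub>K gR c)"
    by (simp add: klinear_def a_minus_def gL_lin gR_lin K.smult_r_distr K.M.minus_add K.M.a_ac K.smult_r_minus)
  hence b: "bilin k C A K (%c b. ract K (gL c \<ominus>\<^sub>K gR c) b)"
    using bilin_comp[OF KB.ra_bilin, where f = "%c. gL c \<ominus>\<^sub>K gR c" and g = "%b. b"]
      A.id_kl by blast
  show "trifam k A C A K ?\<psi>" by (intro trifam_smult[OF gA gC mK] trifam_right[OF gA gC gA KB.la_bilin _ b, where h = "%a. a"]
       A.id_kl) simp
qed (use tdiff_eq A.gcar C.gcar in blast)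

lemma dK_kl: "klinear k K K (diff K)"
proof -
  have 1: "klinear k K K (diff T)" using T3.T.diff_VW_klinear[OF T3.L.diff_VW_klinear[OF dA_deg[THEN deg_klinear] d_deg[THEN deg_klinear]]
        dA_deg[THEN deg_klinear]] by (simp add: klinear_KT)
  have 2: "klinear k K K (tl3 A C K tdiff)" using T3.tl3_klinear[OF mK tdiff_trifam] by (simp add: klinear_KT)
  note l = klinearD[OF 1] klinearD[OF 2]
  show ?thesis unfolding klinear_def by (simp add: diff_K l K.M.a_ac K.smult_r_distr)
qed

lemmas dK_lin = klinearD[OF dK_kl]

lemma dK_pt:
  assumes "a \<in> grade A i" "c \<in> grade C j" "b \<in> carrier A"
  shows "diff K (lact K a (ract K (gen c) b)) = lact K (diff A a) (ract K (gen c) b)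
    \<oplus>\<^sub>K ksgn k i \<odot>\<^sub>K lact K a (ract K (dgen c) b) \<oplus>\<^sub>K ksgn k (i + j) \<odot>\<^sub>K lact K a (ract K (gen c) (diff A b))"
proof -
  have ac: "a \<in> carrier A" "c \<in> carrier C" using assms A.gcar C.gcar by auto
  have c: "gL c \<ominus>\<^sub>K gR c \<in> carrier K" using ac gL_lin gR_lin by simp
  have "diff K (pt a c b) = (pt (diff A a) c b \<oplus>\<^sub>K ksgn k i \<odot>\<^sub>K pt a (diff C c) b \<oplus>\<^sub>K ksgn k (i + j) \<odot>\<^sub>K pt a c (diff A b))
     \<oplus>\<^sub>K ksgn k i \<odot>\<^sub>K lact K a (ract K (gL c \<ominus>\<^sub>K gR c) b)"
    unfolding diff_K using T3.diff_pp[OF dA_deg d_deg dA_deg assms] T3.tl3_pp[OF mK tdiff_trifam assms]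
      tdiff_eq[OF ac assms(3), of i j] by (simp add: pt_pp K_simps)
  thus ?thesis using ac assms(3) c by (simp add: pt_gen dA_lin d_lin dgen_def gen_lin lactD ractD K.smult_r_distr K.M.a_ac)
qed

lemma dK_gen: "c \<in> carrier C ==> diff K (gen c) = dgen c"
proof (induction rule: C.graded_induct)
  case (hom i c)
  thus ?case using dK_pt[OF one_g hom AR.one_closed] C.gcar[OF hom] by (simp add: dA_one KB.la_one KB.ra_one KB.la_zero KB.ra_zero gen_lin dgen_lin lactD ractD)
next
  case (add x y)
  thus ?case by (simp add: gen_lin dgen_lin dK_lin)
qed

lemma dK_deg: "deg_linear k K K 1 (diff K)"
proof (rule K_grade[OF dK_kl gK])
  fix i j l a c b assume a: "a \<in> grade A i" and c: "c \<in> grade C j" and b: "b \<in> grade A l"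
  note cc = A.gcar[OF a] C.gcar[OF c] A.gcar[OF b]
  have "lact K (diff A a) (ract K (gen c) b) \<in> grade K (i + j + l + 1)" using KB.la_g[OF dA_g[OF a] KB.ra_g[OF gen_g[OF c] b]] by (simp add: algebra_simps)
  moreover have "lact K a (ract K (dgen c) b) \<in> grade K (i + j + l + 1)" using KB.la_g[OF a KB.ra_g[OF dgen_g[OF c] b]] by (simp add: algebra_simps)
  moreover have "lact K a (ract K (gen c) (diff A b)) \<in> grade K (i + j + l + 1)"
    using KB.la_g[OF a KB.ra_g[OF gen_g[OF c] dA_g[OF b]]] by (simp add: algebra_simps)
  ultimately show "diff K (pt a c b) \<in> grade K (i + j + l + 1)" using cc by (simp add: pt_gen dK_pt[OF a c])
qed

lemma gen_induct [consumes 1, case_names hom add]: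
  assumes "t \<in> carrier K"
    and "!!i j l a c b. a \<in> grade A i ==> c \<in> grade C j ==> b \<in> grade A l ==> a \<in> carrier A ==> c \<in> carrier C ==> b \<in> carrier A
      ==> P (lact K a (ract K (gen c) b))"
    and "!!x y. x \<in> carrier K ==> y \<in> carrier K ==> P x ==> P y ==> P (x \<oplus>\<^sub>K y)"
  shows "P t"
proof -
  have "t \<in> carrier T" using assms(1) by (simp add: K_simps)
  thus ?thesis
  proof (induction rule: T3.h_induct)
    case zero
    have "P (lact K \<zero>\<^sub>A (ract K (gen \<zero>\<^sub>C) \<zero>\<^sub>A))" by (rule assms(2)[of _ 0 _ 0 _ 0]) auto
    thus ?case by (simp add: KB.la_zero ractD gen_lin K_simps(2)[symmetric] KB.ra_zero KB.la_zero2)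
  next
    case (pure i j l a c b t)
    note cc = A.gcar[OF pure(1)] C.gcar[OF pure(2)] A.gcar[OF pure(3)]
    have "P (pt a c b)" using assms(2)[OF pure(1-3)] cc by (simp add: pt_gen)
    hence "P (pt a c b \<oplus>\<^sub>K t)" using pure(4,5) cc by (intro assms(3)) (auto simp: K_simps[symmetric])
    thus ?case by (simp add: K_simps pt_pp)
  qed
qed

lemma dK_leib_l:
  assumes a: "a \<in> grade A i" and m: "m \<in> carrier K"
  shows "diff K (lact K a m) = lact K (diff A a) m \<oplus>\<^sub>K ksgn k i \<odot>\<^sub>K lact K a (diff K m)" using m
proof (induction rule: gen_induct)
  case (hom i' j l a' c b)
  note ac = A.gcar[OF a]
  let ?m = "ract K (gen c) b"
  have c: "?m \<in> carrier K" "ract K (dgen c) b \<in> carrier K" "ract K (gen c) (diff A b) \<in> carrier K"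
    using hom(4-) by (simp_all add: gen_lin dgen_lin ractD dA_lin)
  have e: "lact K a (lact K a' m) = lact K (a \<otimes>\<^sub>A a') m" if "m \<in> carrier K" for m using that ac hom(4) by (simp add: KB.la_assoc)
  show ?case unfolding dK_pt[OF hom(1,2,6)] using ac hom(4-) c
    by (simp add: e dK_pt[OF mult_g[OF a hom(1)] hom(2,6)] leibA[OF a] KB.la KB.la_assoc[symmetric] dA_lin
       K.ksgn_ksgn K.smult_r_distr K.M.a_ac algebra_simps)
next
  case (add x y)
  thus ?case using A.gcar[OF a] by (simp add: lactD dK_lin dA_lin K.smult_r_distr K.M.a_ac)
qed

lemma gen_induct_grade [consumes 1, case_names zero hom]:
  assumes "t \<in> grade K n" "P \<zero>\<^sub>K"
    and "!!i j l a c b t. a \<in> grade A i ==> c \<in> grade C j ==> b \<in> grade A l ==> i + j + l = n ==>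
      a \<in> carrier A ==> c \<in> carrier C ==> b \<in> carrier A ==> t \<in> carrier K ==> P t
      ==> P (lact K a (ract K (gen c) b) \<oplus>\<^sub>K t)"
  shows "P t"
proof -
  have "t \<in> grade T n" using assms(1) by (simp add: K_simps)
  thus ?thesis
  proof (induction rule: T3.grade_induct3)
    case zero thus ?case using assms(2) by (simp add: K_simps)
  next
    case (pure i j l a c b t)
    note cc = A.gcar[OF pure(1)] C.gcar[OF pure(2)] A.gcar[OF pure(3)]
    have t: "t \<in> carrier K" using pure(5) K.gcar by (simp add: K_simps)
    hence "P (pt a c b \<oplus>\<^sub>K t)" using assms(3)[OF pure(1-4) cc t pure(6)] cc by (simp add: pt_gen)
    thus ?case by (simp add: K_simps pt_pp)
  qed
qed

lemma dK_leib_r: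
  assumes m: "m \<in> grade K n" and b': "b' \<in> carrier A"
  shows "diff K (ract K m b') = ract K (diff K m) b' \<oplus>\<^sub>K ksgn k n \<odot>\<^sub>K ract K m (diff A b')" using m
proof (induction rule: gen_induct_grade)
  case zero
  thus ?case using b' additive_zero[OF K.ab K.ab klinear_additive[OF dK_kl]] by (simp add: KB.ra_zero2 dA_lin)
next
  case (hom i j l a c b t)
  have e: "ract K (lact K a (ract K m b)) x = lact K a (ract K m (b \<otimes>\<^sub>A x))" if "m \<in> carrier K" "x \<in> carrier A" for m x
    using that hom(5,7) by (simp add: KB.lra KB.ra_assoc KB.ra)
  have c: "gen c \<in> carrier K" "dgen c \<in> carrier K" using hom(6) by (simp_all add: gen_lin dgen_lin)
  have 1: "diff K (ract K (lact K a (ract K (gen c) b)) b') =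
      ract K (diff K (lact K a (ract K (gen c) b))) b' \<oplus>\<^sub>K ksgn k n \<odot>\<^sub>K ract K (lact K a (ract K (gen c) b)) (diff A b')"
    unfolding e[OF c(1) b'] e[OF c(1) dA_lin(1)[OF b']] dK_pt[OF hom(1,2,7)] using b' hom(4-7) c
    by (simp add: dK_pt[OF hom(1,2)] leibA[OF hom(3)] KB.ra KB.la dA_lin KB.lra KB.ra_assoc[symmetric] K.ksgn_ksgn
       K.smult_r_distr K.M.a_ac algebra_simps)
  have cl: "lact K a (ract K (gen c) b) \<in> carrier K" using hom(5-7) c by (simp add: KB.la KB.ra)
  show ?case using hom(8) b' cl by (simp add: ractD dK_lin 1 hom(9) dA_lin K.smult_r_distr K.M.a_ac)
qed

section \<open>The square of the twisted differential\<close>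

lemmas d_kl = d_deg[THEN deg_klinear]
lemmas dA_kl = dA_deg[THEN deg_klinear]

abbreviation pp2 :: "'c => 'a" where
  "pp2 \<equiv> SA (%p. p) \<pi> \<pi>"

lemma pp2_kl: "klinear k C A pp2" by (rule sw_klinear[OF mA bmul[OF pi_kl pi_kl]])

lemma twisting: "c \<in> carrier C ==>
    diff A (\<pi> c) \<oplus>\<^sub>A \<pi> (diff C c) = pp2 c \<ominus>\<^sub>A curv C c \<odot>\<^sub>A \<one>\<^sub>A"
proof -
  assume c: "c \<in> carrier C"
  have cc: "curv C c \<in> carrier k" using curv_form c by (auto simp: deg_form_def)
  have cl: "pp2 c \<in> carrier A" "diff A (\<pi> c) \<oplus>\<^sub>A \<pi> (diff C c) \<in> carrier A" "curv C c \<odot>\<^sub>A \<one>\<^sub>A \<in> carrier A"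
    using c cc klinearD(1)[OF pp2_kl] by (simp_all add: pi_lin d_lin dA_lin)
  have "\<ominus>\<^sub>A (curv C c \<odot>\<^sub>A \<one>\<^sub>A) \<ominus>\<^sub>A (diff A (\<pi> c) \<oplus>\<^sub>A \<pi> (diff C c)) \<oplus>\<^sub>A pp2 c = \<zero>\<^sub>A"
    using tc c unfolding twisting_cochain_def conv_def by simp
  hence "pp2 c \<ominus>\<^sub>A curv C c \<odot>\<^sub>A \<one>\<^sub>A \<ominus>\<^sub>A (diff A (\<pi> c) \<oplus>\<^sub>A \<pi> (diff C c)) = \<zero>\<^sub>A"
    using cl by (simp add: a_minus_def A.M.a_ac)
  thus ?thesis using A.diff_zero_eq[of "pp2 c \<ominus>\<^sub>A curv C c \<odot>\<^sub>A \<one>\<^sub>A" "diff A (\<pi> c) \<oplus>\<^sub>A \<pi> (diff C c)"] cl by simp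
qed

lemma dgen_sgn: "c \<in> carrier C ==> dgen c = gen (diff C c) \<oplus>\<^sub>K (gL c \<oplus>\<^sub>K ksgn k 1 \<odot>\<^sub>K gR c)"
  by (simp add: dgen_def a_minus_def K.minus_as_ksgn gR_lin)

lemma tri_ops:
  assumes "klinear k C A g" "klinear k C A h"
  shows "klinear k C K f ==> trifam k C C C K (%i j x u v. ksgn k (r i j) \<odot>\<^sub>K lact K (g x) (lact K (h u) (f v)))"
    and "klinear k C K f ==> trifam k C C C K (%i j x u v. ksgn k (r i j) \<odot>\<^sub>K lact K (g x) (ract K (f u) (h v)))"
    and "klinear k C K f ==> trifam k C C C K (%i j u v y. ksgn k (r i j) \<odot>\<^sub>K ract K (ract K (f u) (g v)) (h y))"
  by (rule trifam_smult[OF gC gC mK trifam_right[OF gC gC gC KB.la_bilin assms(1) bilin_comp[OF KB.la_bilin assms(2)]]]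
      trifam_smult[OF gC gC mK trifam_right[OF gC gC gC KB.la_bilin assms(1) bilin_comp[OF KB.ra_bilin _ assms(2)]]]
      trifam_smult[OF gC gC mK trifam_left[OF gC gC gC KB.ra_bilin bilin_comp[OF KB.ra_bilin _ assms(1)] assms(2)]]; simp)+

lemma SL_shift:
  assumes "klinear k C A f" "klinear k C K g" "c \<in> carrier C" "!!p. even (s p) = even (m + r p)"
  shows "SL K s f g c = ksgn k m \<odot>\<^sub>K SL K r f g c" using klinearD(1)[OF assms(1)] klinearD(1)[OF assms(2)] ksgn_cong[OF assms(4), where k = k]
  by (intro sw_smult[OF mK bla[OF KBx assms(1,2)] K.ksgn_cl assms(3)]) (simp add: K.ksgn_ksgn C.gcar lactD)

lemma SR_shift:
  assumes "klinear k C K g" "klinear k C A f" "c \<in> carrier C" "!!p. even (s p) = even (m + r p)"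
  shows "SR K s g f c = ksgn k m \<odot>\<^sub>K SR K r g f c" using klinearD(1)[OF assms(1)] klinearD(1)[OF assms(2)] ksgn_cong[OF assms(4), where k = k]
  by (intro sw_smult[OF mK bra[OF KBx assms(1,2)] K.ksgn_cl assms(3)]) (simp add: K.ksgn_ksgn C.gcar ractD)

text \<open>Coassociativity for \<pi> acting from the left on a sum that acts from the right. The
  parity condition says that the product of the two signs depends only on the total degree of the
  left factor after regrouping.\<close>

lemma nest_LR:
  assumes f: "klinear k C A f" and par: "!!p q. even (r p + s q) = even (t (p + q))" and c: "c \<in> carrier C"
  shows "SL K r \<pi> (SR K s gen f) c = SR K t gL f c"
proof -
  let ?\<psi> = "%p q u v y. ksgn k (r p + s q) \<odot>\<^sub>K lact K (\<pi> u) (ract K (gen v) (f y))"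
  note fl = klinearD[OF f] and t = tri_ops(2)[OF pi_kl f gen_kl, of "%p q. r p + s q"]
  show ?thesis
  proof (rule sw_coassoc[where \<psi> = ?\<psi>, OF mK t c, symmetric])
    fix i j x y assume x: "x \<in> grade C i" and y: "y \<in> grade C j"
    note xc = C.gcar[OF x] and yc = C.gcar[OF y]
    show "ksgn k (t i) \<odot>\<^sub>K ract K (gL x) (f y) = sweedler C K (%p q u v. ?\<psi> p q u v y) x" unfolding gL_def
    proof (rule sw_map_grade[OF mK bL mK op_kl(2)[OF fl(1)[OF yc]] trifamD(1)[OF t yc] x])
      fix p q u v assume pq: "p + q = i" and u: "u \<in> grade C p" and v: "v \<in> grade C q"
      have "ksgn k (t i) = ksgn k (r p + s q)" using par pq by (intro ksgn_cong) blast
      thus "ksgn k (t i) \<odot>\<^sub>K ract K (lact K (\<pi> u) (gen v)) (f y) = ?\<psi> p q u v y"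
        using C.gcar[OF u] C.gcar[OF v] yc by (simp add: gen_lin pi_lin fl KB.lra)
    qed
    show "ksgn k (r i) \<odot>\<^sub>K lact K (\<pi> x) (SR K s gen f y) = sweedler C K (%p q u v. ?\<psi> i p x u v) y"
      by (rule sw_map[OF mK bra[OF KBx gen_kl f] mK op_kl(1)[OF pi_lin(1)[OF xc]] trifam_inner_right[OF t x] yc])
        (simp add: C.gcar xc gen_lin pi_lin fl ractD lactD K.ksgn_ksgn)
  qed
qed

lemma sw_LL:
  assumes c: "c \<in> carrier C"
  shows "SL K (%p. p + 1) \<pi> gL c = ksgn k 1 \<odot>\<^sub>K SL0 K pp2 gen c"
proof -
  let ?\<psi> = "%p q u v y. ksgn k (p + 1) \<odot>\<^sub>K lact K (\<pi> u) (lact K (\<pi> v) (gen y))"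
  note t = tri_ops(1)[OF pi_kl pi_kl gen_kl, of "%p _. p + 1"]
  have "SL K (%p. p + 1) \<pi> gL c = SL K (%_. 1) pp2 gen c"
  proof (rule sw_coassoc[where \<psi> = ?\<psi>, OF mK t c, symmetric])
    fix i j x y assume x: "x \<in> grade C i" and y: "y \<in> grade C j"
    note xc = C.gcar[OF x] and yc = C.gcar[OF y]
    show "ksgn k (i + 1) \<odot>\<^sub>K lact K (\<pi> x) (gL y) = sweedler C K (%p q u v. ?\<psi> i p x u v) y"
      unfolding gL_def by (rule sw_lin[OF mK bL mK op_kl(1)[OF pi_lin(1)[OF xc]] yc])
    show "ksgn k 1 \<odot>\<^sub>K lact K (pp2 x) (gen y) = sweedler C K (%p q u v. ?\<psi> p q u v y) x"
      by (rule sw_map[OF mA bmul[OF pi_kl pi_kl] mK op_kl(3)[OF gen_lin(1)[OF yc]] trifamD(1)[OF t yc] xc])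
        (simp add: C.gcar yc gen_lin pi_lin KB.la KB.la_assoc K.ksgn_ksgn add.commute)
  qed
  also have "... = ksgn k 1 \<odot>\<^sub>K SL0 K pp2 gen c" by (rule sw_smult[OF mK bla0[OF KBx pp2_kl gen_kl] _ c]) simp_all
  finally show ?thesis .
qed

text \<open>By coassociativity an iterated right action is a right action by a convolution. The sign
  \<open>t\<close> belongs to the generator and \<open>w\<close> to the convolution; the parity
  condition matches them with the signs before regrouping.\<close>

lemma nest_RR:
  assumes g: "klinear k C A g" and h: "klinear k C A h"
    and par: "!!p q. even (r (p + q) + s p) = even (t p + w q)" and c: "c \<in> carrier C"
  shows "SR K r (SR K s gen g) h c = SR K t gen (SA w g h) c"
proof -
  let ?\<psi> = "%p q u v y. ksgn k (t p + w q) \<odot>\<^sub>K ract K (ract K (gen u) (g v)) (h y)"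
  note gl = klinearD[OF g] and hl = klinearD[OF h] and t = tri_ops(3)[OF g h gen_kl, of "%p q. t p + w q"]
  show ?thesis
  proof (rule sw_coassoc[where \<psi> = ?\<psi>, OF mK t c])
    fix i j x y assume x: "x \<in> grade C i" and y: "y \<in> grade C j"
    note xc = C.gcar[OF x] and yc = C.gcar[OF y]
    show "ksgn k (r i) \<odot>\<^sub>K ract K (SR K s gen g x) (h y) = sweedler C K (%p q u v. ?\<psi> p q u v y) x"
    proof (rule sw_map_grade[OF mK bra[OF KBx gen_kl g] mK op_kl(2)[OF hl(1)[OF yc]] trifamD(1)[OF t yc] x])
      fix p q u v assume pq: "p + q = i" and u: "u \<in> grade C p" and v: "v \<in> grade C q"
      have "ksgn k (r i + s p) = ksgn k (t p + w q)" using par pq by (intro ksgn_cong) blast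
      thus "ksgn k (r i) \<odot>\<^sub>K ract K (ksgn k (s p) \<odot>\<^sub>K ract K (gen u) (g v)) (h y) = ?\<psi> p q u v y"
        using C.gcar[OF u] C.gcar[OF v] yc by (simp add: gen_lin gl hl ractD K.ksgn_ksgn)
    qed
    show "ksgn k (t i) \<odot>\<^sub>K ract K (gen x) (SA w g h y) = sweedler C K (%p q u v. ?\<psi> i p x u v) y"
      by (rule sw_map[OF mA bmul[OF g h] mK op_kl(4)[OF gen_lin(1)[OF xc]] trifam_inner_right[OF t x] yc])
        (simp add: C.gcar xc gen_lin gl hl KB.ra KB.ra_assoc K.ksgn_ksgn)
  qed
qed

text \<open>The twisting equation splits \<open>?P\<close> and \<open>?Q\<close>, the sums formed
  with the convolution square of \<pi>, into terms with the differential before \<pi>, after \<pi>,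
  and the curvature. The curvature parts match the square of \<open>diff C\<close>; the rest cancels
  in pairs.\<close>

lemma dK_dgen:
  assumes c: "c \<in> carrier C"
  shows "diff K (dgen c) = \<zero>\<^sub>K"
proof -
  let ?s = "ksgn k 1"
  let ?S1 = "SL0 K (%x. \<pi> (diff C x)) gen c" and ?S2 = "SL K (%p. p) \<pi> (%y. gen (diff C y)) c"
  let ?S3 = "SR K (%p. p) (%x. gen (diff C x)) \<pi> c" and ?S4 = "SR0 K gen (%y. \<pi> (diff C y)) c"
  let ?S5 = "SL0 K (%x. diff A (\<pi> x)) gen c" and ?S6 = "SR0 K gen (%y. diff A (\<pi> y)) c"
  let ?U2 = "SR K (%p. p) gL \<pi> c" and ?P = "SL0 K pp2 gen c" and ?Q = "SR0 K gen pp2 c"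
  let ?F = "sweedler C K (%_ _ x y. curv C x \<odot>\<^sub>K gen y) c" and ?G = "sweedler C K (%_ _ x y. curv C y \<odot>\<^sub>K gen x) c"
  note kl = klinear_compose[OF d_kl gen_kl] klinear_compose[OF d_kl pi_kl] klinear_compose[OF pi_kl dA_kl] gen_kl pi_kl gL_kl gR_kl pp2_kl
  note b = bla0[OF KBx] bra0[OF KBx] bla[OF KBx] bra[OF KBx] bifam_form[OF mK gen_kl curv_form]
  have cl: "?S1 \<in> carrier K" "?S2 \<in> carrier K" "?S3 \<in> carrier K" "?S4 \<in> carrier K" "?S5 \<in> carrier K" "?S6 \<in> carrier K"
    "?U2 \<in> carrier K" "?P \<in> carrier K" "?Q \<in> carrier K" "?F \<in> carrier K" "?G \<in> carrier K" by (intro sw_closed[OF mK _ c] b kl)+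
  have cc: "curv C x \<in> carrier k" if "x \<in> carrier C" for x using curv_form that by (auto simp: deg_form_def)
  have pp2: "pp2 x = \<pi> (diff C x) \<oplus>\<^sub>A (diff A (\<pi> x) \<oplus>\<^sub>A curv C x \<odot>\<^sub>A \<one>\<^sub>A)" if x: "x \<in> carrier C" for x
    using twisting[OF x] cc[OF x] klinearD(1)[OF pp2_kl x] x
    by (simp add: A.M.a_assoc[symmetric] A.M.a_comm[of "\<pi> (diff C x)"] pi_lin d_lin dA_lin) (simp add: a_minus_def A.M.a_assoc A.M.l_neg)
  have e1: "?P = ?S1 \<oplus>\<^sub>K (?S5 \<oplus>\<^sub>K ?F)"
    by (intro sw_add3[OF mK _ _ _ c] b kl) (simp add: pp2 C.gcar cc KB.la gen_lin pi_lin d_lin dA_lin KB.la_one)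
  have e2: "?Q = ?S4 \<oplus>\<^sub>K (?S6 \<oplus>\<^sub>K ?G)"
    by (intro sw_add3[OF mK _ _ _ c] b kl) (simp add: pp2 C.gcar cc KB.ra gen_lin pi_lin d_lin dA_lin KB.ra_one)
  have e3: "gen (diff C (diff C c)) = ?F \<oplus>\<^sub>K ?s \<odot>\<^sub>K ?G" using sw_curv[OF mK gen_kl c] cl by (simp add: a_minus_def K.minus_as_ksgn)
  have gLd: "gL (diff C c) = ?S1 \<oplus>\<^sub>K ?S2" unfolding gL_def sw_diff[OF mK bL c] by (intro sw_add[OF mK _ _ c] b kl) simp
  have "gR (diff C c) = SR K (%p. p + 1) (%x. gen (diff C x)) \<pi> c \<oplus>\<^sub>K ?S4"
    unfolding gR_def sw_diff[OF mK bR c] by (intro sw_add[OF mK _ _ c] b kl) (simp add: C.gcar gen_lin pi_lin d_lin ractD K.ksgn_ksgn K.ksgn_even)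
  also have "SR K (%p. p + 1) (%x. gen (diff C x)) \<pi> c = ?s \<odot>\<^sub>K ?S3" by (rule SR_shift[OF kl(1,5) c]) simp
  finally have gRd: "gR (diff C c) = ?s \<odot>\<^sub>K ?S3 \<oplus>\<^sub>K ?S4" .
  have "diff K (gL c) = ?S5 \<oplus>\<^sub>K (SL K (%p. p + 1) \<pi> (%y. gen (diff C y)) c \<oplus>\<^sub>K (SL K (%p. p + 1) \<pi> gL c \<oplus>\<^sub>K SL K (%p. p) \<pi> gR c))"
    unfolding sw_lin[OF mK bL mK dK_kl c, folded gL_def]
  proof (intro sw_add4[OF mK _ _ _ _ c] b kl)
    fix p q x y assume x: "x \<in> grade C p" and y: "y \<in> grade C q"
    have e: "ksgn k (p + 1 + 1) = ksgn k p" by (rule ksgn_cong) simp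
    show "diff K (lact K (\<pi> x) (gen y)) = lact K (diff A (\<pi> x)) (gen y) \<oplus>\<^sub>K (ksgn k (p + 1) \<odot>\<^sub>K lact K (\<pi> x) (gen (diff C y))
     \<oplus>\<^sub>K (ksgn k (p + 1) \<odot>\<^sub>K lact K (\<pi> x) (gL y) \<oplus>\<^sub>K ksgn k p \<odot>\<^sub>K lact K (\<pi> x) (gR y)))"
      using C.gcar[OF x] C.gcar[OF y] e
      by (simp add: dK_leib_l[OF pi_g[OF x]] gen_lin dK_gen dgen_sgn gL_lin gR_lin d_lin pi_lin lactD K.smult_r_distr K.ksgn_ksgn)
  qed
  also have "SL K (%p. p + 1) \<pi> (%y. gen (diff C y)) c = ?s \<odot>\<^sub>K ?S2" by (rule SL_shift[OF kl(5,1) c]) simp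
  also have "SL K (%p. p) \<pi> gR c = ?U2" unfolding gR_def by (rule nest_LR[OF pi_kl _ c]) simp
  finally have DL: "diff K (gL c) = ?S5 \<oplus>\<^sub>K (?s \<odot>\<^sub>K ?S2 \<oplus>\<^sub>K (?s \<odot>\<^sub>K ?P \<oplus>\<^sub>K ?U2))" unfolding sw_LL[OF c] .
  have "diff K (gR c) = ?S3 \<oplus>\<^sub>K (?S6 \<oplus>\<^sub>K (?U2 \<oplus>\<^sub>K SR K (%p. p + 1) gR \<pi> c))"
    unfolding sw_lin[OF mK bR mK dK_kl c, folded gR_def] by (intro sw_add4[OF mK _ _ _ _ c] b kl)
      (simp add: C.gcar dK_lin dK_leib_r[OF gen_g] gen_lin dK_gen dgen_sgn gL_lin gR_lin d_lin dA_lin pi_lin ractD K.smult_r_distr K.ksgn_ksgn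
         K.ksgn_even K.M.a_ac)
  also have "SR K (%p. p + 1) gR \<pi> c = SR K (%_. 1) gen pp2 c" unfolding gR_def by (rule nest_RR[OF pi_kl pi_kl _ c]) auto
  also have "... = ?s \<odot>\<^sub>K ?Q" by (rule sw_smult[OF mK b(2)[OF gen_kl pp2_kl] _ c]) simp_all
  finally have DR: "diff K (gR c) = ?S3 \<oplus>\<^sub>K (?S6 \<oplus>\<^sub>K (?U2 \<oplus>\<^sub>K ?s \<odot>\<^sub>K ?Q))" .
  have z: "x \<oplus>\<^sub>K ?s \<odot>\<^sub>K x = \<zero>\<^sub>K" if "x \<in> carrier K" for x
    using that by (simp add: K.minus_as_ksgn[symmetric] K.M.r_neg)
  note dc = d_lin(1)[OF c]
  have "diff K (dgen c) = dgen (diff C c) \<oplus>\<^sub>K (diff K (gL c) \<oplus>\<^sub>K ?s \<odot>\<^sub>K diff K (gR c))"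
    using c dc by (simp add: dgen_sgn[OF c] dK_lin dK_gen gen_lin gL_lin gR_lin)
  also have "... = (?F \<oplus>\<^sub>K ?s \<odot>\<^sub>K ?G) \<oplus>\<^sub>K ((?S1 \<oplus>\<^sub>K ?S2) \<oplus>\<^sub>K ?s \<odot>\<^sub>K (?s \<odot>\<^sub>K ?S3 \<oplus>\<^sub>K ?S4))
     \<oplus>\<^sub>K ((?S5 \<oplus>\<^sub>K (?s \<odot>\<^sub>K ?S2 \<oplus>\<^sub>K (?s \<odot>\<^sub>K ?P \<oplus>\<^sub>K ?U2))) \<oplus>\<^sub>K ?s \<odot>\<^sub>K (?S3 \<oplus>\<^sub>K (?S6 \<oplus>\<^sub>K (?U2 \<oplus>\<^sub>K ?s \<odot>\<^sub>K ?Q))))"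
    unfolding dgen_sgn[OF dc] gLd gRd DL DR e3 ..
  \<comment> \<open>Grouped so that \<open>e1\<close> and \<open>e2\<close> apply;
    \<open>?S2\<close>, \<open>?S3\<close> and \<open>?U2\<close> each occur twice with opposite
    signs.\<close>
  also have "... = ((?S1 \<oplus>\<^sub>K (?S5 \<oplus>\<^sub>K ?F)) \<oplus>\<^sub>K ?s \<odot>\<^sub>K ?P) \<oplus>\<^sub>K (?Q \<oplus>\<^sub>K ?s \<odot>\<^sub>K (?S4 \<oplus>\<^sub>K (?S6 \<oplus>\<^sub>K ?G)))
     \<oplus>\<^sub>K ((?S2 \<oplus>\<^sub>K ?s \<odot>\<^sub>K ?S2) \<oplus>\<^sub>K (?S3 \<oplus>\<^sub>K ?s \<odot>\<^sub>K ?S3) \<oplus>\<^sub>K (?U2 \<oplus>\<^sub>K ?s \<odot>\<^sub>K ?U2))"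
    using cl by (simp add: K.smult_r_distr K.ksgn_ksgn K.ksgn_even K.M.a_ac)
  also have "... = \<zero>\<^sub>K" unfolding e1[symmetric] e2[symmetric] using cl by (simp add: z)
  finally show ?thesis .
qed

text \<open>The product rules reduce the square to its value on generators, which is 0 by
  \<open>dK_dgen\<close>; the cross terms have signs of opposite parity.\<close>

lemma ddK: "m \<in> carrier K ==> diff K (diff K m) = \<zero>\<^sub>K"
proof (induction rule: gen_induct)
  case (hom i j l a c b)
  let ?g = "gen c" and ?dg = "dgen c"
  have cl: "?g \<in> carrier K" "?dg \<in> carrier K" using hom by (simp_all add: gen_lin dgen_lin)
  have r: "diff K (ract K ?g b) = ract K ?dg b \<oplus>\<^sub>K ksgn k j \<odot>\<^sub>K ract K ?g (diff A b)" if "b \<in> carrier A" for b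
    using dK_leib_r[OF gen_g[OF hom(2)] that] hom(5) by (simp add: dK_gen)
  have r': "diff K (ract K ?dg b) = ksgn k (j + 1) \<odot>\<^sub>K ract K ?dg (diff A b)"
    using dK_leib_r[OF dgen_g[OF hom(2)] hom(6)] hom(5,6) cl by (simp add: dK_dgen KB.ra_zero2 dA_lin ractD)
  have rr: "diff K (diff K (ract K ?g b)) = \<zero>\<^sub>K" using hom(6) cl
    by (simp add: r r' dK_lin ractD dA_lin K.smult_r_distr K.ksgn_ksgn ddA KB.ra_zero K.M.r_zero) (rule K.ksgn_add_zero, simp_all add: ractD dA_lin)
  let ?m = "ract K ?g b"
  have mc: "?m \<in> carrier K" "diff K ?m \<in> carrier K" using hom cl by (simp_all add: ractD dK_lin)
  have "diff K (diff K (lact K a ?m)) = ksgn k (i + 1) \<odot>\<^sub>K lact K (diff A a) (diff K ?m) \<oplus>\<^sub>K ksgn k i \<odot>\<^sub>K lact K (diff A a) (diff K ?m)"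
    using mc hom(4) by (simp add: dK_leib_l[OF hom(1)] dK_leib_l[OF dA_g[OF hom(1)]] dK_lin lactD dA_lin ddA KB.la_zero rr KB.la_zero2)
  also have "... = \<zero>\<^sub>K" using mc hom(4) by (intro K.ksgn_add_zero) (simp_all add: lactD dA_lin)
  finally show ?case .
next
  case (add x y)
  thus ?case by (simp add: dK_lin)
qed

lemma K_dg: "dg_bimodule k A K" unfolding dg_bimodule_def dg_space_def using K_gbim gsK dK_deg ddK dK_leib_l dK_leib_r by blast

end

section \<open>Bimodule maps out of the twisted tensor product\<close>

sublocale tw \<subseteq> KD: dbim k A "twisted_tensor k A C \<pi>" by (rule dbimI[OF dga_axioms K_dg])

sublocale tw \<subseteq> KE: dbim_end k A "twisted_tensor k A C \<pi>" by (intro dbim_end.intro dbim2.intro KD.dbim_axioms)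

context tw begin

text \<open>The existence half of the freeness of K, for maps of any degree n. The sign moves the
  map past \<open>a\<close>.\<close>

definition ext :: "('k, 'a, 'n) dgbimod => int => ('c => 'n) => (('a \<times> 'c) list set \<times> 'a) list set => 'n" where
  "ext N n \<phi> = (\<lambda>t\<in>carrier K. tl3 A C N (%i j a c b. ksgn k (n * i) \<odot>\<^sub>N lact N a (ract N (\<phi> c) b)) t)"

lemma ext_trifam:
  assumes "gbim k A N" "klinear k C N \<phi>"
  shows "trifam k A C A N (%i j a c b. ksgn k (n * i) \<odot>\<^sub>N lact N a (ract N (\<phi> c) b))"
proof -
  interpret N: gbim k A N by fact
  have m: "module k N" by (rule N.M.module_axioms)
  note idl = A.id_kl
  show ?thesis by (rule trifam_smult[OF gA gC m trifam_right[OF gA gC gA N.la_bilin idl bilin_comp[OF N.ra_bilin assms(2) idl]]]) simp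
qed

lemma ext_kl:
  assumes "gbim k A N" "klinear k C N \<phi>"
  shows "klinear k K N (ext N n \<phi>)"
proof -
  interpret N: gbim k A N by fact
  have m: "module k N" by (rule N.M.module_axioms)
  have "klinear k K N (tl3 A C N (%i j a c b. ksgn k (n * i) \<odot>\<^sub>N lact N a (ract N (\<phi> c) b)))"
    using T3.tl3_klinear[OF m ext_trifam[OF assms]] by (simp add: klinear_KT)
  thus ?thesis unfolding ext_def klinear_def by (simp add: Pi_iff)
qed

lemma ext_pt:
  assumes "gbim k A N" "klinear k C N \<phi>" "a \<in> grade A i" "c \<in> carrier C" "b \<in> carrier A"
  shows "ext N n \<phi> (lact K a (ract K (gen c) b)) = ksgn k (n * i) \<odot>\<^sub>N lact N a (ract N (\<phi> c) b)"
proof -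
  interpret N: gbim k A N by fact
  have m: "module k N" by (rule N.M.module_axioms)
  note l = klinearD[OF ext_kl[OF assms(1,2)]] and p = klinearD[OF assms(2)]
  note ac = A.gcar[OF assms(3)]
  from assms(4) show ?thesis
  proof (induction rule: C.graded_induct)
    case (hom j c)
    note cc = C.gcar[OF hom]
    have "ext N n \<phi> (lact K a (ract K (gen c) b)) = tl3 A C N (%i j a c b. ksgn k (n * i) \<odot>\<^sub>N lact N a (ract N (\<phi> c) b)) (T3.pp a c b)"
      using ac cc assms(5) by (simp add: ext_def pt_gen[symmetric]) (simp add: pt_pp)
    thus ?case using T3.tl3_pp[OF m ext_trifam[OF assms(1,2)] assms(3) hom assms(5)] by simp
  next
    case (add x y)
    thus ?case using ac assms(5) by (simp add: gen_lin ractD lactD l p N.ra N.la N.M.smult_r_distr)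
  qed
qed

lemma ext_gen: "gbim k A N ==> klinear k C N \<phi> ==> c \<in> carrier C ==> ext N n \<phi> (gen c) = \<phi> c"
proof -
  assume N: "gbim k A N" and p: "klinear k C N \<phi>" and c: "c \<in> carrier C"
  then interpret N: gbim k A N by simp
  show ?thesis using ext_pt[OF N p one_g c AR.one_closed, of n] c klinearD(1)[OF p c] by (simp add: KB.la_one KB.ra_one gen_lin N.la_one N.ra_one)
qed

lemma bl_pt:
  assumes "gbim k A N" "bimod_linear k A K N n f" "a \<in> grade A i" "c \<in> carrier C" "b \<in> carrier A"
  shows "f (lact K a (ract K (gen c) b)) = ksgn k (n * i) \<odot>\<^sub>N lact N a (ract N (f (gen c)) b)"
  using bimod_linearD(2)[OF assms(2,3) gen_lin(1)[OF assms(4)] assms(5)] .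

lemma bl_uniq:
  assumes "gbim k A N" "bimod_linear k A K N n f" "bimod_linear k A K N n g"
    "!!j c. c \<in> grade C j ==> f (gen c) = g (gen c)" "t \<in> carrier K"
  shows "f t = g t" using assms(5)
proof (induction rule: gen_induct)
  case (hom i j l a c b)
  thus ?case using assms(4) by (simp add: bl_pt[OF assms(1,2)] bl_pt[OF assms(1,3)])
next
  case (add x y)
  thus ?case using deg_linearD(2)[OF bimod_linearD(1)[OF assms(2)]]
    deg_linearD(2)[OF bimod_linearD(1)[OF assms(3)]] by simp
qed

lemma ext_bl:
  assumes N: "gbim k A N" and p: "deg_linear k C N n \<phi>"
  shows "bimod_linear k A K N n (ext N n \<phi>)"
proof -
  interpret N: gbim k A N by fact
  interpret KN: gbim2 k A K N by (intro gbim2.intro KBx N)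
  note pk = deg_klinear[OF p]
  note l = klinearD[OF ext_kl[OF N pk, of n]] and e = ext_pt[OF N pk, where n = n]
  note pc = klinearD[OF pk]
  show ?thesis
  proof (rule KN.bimod_linearI)
    show "deg_linear k K N n (ext N n \<phi>)"
    proof (rule K_grade[OF ext_kl[OF N pk] N.M.gspace_axioms])
      fix i j l a c b assume a: "a \<in> grade A i" and c: "c \<in> grade C j" and b: "b \<in> grade A l"
      note cc = A.gcar[OF a] C.gcar[OF c] A.gcar[OF b]
      show "ext N n \<phi> (pt a c b) \<in> grade N (i + j + l + n)" using N.la_g[OF a N.ra_g[OF deg_linear_grade[OF p c] b]] cc
        by (simp add: pt_gen e[OF a] algebra_simps)
    qed
    fix a i m assume a: "a \<in> grade A i" and m: "m \<in> carrier K"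
    note ac = A.gcar[OF a]
    from m show "ext N n \<phi> (lact K a m) = ksgn k (n * i) \<odot>\<^sub>N lact N a (ext N n \<phi> m)"
    proof (induction rule: gen_induct)
      case (hom i' j l a' c b)
      have "lact K a (lact K a' (ract K (gen c) b)) = lact K (a \<otimes>\<^sub>A a') (ract K (gen c) b)"
        using ac hom(4-) by (simp add: KB.la_assoc ractD gen_lin)
      thus ?case using ac hom(4-) by (simp add: e[OF mult_g[OF a hom(1)]] e[OF hom(1)] N.la_assoc N.la N.ra pc N.M.ksgn_ksgn algebra_simps)
    next
      case (add x y)
      thus ?case using ac by (simp add: lactD l N.la N.M.smult_r_distr)
    qed
  next
    fix m b' assume m: "m \<in> carrier K" and b': "b' \<in> carrier A"
    from m show "ext N n \<phi> (ract K m b') = ract N (ext N n \<phi> m) b'"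
    proof (induction rule: gen_induct)
      case (hom i j l a c b)
      have "ract K (lact K a (ract K (gen c) b)) b' = lact K a (ract K (gen c) (b \<otimes>\<^sub>A b'))"
        using b' hom(4-) by (simp add: KB.lra KB.ra_assoc ractD gen_lin)
      thus ?case using b' hom(4-) by (simp add: e[OF hom(1)] N.la N.ra N.ra_assoc N.lra pc)
    next
      case (add x y)
      thus ?case using b' by (simp add: ractD l N.ra)
    qed
  qed
qed

lemma ext_ext: "ext N n \<phi> \<in> extensional (carrier K)" by (simp add: ext_def)

text \<open>Moving f past \<pi>(c_1), of degree |c_1| + 1, produces the exponent n (p + 1); the
  right action costs no further sign.\<close>

lemma bl_dgen:
  assumes N: "gbim k A N" and f: "bimod_linear k A K N n f" and c: "c \<in> carrier C"
  shows "f (dgen c) = f (gen (diff C c)) \<oplus>\<^sub>N (SL N (%p. n * (p + 1)) \<pi> (%y. f (gen y)) c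
     \<ominus>\<^sub>N SR N (%p. p) (%x. f (gen x)) \<pi> c)"
proof -
  interpret N: gbim k A N by fact
  interpret KN: gbim2 k A K N by (intro gbim2.intro KBx N)
  have m: "module k N" by (rule N.M.module_axioms)
  have fk: "klinear k K N f" using KN.bl_lin[OF f] .
  note fl = klinearD[OF fk]
  note fg = klinear_compose[OF gen_kl fk]
  have 1: "f (gL c) = SL N (%p. n * (p + 1)) \<pi> (%y. f (gen y)) c" unfolding gL_def
    by (rule sw_map[OF mK bL m fk bla[OF N pi_kl fg] c]) (simp add: KN.bl_l[OF f pi_g] gen_lin C.gcar)
  have 2: "f (gR c) = SR N (%p. p) (%x. f (gen x)) \<pi> c" unfolding gR_def
    by (rule sw_map[OF mK bR m fk bra[OF N fg pi_kl] c]) (simp add: KN.bl_r[OF f] gen_lin C.gcar fl ractD pi_lin)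
  show ?thesis using c 1 2 additive_diff[OF K.ab N.M.ab klinear_additive[OF fk], of "gL c" "gR c"] by (simp add: dgen_def fl gen_lin gL_lin gR_lin d_lin)
qed

section \<open>The augmentation\<close>

abbreviation "R \<equiv> regular_bimodule A"
abbreviation "aug \<equiv> tw_augmentation A C"

lemma R_gbim: "gbim k A R" using regular_dg by (intro gbimI[OF dga_axioms]) (simp add: dg_bimodule_def)

lemma counit_cl: "c \<in> carrier C ==> counit C c \<in> carrier k" using counit_form by (auto simp: deg_form_def)

lemma counit_R: "deg_linear k C R 0 (%c. counit C c \<odot>\<^sub>A \<one>\<^sub>A)"
proof -
  have "counit C c \<odot>\<^sub>A \<one>\<^sub>A \<in> grade A i" if "c \<in> grade C i" for c i
  proof (cases "i = 0")
    case True thus ?thesis using one_g counit_cl C.gcar[OF that] by simp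
  next
    case False
    hence "counit C c = \<zero>\<^sub>k" using counit_form that by (simp add: deg_form_def)
    thus ?thesis by simp
  qed
  thus ?thesis using counit_form counit_cl by (auto simp: deg_linear_def klinear_def deg_form_def regular_simps A.smult_l_distr A.smult_assoc1)
qed

text \<open>The augmentation is the extension of c |-> \<epsilon>(c) 1, and so inherits its bimodule
  linearity from \<open>ext\<close>.\<close>

lemma aug_ext: "t \<in> carrier K ==> aug t = ext R 0 (%c. counit C c \<odot>\<^sub>A \<one>\<^sub>A) t"
proof -
  let ?\<psi> = "%i j a c b. ksgn k (0 * i) \<odot>\<^sub>R lact R a (ract R (counit C c \<odot>\<^sub>A \<one>\<^sub>A) b)"
  assume t: "t \<in> carrier K"
  have tr: "trifam k A C A R ?\<psi>" by (rule ext_trifam[OF R_gbim deg_klinear[OF counit_R]])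
  have mR: "module k R" by (rule module_cong[OF mA]) (simp_all add: regular_simps)
  have e: "counit C c \<odot>\<^sub>A (a \<otimes>\<^sub>A b) = ?\<psi> i j a c b" if "a \<in> carrier A" "c \<in> carrier C" "b \<in> carrier A" for i j a c b
    using that counit_cl by (simp add: regular_simps A_smult_l A_smult_r)
  have tr': "trifam k A C A R (%_ _ a c b. counit C c \<odot>\<^sub>A (a \<otimes>\<^sub>A b))" by (rule T3.trifam_cong[OF tr e]) (auto intro: A.gcar C.gcar)
  have eq: "carrier A = carrier R" "add A = add R" "\<zero>\<^sub>A = \<zero>\<^sub>R" by (simp_all add: regular_simps)
  have "aug t = tl3 A C R (%_ _ a c b. counit C c \<odot>\<^sub>A (a \<otimes>\<^sub>A b)) t"
    unfolding tw_augmentation_def lift3_tl3 tl3_def tlift_hom_def hsum_cong_struct[OF eq]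
      tlift_cong_struct[OF eq(2,3)] ..
  also have "... = tl3 A C R ?\<psi> t"
  proof (rule K_eqI[OF _ _ _ t])
    show "abelian_group R" using mR unfolding module_def by blast
    show "additive K R (tl3 A C R (%_ _ a c b. counit C c \<odot>\<^sub>A (a \<otimes>\<^sub>A b)))" "additive K R (tl3 A C R ?\<psi>)"
      using T3.tl3_klinear[OF mR tr'] T3.tl3_klinear[OF mR tr] by (simp_all add: klinear_KT klinear_additive)
    show "tl3 A C R (%_ _ a c b. counit C c \<odot>\<^sub>A (a \<otimes>\<^sub>A b)) (pt a c b) = tl3 A C R ?\<psi> (pt a c b)"
      if "a \<in> grade A i" "c \<in> grade C j" "b \<in> carrier A" for i j a c b unfolding pt_pp T3.tl3_pp[OF mR tr' that] T3.tl3_pp[OF mR tr that]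
      by (rule e) (use that A.gcar C.gcar in blast)+
  qed
  finally show ?thesis using t by (simp add: ext_def)
qed

lemma aug_bl: "bimod_linear k A K R 0 aug"
proof -
  have e: "bimod_linear k A K R 0 (ext R 0 (%c. counit C c \<odot>\<^sub>A \<one>\<^sub>A))" by (rule ext_bl[OF R_gbim counit_R])
  show ?thesis using e unfolding bimod_linear_def deg_linear_def klinear_def by (simp add: aug_ext Pi_iff KB.la KB.ra A.gcar image_subset_iff K.gcar)
qed

lemma aug_gen: "c \<in> carrier C ==> aug (gen c) = counit C c \<odot>\<^sub>A \<one>\<^sub>A"
  using aug_ext[OF gen_lin(1)] ext_gen[OF R_gbim deg_klinear[OF counit_R]] by simp

lemma aug_kl: "klinear k K A aug" using deg_klinear[OF bimod_linearD(1)[OF aug_bl]] unfolding klinear_def by (simp add: regular_simps)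

end

section \<open>The twisted convolution algebra\<close>

sublocale tw \<subseteq> HK: homc k C A "%n. {f \<in> extensional (carrier C). deg_linear k C A n f}"
proof
  show "deg_linear k C C 1 (diff C)" "deg_linear k A A 1 (diff A)" by (rule d_deg, rule dA_deg)
  fix n :: int
  show "(\<lambda>v\<in>carrier C. \<zero>\<^sub>A) \<in> {f \<in> extensional (carrier C). deg_linear k C A n f}"
    by (auto simp: deg_linear_def klinear_def C.gcar)
  fix f assume "f \<in> {f \<in> extensional (carrier C). deg_linear k C A n f}"
  hence f: "deg_linear k C A n f" by simp
  note lf = deg_linearD[OF f] and gf = deg_linear_grade[OF f]
  show "(\<lambda>v\<in>carrier C. r \<odot>\<^sub>A f v) \<in> {f \<in> extensional (carrier C). deg_linear k C A n f}" if "r \<in> carrier k" for r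
    using that by (auto simp: deg_linear_def klinear_def lf gf C.gcar A.smult_r_distr A.smult_comm)
  show "(\<lambda>v\<in>carrier C. f v \<oplus>\<^sub>A g v) \<in> {f \<in> extensional (carrier C). deg_linear k C A n f}"
    if "g \<in> {f \<in> extensional (carrier C). deg_linear k C A n f}" for g
  proof -
    have g: "deg_linear k C A n g" using that by simp
    note lg = deg_linearD[OF g] and gg = deg_linear_grade[OF g]
    show ?thesis by (auto simp: deg_linear_def klinear_def lf gf lg gg C.gcar A.smult_r_distr A.M.a_ac)
  qed
  have dd: "f (diff C v) \<in> grade A (i + (n + 1))" "diff A (f v) \<in> grade A (i + (n + 1))" if "v \<in> grade C i" for v i
    using gf[OF deg_linear_grade[OF d_deg that]] dA_g[OF gf[OF that]] by (simp_all add: algebra_simps)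
  show "(\<lambda>v\<in>carrier C. diff A (f v) \<ominus>\<^sub>A ksgn k n \<odot>\<^sub>A f (diff C v)) \<in> {f \<in> extensional (carrier C). deg_linear k C A (n + 1) f}"
    by (auto simp: deg_linear_def klinear_def lf dd C.gcar d_lin dA_lin a_minus_def A.smult_r_distr A.M.minus_add A.M.a_ac A.smult_r_minus
      A.smult_comm)
qed auto

context tw begin

abbreviation "Htw \<equiv> Hom_tw k C A \<pi>"
abbreviation "GH n \<equiv> {f \<in> extensional (carrier C). deg_linear k C A n f}"

lemma Htw_simps:
  "carrier Htw = carrier HK.H" "\<zero>\<^sub>Htw = \<zero>\<^sub>HK.H" "add Htw = add HK.H" "smult Htw = smult HK.H" "grade Htw = GH"
  "\<one>\<^sub>Htw = (\<lambda>c\<in>carrier C. counit C c \<odot>\<^sub>A \<one>\<^sub>A)"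
  by (simp_all add: Hom_tw_def Let_def Hom_k_def hom_simps HK.H_simps)

lemma gs_Htw: "graded_space k Htw" by (rule graded_space_cong[OF HK.gsH]) (simp_all add: Htw_simps HK.H_simps)

lemma H_cl: "f \<in> carrier HK.H ==> c \<in> carrier C ==> f c \<in> carrier A" using klinearD(1)[OF HK.H_klinear] .

subsection \<open>Convolution\<close>

abbreviation "cfam n f g \<equiv> FA (%i. i * n) f g"

lemma cfam_bifam: "klinear k C A f ==> klinear k C A g ==> bifam k C C A (cfam n f g)" by (rule bmul)

lemma conv_eq: "c \<in> carrier C ==> conv k C A n f g c = sweedler C A (cfam n f g) c" by (simp add: conv_def)

lemma conv_G:
  assumes "f \<in> GH m" "g \<in> GH n"
  shows "conv k C A l f g \<in> GH (m + n)"
proof -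
  have f: "deg_linear k C A m f" and g: "deg_linear k C A n g" using assms by auto
  note b = cfam_bifam[OF deg_klinear[OF f] deg_klinear[OF g], of l]
  have "deg_linear k C A (m + n) (sweedler C A (cfam l f g))"
  proof (rule sw_deg[OF gA b])
    fix i j x y assume "x \<in> grade C i" "y \<in> grade C j"
    from mult_g[OF deg_linear_grade[OF f this(1)] deg_linear_grade[OF g this(2)]]
    show "ksgn k (i * l) \<odot>\<^sub>A (f x \<otimes>\<^sub>A g y) \<in> grade A (i + j + (m + n))" by (simp add: algebra_simps)
  qed
  hence "deg_linear k C A (m + n) (conv k C A l f g)" unfolding deg_linear_def klinear_def by (auto simp: conv_def C.gcar)
  thus ?thesis by (simp add: conv_def)
qed

lemma conv_add_left:
  assumes "klinear k C A f" "klinear k C A f'" "klinear k C A g"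
  shows "conv k C A n (f \<oplus>\<^sub>HK.H f') g = conv k C A n f g \<oplus>\<^sub>HK.H conv k C A n f' g"
proof -
  have "sweedler C A (cfam n (f \<oplus>\<^sub>HK.H f') g) c = sweedler C A (cfam n f g) c \<oplus>\<^sub>A sweedler C A (cfam n f' g) c"
    if c: "c \<in> carrier C" for c by (rule sw_add[OF mA cfam_bifam[OF assms(1,3)] cfam_bifam[OF assms(2,3)] c])
      (simp add: HK.H_simps C.gcar klinearD[OF assms(1)] klinearD[OF assms(2)] klinearD[OF assms(3)] AR.l_distr A.smult_r_distr)
  thus ?thesis by (simp add: HK.H_simps conv_def cong: restrict_cong)
qed

lemma conv_add_right:
  assumes "klinear k C A f" "klinear k C A g" "klinear k C A g'"
  shows "conv k C A n f (g \<oplus>\<^sub>HK.H g') = conv k C A n f g \<oplus>\<^sub>HK.H conv k C A n f g'"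
proof -
  have "sweedler C A (cfam n f (g \<oplus>\<^sub>HK.H g')) c = sweedler C A (cfam n f g) c \<oplus>\<^sub>A sweedler C A (cfam n f g') c"
    if c: "c \<in> carrier C" for c by (rule sw_add[OF mA cfam_bifam[OF assms(1,2)] cfam_bifam[OF assms(1,3)] c])
      (simp add: HK.H_simps C.gcar klinearD[OF assms(1)] klinearD[OF assms(2)] klinearD[OF assms(3)] AR.r_distr A.smult_r_distr)
  thus ?thesis by (simp add: HK.H_simps conv_def cong: restrict_cong)
qed

lemma conv_H:
  assumes "f \<in> carrier HK.H" "g \<in> GH n" shows "conv k C A l f g \<in> carrier HK.H" using assms(1)
proof (induction rule: HK.H.graded_induct)
  case (hom i f) thus ?case using HK.G_H[OF conv_G[OF _ assms(2)]] by (simp add: HK.H_simps)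
next
  case (add x y)
  have "klinear k C A g" using assms(2) deg_klinear by blast
  thus ?case using add by (simp add: conv_add_left HK.H_klinear)
qed

lemma mult_addfam: "f \<in> carrier HK.H ==> addfam HK.HC HK.HC (%n g'. conv k C A n f g')" unfolding addfam_def hom_simps HK.H_simps(4)
proof (intro allI ballI conjI)
  fix n g assume f: "f \<in> carrier HK.H" and g: "g \<in> GH n"
  show "conv k C A n f g \<in> carrier HK.H" by (rule conv_H[OF f g])
  fix h assume h: "h \<in> GH n"
  show "conv k C A n f (g \<oplus>\<^sub>HK.H h) = conv k C A n f g \<oplus>\<^sub>HK.H conv k C A n f h"
    by (rule conv_add_right[OF HK.H_klinear[OF f] HK.H_klinear[OF HK.G_H[OF g]] HK.H_klinear[OF HK.G_H[OF h]]])
qed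

lemma Htw_mult: "f \<otimes>\<^sub>Htw g = hsum HK.HC HK.HC (%n g'. conv k C A n f g') g" by (simp add: Hom_tw_def Let_def Hom_k_def)

lemma mult_hom: "f \<in> carrier HK.H ==> g \<in> GH n ==> f \<otimes>\<^sub>Htw g = conv k C A n f g"
  unfolding Htw_mult by (rule HK.HC.hsum_hom[OF HK.HC.ab mult_addfam]) (simp_all add: hom_simps HK.H_simps)

lemma mult_add_right: "f \<in> carrier HK.H ==> additive HK.H HK.H (%g. f \<otimes>\<^sub>Htw g)" using HK.HC.hsum_additive[OF HK.HC.ab mult_addfam]
  unfolding Htw_mult additive_def hom_simps .

text \<open>The product is defined through the homogeneous components of the right factor, so
  additivity in the left factor is proved by induction over the right one.\<close>

lemma mult_add_left: "g \<in> carrier HK.H ==> additive HK.H HK.H (%f. f \<otimes>\<^sub>Htw g)"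
proof (induction rule: HK.H.graded_induct)
  case (hom n g)
  hence g: "g \<in> GH n" by (simp add: HK.H_simps)
  hence gl: "klinear k C A g" using deg_klinear by blast
  show ?case unfolding additive_def by (simp add: Pi_iff mult_hom[OF _ g] conv_H[OF _ g] conv_add_left[OF HK.H_klinear HK.H_klinear gl])
next
  case (add x y)
  thus ?case using additiveD(2)[OF mult_add_right] additiveD[OF add(3)] additiveD[OF add(4)] unfolding additive_def by (simp add: Pi_iff HK.H.M.a_ac)
qed

subsection \<open>The twisted differential\<close>

definition dtw :: "int => ('c => 'a) => 'c => 'a" where
  "dtw n f = diff HK.HC f \<ominus>\<^sub>HK.H (conv k C A n \<pi> f \<ominus>\<^sub>HK.H ksgn k n \<odot>\<^sub>HK.H conv k C A 1 f \<pi>)"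

lemma pi_G: "\<pi> \<in> GH 1" using pi_ext pi_deg by simp

lemma dtw_G: "f \<in> GH n ==> dtw n f \<in> GH (n + 1)"
proof -
  assume f: "f \<in> GH n"
  have "conv k C A n \<pi> f \<in> GH (n + 1)" "conv k C A 1 f \<pi> \<in> GH (n + 1)"
    using conv_G[OF pi_G f, of n] conv_G[OF f pi_G, of 1] by (simp_all add: add.commute)
  moreover have "diff HK.HC f \<in> GH (n + 1)" by (rule HK.HC_diff_G[OF f])
  moreover note HK.H.g_minus[unfolded HK.H_simps(4)] HK.H.g_smult[unfolded HK.H_simps(4)]
  ultimately show ?thesis unfolding dtw_def by (simp only: HK.H.ksgn_cl)
qed

lemma dtw_addfam: "addfam HK.HC HK.HC dtw" unfolding addfam_def hom_simps HK.H_simps(4)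
proof (intro allI ballI conjI)
  fix n f assume f: "f \<in> GH n"
  show "dtw n f \<in> carrier HK.H" by (rule HK.G_H[OF dtw_G[OF f]])
  fix g assume g: "g \<in> GH n"
  note fl = HK.H_klinear[OF HK.G_H[OF f]] and gl = HK.H_klinear[OF HK.G_H[OF g]]
  note cl = HK.G_H[OF conv_G[OF pi_G f, of n]] HK.G_H[OF conv_G[OF pi_G g, of n]]
    HK.G_H[OF conv_G[OF f pi_G, of 1]] HK.G_H[OF conv_G[OF g pi_G, of 1]]
    HK.G_H[OF HK.HC_diff_G[OF f]] HK.G_H[OF HK.HC_diff_G[OF g]]
  have d: "diff HK.HC (f \<oplus>\<^sub>HK.H g) = diff HK.HC f \<oplus>\<^sub>HK.H diff HK.HC g"
    using klinearD(2)[OF HK.HC_diff_klinear, unfolded hom_simps, OF HK.G_H[OF f] HK.G_H[OF g]] .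
  show "dtw n (f \<oplus>\<^sub>HK.H g) = dtw n f \<oplus>\<^sub>HK.H dtw n g" unfolding dtw_def d conv_add_left[OF fl gl pi_kl] conv_add_right[OF pi_kl fl gl]
    using cl by (simp add: a_minus_def HK.H.minus_as_ksgn HK.H.smult_r_distr HK.H.ksgn_ksgn HK.H.M.a_ac)
qed

lemma Htw_diff: "diff Htw = hsum HK.HC HK.HC dtw"
proof -
  have e: "a_minus HK.HC = a_minus HK.H" by (intro ext a_minus_cong_struct) (simp_all add: hom_simps)
  show ?thesis by (simp add: Hom_tw_def Let_def Hom_k_def dtw_def[abs_def] e hom_simps)
qed

lemma diff_hom: "f \<in> GH n ==> diff Htw f = dtw n f" unfolding Htw_diff by (rule HK.HC.hsum_hom[OF HK.HC.ab dtw_addfam]) (simp add: hom_simps HK.H_simps)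

lemma diff_add: "additive HK.H HK.H (diff Htw)" using HK.HC.hsum_additive[OF HK.HC.ab dtw_addfam] unfolding Htw_diff additive_def hom_simps .

lemma dtw_apply:
  assumes f: "f \<in> GH n" and c: "c \<in> carrier C"
  shows "dtw n f c = diff A (f c) \<oplus>\<^sub>A (ksgn k (n + 1) \<odot>\<^sub>A f (diff C c) \<oplus>\<^sub>A
    (ksgn k 1 \<odot>\<^sub>A sweedler C A (cfam n \<pi> f) c \<oplus>\<^sub>A ksgn k n \<odot>\<^sub>A sweedler C A (cfam 1 f \<pi>) c))"
proof -
  note cl = HK.G_H[OF conv_G[OF pi_G f, of n]] HK.G_H[OF conv_G[OF f pi_G, of 1]] HK.G_H[OF HK.HC_diff_G[OF f]]
  have sc: "ksgn k n \<odot>\<^sub>HK.H conv k C A 1 f \<pi> \<in> carrier HK.H" using cl by simp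
  note ac = H_cl[OF cl(1) c] H_cl[OF cl(2) c] H_cl[OF HK.G_H[OF f]]
  have e: "ksgn k (n + 2) = ksgn k n" by (rule ksgn_cong) simp
  show ?thesis unfolding dtw_def HK.H_minus[OF cl(3) HK.H.M.minus_closed[OF cl(1) sc] c] HK.H_minus[OF cl(1) sc c] using c ac unfolding conv_eq[OF c]
    by (simp add: HK.H_simps HK.HC_diff[OF f c] conv_eq a_minus_def A.minus_as_ksgn A.smult_r_distr A.ksgn_ksgn A.ksgn_even d_lin dA_lin A.M.a_assoc add.commute e)
qed

section \<open>The map \<open>l\<close>\<close>

text \<open>The value of l(f) on a generator: the signed sum of 1 (x) c_1 (x) f(c_2).\<close>

definition lg :: "int => ('c => 'a) => 'c => (('a \<times> 'c) list set \<times> 'a) list set" where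
  "lg n f = SR K (%p. n * p) gen f"

lemma lgb: "klinear k C A f ==> bifam k C C K (FR K (%p. n * p) gen f)" by (rule bra[OF KBx gen_kl])

lemma lg_deg: "deg_linear k C A n f ==> deg_linear k C K n (lg n f)" unfolding lg_def
proof (rule sw_deg[OF gK lgb])
  assume f: "deg_linear k C A n f"
  show "klinear k C A f" by (rule deg_klinear[OF f])
  fix i j x y assume "x \<in> grade C i" "y \<in> grade C j"
  from KB.ra_g[OF gen_g[OF this(1)] deg_linear_grade[OF f this(2)]]
  show "ksgn k (n * i) \<odot>\<^sub>K ract K (gen x) (f y) \<in> grade K (i + j + n)" by (simp add: algebra_simps)
qed

lemmas lg_kl = deg_klinear[OF lg_deg]

definition lfam :: "int => ('c => 'a) => (('a \<times> 'c) list set \<times> 'a) list set => (('a \<times> 'c) list set \<times> 'a) list set" where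
  "lfam n f = (\<lambda>t\<in>carrier K. lift3 A C K (%i j a c b.
         sweedler C K (%p q x y. ksgn k (n * (i + p)) \<odot>\<^sub>K pt a x (f y \<otimes>\<^sub>A b)) c) t)"

text \<open>Once l(f) is recognised as the extension of \<open>lg n f\<close>, it is a bimodule map
  and identities for it can be checked on generators.\<close>

lemma lfam_ext:
  assumes f: "deg_linear k C A n f" shows "lfam n f = ext K n (lg n f)"
proof -
  note fk = deg_klinear[OF f] and fl = deg_linearD[OF f]
  let ?\<psi> = "%i j a c b. ksgn k (n * i) \<odot>\<^sub>K lact K a (ract K (lg n f c) b)"
  let ?\<phi> = "%i j a c b. sweedler C K (%p q x y. ksgn k (n * (i + p)) \<odot>\<^sub>K pt a x (f y \<otimes>\<^sub>A b)) c"
  have tr: "trifam k A C A K ?\<psi>" by (rule ext_trifam[OF KBx lg_kl[OF f]])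
  have e: "?\<phi> i j a c b = ?\<psi> i j a c b" if a: "a \<in> carrier A" and c: "c \<in> carrier C" and b: "b \<in> carrier A" for i j a c b
  proof -
    have "klinear k C A (%y. f y \<otimes>\<^sub>A b)" using b by (simp add: klinear_def fl AR.l_distr A_smult_l)
    moreover have "bilin k C A K (%c b. pt a c b)" using a by (simp add: bilin_def pt_lin)
    ultimately have b1: "bifam k C C K (%p q x y. pt a x (f y \<otimes>\<^sub>A b))"
      using bifam_bilin[OF gC gC, where g = "%y. f y \<otimes>\<^sub>A b" and f = "%x. x" and B = "%c b. pt a c b"]
        C.id_kl by blast
    show ?thesis unfolding lg_def by (rule sw_map[OF mK lgb[OF fk] mK op_kl(5)[OF a b] bifam_smult[OF gC gC mK b1] c, symmetric])
        (use a b in \<open>simp_all add: C.gcar fl gen_def lact_pt ract_pt ractD lactD K.ksgn_ksgn algebra_simps\<close>)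
  qed
  have tr': "trifam k A C A K ?\<phi>" by (rule T3.trifam_cong[OF tr e]) (auto intro: A.gcar C.gcar)
  have "tl3 A C K ?\<phi> t = tl3 A C K ?\<psi> t" if t: "t \<in> carrier K" for t
  proof (rule K_eqI[OF K.ab _ _ t])
    show "additive K K (tl3 A C K ?\<phi>)" "additive K K (tl3 A C K ?\<psi>)"
      using T3.tl3_klinear[OF mK tr'] T3.tl3_klinear[OF mK tr] by (simp_all add: klinear_KT klinear_additive)
    show "tl3 A C K ?\<phi> (pt a c b) = tl3 A C K ?\<psi> (pt a c b)" if "a \<in> grade A i" "c \<in> grade C j" "b \<in> carrier A" for i j a c b
    proof -
      have "tl3 A C K ?\<phi> (pt a c b) = ?\<phi> i j a c b" "tl3 A C K ?\<psi> (pt a c b) = ?\<psi> i j a c b"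
        using T3.tl3_pp[OF mK tr' that] T3.tl3_pp[OF mK tr that] by (simp_all only: pt_pp)
      thus ?thesis using e[OF A.gcar[OF that(1)] C.gcar[OF that(2)] that(3)] by simp
    qed
  qed
  thus ?thesis unfolding lfam_def ext_def lift3_tl3 by (simp cong: restrict_cong)
qed

lemma lfam_G: "f \<in> GH n ==> lfam n f \<in> KE.BL n" using lfam_ext[of n f] ext_bl[OF KBx lg_deg[of n f]] ext_ext[of K n "lg n f"] by simp

lemma lfam_gen: "f \<in> GH n ==> c \<in> carrier C ==> lfam n f (gen c) = lg n f c" using lfam_ext[of n f] ext_gen[OF KBx lg_kl[of n f]] by simp

lemma BL_eqI:
  assumes "F \<in> KE.BL n" "G \<in> KE.BL n" "!!j c. c \<in> grade C j ==> F (gen c) = G (gen c)"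
  shows "F = G"
proof -
  have FG: "bimod_linear k A K K n F" "bimod_linear k A K K n G" using assms by simp_all
  have "F t = G t" if "t \<in> carrier K" for t by (rule bl_uniq[OF KBx FG]) (use assms(3) that in auto)
  thus ?thesis using assms(1,2) by (auto intro: extensionalityI[of _ "carrier K"])
qed

lemma lfam_addfam: "addfam Htw KE.E lfam" unfolding addfam_def Htw_simps KE.E_simps
proof (intro allI ballI conjI)
  fix n f assume f: "f \<in> GH n"
  show "lfam n f \<in> carrier KE.H" by (rule KE.G_H[OF lfam_G[OF f]])
  fix g assume g: "g \<in> GH n"
  have fg: "f \<oplus>\<^sub>HK.H g \<in> GH n" using HK.G_add[OF f g] by (simp add: HK.H_simps)
  note fl = HK.H_klinear[OF HK.G_H[OF f]] and gl = HK.H_klinear[OF HK.G_H[OF g]] and fgl = HK.H_klinear[OF HK.G_H[OF fg]]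
  show "lfam n (f \<oplus>\<^sub>HK.H g) = lfam n f \<oplus>\<^sub>KE.H lfam n g"
  proof (rule BL_eqI[OF lfam_G[OF fg]])
    show "lfam n f \<oplus>\<^sub>KE.H lfam n g \<in> KE.BL n" using KE.G_add[OF lfam_G[OF f] lfam_G[OF g]] by (simp add: KE.H_simps)
    fix j c assume "c \<in> grade C j"
    hence c: "c \<in> carrier C" by (rule C.gcar)
    have "lg n (f \<oplus>\<^sub>HK.H g) c = lg n f c \<oplus>\<^sub>K lg n g c" unfolding lg_def by (rule sw_add[OF mK lgb[OF fl] lgb[OF gl] c])
        (simp add: HK.H_simps C.gcar gen_lin klinearD[OF fl] klinearD[OF gl] KB.ra K.smult_r_distr)
    thus "lfam n (f \<oplus>\<^sub>HK.H g) (gen c) = (lfam n f \<oplus>\<^sub>KE.H lfam n g) (gen c)"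
      using c by (simp add: lfam_gen[OF fg] lfam_gen[OF f] lfam_gen[OF g] KE.H_simps gen_lin)
  qed
qed

abbreviation "lm \<equiv> l_map k C A \<pi>"

lemma lm_eq: "lm = hsum Htw KE.E lfam" by (simp add: l_map_def Let_def lfam_def[abs_def])

end

sublocale tw \<subseteq> Htw: gspace k "Hom_tw k C A \<pi>" using gs_Htw by (rule gspaceI)

sublocale tw \<subseteq> KEE: dga k "End_bimod k A (twisted_tensor k A C \<pi>)" by (rule dga.intro[OF KE.E_dga])

context tw begin

lemma lm_hom: "f \<in> GH n ==> lm f = lfam n f" unfolding lm_eq by (rule Htw.hsum_hom[OF KEE.A.ab lfam_addfam]) (simp add: Htw_simps)

lemma lm_add: "additive Htw KE.E lm" unfolding lm_eq by (rule Htw.hsum_additive[OF KEE.A.ab lfam_addfam])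

lemma lm_G: "f \<in> GH n ==> lm f \<in> KE.BL n" by (simp only: lm_hom lfam_G)

lemma lm_gen: "f \<in> GH n ==> c \<in> carrier C ==> lm f (gen c) = lg n f c" by (simp only: lm_hom lfam_gen)

text \<open>The counit vanishes outside degree 0, so the sign (-1)^(n|c_1|) is 1 in every surviving
  term, and the counit axiom leaves \<open>f c\<close>.\<close>

lemma aug_lg:
  assumes f: "deg_linear k C A n f" and c: "c \<in> carrier C"
  shows "aug (lg n f c) = f c"
proof -
  note fk = deg_klinear[OF f]
  note fl = klinearD[OF fk]
  interpret KR: gbim2 k A K R by (intro gbim2.intro KBx R_gbim)
  have "aug (lg n f c) = sweedler C A (%_ _ x y. counit C x \<odot>\<^sub>A f y) c" unfolding lg_def
  proof (rule sw_map[OF mK lgb[OF fk] mA aug_kl bifam_form(1)[OF mA fk counit_form] c])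
    fix p q x y assume x: "x \<in> grade C p" and y: "y \<in> grade C q"
    note xc = C.gcar[OF x] and yc = C.gcar[OF y]
    have 1: "aug (ksgn k (n * p) \<odot>\<^sub>K ract K (gen x) (f y)) = ksgn k (n * p) \<odot>\<^sub>A (counit C x \<odot>\<^sub>A f y)"
      using xc yc KR.bl_r[OF aug_bl gen_lin(1)[OF xc] fl(1)[OF yc]] klinearD[OF aug_kl]
      by (simp add: ractD gen_lin fl aug_gen regular_simps A_smult_l counit_cl)
    show "aug (ksgn k (n * p) \<odot>\<^sub>K ract K (gen x) (f y)) = counit C x \<odot>\<^sub>A f y"
    proof (cases "p = 0")
      case True thus ?thesis unfolding 1 using counit_cl xc yc fl by simp
    next
      case False
      hence "counit C x = \<zero>\<^sub>k" using counit_form x by (simp add: deg_form_def)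
      thus ?thesis unfolding 1 using yc fl by simp
    qed
  qed
  also have "... = f c" by (rule sw_counit[OF mA fk c])
  finally show ?thesis .
qed

lemma aug_lm:
  assumes "f \<in> carrier Htw" "c \<in> carrier C"
  shows "aug (lm f (gen c)) = f c" using assms(1)
proof (induction rule: Htw.graded_induct)
  case (hom n f)
  hence "f \<in> GH n" by (simp add: Htw_simps)
  thus ?case using lm_gen[of f n c] assms(2) aug_lg[of n f c] by simp
next
  case (add x y)
  have "lm x \<in> carrier KE.H" "lm y \<in> carrier KE.H" using additiveD(1)[OF lm_add] add by (simp_all add: KE.E_simps)
  hence "lm x (gen c) \<in> carrier K" "lm y (gen c) \<in> carrier K" using KE.E_cl gen_lin(1)[OF assms(2)] by simp_all
  hence "aug (lm (x \<oplus>\<^sub>Htw y) (gen c)) = aug (lm x (gen c)) \<oplus>\<^sub>A aug (lm y (gen c))"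
    unfolding additiveD(2)[OF lm_add add(1,2)] using gen_lin(1)[OF assms(2)] by (simp add: KE.E_simps KE.H_simps klinearD[OF aug_kl])
  moreover have "(x \<oplus>\<^sub>Htw y) c = x c \<oplus>\<^sub>A y c" using assms(2) by (simp add: Htw_simps HK.H_simps)
  ultimately show ?case using add(3,4) by simp
qed

lemma lm_inj:
  assumes "f \<in> carrier Htw" "g \<in> carrier Htw" "lm f = lm g" shows "f = g"
proof (rule HK.H_eqI)
  show "f \<in> carrier HK.H" "g \<in> carrier HK.H" using assms by (simp_all add: Htw_simps)
  show "f c = g c" if "c \<in> carrier C" for c using aug_lm[OF assms(1) that] aug_lm[OF assms(2) that] assms(3) by simp
qed

subsection \<open>Multiplicativity\<close>

text \<open>Because l(f) commutes with the right action, it meets only the generator in each term of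
  l(g); coassociativity then turns the iterated right action into a convolution.\<close>

lemma lg_conv:
  assumes f: "f \<in> GH m" and g: "g \<in> GH n" and c: "c \<in> carrier C"
  shows "lm f (lg n g c) = lg (m + n) (conv k C A n f g) c"
proof -
  have fd: "deg_linear k C A m f" and gd: "deg_linear k C A n g" using f g by auto
  note fk = deg_klinear[OF fd] and gk = deg_klinear[OF gd]
  have lf: "bimod_linear k A K K m (lm f)" using lm_G[OF f] by simp
  note lk = KE.bl_lin[OF lf]
  have ck: "klinear k C A (conv k C A n f g)" "klinear k C A (sweedler C A (cfam n f g))"
    using conv_G[OF f g, of n] deg_klinear sw_klinear[OF mA cfam_bifam[OF fk gk]] by blast+
  have "lm f (lg n g c) = SR K (%p. n * p) (lg m f) g c" unfolding lg_def[of n g] by (rule sw_map[OF mK lgb[OF gk] mK lk bra[OF KBx lg_kl[OF fd] gk] c])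
      (simp add: C.gcar klinearD[OF lk] ractD gen_lin klinearD[OF gk] KE.bl_r[OF lf] lm_gen[OF f])
  also have "... = SR K (%p. (m + n) * p) gen (sweedler C A (cfam n f g)) c" unfolding lg_def by (rule nest_RR[OF fk gk _ c]) (simp add: algebra_simps)
  also have "... = lg (m + n) (conv k C A n f g) c" unfolding lg_def by (rule sw_cong[OF mK lgb[OF ck(1)] c]) (simp add: conv_eq C.gcar)
  finally show ?thesis .
qed

lemma lm_mult_hom:
  assumes f: "f \<in> GH m" and g: "g \<in> GH n"
  shows "lm (conv k C A n f g) = lm f \<otimes>\<^sub>KE.E lm g"
proof (rule BL_eqI[OF lm_G[OF conv_G[OF f g]]])
  show "lm f \<otimes>\<^sub>KE.E lm g \<in> KE.BL (m + n)" unfolding KE.E_simps by (rule KE.E_mult_g[OF lm_G[OF f] lm_G[OF g]])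
  fix j c assume "c \<in> grade C j"
  hence c: "c \<in> carrier C" by (rule C.gcar)
  thus "lm (conv k C A n f g) (gen c) = (lm f \<otimes>\<^sub>KE.E lm g) (gen c)"
    using lm_gen[OF conv_G[OF f g] c] lm_gen[OF g c] lg_conv[OF f g c] gen_lin(1)[OF c] by (simp add: KE.E_simps compose_eq)
qed

lemma lm_mult:
  assumes f: "f \<in> carrier Htw" and g: "g \<in> carrier Htw"
  shows "lm (f \<otimes>\<^sub>Htw g) = lm f \<otimes>\<^sub>KE.E lm g"
proof -
  note la = additiveD[OF lm_add]
  have fH: "f \<in> carrier HK.H" using f by (simp add: Htw_simps)
  have "\<forall>f\<in>carrier Htw. lm (f \<otimes>\<^sub>Htw g) = lm f \<otimes>\<^sub>KE.E lm g" using g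
  proof (induction rule: Htw.graded_induct)
    case (hom n g)
    hence g: "g \<in> GH n" by (simp add: Htw_simps)
    have gH: "g \<in> carrier HK.H" by (rule HK.G_H[OF g])
    hence gc: "g \<in> carrier Htw" by (simp add: Htw_simps)
    have ml: "(x \<oplus>\<^sub>Htw y) \<otimes>\<^sub>Htw g = x \<otimes>\<^sub>Htw g \<oplus>\<^sub>Htw y \<otimes>\<^sub>Htw g" "x \<otimes>\<^sub>Htw g \<in> carrier Htw"
      if "x \<in> carrier Htw" "y \<in> carrier Htw" for x y using additiveD[OF mult_add_left[OF gH]] that by (simp_all add: Htw_simps)
    show ?case
    proof
      fix f assume "f \<in> carrier Htw"
      thus "lm (f \<otimes>\<^sub>Htw g) = lm f \<otimes>\<^sub>KE.E lm g"
      proof (induction rule: Htw.graded_induct)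
        case (hom m f)
        hence f: "f \<in> GH m" by (simp add: Htw_simps)
        thus ?case using lm_mult_hom[OF f g] mult_hom[OF HK.G_H[OF f] g] by simp
      next
        case (add x y)
        have "lm (x \<otimes>\<^sub>Htw g \<oplus>\<^sub>Htw y \<otimes>\<^sub>Htw g) = lm (x \<otimes>\<^sub>Htw g) \<oplus>\<^sub>KE.E lm (y \<otimes>\<^sub>Htw g)"
          by (rule la(2)) (use ml(2) add in blast)+
        thus ?case using gc add by (simp only: ml(1) la KEE.AR.l_distr)
      qed
    qed
  next
    case (add x y)
    have "f \<otimes>\<^sub>Htw (x \<oplus>\<^sub>Htw y) = f \<otimes>\<^sub>Htw x \<oplus>\<^sub>Htw f \<otimes>\<^sub>Htw y" "f \<otimes>\<^sub>Htw x \<in> carrier Htw" "f \<otimes>\<^sub>Htw y \<in> carrier Htw"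
      if "f \<in> carrier Htw" for f using additiveD[OF mult_add_right, of f] that add(1,2) by (simp_all add: Htw_simps)
    thus ?case using add by (simp add: la KEE.AR.r_distr)
  qed
  thus ?thesis using f by blast
qed

lemma one_G: "\<one>\<^sub>Htw \<in> GH 0"
proof -
  have "deg_linear k C A 0 (%c. counit C c \<odot>\<^sub>A \<one>\<^sub>A)" using counit_R unfolding deg_linear_def klinear_def by (simp add: regular_simps)
  thus ?thesis unfolding Htw_simps deg_linear_def klinear_def by (auto simp: C.gcar)
qed

lemma lm_one: "lm \<one>\<^sub>Htw = \<one>\<^sub>KE.E"
proof (rule BL_eqI[OF lm_G[OF one_G]])
  show "\<one>\<^sub>KE.E \<in> KE.BL 0" using KE.E_one by (simp add: KE.E_simps)
  fix j c assume "c \<in> grade C j"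
  hence c: "c \<in> carrier C" by (rule C.gcar)
  have "lg 0 \<one>\<^sub>Htw c = sweedler C K (%_ _ x y. counit C y \<odot>\<^sub>K gen x) c"
    unfolding lg_def by (rule sw_cong[OF mK bifam_form(2)[OF mK gen_kl counit_form] c]) (simp add: C.gcar gen_lin Htw_simps KB.ra KB.ra_one counit_cl)
  also have "... = gen c" by (rule sw_counit[OF mK gen_kl c])
  finally show "lm \<one>\<^sub>Htw (gen c) = \<one>\<^sub>KE.E (gen c)" using c by (simp only: lm_gen[OF one_G c]) (simp add: KE.E_simps gen_lin)
qed

subsection \<open>Compatibility with the differentials\<close>

text \<open>The terms with \<open>diff C\<close> on the left factor, and those with \<pi> acting
  from the left, occur in both composites and cancel. What remains is \<open>diff A\<close> after f,
  f after \<open>diff C\<close> and the two convolutions with \<pi>: the twisted differential of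
  f.\<close>

lemma lg_diff:
  assumes f: "f \<in> GH n" and c: "c \<in> carrier C"
  shows "diff K (lg n f c) \<ominus>\<^sub>K ksgn k n \<odot>\<^sub>K lm f (dgen c) = lg (n + 1) (dtw n f) c"
proof -
  have fd: "deg_linear k C A n f" using f by simp
  note fk = deg_klinear[OF fd] and fl = deg_linearD[OF fd]
  have lf: "bimod_linear k A K K n (lm f)" using lm_G[OF f] by simp
  let ?A1 = "SR K (%p. n * p) (%x. gen (diff C x)) f c" and ?A2 = "SR K (%p. n * p) gL f c" and ?A3 = "SR K (%p. n * p) gR f c"
  let ?A4 = "SR K (%p. (n + 1) * p) gen (%y. diff A (f y)) c"
  let ?B3 = "SR K (%p. p) (lg n f) \<pi> c" and ?B4 = "SR K (%p. (n + 1) * p) gen (%y. f (diff C y)) c"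
  note ck = sw_klinear[OF mA cfam_bifam[OF pi_kl fk, of n]] sw_klinear[OF mA cfam_bifam[OF fk pi_kl, of 1]]
  note kl = klinear_compose[OF d_kl gen_kl] klinear_compose[OF d_kl fk] klinear_compose[OF fk dA_kl] gen_kl pi_kl gL_kl gR_kl fk lg_kl[OF fd] ck
  note b = bla[OF KBx] bra[OF KBx]
  have cl: "?A1 \<in> carrier K" "?A2 \<in> carrier K" "?A3 \<in> carrier K" "?A4 \<in> carrier K" "?B3 \<in> carrier K" "?B4 \<in> carrier K"
    by (intro sw_closed[OF mK _ c] b kl)+
  have "diff K (lg n f c) = ?A1 \<oplus>\<^sub>K (?A2 \<oplus>\<^sub>K (SR K (%p. n * p + 1) gR f c \<oplus>\<^sub>K ?A4))"
    unfolding sw_lin[OF mK lgb[OF fk] mK dK_kl c, folded lg_def]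
  proof (intro sw_add4[OF mK _ _ _ _ c] b kl)
    fix p q x y assume x: "x \<in> grade C p" and y: "y \<in> grade C q"
    show "diff K (ksgn k (n * p) \<odot>\<^sub>K ract K (gen x) (f y)) = ksgn k (n * p) \<odot>\<^sub>K ract K (gen (diff C x)) (f y) \<oplus>\<^sub>K (ksgn k (n * p) \<odot>\<^sub>K ract K (gL x) (f y)
     \<oplus>\<^sub>K (ksgn k (n * p + 1) \<odot>\<^sub>K ract K (gR x) (f y) \<oplus>\<^sub>K ksgn k ((n + 1) * p) \<odot>\<^sub>K ract K (gen x) (diff A (f y))))"
      using C.gcar[OF x] C.gcar[OF y]
      by (simp add: dK_lin dK_leib_r[OF gen_g[OF x]] gen_lin dK_gen dgen_sgn gL_lin gR_lin d_lin dA_lin fl ractD K.smult_r_distr K.ksgn_ksgn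
         K.M.a_assoc algebra_simps)
  qed
  also have "SR K (%p. n * p + 1) gR f c = ksgn k 1 \<odot>\<^sub>K ?A3" by (rule SR_shift[OF gR_kl fk c]) simp
  finally have P1: "diff K (lg n f c) = ?A1 \<oplus>\<^sub>K (?A2 \<oplus>\<^sub>K (ksgn k 1 \<odot>\<^sub>K ?A3 \<oplus>\<^sub>K ?A4))" .
  have "lg n f (diff C c) = SR K (%p. n + n * p) (%x. gen (diff C x)) f c \<oplus>\<^sub>K ?B4"
    unfolding lg_def sw_diff[OF mK lgb[OF fk] c] by (intro sw_add[OF mK _ _ c] b kl) (simp add: C.gcar gen_lin fl d_lin ractD K.ksgn_ksgn algebra_simps)
  also have "SR K (%p. n + n * p) (%x. gen (diff C x)) f c = ksgn k n \<odot>\<^sub>K ?A1" by (rule SR_shift[OF kl(1) fk c]) simp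
  finally have P2: "lg n f (diff C c) = ksgn k n \<odot>\<^sub>K ?A1 \<oplus>\<^sub>K ?B4" .
  have "SL K (%p. n * (p + 1)) \<pi> (%y. lm f (gen y)) c = SL K (%p. n * (p + 1)) \<pi> (lg n f) c"
    by (intro sw_cong[OF mK _ c] b kl) (simp add: lm_gen[OF f] C.gcar)
  also have "... = SR K (%p. n + n * p) gL f c" unfolding lg_def by (rule nest_LR[OF fk _ c]) (simp add: algebra_simps)
  also have "... = ksgn k n \<odot>\<^sub>K ?A2" by (rule SR_shift[OF gL_kl fk c]) simp
  finally have P3: "SL K (%p. n * (p + 1)) \<pi> (%y. lm f (gen y)) c = ksgn k n \<odot>\<^sub>K ?A2" .
  have P4: "SR K (%p. p) (%x. lm f (gen x)) \<pi> c = ?B3" by (intro sw_cong[OF mK _ c] b kl) (simp add: lm_gen[OF f] C.gcar)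
  have P5: "lm f (dgen c) = (ksgn k n \<odot>\<^sub>K ?A1 \<oplus>\<^sub>K ?B4) \<oplus>\<^sub>K (ksgn k n \<odot>\<^sub>K ?A2 \<ominus>\<^sub>K ?B3)"
    unfolding bl_dgen[OF KBx lf c] P3 P4 lm_gen[OF f d_lin(1)[OF c]] P2 K.M.a_assoc[symmetric] a_minus_def using cl by (simp add: K.M.a_assoc)
  have "lg (n + 1) (dtw n f) c = ?A4 \<oplus>\<^sub>K (SR K (%p. (n + 1) + (n + 1) * p) gen (%y. f (diff C y)) c \<oplus>\<^sub>K
      (SR K (%p. 1 + (n + 1) * p) gen (sweedler C A (cfam n \<pi> f)) c \<oplus>\<^sub>K SR K (%p. n + (n + 1) * p) gen (sweedler C A (cfam 1 f \<pi>)) c))"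
    unfolding lg_def
  proof (intro sw_add4[OF mK _ _ _ _ c] b kl)
    fix p q x y assume "x \<in> grade C p" "y \<in> grade C q"
    hence x: "x \<in> carrier C" and y: "y \<in> carrier C" by (auto intro: C.gcar)
    note kk = klinearD(1)[OF ck(1) y] klinearD(1)[OF ck(2) y]
    show "ksgn k ((n + 1) * p) \<odot>\<^sub>K ract K (gen x) (dtw n f y) = ksgn k ((n + 1) * p) \<odot>\<^sub>K ract K (gen x) (diff A (f y)) \<oplus>\<^sub>K
     (ksgn k ((n + 1) + (n + 1) * p) \<odot>\<^sub>K ract K (gen x) (f (diff C y)) \<oplus>\<^sub>K
     (ksgn k (1 + (n + 1) * p) \<odot>\<^sub>K ract K (gen x) (sweedler C A (cfam n \<pi> f) y) \<oplus>\<^sub>K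
      ksgn k (n + (n + 1) * p) \<odot>\<^sub>K ract K (gen x) (sweedler C A (cfam 1 f \<pi>) y)))" unfolding dtw_apply[OF f y] using x y kk
      by (simp only: KB.ra gen_lin A.M.a_closed A.smult_closed A.ksgn_cl fl d_lin dA_lin K.smult_r_distr K.smult_closed K.M.a_closed K.ksgn_ksgn K.ksgn_cl add.commute[of "(n + 1) * p"])
  qed
  also have "SR K (%p. (n + 1) + (n + 1) * p) gen (%y. f (diff C y)) c = ksgn k (n + 1) \<odot>\<^sub>K ?B4" by (rule SR_shift[OF gen_kl kl(2) c]) simp
  \<comment> \<open>The convolution of \<pi> with f corresponds to the right twisting term
    \<open>gR\<close> followed by the right action of f.\<close>
  also have "SR K (%p. 1 + (n + 1) * p) gen (sweedler C A (cfam n \<pi> f)) c = SR K (%p. n * p + 1) gR f c" unfolding gR_def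
    by (rule nest_RR[OF pi_kl fk _ c, symmetric]) (simp add: algebra_simps, blast?)
  also have "... = ksgn k 1 \<odot>\<^sub>K ?A3" by (rule SR_shift[OF gR_kl fk c]) simp
  also have "SR K (%p. n + (n + 1) * p) gen (sweedler C A (cfam 1 f \<pi>)) c = SR K (%p. n + p) (lg n f) \<pi> c" unfolding lg_def
    by (rule nest_RR[OF fk pi_kl _ c, symmetric]) (simp add: algebra_simps, blast?)
  also have "... = ksgn k n \<odot>\<^sub>K ?B3" by (rule SR_shift[OF kl(9) pi_kl c]) simp
  finally have R: "lg (n + 1) (dtw n f) c = ?A4 \<oplus>\<^sub>K (ksgn k (n + 1) \<odot>\<^sub>K ?B4 \<oplus>\<^sub>K (ksgn k 1 \<odot>\<^sub>K ?A3 \<oplus>\<^sub>K ksgn k n \<odot>\<^sub>K ?B3))" .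
  have e: "ksgn k (1 + 2 * n) = ksgn k 1" "ksgn k (n + 2) = ksgn k n" by (rule ksgn_cong, simp)+
  have "diff K (lg n f c) \<ominus>\<^sub>K ksgn k n \<odot>\<^sub>K lm f (dgen c)
      = (?A1 \<oplus>\<^sub>K \<ominus>\<^sub>K ?A1) \<oplus>\<^sub>K (?A2 \<oplus>\<^sub>K \<ominus>\<^sub>K ?A2) \<oplus>\<^sub>K (?A4 \<oplus>\<^sub>K (ksgn k (n + 1) \<odot>\<^sub>K ?B4 \<oplus>\<^sub>K (ksgn k 1 \<odot>\<^sub>K ?A3 \<oplus>\<^sub>K ksgn k n \<odot>\<^sub>K ?B3)))"
    unfolding P1 P5 using cl by (simp add: a_minus_def K.minus_as_ksgn K.smult_r_distr K.ksgn_ksgn K.M.a_ac) (simp add: e K.M.a_ac add_ac)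
  thus ?thesis unfolding R using cl by (simp add: K.M.r_neg)
qed

lemma lm_diff_hom: "f \<in> GH n ==> lm (dtw n f) = diff KE.E (lm f)"
proof (rule BL_eqI[OF lm_G[OF dtw_G]])
  assume f: "f \<in> GH n"
  thus "f \<in> GH n" .
  show "diff KE.E (lm f) \<in> KE.BL (n + 1)" using KE.HC_diff_G[OF lm_G[OF f]] by (simp add: KE.E_simps)
  fix j c assume "c \<in> grade C j"
  hence c: "c \<in> carrier C" by (rule C.gcar)
  show "lm (dtw n f) (gen c) = diff KE.E (lm f) (gen c)"
    unfolding KE.E_simps KE.HC_diff[OF lm_G[OF f] gen_lin(1)[OF c]] dK_gen[OF c] lm_gen[OF f c] lg_diff[OF f c]
      lm_gen[OF dtw_G[OF f] c] ..
qed

lemma diff_cl: "f \<in> carrier Htw ==> diff Htw f \<in> carrier Htw" using additiveD(1)[OF diff_add] by (simp add: Htw_simps)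

lemma lm_diff: "f \<in> carrier Htw ==> lm (diff Htw f) = diff KE.E (lm f)"
proof (induction rule: Htw.graded_induct)
  case (hom n f)
  hence "f \<in> GH n" by (simp add: Htw_simps)
  thus ?case by (simp only: diff_hom lm_diff_hom)
next
  case (add x y)
  have "diff Htw (x \<oplus>\<^sub>Htw y) = diff Htw x \<oplus>\<^sub>Htw diff Htw y" using additiveD(2)[OF diff_add] add(1,2) by (simp add: Htw_simps)
  thus ?case using add additiveD[OF lm_add] klinearD[OF KEE.A_dg[unfolded dg_space_def, THEN conjunct2, THEN conjunct1, THEN deg_klinear]]
    by (simp add: diff_cl)
qed

lemma lm_smult: "f \<in> carrier Htw ==> r \<in> carrier k ==> lm (r \<odot>\<^sub>Htw f) = r \<odot>\<^sub>KE.E lm f" unfolding lm_eq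
proof (rule Htw.hsum_smult[OF KEE.A.module_axioms lfam_addfam], assumption+)
  fix n f assume r: "r \<in> carrier k" and "f \<in> grade Htw n"
  hence f: "f \<in> GH n" by (simp add: Htw_simps)
  have rf: "r \<odot>\<^sub>HK.H f \<in> GH n" using HK.G_smult[OF r f] by (simp add: HK.H_simps)
  note fl = HK.H_klinear[OF HK.G_H[OF f]] and rfl = HK.H_klinear[OF HK.G_H[OF rf]]
  show "lfam n (r \<odot>\<^sub>Htw f) = r \<odot>\<^sub>KE.E lfam n f" unfolding Htw_simps KE.E_simps
  proof (rule BL_eqI[OF lfam_G[OF rf]])
    show "r \<odot>\<^sub>KE.H lfam n f \<in> KE.BL n" using KE.G_smult[OF r lfam_G[OF f]] by (simp add: KE.H_simps)
    fix j c assume "c \<in> grade C j"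
    hence c: "c \<in> carrier C" by (rule C.gcar)
    have "lg n (r \<odot>\<^sub>HK.H f) c = r \<odot>\<^sub>K lg n f c" unfolding lg_def by (rule sw_smult[OF mK lgb[OF fl] r c])
        (simp add: HK.H_simps C.gcar gen_lin klinearD[OF fl] KB.ra r K.smult_comm)
    thus "lfam n (r \<odot>\<^sub>HK.H f) (gen c) = (r \<odot>\<^sub>KE.H lfam n f) (gen c)"
      using c by (simp add: lfam_gen[OF rf] lfam_gen[OF f] KE.H_simps gen_lin)
  qed
qed

lemma lm_cl: "f \<in> carrier Htw ==> lm f \<in> carrier KE.E" using additiveD(1)[OF lm_add] .

lemma mult_cl: "f \<in> carrier Htw ==> g \<in> carrier Htw ==> f \<otimes>\<^sub>Htw g \<in> carrier Htw"
  using additiveD(1)[OF mult_add_right] by (simp add: Htw_simps)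

text \<open>The axioms of a dg algebra are pulled back along the injection \<open>l\<close>.\<close>

lemma Htw_ring: "ring Htw"
proof (rule ringI)
  show "abelian_group Htw" by (rule Htw.ab)
  have oc: "\<one>\<^sub>Htw \<in> carrier Htw" using HK.G_H[OF one_G] by (simp add: Htw_simps)
  note L = lm_mult lm_one lm_cl mult_cl oc
  show "monoid Htw" by (rule monoidI; (rule lm_inj)?) (simp_all add: L KEE.AR.m_assoc)
  note La = additiveD(2)[OF lm_add]
  show "(x \<oplus>\<^sub>Htw y) \<otimes>\<^sub>Htw z = x \<otimes>\<^sub>Htw z \<oplus>\<^sub>Htw y \<otimes>\<^sub>Htw z"
    "z \<otimes>\<^sub>Htw (x \<oplus>\<^sub>Htw y) = z \<otimes>\<^sub>Htw x \<oplus>\<^sub>Htw z \<otimes>\<^sub>Htw y"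
    if "x \<in> carrier Htw" "y \<in> carrier Htw" "z \<in> carrier Htw" for x y z
    using that by (rule_tac [!] lm_inj) (simp_all add: L La KEE.AR.l_distr KEE.AR.r_distr)
qed

lemma Htw_dga: "dg_algebra k Htw"
proof -
  interpret R: ring Htw by (rule Htw_ring)
  note L = lm_mult lm_one lm_cl mult_cl lm_smult lm_diff diff_cl
  note La = additiveD(2)[OF lm_add]
  have z: "lm \<zero>\<^sub>Htw = \<zero>\<^sub>KE.E" by (rule additive_zero[OF Htw.ab KEE.A.ab lm_add])
  have lg: "lm x \<in> grade KE.E i" if "x \<in> grade Htw i" for x i using lm_G that unfolding Htw_simps KE.E_simps KE.H_simps .
  have "graded_algebra k Htw" unfolding graded_algebra_def
  proof (intro conjI allI ballI)
    show "graded_space k Htw" by (rule gs_Htw)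
    show "ring Htw" by (rule Htw_ring)
    show "\<one>\<^sub>Htw \<in> grade Htw 0" using one_G by (simp only: Htw_simps)
    show "x \<otimes>\<^sub>Htw y \<in> grade Htw (i + j)" if "x \<in> grade Htw i" "y \<in> grade Htw j" for i j x y
    proof -
      have x: "x \<in> GH i" and y: "y \<in> GH j" using that by (simp_all only: Htw_simps)
      show ?thesis unfolding mult_hom[OF HK.G_H[OF x] y] Htw_simps(5) by (rule conv_G[OF x y])
    qed
    fix r x y assume "r \<in> carrier k" "x \<in> carrier Htw" "y \<in> carrier Htw"
    thus "(r \<odot>\<^sub>Htw x) \<otimes>\<^sub>Htw y = r \<odot>\<^sub>Htw (x \<otimes>\<^sub>Htw y)" "x \<otimes>\<^sub>Htw (r \<odot>\<^sub>Htw y) = r \<odot>\<^sub>Htw (x \<otimes>\<^sub>Htw y)"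
      by (rule_tac [!] lm_inj) (simp_all add: L KEE.A_smult_l KEE.A_smult_r)
  qed
  moreover have "dg_space k Htw" unfolding dg_space_def deg_linear_def
  proof (intro conjI allI ballI subsetI)
    show "graded_space k Htw" by (rule gs_Htw)
    show "diff Htw (diff Htw v) = \<zero>\<^sub>Htw" if "v \<in> carrier Htw" for v using that by (intro lm_inj) (simp_all add: L z KEE.ddA)
    show "klinear k Htw Htw (diff Htw)" unfolding klinear_def
    proof (intro conjI ballI Pi_I)
      fix x assume x: "x \<in> carrier Htw"
      show "diff Htw x \<in> carrier Htw" using x by (rule diff_cl)
      show "diff Htw (x \<oplus>\<^sub>Htw y) = diff Htw x \<oplus>\<^sub>Htw diff Htw y" if "y \<in> carrier Htw" for y
        using x that by (intro lm_inj) (simp_all add: L La KEE.dA_lin)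
      show "diff Htw (r \<odot>\<^sub>Htw x) = r \<odot>\<^sub>Htw diff Htw x" if "r \<in> carrier k" for r
        using x that by (intro lm_inj) (simp_all add: L KEE.dA_lin)
    qed
    fix i f assume "f \<in> diff Htw ` grade Htw i"
    then obtain g where g: "g \<in> GH i" "f = diff Htw g" unfolding Htw_simps by blast
    show "f \<in> grade Htw (i + 1)" unfolding g(2) diff_hom[OF g(1)] Htw_simps(5) by (rule dtw_G[OF g(1)])
  qed
  moreover have "diff Htw (x \<otimes>\<^sub>Htw y) = diff Htw x \<otimes>\<^sub>Htw y \<oplus>\<^sub>Htw ksgn k i \<odot>\<^sub>Htw (x \<otimes>\<^sub>Htw diff Htw y)"
    if "x \<in> grade Htw i" "y \<in> carrier Htw" for i x y using that Htw.gcar[OF that(1)] KEE.leibA[OF lg[OF that(1)] lm_cl[OF that(2)]]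
    by (intro lm_inj) (simp_all add: L La)
  ultimately show ?thesis unfolding dg_algebra_def by blast
qed

lemma lm_dga_hom: "dg_algebra_hom k Htw KE.E lm" unfolding dg_algebra_hom_def chain_map_def deg_linear_def
proof (intro conjI allI ballI)
  show "dg_algebra k Htw" by (rule Htw_dga)
  show "dg_algebra k KE.E" by (rule KE.E_dga)
  show "lm \<in> ring_hom Htw KE.E" by (rule ring_hom_memI) (simp_all add: lm_cl lm_mult lm_one additiveD(2)[OF lm_add])
  show "klinear k Htw KE.E lm" unfolding klinear_def by (simp add: Pi_iff lm_cl lm_smult additiveD(2)[OF lm_add])
  show "lm ` grade Htw i \<subseteq> grade KE.E (i + 0)" for i unfolding Htw_simps KE.E_simps KE.H_simps add_0_right by (intro image_subsetI lm_G)
qed (rule lm_diff)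

end

section \<open>Linear algebra over a field\<close>

text \<open>The field as a graded space in degree 0, so that linear forms become instances of
  \<open>klinear\<close>.\<close>

definition base :: "'k ring => ('k, 'k) dgspace" where
  "base k = \<lparr>carrier = carrier k, mult = mult k, one = \<one>\<^sub>k, zero = \<zero>\<^sub>k, add = add k, smult = mult k,
     grade = (%i. if i = 0 then carrier k else {\<zero>\<^sub>k}), diff = (%_. \<zero>\<^sub>k)\<rparr>"

lemma base_simps [simp]:
  "carrier (base k) = carrier k" "\<zero>\<^bsub>base k\<^esub> = \<zero>\<^sub>k" "add (base k) = add k" "smult (base k) = mult k" by (simp_all add: base_def)

abbreviation form :: "'k ring => ('k, 'v, 'z) dgspace_scheme => ('v => 'k) => bool" where
  "form k V \<equiv> klinear k V (base k)"

lemma base_module: "cring k ==> module k (base k)"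
proof -
  assume "cring k" then interpret cring k .
  show ?thesis by (intro moduleI abelian_groupI) (auto simp: cring_axioms l_distr r_distr a_ac m_ac intro: bexI[of _ "\<ominus>\<^sub>k _"] l_neg)
qed

definition addl :: "('k, 'v, 'z) module_scheme => 'k ring => 'v => 'v set => 'v set" where
  "addl V k x U = {r \<odot>\<^sub>V x \<oplus>\<^sub>V u |r u. r \<in> carrier k & u \<in> U}"

abbreviation lspan :: "('k, 'v, 'z) module_scheme => 'k ring => 'v list => 'v set" where
  "lspan V k xs \<equiv> foldr (addl V k) xs {\<zero>\<^sub>V}"

section \<open>Subspaces, complements and graded sections over a field\<close>

context gspace begin

lemma subm_minus: "subm S ==> x \<in> S ==> y \<in> S ==> x \<ominus>\<^sub>V y \<in> S" by (simp add: a_minus_def subm_add subm_uminus)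

lemma subm_inter: "subm S ==> subm T ==> subm (S \<inter> T)" by (rule submI) (auto intro: subm_car subm_add subm_smult subm_zero)

lemma subm_trivial: "subm {\<zero>\<^sub>V}" by (rule submI) auto

lemma subm_carrier: "subm (carrier V)" by (rule submI) auto

lemma subm_vimage:
  assumes "klinear k V W f" "gspace k W" "submodule S k W" shows "subm {v \<in> carrier V. f v \<in> S}"
proof -
  interpret W: gspace k W by fact
  have "f \<zero>\<^sub>V = \<zero>\<^sub>W" by (rule additive_zero[OF ab W.ab klinear_additive[OF assms(1)]])
  thus ?thesis by (intro submI) (auto simp: klinearD[OF assms(1)] W.subm_add[OF assms(3)] W.subm_smult[OF assms(3)] W.subm_zero[OF assms(3)])
qed

lemma add_sub_cancel: "x \<in> carrier V ==> u \<in> carrier V ==> (x \<oplus>\<^sub>V u) \<ominus>\<^sub>V x = u"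
  by (simp add: a_minus_def M.a_comm[of x u] M.a_assoc M.r_neg)

lemma sub_sub_cancel: "v \<in> carrier V ==> x \<in> carrier V ==> y \<in> carrier V ==> (v \<ominus>\<^sub>V x) \<ominus>\<^sub>V (v \<ominus>\<^sub>V y) = y \<ominus>\<^sub>V x"
proof -
  assume c: "v \<in> carrier V" "x \<in> carrier V" "y \<in> carrier V"
  hence "v \<ominus>\<^sub>V x = (v \<ominus>\<^sub>V y) \<oplus>\<^sub>V (y \<ominus>\<^sub>V x)" by (simp add: a_minus_def M.a_assoc M.r_neg1)
  thus ?thesis using add_sub_cancel[of "v \<ominus>\<^sub>V y" "y \<ominus>\<^sub>V x"] c by simp
qed

lemma addlI: "r \<in> carrier k ==> u \<in> U ==> r \<odot>\<^sub>V x \<oplus>\<^sub>V u \<in> addl V k x U" by (auto simp: addl_def)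

lemma addlE: "v \<in> addl V k x U ==> (!!r u. r \<in> carrier k ==> u \<in> U ==> v = r \<odot>\<^sub>V x \<oplus>\<^sub>V u ==> P) ==> P"
  by (auto simp: addl_def)

lemma addl_sub: "subm U ==> x \<in> carrier V ==> U \<subseteq> addl V k x U" using addlI[of "\<zero>\<^sub>k" _ U x] subm_car[of U] by fastforce

lemma addl_self: "subm U ==> x \<in> carrier V ==> x \<in> addl V k x U" using addlI[of "\<one>\<^sub>k" "\<zero>\<^sub>V" U x] subm_zero[of U] by simp

lemma addl_subm: "subm U ==> x \<in> carrier V ==> subm (addl V k x U)"
proof (rule submI)
  assume U: "subm U" and x: "x \<in> carrier V"
  note c = subm_car[OF U]
  show "addl V k x U \<subseteq> carrier V" using x c by (auto simp: addl_def)
  show "\<zero>\<^sub>V \<in> addl V k x U" using addl_sub[OF U x] subm_zero[OF U] by blast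
  fix v w r assume "v \<in> addl V k x U"
  then obtain a u where u: "a \<in> carrier k" "u \<in> U" "v = a \<odot>\<^sub>V x \<oplus>\<^sub>V u" by (auto simp: addl_def)
  thus "r \<odot>\<^sub>V v \<in> addl V k x U" if "r \<in> carrier k"
    using addlI[of "r \<otimes>\<^sub>k a" "r \<odot>\<^sub>V u" U x] that x c subm_smult[OF U] by (simp add: smult_r_distr smult_assoc1)
  assume "w \<in> addl V k x U"
  then obtain b t where t: "b \<in> carrier k" "t \<in> U" "w = b \<odot>\<^sub>V x \<oplus>\<^sub>V t" by (auto simp: addl_def)
  show "v \<oplus>\<^sub>V w \<in> addl V k x U"
    using addlI[of "a \<oplus>\<^sub>k b" "u \<oplus>\<^sub>V t" U x] u t x c subm_add[OF U u(2) t(2)] by (simp add: smult_l_distr M.a_ac)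
qed

lemma addl_least: "subm T ==> x \<in> T ==> U \<subseteq> T ==> addl V k x U \<subseteq> T" by (auto simp: addl_def intro!: subm_add subm_smult)

lemma foldr_addl_subm: "subm U ==> set xs \<subseteq> carrier V ==> subm (foldr (addl V k) xs U)" by (induction xs) (auto intro: addl_subm)

lemma foldr_addl_sub: "subm U ==> set xs \<subseteq> carrier V ==> U \<subseteq> foldr (addl V k) xs U & set xs \<subseteq> foldr (addl V k) xs U"
proof (induction xs)
  case (Cons x xs)
  thus ?case using addl_sub[OF foldr_addl_subm, of U xs x] addl_self[OF foldr_addl_subm, of U xs x] by auto
qed simp

lemma lspan_least: "subm T ==> set xs \<subseteq> T ==> lspan V k xs \<subseteq> T"
proof (induction xs)
  case (Cons x xs)
  thus ?case using addl_least[of T x "lspan V k xs"] by simp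
qed (simp add: subm_zero)

lemmas lspan_subm = foldr_addl_subm[OF subm_trivial]
lemmas lspan_sub = foldr_addl_sub[OF subm_trivial, THEN conjunct2]

text \<open>In y = r x + u the coefficient r is nonzero because y is not in U; dividing by r solves
  for x.\<close>

lemma addl_exchange:
  assumes "field k" "subm U" "x \<in> carrier V" "y \<in> addl V k x U" "y \<notin> U"
  shows "x \<in> addl V k y U"
proof -
  interpret k: field k by fact
  obtain r u where u: "r \<in> carrier k" "u \<in> U" "y = r \<odot>\<^sub>V x \<oplus>\<^sub>V u" using assms(4) by (auto simp: addl_def)
  note uc = subm_car[OF assms(2) u(2)]
  have "r ~= \<zero>\<^sub>k" using u uc assms(3,5) by auto
  hence r: "r \<in> Units k" using u(1) k.field_Units by simp
  define s where "s = inv\<^bsub>k\<^esub> r"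
  have s: "s \<in> carrier k" "s \<otimes>\<^sub>k r = \<one>\<^sub>k" using r by (simp_all add: s_def)
  have "s \<odot>\<^sub>V y \<oplus>\<^sub>V (\<ominus>\<^sub>V (s \<odot>\<^sub>V u)) = x"
    using u s uc assms(3) by (simp add: smult_r_distr smult_assoc1[symmetric] M.a_assoc M.r_neg)
  thus ?thesis using addlI[OF s(1), of "\<ominus>\<^sub>V (s \<odot>\<^sub>V u)" U y] subm_uminus[OF assms(2)] subm_smult[OF assms(2) s(1) u(2)] by simp
qed

text \<open>Zorn's lemma for subspaces with operators. With the identity and one forbidden vector it
  yields separating forms; with the projections \<open>hcomp\<close> and the nonzero kernel vectors
  it yields graded complements.\<close>

lemma max_subm:
  assumes "subm U0" "!!i. h i ` U0 \<subseteq> U0" "U0 \<inter> B = {}"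
  obtains U where "subm U" "U0 \<subseteq> U" "!!i. h i ` U \<subseteq> U" "U \<inter> B = {}"
    "!!T. subm T ==> U \<subseteq> T ==> (!!i. h i ` T \<subseteq> T) ==> T \<inter> B = {} ==> T = U"
proof -
  let ?P = "%U. subm U & U0 \<subseteq> U & (\<forall>i. h i ` U \<subseteq> U) & U \<inter> B = {}"
  have "\<exists>M\<in>Collect ?P. \<forall>X\<in>Collect ?P. M \<subseteq> X --> X = M"
  proof (rule subset_Zorn_nonempty)
    have "U0 \<in> Collect ?P" using assms by (intro CollectI conjI allI) simp_all
    thus "Collect ?P ~= {}" by (metis empty_iff)
    fix \<C> assume ne: "\<C> ~= {}" and ch: "subset.chain (Collect ?P) \<C>"
    have P: "?P U" if "U \<in> \<C>" for U using ch that by (auto simp: subset_chain_def)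
    note sm = P[THEN conjunct1]
    have tot: "U \<subseteq> U' \<or> U' \<subseteq> U" if "U \<in> \<C>" "U' \<in> \<C>" for U U' using ch that by (auto simp: subset_chain_def)
    have "subm (\<Union>\<C>)"
    proof (rule submI)
      show "\<Union>\<C> \<subseteq> carrier V" using sm subm_car by blast
      show "\<zero>\<^sub>V \<in> \<Union>\<C>" using sm subm_zero ne by blast
      show "r \<odot>\<^sub>V x \<in> \<Union>\<C>" if "r \<in> carrier k" "x \<in> \<Union>\<C>" for r x using sm that subm_smult by blast
      show "x \<oplus>\<^sub>V y \<in> \<Union>\<C>" if xy: "x \<in> \<Union>\<C>" "y \<in> \<Union>\<C>" for x y
      proof -
        obtain U U' where U: "U \<in> \<C>" "x \<in> U" "U' \<in> \<C>" "y \<in> U'" using xy by blast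
        hence "\<exists>U\<in>\<C>. x \<in> U & y \<in> U" using tot[of U U'] by blast
        thus ?thesis using sm subm_add by blast
      qed
    qed
    moreover have "U0 \<subseteq> \<Union>\<C>" "\<Union>\<C> \<inter> B = {}" using P ne by (blast dest: P)+
    moreover have "h i ` \<Union>\<C> \<subseteq> \<Union>\<C>" for i
    proof -
      have "h i ` U \<subseteq> U" if "U \<in> \<C>" for U using P[OF that] by simp
      thus ?thesis by blast
    qed
    ultimately show "\<Union>\<C> \<in> Collect ?P" unfolding mem_Collect_eq by (intro conjI allI)
  qed
  then obtain U where U: "U \<in> Collect ?P" and m: "\<forall>X\<in>Collect ?P. U \<subseteq> X --> X = U" by (rule bexE)
  show thesis
  proof (rule that)
    fix T assume T: "subm T" "U \<subseteq> T" "!!i. h i ` T \<subseteq> T" "T \<inter> B = {}"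
    have "U0 \<subseteq> U" using U by simp
    hence U0: "U0 \<subseteq> T" using T(2) by (rule subset_trans)
    have "T \<in> Collect ?P" by (intro CollectI conjI allI T U0)
    thus "T = U" by (rule m[THEN bspec, THEN mp, OF _ T(2)])
  qed (use U in simp_all)
qed

text \<open>A maximal subspace U above S that avoids x is a complement of the line of x, and the
  coordinate along x is the required form.\<close>

lemma form_exists:
  assumes "field k" "subm S" "x \<in> carrier V" "x \<notin> S"
  obtains f where "form k V f" "f x = \<one>\<^sub>k" "!!s. s \<in> S ==> f s = \<zero>\<^sub>k"
proof -
  interpret k: field k by fact
  obtain U where U: "subm U" "S \<subseteq> U" "U \<inter> {x} = {}"
    and mx: "!!T. subm T ==> U \<subseteq> T ==> (!!i :: int. (%x. x) ` T \<subseteq> T) ==> T \<inter> {x} = {} ==> T = U"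
    by (rule max_subm[of S "%(_ :: int) x. x" "{x}"]) (use assms(2,4) in auto)
  hence xU: "x \<notin> U" and max: "!!T. subm T ==> U \<subseteq> T ==> x \<notin> T ==> T = U" by auto
  note Uc = subm_car[OF U(1)]
  have all: "\<exists>r\<in>carrier k. v \<ominus>\<^sub>V r \<odot>\<^sub>V x \<in> U" if v: "v \<in> carrier V" for v
  proof -
    have "v \<in> addl V k x U"
    proof (cases "v \<in> U")
      case True thus ?thesis using addl_sub[OF U(1) assms(3)] by blast
    next
      case False
      \<comment> \<open>Maximality puts x into the span of v and U; exchange turns this into v lying
        in the span of x and U.\<close>
      hence "x \<in> addl V k v U" using max[OF addl_subm[OF U(1) v]] addl_sub[OF U(1) v] addl_self[OF U(1) v] by blast
      thus ?thesis using addl_exchange[OF assms(1) U(1) v _ xU] by blast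
    qed
    then obtain r u where "r \<in> carrier k" "u \<in> U" "v = r \<odot>\<^sub>V x \<oplus>\<^sub>V u" by (auto simp: addl_def)
    hence "r \<in> carrier k" "v \<ominus>\<^sub>V r \<odot>\<^sub>V x = u" using Uc assms(3) by (simp_all add: add_sub_cancel)
    thus ?thesis using \<open>u \<in> U\<close> by blast
  qed
  have uniq: "r = s" if "r \<in> carrier k" "s \<in> carrier k" "v \<in> carrier V" "v \<ominus>\<^sub>V r \<odot>\<^sub>V x \<in> U" "v \<ominus>\<^sub>V s \<odot>\<^sub>V x \<in> U" for v r s
  proof (rule ccontr)
    assume "r ~= s"
    have "(r \<ominus>\<^sub>k s) \<oplus>\<^sub>k s = r" using that by (simp add: a_minus_def R.a_assoc R.l_neg)
    hence "r \<ominus>\<^sub>k s ~= \<zero>\<^sub>k" using \<open>r ~= s\<close> that by (metis R.l_zero)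
    hence n: "r \<ominus>\<^sub>k s \<in> Units k" using that by (simp add: k.field_Units)
    have "(v \<ominus>\<^sub>V s \<odot>\<^sub>V x) \<ominus>\<^sub>V (v \<ominus>\<^sub>V r \<odot>\<^sub>V x) \<in> U" using subm_minus[OF U(1)] that by blast
    also have "(v \<ominus>\<^sub>V s \<odot>\<^sub>V x) \<ominus>\<^sub>V (v \<ominus>\<^sub>V r \<odot>\<^sub>V x) = (r \<ominus>\<^sub>k s) \<odot>\<^sub>V x"
      using that assms(3) by (subst sub_sub_cancel) (simp_all add: a_minus_def smult_l_distr smult_l_minus)
    finally have "inv\<^bsub>k\<^esub> (r \<ominus>\<^sub>k s) \<odot>\<^sub>V ((r \<ominus>\<^sub>k s) \<odot>\<^sub>V x) \<in> U" using n subm_smult[OF U(1)] by blast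
    thus False using xU n assms(3) R.Units_closed[OF n] by (simp add: smult_assoc1[symmetric])
  qed
  define f where "f v = (THE r. r \<in> carrier k & v \<ominus>\<^sub>V r \<odot>\<^sub>V x \<in> U)" for v
  have fI: "f v = r" if "r \<in> carrier k" "v \<in> carrier V" "v \<ominus>\<^sub>V r \<odot>\<^sub>V x \<in> U" for v r
    unfolding f_def using that uniq by blast
  have fP: "f v \<in> carrier k & v \<ominus>\<^sub>V f v \<odot>\<^sub>V x \<in> U" if v: "v \<in> carrier V" for v using all[OF v] fI[OF _ v] by metis
  show thesis
  proof (rule that)
    show "form k V f" unfolding klinear_def
    proof (intro conjI ballI Pi_I)
      fix v assume v: "v \<in> carrier V"
      show "f v \<in> carrier (base k)" using fP[OF v] by simp
      show "f (v \<oplus>\<^sub>V w) = f v \<oplus>\<^bsub>base k\<^esub> f w" if w: "w \<in> carrier V" for w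
      proof -
        have c: "f v \<odot>\<^sub>V x \<in> carrier V" "f w \<odot>\<^sub>V x \<in> carrier V" using fP[OF v] fP[OF w] assms(3) by simp_all
        have "(v \<ominus>\<^sub>V f v \<odot>\<^sub>V x) \<oplus>\<^sub>V (w \<ominus>\<^sub>V f w \<odot>\<^sub>V x) = v \<oplus>\<^sub>V w \<ominus>\<^sub>V (f v \<oplus>\<^sub>k f w) \<odot>\<^sub>V x"
          using fP[OF v] fP[OF w] v w assms(3) c by (simp add: a_minus_def smult_l_distr M.minus_add M.a_ac)
        hence "v \<oplus>\<^sub>V w \<ominus>\<^sub>V (f v \<oplus>\<^sub>k f w) \<odot>\<^sub>V x \<in> U"
          using subm_add[OF U(1) fP[OF v, THEN conjunct2] fP[OF w, THEN conjunct2]] by simp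
        thus ?thesis using fP[OF v] fP[OF w] v w by (simp add: fI)
      qed
      show "f (r \<odot>\<^sub>V v) = r \<odot>\<^bsub>base k\<^esub> f v" if r: "r \<in> carrier k" for r
      proof -
        have "r \<odot>\<^sub>V (v \<ominus>\<^sub>V f v \<odot>\<^sub>V x) = r \<odot>\<^sub>V v \<ominus>\<^sub>V (r \<otimes>\<^sub>k f v) \<odot>\<^sub>V x"
          using fP[OF v] v assms(3) r by (simp add: a_minus_def smult_r_distr smult_r_minus smult_assoc1)
        hence "r \<odot>\<^sub>V v \<ominus>\<^sub>V (r \<otimes>\<^sub>k f v) \<odot>\<^sub>V x \<in> U" using subm_smult[OF U(1) r fP[OF v, THEN conjunct2]] by simp
        thus ?thesis using fP[OF v] v r by (simp add: fI)
      qed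
    qed
    show "f x = \<one>\<^sub>k" using subm_zero[OF U(1)] assms(3) by (intro fI) (simp_all add: a_minus_def M.r_neg)
    show "f s = \<zero>\<^sub>k" if "s \<in> S" for s using that U(2) Uc assms(3) by (intro fI) (auto simp: a_minus_def minus_as_ksgn)
  qed
qed

text \<open>For a subspace \<open>S\<close> of the span of \<open>ys\<close> this is its dimension.
  Each step adds the dimension, 0 or 1, of the image of S in the quotient by the span of the
  remaining vectors. It serves to select maximal and minimal subspaces.\<close>

primrec pivots :: "'v list => 'v set => nat" where
  "pivots [] S = 0"
| "pivots (y # ys) S = (if S \<subseteq> lspan V k ys then 0 else 1) + pivots ys (S \<inter> lspan V k ys)"

lemma pivots_le: "pivots ys S \<le> length ys"
proof (induction ys arbitrary: S)
  case (Cons y ys) thus ?case by (simp add: le_SucI)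
qed simp

lemma pivots_mono: "S \<subseteq> T ==> pivots ys S \<le> pivots ys T"
proof (induction ys arbitrary: S T)
  case (Cons y ys)
  have "pivots ys (S \<inter> lspan V k ys) \<le> pivots ys (T \<inter> lspan V k ys)" by (rule Cons.IH) (use Cons.prems in blast)
  thus ?case using Cons.prems by auto
qed simp

text \<open>By induction both subspaces have the same intersection with the span of the tail. If
  they leave that span, a single s in S outside it suffices to reduce every t in T to the
  tail.\<close>

lemma pivots_inj:
  assumes "field k"
  shows "set ys \<subseteq> carrier V ==> subm S ==> subm T ==> S \<subseteq> T ==> T \<subseteq> lspan V k ys ==> pivots ys S = pivots ys T ==> S = T"
proof (induction ys arbitrary: S T)
  case Nil thus ?case using subm_zero by fastforce
next
  case (Cons y ys)
  let ?L = "lspan V k ys"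
  have L: "subm ?L" and y: "y \<in> carrier V" using Cons.prems(1) lspan_subm by auto
  have m: "pivots ys (S \<inter> ?L) \<le> pivots ys (T \<inter> ?L)" using Cons.prems(4) by (intro pivots_mono) blast
  hence e: "pivots ys (S \<inter> ?L) = pivots ys (T \<inter> ?L)" and q: "S \<subseteq> ?L \<longleftrightarrow> T \<subseteq> ?L"
    using Cons.prems(4,6) by (auto split: if_splits)
  have i: "S \<inter> ?L = T \<inter> ?L" by (rule Cons.IH[OF _ subm_inter[OF Cons.prems(2) L] subm_inter[OF Cons.prems(3) L] _ _ e]) (use Cons.prems in auto)
  show ?case
  proof (cases "S \<subseteq> ?L")
    case True thus ?thesis using i q by blast
  next
    case False
    then obtain s where s: "s \<in> S" "s \<notin> ?L" by blast
    have "s \<in> addl V k y ?L" using s Cons.prems(4,5) by auto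
    hence ys: "y \<in> addl V k s ?L" by (rule addl_exchange[OF assms L y _ s(2)])
    have "T \<subseteq> S"
    proof
      fix t assume t: "t \<in> T"
      note sc = subm_car[OF Cons.prems(2) s(1)] and tc = subm_car[OF Cons.prems(3) t]
      have "t \<in> addl V k s ?L" using t Cons.prems(5) addl_least[OF addl_subm[OF L sc] ys addl_sub[OF L sc]] by auto
      then obtain r u where u: "r \<in> carrier k" "u \<in> ?L" "t = r \<odot>\<^sub>V s \<oplus>\<^sub>V u" by (auto simp: addl_def)
      note uc = subm_car[OF L u(2)] and rs = subm_smult[OF Cons.prems(2) u(1) s(1)]
      have "t \<ominus>\<^sub>V r \<odot>\<^sub>V s = u" unfolding u(3) using uc u(1) sc by (simp add: add_sub_cancel)
      hence "u \<in> T \<inter> ?L" using u(2) subm_minus[OF Cons.prems(3) t] rs Cons.prems(4) by force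
      thus "t \<in> S" using i u(3) subm_add[OF Cons.prems(2) rs] by blast
    qed
    thus ?thesis using Cons.prems(4) by blast
  qed
qed

lemma hcomp_deg:
  assumes "gspace k W" "deg_linear k V W n q" "x \<in> carrier V"
  shows "q (hcomp V i x) = hcomp W (i + n) (q x)"
proof -
  interpret W: gspace k W by fact
  note ql = deg_linearD[OF assms(2)]
  have q0: "q \<zero>\<^sub>V = \<zero>\<^sub>W" by (rule additive_zero[OF ab W.ab deg_additive[OF assms(2)]])
  from assms(3) show ?thesis
  proof (induction rule: graded_induct)
    case (hom j x)
    thus ?case using deg_linear_grade[OF assms(2) hom] by (simp add: hcomp_hom W.hcomp_hom q0)
  next
    case (add x y) thus ?case by (simp add: hcomp_add W.hcomp_add ql)
  qed
qed

text \<open>A maximal graded subspace that meets the kernel of q only in 0 is mapped bijectively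
  onto the image; the inverse is the section.\<close>

lemma graded_section:
  assumes "field k" "gspace k W" and q: "deg_linear k V W n q"
  shows "\<exists>s. \<forall>y\<in>q ` carrier V. s y \<in> carrier V & q (s y) = y
    & (\<forall>z\<in>q ` carrier V. s (y \<oplus>\<^sub>W z) = s y \<oplus>\<^sub>V s z)
    & (\<forall>r\<in>carrier k. s (r \<odot>\<^sub>W y) = r \<odot>\<^sub>V s y)
    & (\<forall>i. y \<in> grade W (i + n) --> s y \<in> grade V i)"
proof -
  interpret W: gspace k W by fact
  note qk = deg_klinear[OF q]
  note ql = klinearD[OF qk]
  note hq = hcomp_deg[OF assms(2) q]
  let ?B = "{x \<in> carrier V. q x = \<zero>\<^sub>W} - {\<zero>\<^sub>V}"
  have h0: "hcomp V i ` {\<zero>\<^sub>V} \<subseteq> {\<zero>\<^sub>V}" for i by (simp add: hcomp_hom[OF g_zero[of i]])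
  obtain U where U: "subm U" "!!i. hcomp V i ` U \<subseteq> U" "U \<inter> ?B = {}"
    and max: "!!T. subm T ==> U \<subseteq> T ==> (!!i. hcomp V i ` T \<subseteq> T) ==> T \<inter> ?B = {} ==> T = U"
    by (rule max_subm[OF subm_trivial, of "hcomp V" ?B]) (assumption | rule h0 | simp)+
  note Uc = subm_car[OF U(1)]
  have inj: "x = y" if "x \<in> U" "y \<in> U" "q x = q y" for x y
  proof -
    have "q (x \<ominus>\<^sub>V y) = \<zero>\<^sub>W"
      using additive_diff[OF ab W.ab klinear_additive[OF qk], of x y] Uc that ql(1)[of y] by (simp add: a_minus_def W.M.r_neg)
    thus ?thesis using U(3) subm_minus[OF U(1) that(1,2)] Uc that diff_zero_eq by blast
  qed
  \<comment> \<open>If the image of a homogeneous x were missed, U could be enlarged by x: the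
    larger space is still stable under the projections, and by exchange a nonzero kernel vector in
    it would put q x into the image of U.\<close>
  have surj: "q x \<in> q ` U" if "x \<in> carrier V" for x using that
  proof (induction rule: graded_induct)
    case (hom i x)
    note xc = gcar[OF hom]
    let ?T = "addl V k x U"
    show ?case
    proof (rule ccontr)
      assume n: "q x \<notin> q ` U"
      have "hcomp V j ` ?T \<subseteq> ?T" for j
      proof
        fix t assume "t \<in> hcomp V j ` ?T"
        then obtain r u where u: "r \<in> carrier k" "u \<in> U" "t = hcomp V j (r \<odot>\<^sub>V x \<oplus>\<^sub>V u)" by (auto simp: addl_def)
        have "t = (if j = i then r else \<zero>\<^sub>k) \<odot>\<^sub>V x \<oplus>\<^sub>V hcomp V j u"
          using u xc Uc by (simp add: hcomp_add hcomp_smult hcomp_hom[OF hom])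
        moreover have "hcomp V j u \<in> U" using U(2)[of j] u(2) by blast
        ultimately show "t \<in> ?T" using addlI[of "if j = i then r else \<zero>\<^sub>k" "hcomp V j u" U x] u(1) by simp
      qed
      moreover have "?T \<inter> ?B = {}"
      proof (rule ccontr)
        assume "?T \<inter> ?B ~= {}"
        then obtain t where t: "t \<in> ?T" "t \<in> carrier V" "q t = \<zero>\<^sub>W" "t ~= \<zero>\<^sub>V" by blast
        hence "t \<notin> U" using U(3) by blast
        hence "x \<in> addl V k t U" using addl_exchange[OF assms(1) U(1) xc t(1)] by blast
        then obtain r u where u: "r \<in> carrier k" "u \<in> U" "x = r \<odot>\<^sub>V t \<oplus>\<^sub>V u" by (auto simp: addl_def)
        hence "q x = q u" using t Uc ql by simp
        thus False using n u(2) by blast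
      qed
      ultimately have "?T = U" using max[OF addl_subm[OF U(1) xc] addl_sub[OF U(1) xc]] by blast
      thus False using n addl_self[OF U(1) xc] by blast
    qed
  next
    case (add x y)
    then obtain u v where uv: "u \<in> U" "v \<in> U" "q x = q u" "q y = q v" by blast
    hence "q (x \<oplus>\<^sub>V y) = q (u \<oplus>\<^sub>V v)" using add(1,2) Uc ql by simp
    thus ?case using subm_add[OF U(1) uv(1,2)] by blast
  qed
  define s where "s y = (THE u. u \<in> U & q u = y)" for y
  have sI: "s y = u" if "u \<in> U" "q u = y" for u y unfolding s_def using that inj by blast
  have sP: "s y \<in> U & q (s y) = y" if "y \<in> q ` carrier V" for y using that surj sI by (metis imageE)
  show ?thesis
  proof (intro exI[of _ s] ballI conjI allI impI)
    fix y assume y: "y \<in> q ` carrier V"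
    show "s y \<in> carrier V" "q (s y) = y" using sP[OF y] Uc by blast+
    show "s (y \<oplus>\<^sub>W z) = s y \<oplus>\<^sub>V s z" if "z \<in> q ` carrier V" for z
      using sP[OF y] sP[OF that] subm_add[OF U(1)] Uc ql by (intro sI) auto
    show "s (r \<odot>\<^sub>W y) = r \<odot>\<^sub>V s y" if "r \<in> carrier k" for r
      using sP[OF y] subm_smult[OF U(1) that(1)] Uc ql that(1) by (intro sI) auto
    fix i assume yi: "y \<in> grade W (i + n)"
    \<comment> \<open>The component of \<open>s y\<close> in degree i lies in U and has the same
      image as \<open>s y\<close>, so the two are equal.\<close>
    have "q (hcomp V i (s y)) = y" using hq[of "s y" i] sP[OF y] Uc W.hcomp_hom[OF yi, of "i + n"] by simp
    hence "s y = hcomp V i (s y)" using sP[OF y] U(2) by (intro sI) blast+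
    thus "s y \<in> grade V i" using hcomp_g[of "s y" i] sP[OF y] Uc by simp
  qed
qed

end

lemma tsum_zero: "abelian_group X ==> (!!x y. (x, y) \<in> set zs ==> \<beta> x y = \<zero>\<^sub>X) ==> tsum X \<beta> zs = \<zero>\<^sub>X"
proof -
  assume "abelian_group X" then interpret X: abelian_group X .
  show "(!!x y. (x, y) \<in> set zs ==> \<beta> x y = \<zero>\<^sub>X) ==> tsum X \<beta> zs = \<zero>\<^sub>X" by (induction zs) auto
qed

section \<open>Rewriting tensors and contracting them with linear forms\<close>

context tens begin

lemma teq_flip: "teq xs ys ==> tensor_eq k W V (map prod.swap xs) (map prod.swap ys)"
proof (induction rule: tensor_eq.induct)
  case (refl xs) thus ?case by (intro tensor_eq.refl) auto
next
  case (comm xs ys)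
  have "set (map prod.swap xs) \<subseteq> carrier W \<times> carrier V" "set (map prod.swap ys) \<subseteq> carrier W \<times> carrier V" using comm by auto
  thus ?case unfolding map_append by (rule tensor_eq.comm)
next
  case (zero w)
  hence "tensor_eq k W V [(w, \<zero>\<^sub>V)] [(\<zero>\<^sub>W, \<zero>\<^sub>V)]"
    using tensor_eq.sym[OF tensor_eq.balanced[of "\<zero>\<^sub>k" k w W "\<zero>\<^sub>V" V]] by simp
  thus ?case using tensor_eq.zero[of "\<zero>\<^sub>V" V k W] by (auto intro: tensor_eq.trans)
qed (auto intro: tensor_eq.intros)

text \<open>If x = r v + u, where v is the left entry of another pair (v, w), the part r v (x) y is
  moved into that pair as v (x) (w + r y). The number of pairs stays the same while x is reduced
  towards S.\<close>

lemma teq_exchange: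
  assumes "V.subm S"
  shows "set zs \<subseteq> cVW ==> y \<in> carrier W ==> x \<in> foldr (addl V k) (map fst zs) S ==>
    \<exists>s\<in>S. \<exists>zs'. length zs' = length zs & teq ((x, y) # zs) ((s, y) # zs')"
proof (induction zs arbitrary: x)
  case Nil thus ?case using V.subm_car[OF assms] by (intro bexI[of _ x] exI[of _ "[]"]) (auto intro: tensor_eq.refl)
next
  case (Cons z zs)
  obtain v w where z: "z = (v, w)" by fastforce
  obtain r u where u: "r \<in> carrier k" "x = r \<odot>\<^sub>V v \<oplus>\<^sub>V u" "u \<in> foldr (addl V k) (map fst zs) S"
    using Cons.prems(3) z by (auto elim: V.addlE)
  have vw: "v \<in> carrier V" "w \<in> carrier W" and zs: "set zs \<subseteq> cVW" using Cons.prems(1) z by auto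
  have fz: "set (map fst zs) \<subseteq> carrier V" using zs by auto
  note uc = V.subm_car[OF V.foldr_addl_subm[OF assms fz] u(3)]
  obtain s zs' where s: "s \<in> S" "length zs' = length zs" "teq ((u, y) # zs) ((s, y) # zs')" using Cons.IH[OF zs Cons.prems(2) u(3)] by blast
  note t = cls_cong[OF s(3)]
  have c: "s \<in> carrier V" "set zs' \<subseteq> cVW" using teq_sub[OF s(3)] by auto
  have y: "y \<in> carrier W" by fact
  have t': "p u y \<oplus>\<^sub>VW cls zs = p s y \<oplus>\<^sub>VW cls zs'" using t c uc y zs by (simp add: cls_Cons)
  have cc: "cls zs \<in> carrier VW" "cls zs' \<in> carrier VW" using zs c cls_car by blast+
  have "cls ((x, y) # z # zs) = p v (w \<oplus>\<^sub>W r \<odot>\<^sub>W y) \<oplus>\<^sub>VW (p u y \<oplus>\<^sub>VW cls zs)"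
    using uc vw y zs u(1) cc by (simp add: z u(2) cls_Cons pure_add_left pure_add_right pure_smult_left pure_smult_right VW.a_ac)
  also have "... = cls ((s, y) # (v, w \<oplus>\<^sub>W r \<odot>\<^sub>W y) # zs')" unfolding t' using vw y u(1) c cc by (simp add: cls_Cons VW.a_ac)
  finally have "teq ((x, y) # z # zs) ((s, y) # (v, w \<oplus>\<^sub>W r \<odot>\<^sub>W y) # zs')"
    using cls_eq[of "(x, y) # z # zs"] Cons.prems uc vw u by auto
  thus ?case using s(1,2) by (intro bexI[of _ s] exI[of _ "(v, w \<oplus>\<^sub>W r \<odot>\<^sub>W y) # zs'"]) simp_all
qed

lemma form_bilin: "form k V f ==> bilin k V W W (%x y. f x \<odot>\<^sub>W y)"
  unfolding bilin_def klinear_def by (auto simp: Pi_iff W.smult_l_distr W.smult_r_distr W.smult_assoc1 W.smult_comm)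

text \<open>A tensor whose contractions by all forms vanishing on S lie in D belongs to S (x) W + V
  (x) D, which \<beta> kills. The induction on the length either moves the first left entry into S,
  or separates it from S and the other left entries by a form; the contraction with this form then
  shows its right entry to be in D.\<close>

lemma tsum_separate:
  assumes "field k" and m: "module k X" "bilin k V W X \<beta>" and S: "V.subm S" "W.subm D"
    and z: "!!x y. x \<in> S ==> y \<in> carrier W ==> \<beta> x y = \<zero>\<^sub>X" "!!x y. x \<in> carrier V ==> y \<in> D ==> \<beta> x y = \<zero>\<^sub>X"
  shows "set xs \<subseteq> cVW ==> (!!f. form k V f ==> (!!s. s \<in> S ==> f s = \<zero>\<^sub>k) ==> tsum W (%x y. f x \<odot>\<^sub>W y) xs \<in> D)
    ==> tsum X \<beta> xs = \<zero>\<^sub>X"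
proof (induction "length xs" arbitrary: xs rule: less_induct)
  case less
  interpret X: kmod k X using m(1) by (simp add: kmod_def)
  have fm: "module k W" by unfold_locales
  have c: "f s \<in> carrier k" if "form k V f" "s \<in> carrier V" for f s using klinearD(1)[OF that] by simp
  show ?case
  proof (cases xs)
    case (Cons q zs)
    obtain x y where q: "q = (x, y)" by fastforce
    have xy: "x \<in> carrier V" "y \<in> carrier W" and zs: "set zs \<subseteq> cVW" using less.prems(1) by (auto simp: Cons q)
    let ?L = "foldr (addl V k) (map fst zs) S"
    have fz: "set (map fst zs) \<subseteq> carrier V" using zs by auto
    have L: "V.subm ?L" "S \<subseteq> ?L" "fst ` set zs \<subseteq> ?L" using V.foldr_addl_subm[OF S(1) fz] V.foldr_addl_sub[OF S(1) fz] by auto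
    have tz: "tsum X \<beta> zs = \<zero>\<^sub>X ==> ?thesis" if "\<beta> x y = \<zero>\<^sub>X" using that by (simp add: Cons q)
    show ?thesis
    proof (cases "x \<in> ?L")
      case True
      obtain s zs' where s: "s \<in> S" "length zs' = length zs" "teq xs ((s, y) # zs')" using teq_exchange[OF S(1) zs xy(2) True] by (auto simp: Cons q)
      have sc: "s \<in> carrier V" "set zs' \<subseteq> cVW" using teq_sub[OF s(3)] by auto
      have "tsum X \<beta> zs' = \<zero>\<^sub>X"
      proof (rule less.hyps[OF _ sc(2)])
        show "length zs' < length xs" using s by (simp add: Cons)
        fix f assume f: "form k V f" "!!s. s \<in> S ==> f s = \<zero>\<^sub>k"
        have "tsum W (%x y. f x \<odot>\<^sub>W y) ((s, y) # zs') \<in> D" using less.prems(2)[OF f] tsum_teq[OF fm form_bilin[OF f(1)] s(3)] by simp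
        thus "tsum W (%x y. f x \<odot>\<^sub>W y) zs' \<in> D"
          using f(2)[OF s(1)] xy tsum_closed[OF W.ab, of "%x y. f x \<odot>\<^sub>W y" zs'] c[OF f(1)] sc by simp
      qed
      thus ?thesis using tsum_teq[OF m s(3)] z(1)[OF s(1) xy(2)] by simp
    next
      case False
      obtain f where f: "form k V f" "f x = \<one>\<^sub>k" "!!s. s \<in> ?L ==> f s = \<zero>\<^sub>k"
        using V.form_exists[OF assms(1) L(1) xy(1) False] by blast
      have "tsum W (%x y. f x \<odot>\<^sub>W y) zs = \<zero>\<^sub>W" by (rule tsum_zero[OF W.ab]) (use zs L(3) f(3) in force)
      hence yD: "y \<in> D" using less.prems(2)[OF f(1)] f L(2) xy by (auto simp: Cons q)
      have "tsum X \<beta> zs = \<zero>\<^sub>X"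
      proof (rule less.hyps[OF _ zs])
        show "length zs < length xs" by (simp add: Cons)
        fix f assume f: "form k V f" "!!s. s \<in> S ==> f s = \<zero>\<^sub>k"
        have t: "tsum W (%x y. f x \<odot>\<^sub>W y) zs \<in> carrier W" by (rule tsum_closed[OF W.ab _ zs]) (simp add: c[OF f(1)])
        have "f x \<odot>\<^sub>W y \<oplus>\<^sub>W tsum W (%x y. f x \<odot>\<^sub>W y) zs \<in> D" using less.prems(2)[OF f] by (simp add: Cons q)
        from W.subm_add[OF S(2) W.subm_uminus[OF S(2) W.subm_smult[OF S(2) c[OF f(1) xy(1)] yD]] this]
        show "tsum W (%x y. f x \<odot>\<^sub>W y) zs \<in> D" using t xy c[OF f(1)] by (simp add: W.M.a_assoc[symmetric] W.M.l_neg)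
      qed
      thus ?thesis using tz z(2)[OF xy(1) yD] by blast
    qed
  qed simp
qed

text \<open>In a list of minimal length no left entry lies in the span of the others, so each right
  entry is itself a contraction by some form.\<close>

lemma minimal_right:
  assumes "field k" "set xs \<subseteq> cVW" "!!ys. teq xs ys ==> length xs \<le> length ys" "W.subm D"
    "!!f. form k V f ==> tsum W (%x y. f x \<odot>\<^sub>W y) xs \<in> D"
  shows "snd ` set xs \<subseteq> D"
proof
  fix y assume "y \<in> snd ` set xs"
  then obtain x as bs where xs: "xs = as @ (x, y) # bs" by (auto simp: in_set_conv_decomp)
  obtain zs where zsd: "zs = as @ bs" by blast
  have xy: "x \<in> carrier V" "y \<in> carrier W" and zs: "set zs \<subseteq> cVW" and fz: "set (map fst zs) \<subseteq> carrier V" using assms(2) by (auto simp: xs zsd)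
  have fm: "module k W" by unfold_locales
  have e: "teq xs ((x, y) # zs)" using assms(2) tensor_eq.app[OF tensor_eq.comm[of as V W "[(x, y)]" k] tensor_eq.refl[of bs V W k]] by (auto simp: xs zsd)
  have "x \<notin> lspan V k (map fst zs)"
  proof
    assume "x \<in> lspan V k (map fst zs)"
    then obtain s zs' where s: "s \<in> {\<zero>\<^sub>V}" "length zs' = length zs" "teq ((x, y) # zs) ((s, y) # zs')"
      using teq_exchange[OF V.subm_trivial zs xy(2)] by blast
    have zs': "set zs' \<subseteq> cVW" using teq_sub[OF s(3)] by auto
    have "teq ((s, y) # zs') zs'" using s(1) tensor_eq.app[OF tensor_eq.zero[OF xy(2)] tensor_eq.refl[OF zs']] by simp
    hence "teq xs zs'" using e s(3) by (blast intro: tensor_eq.trans)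
    thus False using assms(3)[of zs'] s(2) by (simp add: xs zsd)
  qed
  then obtain f where f: "form k V f" "f x = \<one>\<^sub>k" "!!s. s \<in> lspan V k (map fst zs) ==> f s = \<zero>\<^sub>k"
    using V.form_exists[OF assms(1) V.lspan_subm[OF fz] xy(1)] by blast
  have "tsum W (%x y. f x \<odot>\<^sub>W y) zs = \<zero>\<^sub>W" by (rule tsum_zero[OF W.ab]) (use zs f(3) V.lspan_sub[OF fz] in force)
  hence "tsum W (%x y. f x \<odot>\<^sub>W y) xs = y" using tsum_teq[OF fm form_bilin[OF f(1)] e] xy f(2) by simp
  thus "y \<in> D" using assms(5)[OF f(1)] by simp
qed

end

section \<open>Conilpotency of connected coalgebras\<close>

lemma form_bilin': "module k X ==> form k V f ==> bilin k V X X (%x y. f x \<odot>\<^sub>X y)"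
proof -
  assume "module k X" and f: "form k V f"
  then interpret X: kmod k X by (simp add: kmod_def)
  show ?thesis using klinearD[OF f] by (auto simp: bilin_def X.smult_l_distr X.smult_r_distr X.smult_assoc1 X.smult_comm)
qed

locale fcoal = coal k C for k :: "'k ring" and C :: "('k, 'c) coalg" +
  assumes fk: "field k"
begin

lemma mk: "module k (base k)" by (rule base_module[OF cring])

lemmas formD = klinearD[where W = "base k", simplified base_simps]

lemma form_lin: "form k C f ==> form k C h ==> r \<in> carrier k ==> form k C (%x. f x \<oplus>\<^sub>k r \<otimes>\<^sub>k h x)"
  by (simp add: klinear_def Pi_iff C.R.r_distr C.R.a_ac C.R.m_ac)

lemma form_counit: "form k C (counit C)" using counit_form by (auto simp: klinear_def deg_form_def)

text \<open>\<open>rho\<close> and \<open>lam\<close> are the two actions of the dual algebra on C,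
  by applying a form to the left or to the right factor of the comultiplication. They carry no
  signs, since the forms may be inhomogeneous.\<close>

definition rho :: "('c => 'k) => 'c => 'c" where
  "rho f = sweedler C C (%_ _ x y. f x \<odot>\<^sub>C y)"

definition lam :: "('c => 'k) => 'c => 'c" where
  "lam f = sweedler C C (%_ _ x y. f y \<odot>\<^sub>C x)"

lemma rb: "module k X ==> form k C f ==> klinear k C X h ==> bifam k C C X (%_ _ x y. f x \<odot>\<^sub>X h y)"
  by (rule bifam_bilin[OF gC gC form_bilin' C.id_kl])

lemma lb: "module k X ==> form k C f ==> klinear k C X h ==> bifam k C C X (%_ _ x y. f y \<odot>\<^sub>X h x)"
  by (rule bifam_bilin[OF gC gC bilin_flip[OF form_bilin'] _ C.id_kl])

lemma rho_kl: "form k C f ==> klinear k C C (rho f)" unfolding rho_def by (rule sw_klinear[OF mC rb[OF mC _ C.id_kl]])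

lemma lam_kl: "form k C f ==> klinear k C C (lam f)" unfolding lam_def by (rule sw_klinear[OF mC lb[OF mC _ C.id_kl]])

lemmas rhoD = klinearD[OF rho_kl] and lamD = klinearD[OF lam_kl]

lemma rho_zero: "form k C f ==> rho f \<zero>\<^sub>C = \<zero>\<^sub>C" and lam_zero: "form k C f ==> lam f \<zero>\<^sub>C = \<zero>\<^sub>C"
  by (rule additive_zero[OF C.ab C.ab klinear_additive], erule rho_kl lam_kl)+

lemma form_zero: "form k C f ==> f \<zero>\<^sub>C = \<zero>\<^sub>k"
  using formD(3)[of k C f "\<zero>\<^sub>k" "\<zero>\<^sub>C"] formD(1)[of k C f "\<zero>\<^sub>C"] by simp

lemma rho_lin:
  assumes "module k X" "form k C f" "klinear k C X h" "c \<in> carrier C"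
  shows "h (rho f c) = sweedler C X (%_ _ x y. f x \<odot>\<^sub>X h y) c"
  unfolding rho_def by (rule sw_map[OF mC rb[OF mC assms(2) C.id_kl] assms(1,3) rb[OF assms(1-3)] assms(4)])
    (simp add: klinearD[OF assms(3)] formD[OF assms(2)] C.gcar)

lemma lam_lin:
  assumes "module k X" "form k C f" "klinear k C X h" "c \<in> carrier C"
  shows "h (lam f c) = sweedler C X (%_ _ x y. f y \<odot>\<^sub>X h x) c"
  unfolding lam_def by (rule sw_map[OF mC lb[OF mC assms(2) C.id_kl] assms(1,3) lb[OF assms(1-3)] assms(4)])
    (simp add: klinearD[OF assms(3)] formD[OF assms(2)] C.gcar)

text \<open>Both sides are the unsigned convolution of f and h at c. This adjointness lets
  statements about one action be deduced from the other.\<close>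

lemma form_rho_lam: "form k C f ==> form k C h ==> c \<in> carrier C ==> f (lam h c) = h (rho f c)"
proof -
  assume f: "form k C f" and h: "form k C h" and c: "c \<in> carrier C"
  show ?thesis unfolding lam_lin[OF mk h f c] rho_lin[OF mk f h c]
    by (rule sw_cong[OF mk rb[OF mk f h] c]) (simp add: formD[OF f] formD[OF h] C.gcar C.R.m_comm)
qed

lemma form_rho: "form k C f ==> form k C h ==> form k C (%x. f (rho h x))"
  and form_lam: "form k C f ==> form k C h ==> form k C (%x. f (lam h x))" by (rule klinear_compose[OF rho_kl], assumption+) (rule klinear_compose[OF lam_kl])

lemma fb: "form k C f ==> bilin k C C C (%x y. f x \<odot>\<^sub>C y)" by (rule form_bilin'[OF mC])

lemma rho_lam:
  assumes f: "form k C f" and h: "form k C h" and c: "c \<in> carrier C"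
  shows "rho f (lam h c) = lam h (rho f c)"
proof -
  let ?\<psi> = "%_ _ :: int. %u v y. h y \<odot>\<^sub>C (f u \<odot>\<^sub>C v)"
  have t: "trifam k C C C C ?\<psi>" by (rule trifam_left[OF gC gC gC bilin_flip[OF fb[OF h]] fb[OF f] C.id_kl])
  show ?thesis unfolding lam_lin[OF mC h rho_kl[OF f] c] rho_lin[OF mC f lam_kl[OF h] c]
  proof (rule sw_coassoc[where \<psi> = ?\<psi>, OF mC t c])
    fix p q x y assume "x \<in> grade C p" and "y \<in> grade C q"
    hence x: "x \<in> carrier C" and y: "y \<in> carrier C" by (auto intro: C.gcar)
    show "h y \<odot>\<^sub>C rho f x = sweedler C C (%p q u v. ?\<psi> p q u v y) x" unfolding rho_lin[OF mC f bilin_right[OF fb[OF h] y] x]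
      by (rule sw_cong[OF mC trifamD(1)[OF t y] x]) (simp add: C.gcar C.smult_comm formD(1)[OF f] formD(1)[OF h] y)
    show "f x \<odot>\<^sub>C lam h y = sweedler C C (%i q u v. ?\<psi> p i x u v) y" by (rule lam_lin[OF mC h bilin_right[OF fb[OF f] x] y])
  qed
qed

lemma form_separate: "x \<in> carrier C ==> y \<in> carrier C ==> (!!F. form k C F ==> F x = F y) ==> x = y"
proof (rule ccontr)
  assume c: "x \<in> carrier C" "y \<in> carrier C" and e: "!!F. form k C F ==> F x = F y" and "x ~= y"
  hence "x \<ominus>\<^sub>C y \<notin> {\<zero>\<^sub>C}" using C.diff_zero_eq by blast
  then obtain F where F: "form k C F" "F (x \<ominus>\<^sub>C y) = \<one>\<^sub>k" using C.form_exists[OF fk C.subm_trivial] c by (metis C.M.minus_closed)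
  have kg: "abelian_group (base k)" using mk by (simp add: module_def)
  have "F (x \<ominus>\<^sub>C y) = F x \<ominus>\<^bsub>base k\<^esub> F y" by (rule additive_diff[OF C.ab kg klinear_additive[OF F(1)] c])
  also have "... = \<zero>\<^sub>k" using e[OF F(1)] abelian_group.r_neg[OF kg, of "F y"] formD(1)[OF F(1) c(2)] by (simp add: a_minus_def)
  finally show False using F(2) domain.one_not_zero[OF field.axioms(1)[OF fk]] by simp
qed

text \<open>Forms separate points, and pairing with a form F turns the claim into the fact that
  \<open>rho h\<close> and \<open>lam F\<close> commute.\<close>

lemma rho_rho: "form k C f ==> form k C h ==> c \<in> carrier C ==> rho f (rho h c) = rho (%x. f (rho h x)) c"
proof (rule form_separate)
  fix F assume a: "form k C f" "form k C h" "c \<in> carrier C" "form k C F"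
  show "F (rho f (rho h c)) = F (rho (%x. f (rho h x)) c)"
    using form_rho_lam[OF a(1,4), of "rho h c"] form_rho_lam[OF form_rho[OF a(1,2)] a(4,3)] rho_lam[OF a(2,4,3)] a by (simp add: rhoD)
qed (simp_all add: rhoD form_rho)

lemma lam_lam: "form k C f ==> form k C h ==> c \<in> carrier C ==> lam f (lam h c) = lam (%x. f (lam h x)) c"
proof (rule form_separate)
  fix F assume a: "form k C f" "form k C h" "c \<in> carrier C" "form k C F"
  show "F (lam f (lam h c)) = F (lam (%x. f (lam h x)) c)"
    using form_rho_lam[OF a(4,1), of "lam h c"] form_rho_lam[OF a(4) form_lam[OF a(1,2)] a(3)] rho_lam[OF a(4,2,3)] a by (simp add: lamD)
qed (simp_all add: lamD form_lam)

lemma rho_counit: "c \<in> carrier C ==> rho (counit C) c = c" and lam_counit: "c \<in> carrier C ==> lam (counit C) c = c"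
  unfolding rho_def lam_def using sw_counit[OF mC C.id_kl] by simp_all

lemma rho_form_lin:
  assumes f: "form k C f" and h: "form k C h" and r: "r \<in> carrier k" and c: "c \<in> carrier C"
  shows "rho (%x. f x \<oplus>\<^sub>k r \<otimes>\<^sub>k h x) c = rho f c \<oplus>\<^sub>C r \<odot>\<^sub>C rho h c"
proof -
  note bh = rb[OF mC h C.id_kl]
  show ?thesis unfolding rho_def sw_smult[OF mC bh r c HOL.refl, symmetric] by (rule sw_add[OF mC rb[OF mC f C.id_kl] bifam_smult[OF gC gC mC bh r] c])
      (simp add: formD(1)[OF f] formD(1)[OF h] r C.gcar C.smult_l_distr C.smult_assoc1)
qed

text \<open>Without degree-dependent signs a Sweedler sum can be computed from any list that
  represents \<open>comult C c\<close>, homogeneous or not.\<close>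

lemma sw_tsum:
  assumes m: "module k X" and b: "bilin k C C X \<beta>" and c: "comult C c = tensor_class k C C xs" "set xs \<subseteq> carrier C \<times> carrier C"
    and p: "bifam k C C X \<phi>" and e: "!!i j x y. x \<in> grade C i ==> y \<in> grade C j ==> \<phi> i j x y = \<beta> x y"
  shows "sweedler C X \<phi> c = tsum X \<beta> xs"
proof -
  interpret X: kmod k X using m by (simp add: kmod_def)
  have "tlift_hom C C X \<phi> (comult C c) = tlift X \<beta> (comult C c)"
  proof (rule CC.L.th_additive_eqI[OF X.M.abelian_group_axioms klinear_additive[OF CC.L.th_klinear[OF m p]]
        klinear_additive[OF CC.L.tlift_klinear[OF m b]]])
    show "comult C c \<in> carrier (tensor k C C)" unfolding c(1) by (rule CC.L.cls_car[OF c(2)])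
    fix i j x y assume xy: "x \<in> grade C i" "y \<in> grade C j"
    show "tlift_hom C C X \<phi> (pure k C C x y) = tlift X \<beta> (pure k C C x y)"
      unfolding CC.L.th_pure[OF m p xy] CC.L.tlift_pure[OF m b C.gcar[OF xy(1)] C.gcar[OF xy(2)]] by (rule e[OF xy])
  qed
  thus ?thesis unfolding sweedler_def c(1) CC.L.tlift_cls[OF m b c(2)] by simp
qed

lemma comult_cases:
  assumes "c \<in> carrier C" obtains xs where "set xs \<subseteq> carrier C \<times> carrier C" "comult C c = tensor_class k C C xs"
  using CC.L.car_cases[OF cm_car[OF assms]] by metis

lemma rho_tsum:
  assumes "form k C f" "comult C c = tensor_class k C C xs" "set xs \<subseteq> carrier C \<times> carrier C"
  shows "rho f c = tsum C (%x y. f x \<odot>\<^sub>C y) xs"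
  unfolding rho_def by (rule sw_tsum[OF mC fb[OF assms(1)] assms(2,3) rb[OF mC assms(1) C.id_kl]]) simp

lemma lam_tsum:
  assumes "form k C f" "comult C c = tensor_class k C C xs" "set xs \<subseteq> carrier C \<times> carrier C"
  shows "lam f c = tsum C (%x y. f y \<odot>\<^sub>C x) xs"
  unfolding lam_def by (rule sw_tsum[OF mC bilin_flip[OF fb[OF assms(1)]] assms(2,3) lb[OF mC assms(1) C.id_kl]]) simp

lemma tsum_subm: "C.subm D ==> (!!x y. (x, y) \<in> set xs ==> \<beta> x y \<in> D) ==> tsum C \<beta> xs \<in> D"
  by (induction xs) (auto simp: C.subm_zero C.subm_add)

section \<open>Subcoalgebras as stable subspaces, and local finiteness\<close>

definition stable :: "'c set => bool" where
  "stable D \<longleftrightarrow> C.subm D & (\<forall>f. form k C f --> rho f ` D \<subseteq> D & lam f ` D \<subseteq> D)"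

lemma stableD: "stable D ==> c \<in> D ==> form k C f ==> rho f c \<in> D" "stable D ==> c \<in> D ==> form k C f ==> lam f c \<in> D"
  by (simp_all add: stable_def image_subset_iff)

text \<open>For the converse, a representative of minimal length has its right entries in D by
  stability under \<open>rho\<close> and, after swapping the factors, its left entries in D by
  stability under \<open>lam\<close>.\<close>

lemma subcoalgebra_stable: "subcoalgebra k C D \<longleftrightarrow> stable D"
proof
  assume D: "subcoalgebra k C D"
  hence s: "C.subm D" by (simp add: subcoalgebra_def)
  have "rho f c \<in> D & lam f c \<in> D" if f: "form k C f" and c: "c \<in> D" for f c
  proof -
    obtain xs where xs: "set xs \<subseteq> D \<times> D" "comult C c = tensor_class k C C xs" using D c by (auto simp: subcoalgebra_def)
    have xc: "set xs \<subseteq> carrier C \<times> carrier C" using xs(1) C.subm_car[OF s] by auto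
    show ?thesis unfolding rho_tsum[OF f xs(2) xc] lam_tsum[OF f xs(2) xc]
      using xs(1) xc formD(1)[OF f] by (intro conjI tsum_subm[OF s] C.subm_smult[OF s]) auto
  qed
  thus "stable D" using s by (auto simp: stable_def)
next
  assume D: "stable D"
  hence s: "C.subm D" by (simp add: stable_def)
  have "comult C c \<in> tensor_class k C C ` {xs. set xs \<subseteq> D \<times> D}" if c: "c \<in> D" for c
  proof -
    obtain xs where xs: "set xs \<subseteq> carrier C \<times> carrier C" "comult C c = tensor_class k C C xs" using comult_cases[OF C.subm_car[OF s c]] .
    obtain ys where ys: "tensor_eq k C C xs ys" and min: "!!zs. tensor_eq k C C xs zs ==> length ys \<le> length zs"
      using ex_has_least_nat[of "tensor_eq k C C xs" xs length] tensor_eq.refl[OF xs(1)] by blast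
    have yc: "set ys \<subseteq> carrier C \<times> carrier C" using CC.L.teq_sub[OF ys] by blast
    have cy: "comult C c = tensor_class k C C ys" using xs(2) CC.L.cls_cong[OF ys] by simp
    have "snd ` set ys \<subseteq> D"
    proof (rule CC.L.minimal_right[OF fk yc _ s])
      show "length ys \<le> length zs" if "tensor_eq k C C ys zs" for zs using min tensor_eq.trans[OF ys that] .
      show "tsum C (%x y. f x \<odot>\<^sub>C y) ys \<in> D" if "form k C f" for f using stableD(1)[OF D c that] rho_tsum[OF that cy yc] by simp
    qed
    moreover have "snd ` set (map prod.swap ys) \<subseteq> D"
    proof (rule CC.L.minimal_right[OF fk _ _ s])
      show "set (map prod.swap ys) \<subseteq> carrier C \<times> carrier C" using yc by auto
      show "length (map prod.swap ys) \<le> length zs" if "tensor_eq k C C (map prod.swap ys) zs" for zs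
        using min[OF tensor_eq.trans[OF ys], of "map prod.swap zs"] CC.L.teq_flip[OF that] by (simp add: o_def)
      have sw: "tsum C \<beta> (map prod.swap zs) = tsum C (%x y. \<beta> y x) zs" for \<beta> zs by (induction zs) auto
      show "tsum C (%x y. f x \<odot>\<^sub>C y) (map prod.swap ys) \<in> D" if "form k C f" for f
        using stableD(2)[OF D c that] lam_tsum[OF that cy yc] by (simp add: sw)
    qed
    ultimately have "set ys \<subseteq> D \<times> D" by force
    thus ?thesis using cy by blast
  qed
  thus "subcoalgebra k C D" using s by (auto simp: subcoalgebra_def)
qed

text \<open>\<open>comult C c\<close> involves finitely many vectors; all finiteness below comes
  from here.\<close>

lemma rho_span: "c \<in> carrier C ==> \<exists>ys. set ys \<subseteq> carrier C & (\<forall>f. form k C f --> rho f c \<in> lspan C k ys)"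
  and lam_span: "c \<in> carrier C ==> \<exists>ys. set ys \<subseteq> carrier C & (\<forall>f. form k C f --> lam f c \<in> lspan C k ys)"
proof -
  assume c: "c \<in> carrier C"
  obtain xs where xs: "set xs \<subseteq> carrier C \<times> carrier C" "comult C c = tensor_class k C C xs" using comult_cases[OF c] .
  have s: "set (map snd xs) \<subseteq> carrier C" "set (map fst xs) \<subseteq> carrier C" using xs(1) by auto
  have xm: "y \<in> lspan C k (map snd xs)" "x \<in> lspan C k (map fst xs)" "x \<in> carrier C" "y \<in> carrier C" if "(x, y) \<in> set xs" for x y
    using C.lspan_sub[OF s(1)] C.lspan_sub[OF s(2)] that xs(1) by force+
  have "rho f c \<in> lspan C k (map snd xs)" "lam f c \<in> lspan C k (map fst xs)" if f: "form k C f" for f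
    unfolding rho_tsum[OF f xs(2,1)] lam_tsum[OF f xs(2,1)]
    by (rule tsum_subm[OF C.lspan_subm[OF s(1)]], rule C.subm_smult[OF C.lspan_subm[OF s(1)]]; simp add: xm formD(1)[OF f])
      (rule tsum_subm[OF C.lspan_subm[OF s(2)]], rule C.subm_smult[OF C.lspan_subm[OF s(2)]]; simp add: xm formD(1)[OF f])
  thus "\<exists>ys. set ys \<subseteq> carrier C & (\<forall>f. form k C f --> rho f c \<in> lspan C k ys)"
    "\<exists>ys. set ys \<subseteq> carrier C & (\<forall>f. form k C f --> lam f c \<in> lspan C k ys)" using s by blast+
qed

lemma lam_span_list: "set ys \<subseteq> carrier C ==>
    \<exists>zs. set zs \<subseteq> carrier C & (\<forall>c\<in>lspan C k ys. \<forall>f. form k C f --> lam f c \<in> lspan C k zs)"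
proof (induction ys)
  case Nil thus ?case by (intro exI[of _ "[]"]) (auto simp: lam_zero)
next
  case (Cons y ys)
  then obtain zs where zs: "set zs \<subseteq> carrier C" "!!c f. c \<in> lspan C k ys ==> form k C f ==> lam f c \<in> lspan C k zs" by auto
  obtain us where us: "set us \<subseteq> carrier C" "!!f. form k C f ==> lam f y \<in> lspan C k us" using lam_span[of y] Cons.prems by auto
  have a: "set (us @ zs) \<subseteq> carrier C" using zs us by simp
  note s = C.lspan_subm[OF a]
  have i: "lspan C k us \<subseteq> lspan C k (us @ zs)" "lspan C k zs \<subseteq> lspan C k (us @ zs)"
    using C.lspan_least[OF s, of us] C.lspan_least[OF s, of zs] C.lspan_sub[OF a] by auto
  have "lam f c \<in> lspan C k (us @ zs)" if c: "c \<in> lspan C k (y # ys)" and f: "form k C f" for c f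
  proof -
    obtain r u where u: "r \<in> carrier k" "u \<in> lspan C k ys" "c = r \<odot>\<^sub>C y \<oplus>\<^sub>C u" using c by (auto elim: C.addlE)
    have uc: "u \<in> carrier C" using C.subm_car[OF C.lspan_subm u(2)] Cons.prems by simp
    have "lam f c = r \<odot>\<^sub>C lam f y \<oplus>\<^sub>C lam f u" using u uc Cons.prems by (simp add: lamD[OF f])
    moreover have "lam f y \<in> lspan C k (us @ zs)" "lam f u \<in> lspan C k (us @ zs)" using i us(2)[OF f] zs(2)[OF u(2) f] by blast+
    ultimately show ?thesis using C.subm_add[OF s] C.subm_smult[OF s u(1)] by metis
  qed
  thus ?case using a by blast
qed

end

locale conn_coal = fcoal k C for k :: "'k ring" and C :: "('k, 'c) coalg" +
  assumes conn: "connected_coalgebra k C"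
begin

text \<open>The coradical is a line, and a simple subcoalgebra is a nonzero subspace of it, hence
  the line itself. A generator has nonzero counit and can be normalised to counit 1; stability of
  the line then makes it grouplike, which is expressed here through \<open>rho\<close>.\<close>

lemma grouplike_exists:
  obtains g where "g \<in> coradical k C" "g \<in> carrier C" "counit C g = \<one>\<^sub>k"
    "!!f. form k C f ==> rho f g = f g \<odot>\<^sub>C g" "!!D. simple_subcoalgebra k C D ==> g \<in> D"
proof -
  interpret k: field k by (rule fk)
  obtain h where h: "h \<in> carrier C" "h ~= \<zero>\<^sub>C" and cor: "coradical k C = {r \<odot>\<^sub>C h |r. r \<in> carrier k}"
    using conn by (auto simp: connected_coalgebra_def)
  have hc: "h \<in> coradical k C" unfolding cor using h(1) by (auto intro!: exI[of _ "\<one>\<^sub>k"])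
  have sub: "S \<subseteq> coradical k C" if "simple_subcoalgebra k C S" for S using that by (auto simp: coradical_def)
  have hS: "h \<in> S" if S: "simple_subcoalgebra k C S" for S
  proof -
    have sm: "C.subm S" and "S ~= {\<zero>\<^sub>C}" using S by (auto simp: simple_subcoalgebra_def subcoalgebra_def)
    then obtain s where s: "s \<in> S" "s ~= \<zero>\<^sub>C" using C.subm_zero[OF sm] by blast
    then obtain r where r: "r \<in> carrier k" "s = r \<odot>\<^sub>C h" using sub[OF S] cor by blast
    hence "r ~= \<zero>\<^sub>k" using s(2) h by auto
    hence u: "r \<in> Units k" using r(1) k.field_Units by simp
    have "inv\<^bsub>k\<^esub> r \<odot>\<^sub>C s \<in> S" using C.subm_smult[OF sm _ s(1)] u by simp
    thus ?thesis using u h(1) by (simp add: r C.smult_assoc1[symmetric])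
  qed
  \<comment> \<open>If there were no simple subcoalgebra, the coradical would be the intersection of
    all subspaces, that is 0.\<close>
  obtain S where S: "simple_subcoalgebra k C S"
  proof (rule ccontr)
    assume "\<not> thesis"
    hence "!!S. \<not> simple_subcoalgebra k C S" using that by blast
    hence "coradical k C \<subseteq> {\<zero>\<^sub>C}" using C.subm_trivial by (auto simp: coradical_def)
    thus False using hc h(2) by blast
  qed
  have st: "stable S" using S subcoalgebra_stable by (simp add: simple_subcoalgebra_def)
  have ec: "counit C h \<in> carrier k" using formD(1)[OF form_counit h(1)] .
  have rh: "\<exists>r\<in>carrier k. rho f h = r \<odot>\<^sub>C h" if f: "form k C f" for f using stableD(1)[OF st hS[OF S] f] sub[OF S] cor by blast
  have fe: "f h = counit C (rho f h)" if f: "form k C f" for f using form_rho_lam[OF f form_counit h(1)] by (simp add: lam_counit h(1))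
  obtain f where f: "form k C f" "f h = \<one>\<^sub>k" using C.form_exists[OF fk C.subm_trivial h(1)] h(2) by blast
  \<comment> \<open>For a form with f(h) = 1, the value f(h) = \<epsilon>(rho f h) is a multiple of
    \<epsilon>(h).\<close>
  have "counit C h ~= \<zero>\<^sub>k"
  proof
    assume z: "counit C h = \<zero>\<^sub>k"
    obtain r where "r \<in> carrier k" "rho f h = r \<odot>\<^sub>C h" using rh[OF f(1)] by blast
    hence "f h = \<zero>\<^sub>k" using fe[OF f(1)] h(1) formD(3)[OF form_counit] z by simp
    thus False using f(2) by simp
  qed
  hence eu: "counit C h \<in> Units k" using ec k.field_Units by simp
  define g where "g = inv\<^bsub>k\<^esub> (counit C h) \<odot>\<^sub>C h"
  have gc: "g \<in> carrier C" using eu h(1) by (simp add: g_def)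
  have ge: "counit C g = \<one>\<^sub>k" using eu h(1) formD(3)[OF form_counit] by (simp add: g_def)
  show thesis
  proof (rule that[OF _ gc ge])
    show "g \<in> coradical k C" unfolding cor g_def using eu by blast
    fix f assume f: "form k C f"
    obtain r where r: "r \<in> carrier k" "rho f h = r \<odot>\<^sub>C h" using rh[OF f] by blast
    have "rho f g = r \<odot>\<^sub>C g" using eu r h(1) by (simp add: g_def rhoD[OF f] C.smult_comm)
    moreover have "f g = r" using form_rho_lam[OF f form_counit gc] gc r(1) ge formD(3)[OF form_counit] calculation by (simp add: lam_counit)
    ultimately show "rho f g = f g \<odot>\<^sub>C g" by simp
  next
    fix D assume D: "simple_subcoalgebra k C D"
    hence "C.subm D" by (simp add: simple_subcoalgebra_def subcoalgebra_def)
    thus "g \<in> D" unfolding g_def using C.subm_smult hS[OF D] eu by blast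
  qed
qed

definition g :: 'c where
  "g = (SOME g. g \<in> coradical k C & g \<in> carrier C & counit C g = \<one>\<^sub>k
    & (\<forall>f. form k C f --> rho f g = f g \<odot>\<^sub>C g) & (\<forall>D. simple_subcoalgebra k C D --> g \<in> D))"

lemma g: "g \<in> coradical k C" "g \<in> carrier C" "counit C g = \<one>\<^sub>k"
    "form k C f ==> rho f g = f g \<odot>\<^sub>C g" "simple_subcoalgebra k C D ==> g \<in> D"
proof -
  have "g \<in> coradical k C & g \<in> carrier C & counit C g = \<one>\<^sub>k
    & (\<forall>f. form k C f --> rho f g = f g \<odot>\<^sub>C g) & (\<forall>D. simple_subcoalgebra k C D --> g \<in> D)"
    unfolding g_def by (rule someI_ex) (use grouplike_exists in metis)
  thus "g \<in> coradical k C" "g \<in> carrier C" "counit C g = \<one>\<^sub>k"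
    "form k C f ==> rho f g = f g \<odot>\<^sub>C g" "simple_subcoalgebra k C D ==> g \<in> D" by blast+
qed

text \<open>\<open>W n\<close> is the annihilator of the \<open>n\<close>-th power of the ideal of the linear forms vanishing on \<open>g\<close>.\<close>

abbreviation "I f \<equiv> form k C f & f g = \<zero>\<^sub>k"

primrec W :: "nat => 'c set" where
  "W 0 = {\<zero>\<^sub>C}"
| "W (Suc n) = {c \<in> carrier C. \<forall>f. I f --> rho f c \<in> W n}"

lemma W_subm: "C.subm (W n)"
proof (induction n)
  case (Suc n)
  show ?case by (rule C.submI) (auto simp: rho_zero rhoD C.subm_zero[OF Suc] C.subm_add[OF Suc] C.subm_smult[OF Suc])
qed (simp add: C.subm_trivial)

lemma W_car: "c \<in> W n ==> c \<in> carrier C" using C.subm_car[OF W_subm] .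

lemma W_Suc: "W n \<subseteq> W (Suc n)"
proof (induction n)
  case (Suc n) thus ?case by auto
qed (auto simp: rho_zero)

lemma W_mono: "m \<le> n ==> W m \<subseteq> W n" by (rule lift_Suc_mono_le[of W]) (rule W_Suc)

text \<open>If h vanishes on g, so does h after \<open>rho f\<close>, because \<open>rho f\<close>
  only scales g; hence the condition that defines the next stage is inherited.\<close>

lemma W_rho: "c \<in> W n ==> form k C f ==> rho f c \<in> W n"
proof (cases n)
  case (Suc m)
  assume c: "c \<in> W n" and f: "form k C f"
  have "rho h (rho f c) \<in> W m" if h: "I h" for h
  proof -
    have "I (%x. h (rho f x))" using form_rho[of h f] h f g(2) formD[of k C h] formD(1)[OF f] by (simp add: g(4))
    thus ?thesis using c rho_rho[OF _ f W_car[OF c], of h] h by (auto simp: Suc)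
  qed
  thus ?thesis using W_car[OF c] f by (simp add: Suc rhoD)
qed (simp add: rho_zero)

text \<open>The stages are defined through \<open>rho\<close>, and this is the corresponding
  inclusion for the other side. For n = 0 adjointness puts \<open>lam f c\<close> on the line of g,
  and the counit shows its coefficient to be f(c) = 0; the induction step uses that the two actions
  commute.\<close>

lemma W_lam: "c \<in> W (Suc n) ==> I f ==> lam f c \<in> W n"
proof (induction n arbitrary: c)
  case 0
  hence c: "c \<in> carrier C" and z: "rho h c = \<zero>\<^sub>C" if "I h" for h using that by auto
  have f: "form k C f" and cc: "c \<in> carrier C" using 0 by auto
  have fc: "f c = \<zero>\<^sub>k" using form_rho_lam[OF f form_counit cc] z[OF 0(2)] form_zero[OF form_counit] by (simp add: lam_counit cc)
  have "lam f c \<in> addl C k g {\<zero>\<^sub>C}"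
  proof (rule ccontr)
    assume "lam f c \<notin> addl C k g {\<zero>\<^sub>C}"
    then obtain h where h: "form k C h" "h (lam f c) = \<one>\<^sub>k" "!!s. s \<in> addl C k g {\<zero>\<^sub>C} ==> h s = \<zero>\<^sub>k"
      using C.form_exists[OF fk C.addl_subm[OF C.subm_trivial g(2)] lamD(1)[OF f cc]] by blast
    have "h g = \<zero>\<^sub>k" using h(3)[OF C.addl_self[OF C.subm_trivial g(2)]] .
    hence "h (lam f c) = \<zero>\<^sub>k" using form_rho_lam[OF h(1) f cc] z[of h] h(1) form_zero[OF f] by simp
    thus False using h(2) domain.one_not_zero[OF field.axioms(1)[OF fk]] by simp
  qed
  then obtain r where r: "r \<in> carrier k" "lam f c = r \<odot>\<^sub>C g" using g(2) by (auto simp: addl_def)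
  have "r = \<zero>\<^sub>k" using form_rho_lam[OF form_counit f cc] r fc g(2,3) formD(3)[OF form_counit r(1) g(2)] by (simp add: rho_counit cc)
  thus ?case using r g(2) by simp
next
  case (Suc n)
  have cc: "c \<in> carrier C" using W_car[OF Suc.prems(1)] .
  have "rho h (lam f c) \<in> W n" if h: "I h" for h using Suc.IH[of "rho h c"] Suc.prems h rho_lam[of h f c] cc by auto
  thus ?case using lamD(1)[of f c] Suc.prems cc by auto
qed

end

context conn_coal begin

lemma one_zero: "\<one>\<^sub>k ~= \<zero>\<^sub>k" using domain.one_not_zero[OF field.axioms(1)[OF fk]] .

lemma pivots_eqI:
  "set ys \<subseteq> carrier C ==> C.subm S ==> C.subm T ==> S \<subseteq> T ==> T \<subseteq> lspan C k ys ==> C.pivots ys T \<le> C.pivots ys S ==> S = T"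
  using C.pivots_inj[OF fk, of ys S T] C.pivots_mono[of S T ys] by (simp add: le_antisym)

text \<open>The elements of the right coideal \<open>S\<close> that the ideal of \<open>g\<close> does not move into \<open>S'\<close> can be moved
  into \<open>S'\<close> by a form with value 1 at \<open>g\<close>, if \<open>S / S'\<close> is a simple comodule other than \<open>k g\<close>.\<close>

lemma shift_into:
  assumes S: "C.subm S" "!!c f. c \<in> S ==> form k C f ==> rho f c \<in> S"
    and S': "C.subm S'" "!!c f. c \<in> S' ==> form k C f ==> rho f c \<in> S'" "S' \<subseteq> S"
    and simple: "!!T. C.subm T ==> (!!c f. c \<in> T ==> form k C f ==> rho f c \<in> T) ==> S' \<subseteq> T ==> T \<subseteq> S ==> T = S' \<or> T = S"
    and fixed: "!!s. s \<in> S ==> (!!f. I f ==> rho f s \<in> S') ==> s \<in> S'"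
    and s: "s \<in> S"
  shows "\<exists>F. form k C F & F g = \<one>\<^sub>k & rho F s \<in> S'"
proof (cases "s \<in> S'")
  case True
  thus ?thesis using S'(2) form_counit g(3) by blast
next
  case False
  note Sc = C.subm_car[OF S(1)] and S'c = C.subm_car[OF S'(1)]
  note sc = Sc[OF s]
  \<comment> \<open>The images of s under the forms vanishing on g, enlarged by S'. This space is
    stable under \<open>rho\<close>, and \<open>fixed\<close> prevents it from being S' since s is
    outside S'; simplicity then makes it all of S.\<close>
  let ?T = "{rho f s \<oplus>\<^sub>C w |f w. I f & w \<in> S'}"
  have iz: "I (%x. \<zero>\<^sub>k)" by (simp add: klinear_def)
  have z: "rho (%x. \<zero>\<^sub>k) s = \<zero>\<^sub>C"
    using rho_form_lin[OF iz[THEN conjunct1] iz[THEN conjunct1] C.R.one_closed sc] rhoD(1)[OF iz[THEN conjunct1] sc] by simp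
  note l = rho_form_lin[OF _ _ _ sc]
  have T: "C.subm ?T"
  proof (rule C.submI)
    show "?T \<subseteq> carrier C" using sc S'c by (auto simp: rhoD)
    show "\<zero>\<^sub>C \<in> ?T" using iz z C.subm_zero[OF S'(1)] by (intro CollectI exI[of _ "%x. \<zero>\<^sub>k"] exI[of _ "\<zero>\<^sub>C"]) simp
    fix x y r assume "x \<in> ?T"
    then obtain f w where x: "x = rho f s \<oplus>\<^sub>C w" "I f" "w \<in> S'" by blast
    note xc = rhoD(1)[OF x(2)[THEN conjunct1] sc] S'c[OF x(3)]
    show "r \<odot>\<^sub>C x \<in> ?T" if r: "r \<in> carrier k"
    proof -
      have "r \<odot>\<^sub>C x = rho (%x. \<zero>\<^sub>k \<oplus>\<^sub>k r \<otimes>\<^sub>k f x) s \<oplus>\<^sub>C r \<odot>\<^sub>C w"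
        using x r xc l[OF iz[THEN conjunct1] x(2)[THEN conjunct1] r] z by (simp only: C.smult_r_distr C.M.l_zero C.smult_closed)
      moreover have "I (%x. \<zero>\<^sub>k \<oplus>\<^sub>k r \<otimes>\<^sub>k f x)" using form_lin[OF iz[THEN conjunct1] x(2)[THEN conjunct1] r] x(2) r by simp
      ultimately show ?thesis using C.subm_smult[OF S'(1) r x(3)] by blast
    qed
    assume "y \<in> ?T"
    then obtain f' w' where y: "y = rho f' s \<oplus>\<^sub>C w'" "I f'" "w' \<in> S'" by blast
    note yc = rhoD(1)[OF y(2)[THEN conjunct1] sc] S'c[OF y(3)]
    have "x \<oplus>\<^sub>C y = rho (%x. f x \<oplus>\<^sub>k \<one>\<^sub>k \<otimes>\<^sub>k f' x) s \<oplus>\<^sub>C (w \<oplus>\<^sub>C w')"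
      using x y xc yc l[OF x(2)[THEN conjunct1] y(2)[THEN conjunct1] C.R.one_closed] by (simp add: C.M.a_ac)
    moreover have "I (%x. f x \<oplus>\<^sub>k \<one>\<^sub>k \<otimes>\<^sub>k f' x)" using form_lin[OF x(2)[THEN conjunct1] y(2)[THEN conjunct1] C.R.one_closed] x(2) y(2) by simp
    ultimately show "x \<oplus>\<^sub>C y \<in> ?T" using C.subm_add[OF S'(1) x(3) y(3)] by blast
  qed
  have st: "rho h c \<in> ?T" if c: "c \<in> ?T" and h: "form k C h" for c h
  proof -
    obtain f w where x: "c = rho f s \<oplus>\<^sub>C w" "I f" "w \<in> S'" using c by blast
    have "I (%x. h (rho f x))" using form_rho[OF h] x(2) g(2) formD(3)[OF h] formD(1)[OF h g(2)] form_zero[OF h] by (simp add: g(4))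
    moreover have "rho h c = rho (%x. h (rho f x)) s \<oplus>\<^sub>C rho h w" using x sc S'c by (simp add: rhoD rho_rho[OF h _ sc] h)
    ultimately show ?thesis using S'(2)[OF x(3) h] by blast
  qed
  have "S' \<subseteq> ?T" using iz z S'c by (force intro!: exI[of _ "%x. \<zero>\<^sub>k"])
  moreover have "?T \<subseteq> S" using S(2)[OF s] S'(3) C.subm_add[OF S(1)] by blast
  moreover have "?T ~= S'"
  proof -
    obtain f where f: "I f" "rho f s \<notin> S'" using fixed[OF s] False by blast
    have "rho f s \<oplus>\<^sub>C \<zero>\<^sub>C \<in> ?T" using f(1) C.subm_zero[OF S'(1)] by blast
    thus ?thesis using f rhoD(1)[OF f(1)[THEN conjunct1] sc] by auto
  qed
  ultimately have "?T = S" using simple[OF T st] by blast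
  then obtain f w where f: "s = rho f s \<oplus>\<^sub>C w" "I f" "w \<in> S'" using s by blast
  note fc = rhoD(1)[OF f(2)[THEN conjunct1] sc] and wc = S'c[OF f(3)]
  \<comment> \<open>Since s = rho f s + w, the form \<epsilon> - f moves s to w; its value at g is 1
    because f vanishes there.\<close>
  let ?F = "%x. counit C x \<oplus>\<^sub>k (\<ominus>\<^sub>k \<one>\<^sub>k) \<otimes>\<^sub>k f x"
  have "rho ?F s = s \<ominus>\<^sub>C rho f s"
    using l[OF form_counit f(2)[THEN conjunct1], of "\<ominus>\<^sub>k \<one>\<^sub>k"] sc fc by (simp add: rho_counit a_minus_def C.smult_l_minus)
  also have "... = (rho f s \<oplus>\<^sub>C w) \<ominus>\<^sub>C rho f s" using f(1) by (rule arg_cong)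
  also have "... = w" using fc wc by (simp add: C.add_sub_cancel)
  finally have "rho ?F s \<in> S'" using f(3) by simp
  moreover have "form k C ?F" "?F g = \<one>\<^sub>k" using form_lin[OF form_counit, of f "\<ominus>\<^sub>k \<one>\<^sub>k"] f(2) by (simp_all add: g(3))
  ultimately show ?thesis by blast
qed

text \<open>A counterexample lies in a finite-dimensional comodule E. Above the part S' of E reached
  by the filtration there is a simple subquotient S / S' without vectors killed by all forms that
  vanish on g. Its coefficients span a subcoalgebra, which must contain g, and a form that shifts S
  into S' gives a contradiction at g.\<close>

lemma W_exhaust:
  assumes c: "c \<in> carrier C" shows "\<exists>n. c \<in> W n"
proof (rule ccontr)
  assume nc: "\<nexists>n. c \<in> W n"
  obtain ys where ys: "set ys \<subseteq> carrier C" "!!f. form k C f ==> rho f c \<in> lspan C k ys" using rho_span[OF c] by blast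
  let ?L = "lspan C k ys"
  note L = C.lspan_subm[OF ys(1)]
  \<comment> \<open>The largest subspace that every \<open>rho f\<close> maps into
    \<open>?L\<close>. It is stable under all \<open>rho f\<close> and, by the counit, contained in
    \<open>?L\<close>, hence finite dimensional.\<close>
  define E where "E = {x \<in> carrier C. \<forall>f. form k C f --> rho f x \<in> ?L}"
  have E: "C.subm E" unfolding E_def by (rule C.submI) (auto simp: rhoD rho_zero C.subm_zero[OF L] C.subm_add[OF L] C.subm_smult[OF L])
  have Er: "rho f x \<in> E" if "x \<in> E" "form k C f" for x f using that form_rho by (auto simp: E_def rhoD rho_rho)
  have EL: "E \<subseteq> ?L" using form_counit by (force simp: E_def rho_counit)
  have cE: "c \<in> E" using c ys(2) by (simp add: E_def)
  \<comment> \<open>Dimensions are bounded by the length of \<open>ys\<close>, so some intersection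
    of E with \<open>W n\<close> is of maximal dimension and the filtration of E stops
    there.\<close>
  obtain n where n: "!!m. C.pivots ys (E \<inter> W m) \<le> C.pivots ys (E \<inter> W n)"
    using ex_has_greatest_nat[of "%_. True" 0 "%m. C.pivots ys (E \<inter> W m)" "Suc (length ys)"] C.pivots_le by (auto simp: less_Suc_eq_le)
  define S' where "S' = E \<inter> W n"
  have S': "C.subm S'" "!!c f. c \<in> S' ==> form k C f ==> rho f c \<in> S'" unfolding S'_def using C.subm_inter[OF E W_subm] Er W_rho by auto
  have Sn: "E \<inter> W m \<subseteq> S'" for m
  proof (cases "m \<le> n")
    case True thus ?thesis using W_mono unfolding S'_def by blast
  next
    case False
    have "S' = E \<inter> W m" unfolding S'_def
      by (rule pivots_eqI[OF ys(1) C.subm_inter[OF E W_subm] C.subm_inter[OF E W_subm] _ _ n]) (use W_mono[of n m] False EL in auto)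
    thus ?thesis by simp
  qed
  define P where "P S \<longleftrightarrow> C.subm S & (\<forall>c f. c \<in> S --> form k C f --> rho f c \<in> S) & S' \<subseteq> S & S \<subseteq> E" for S
  have "P E & E ~= S'" using E Er cE nc by (auto simp: P_def S'_def)
  then obtain S where S: "P S" "S ~= S'" and min: "!!T. P T ==> T ~= S' ==> C.pivots ys S \<le> C.pivots ys T"
    using ex_has_least_nat[of "%S. P S & S ~= S'" E "C.pivots ys"] by auto
  have Ss: "C.subm S" "!!c f. c \<in> S ==> form k C f ==> rho f c \<in> S" "S' \<subseteq> S" "S \<subseteq> E" using S(1) by (auto simp: P_def)
  note Sc = C.subm_car[OF Ss(1)]
  have simple: "T = S' \<or> T = S" if T: "C.subm T" "!!c f. c \<in> T ==> form k C f ==> rho f c \<in> T" "S' \<subseteq> T" "T \<subseteq> S" for T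
  proof (cases "T = S'")
    case False
    have "P T" using T Ss(4) by (auto simp: P_def)
    hence "T = S" using pivots_eqI[OF ys(1) T(1) Ss(1) T(4) _ min[OF _ False]] Ss(4) EL by blast
    thus ?thesis ..
  qed simp
  \<comment> \<open>Such an s lies in \<open>W (Suc n)\<close>, whose intersection with E is already
    contained in S'.\<close>
  have fixed: "s \<in> S'" if "s \<in> S" "!!f. I f ==> rho f s \<in> S'" for s using that Ss(4) Sn[of "Suc n"] Sc by (auto simp: S'_def)
  have shift: "\<exists>F. form k C F & F g = \<one>\<^sub>k & rho F s \<in> S'" if s: "s \<in> S" for s
    by (rule shift_into[of S S' s]) (fact Ss(1) Ss(2) Ss(3) S' simple fixed s)+
  \<comment> \<open>The forms on S / S'. The elements \<open>lam l s\<close> with l in J and s in S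
    are the matrix coefficients of this comodule, and T0 is their span.\<close>
  define J where "J = {l. form k C l & (\<forall>w\<in>S'. l w = \<zero>\<^sub>k)}"
  have Jf: "form k C l" "!!w. w \<in> S' ==> l w = \<zero>\<^sub>k" if "l \<in> J" for l using that by (auto simp: J_def)
  define T0 where "T0 = tsum C lam ` {xs. set xs \<subseteq> J \<times> S}"
  have tcl: "tsum C lam xs \<in> carrier C" if "set xs \<subseteq> J \<times> S" for xs
    by (rule tsum_subm[OF C.subm_carrier], rule lamD(1)[OF Jf(1) Sc]) (use that in auto)
  have tapp: "tsum C lam (xs @ zs) = tsum C lam xs \<oplus>\<^sub>C tsum C lam zs" if "set xs \<subseteq> J \<times> S" "set zs \<subseteq> J \<times> S" for xs zs
    using that by (induction xs) (auto simp: tcl lamD Jf Sc C.M.a_assoc)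
  have T0: "C.subm T0"
  proof (rule C.submI)
    show "T0 \<subseteq> carrier C" using tcl by (auto simp: T0_def)
    show "\<zero>\<^sub>C \<in> T0" unfolding T0_def by (rule image_eqI[of _ _ "[]"]) auto
    show "x \<oplus>\<^sub>C y \<in> T0" if xy: "x \<in> T0" "y \<in> T0" for x y
    proof -
      obtain xs zs where "set xs \<subseteq> J \<times> S" "x = tsum C lam xs" "set zs \<subseteq> J \<times> S" "y = tsum C lam zs" using xy by (auto simp: T0_def)
      thus ?thesis unfolding T0_def by (intro image_eqI[of _ _ "xs @ zs"]) (auto simp: tapp)
    qed
    show "r \<odot>\<^sub>C x \<in> T0" if r: "r \<in> carrier k" and x: "x \<in> T0" for r x
    proof -
      obtain xs where xs: "set xs \<subseteq> J \<times> S" "x = tsum C lam xs" using x by (auto simp: T0_def)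
      have "r \<odot>\<^sub>C tsum C lam xs = tsum C lam (map (%(l, s). (l, r \<odot>\<^sub>C s)) xs)"
        using xs(1) by (induction xs) (auto simp: tcl lamD Jf Sc r C.smult_r_distr)
      thus ?thesis unfolding T0_def xs(2) using xs(1) C.subm_smult[OF Ss(1) r] by (intro image_eqI[of _ _ "map (%(l, s). (l, r \<odot>\<^sub>C s)) xs"]) auto
    qed
  qed
  have gT0: "lam l s \<in> T0" if "l \<in> J" "s \<in> S" for l s
    unfolding T0_def by (rule image_eqI[of _ _ "[(l, s)]"]) (use that Jf Sc in \<open>auto simp: lamD\<close>)
  have T0ind: "T0 \<subseteq> D" if D: "C.subm D" "!!l s. l \<in> J ==> s \<in> S ==> lam l s \<in> D" for D
    unfolding T0_def using D(2) by (auto intro!: tsum_subm[OF D(1)])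
  \<comment> \<open>By adjointness h(lam l w) = l(rho h w), and \<open>rho h\<close> preserves S'.
    This yields the stability of T0 under \<open>lam\<close>.\<close>
  have Jlam: "(%x. h (lam l x)) \<in> J" if hl: "l \<in> J" "form k C h" for l h unfolding J_def
  proof (intro CollectI conjI ballI)
    show "form k C (%x. h (lam l x))" by (rule form_lam[OF hl(2) Jf(1)[OF hl(1)]])
    show "h (lam l w) = \<zero>\<^sub>k" if w: "w \<in> S'" for w
      using form_rho_lam[OF hl(2) Jf(1)[OF hl(1)] C.subm_car[OF S'(1) w]] Jf(2)[OF hl(1) S'(2)[OF w hl(2)]] by simp
  qed
  have "stable T0" unfolding stable_def
  proof (intro conjI allI impI T0)
    fix h assume h: "form k C h"
    show "rho h ` T0 \<subseteq> T0" using T0ind[OF C.subm_vimage[OF rho_kl[OF h] gC T0]] gT0 Ss(2) Sc Jf h by (auto simp: lamD rho_lam)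
    show "lam h ` T0 \<subseteq> T0" using T0ind[OF C.subm_vimage[OF lam_kl[OF h] gC T0]] gT0 Jlam Sc Jf h by (auto simp: lamD lam_lam)
  qed
  moreover obtain zs where zs: "set zs \<subseteq> carrier C" "T0 \<subseteq> lspan C k zs"
  proof -
    obtain zs where "set zs \<subseteq> carrier C" "\<forall>c\<in>?L. \<forall>f. form k C f --> lam f c \<in> lspan C k zs" using lam_span_list[OF ys(1)] by blast
    thus ?thesis using that T0ind[OF C.lspan_subm[of zs]] Ss(4) EL Jf by blast
  qed
  moreover have "T0 ~= {\<zero>\<^sub>C}"
  proof -
    obtain s where s: "s \<in> S" "s \<notin> S'" using S(2) Ss(3) by blast
    obtain l where l: "form k C l" "l s = \<one>\<^sub>k" "!!w. w \<in> S' ==> l w = \<zero>\<^sub>k" using C.form_exists[OF fk S'(1) Sc[OF s(1)] s(2)] by blast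
    have "counit C (lam l s) = \<one>\<^sub>k" using form_rho_lam[OF form_counit l(1) Sc[OF s(1)]] by (simp add: rho_counit Sc s l)
    hence "lam l s ~= \<zero>\<^sub>C" using form_zero[OF form_counit] one_zero by auto
    thus ?thesis using gT0[of l s] l s by (auto simp: J_def)
  qed
  \<comment> \<open>A nonzero stable subspace of T0 of least dimension is a simple subcoalgebra, and
    every simple subcoalgebra contains g.\<close>
  ultimately obtain D where D: "stable D" "D \<subseteq> T0" "D ~= {\<zero>\<^sub>C}"
    and Dmin: "!!U. stable U & U \<subseteq> T0 & U ~= {\<zero>\<^sub>C} ==> C.pivots zs D \<le> C.pivots zs U"
    using ex_has_least_nat[of "%D. stable D & D \<subseteq> T0 & D ~= {\<zero>\<^sub>C}" T0 "C.pivots zs"] by blast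
  have "simple_subcoalgebra k C D" unfolding simple_subcoalgebra_def subcoalgebra_stable
  proof (intro conjI allI impI D)
    fix U assume U: "stable U & U \<subseteq> D"
    show "U = {\<zero>\<^sub>C} \<or> U = D"
    proof (cases "U = {\<zero>\<^sub>C}")
      case False
      have "U = D" by (rule pivots_eqI[OF zs(1) _ _ _ _ Dmin]) (use U D zs False in \<open>auto simp: stable_def\<close>)
      thus ?thesis ..
    qed simp
  qed
  hence "g \<in> T0" using g(5) D(2) by blast
  then obtain xs where xs: "set xs \<subseteq> J \<times> S" "g = tsum C lam xs" by (auto simp: T0_def)
  \<comment> \<open>One form for all s in the list, obtained by composing the individual shifts.
    Vectors that have reached S' stay there, and the value at g stays 1 because each
    \<open>rho F\<close> fixes g.\<close>
  have "\<exists>F. form k C F & F g = \<one>\<^sub>k & (\<forall>s\<in>snd ` set xs. rho F s \<in> S')" using xs(1)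
  proof (induction xs)
    case Nil thus ?case using form_counit g(3) by auto
  next
    case (Cons q xs)
    obtain l s where q: "q = (l, s)" by fastforce
    obtain F where F: "form k C F" "F g = \<one>\<^sub>k" "!!s. s \<in> snd ` set xs ==> rho F s \<in> S'" using Cons by auto
    have s: "s \<in> S" "!!s. s \<in> snd ` set xs ==> s \<in> carrier C" using Cons.prems Sc by (auto simp: q)
    obtain F' where F': "form k C F'" "F' g = \<one>\<^sub>k" "rho F' (rho F s) \<in> S'" using shift[OF Ss(2)[OF s(1) F(1)]] by blast
    have "rho (%x. F' (rho F x)) t \<in> S'" if t: "t \<in> snd ` set (q # xs)" for t
    proof -
      have "t = s \<or> t \<in> snd ` set xs" using t by (simp add: q)
      hence "rho F' (rho F t) \<in> S'" "t \<in> carrier C" using F(3)[of t] F'(3) S'(2)[OF _ F'(1)] s(2)[of t] Sc[OF s(1)] by blast+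
      thus ?thesis by (simp add: rho_rho[OF F'(1) F(1)])
    qed
    moreover have "F' (rho F g) = \<one>\<^sub>k" using F F' g(2) by (simp add: g(4))
    ultimately show ?case using form_rho[OF F'(1) F(1)] by blast
  qed
  then obtain F where F: "form k C F" "F g = \<one>\<^sub>k" "!!s. s \<in> snd ` set xs ==> rho F s \<in> S'" by blast
  \<comment> \<open>Each summand is F(lam l s) = l(rho F s) = 0, since l vanishes on S'.\<close>
  have "F (tsum C lam xs) = \<zero>\<^sub>k" using xs(1) F(3)
  proof (induction xs)
    case Nil thus ?case using form_zero[OF F(1)] by simp
  next
    case (Cons q xs)
    obtain l s where q: "q = (l, s)" by fastforce
    have ls: "l \<in> J" "s \<in> S" "rho F s \<in> S'" using Cons.prems by (auto simp: q)
    have "F (lam l s) = \<zero>\<^sub>k" using form_rho_lam[OF F(1) Jf(1)[OF ls(1)] Sc[OF ls(2)]] Jf(2)[OF ls(1,3)] by simp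
    thus ?case using Cons ls Sc Jf(1) by (simp add: q formD[OF F(1)] lamD tcl)
  qed
  thus False using F(2) xs(2) one_zero by simp
qed

end

section \<open>Homogeneous cocycles\<close>

lemma tsum_swap: "tsum X B (map prod.swap zs) = tsum X (%x y. B y x) zs" by (induction zs) auto

context gspace begin

text \<open>The differential has degree 1, so the homogeneous components of a cocycle are again
  cocycles.\<close>

lemma cocycle_induct [consumes 3, case_names hom add]:
  assumes "deg_linear k V V 1 (diff V)" "v \<in> carrier V" "diff V v = \<zero>\<^sub>V"
    and "!!n z. z \<in> grade V n ==> diff V z = \<zero>\<^sub>V ==> P z"
    and "!!y z. y \<in> carrier V ==> z \<in> carrier V ==> diff V y = \<zero>\<^sub>V ==> diff V z = \<zero>\<^sub>V ==> P y ==> P z ==> P (y \<oplus>\<^sub>V z)"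
  shows "P v"
proof -
  note d = deg_linearD[OF assms(1)]
  have dh: "diff V (hcomp V i v) = \<zero>\<^sub>V" for i
    using hcomp_deg[OF gspace_axioms assms(1,2), of i] assms(3) hcomp_hom[OF g_zero[of "i + 1"], of "i + 1"] by simp
  have d0: "diff V \<zero>\<^sub>V = \<zero>\<^sub>V" by (rule additive_zero[OF ab ab deg_additive[OF assms(1)]])
  let ?s = "%S. \<Oplus>\<^sub>V i\<in>S. hcomp V i v"
  have "?s S \<in> carrier V & diff V (?s S) = \<zero>\<^sub>V & P (?s S)" if "finite S" for S using that
  proof induction
    case empty thus ?case using assms(4)[OF g_zero d0] d0 by simp
  next
    case (insert a S)
    thus ?case using assms(2) dh assms(4)[OF hcomp_g dh] by (auto simp: M.finsum_insert d Pi_iff intro!: assms(5))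
  qed
  from this[OF hcomp_finite[OF assms(2)]] show ?thesis using hcomp_sum[OF assms(2) hcomp_finite[OF assms(2)] subset_refl] by simp
qed

text \<open>The operator that multiplies degree i by (-1)^(n i). It hides a Koszul sign inside an
  argument, so that a signed family becomes a bilinear map defined on all elements.\<close>

definition sg :: "int => 'v => 'v" where
  "sg n = hsum V V (%i v. ksgn k (n * i) \<odot>\<^sub>V v)"

lemma sg: "klinear k V V (sg n)" "v \<in> grade V i ==> sg n v = ksgn k (n * i) \<odot>\<^sub>V v"
proof -
  have m: "module k V" ..
  have a: "addfam V V (%i v. ksgn k (n * i) \<odot>\<^sub>V v)" by (auto simp: addfam_def gcar smult_r_distr)
  show "v \<in> grade V i ==> sg n v = ksgn k (n * i) \<odot>\<^sub>V v" unfolding sg_def by (rule hsum_hom[OF ab a])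
  have "sg n (r \<odot>\<^sub>V x) = r \<odot>\<^sub>V sg n x" if "r \<in> carrier k" "x \<in> carrier V" for r x
    unfolding sg_def by (rule hsum_smult[OF m a that(2,1)]) (simp add: gcar smult_comm that(1))
  thus "klinear k V V (sg n)" using additiveD[OF hsum_additive[OF ab a]] by (auto simp: klinear_def sg_def)
qed

end

lemma acyclic_spaceI:
  assumes "dg_space k V" "!!n z. z \<in> grade V n ==> diff V z = \<zero>\<^sub>V ==> \<exists>y\<in>carrier V. diff V y = z"
  shows "acyclic_space V"
proof -
  have d: "deg_linear k V V 1 (diff V)" "!!v. v \<in> carrier V ==> diff V (diff V v) = \<zero>\<^sub>V" and g: "graded_space k V"
    using assms(1) by (auto simp: dg_space_def)
  interpret gspace k V using g by (rule gspaceI)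
  note dl = deg_linearD[OF d(1)]
  have "\<exists>y\<in>carrier V. diff V y = v" if "v \<in> carrier V" "diff V v = \<zero>\<^sub>V" for v using d(1) that
  proof (induction rule: cocycle_induct)
    case (hom n z) thus ?case by (rule assms(2))
  next
    case (add y z) thus ?case by (metis M.a_closed dl(2))
  qed
  thus ?thesis using d(2) dl(1) by (auto simp: acyclic_space_def cocycles_def coboundaries_def)
qed

lemma acyclic_spaceD:
  assumes "dg_space k V" "acyclic_space V" "z \<in> grade V n" "diff V z = \<zero>\<^sub>V"
  shows "\<exists>y\<in>grade V (n - 1). diff V y = z"
proof -
  interpret gspace k V using assms(1) by (intro gspaceI) (simp add: dg_space_def)
  have d: "deg_linear k V V 1 (diff V)" using assms(1) by (simp add: dg_space_def)
  have "z \<in> coboundaries V" using assms(2-4) gcar by (auto simp: acyclic_space_def cocycles_def)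
  then obtain y where y: "y \<in> carrier V" "diff V y = z" by (auto simp: coboundaries_def)
  thus ?thesis using hcomp_deg[OF gspace_axioms d y(1), of "n - 1"] hcomp_hom[OF assms(3)] by (intro bexI[of _ "hcomp V (n - 1) y"]) simp_all
qed

section \<open>Cohomology\<close>

locale dgs = gspace k V for k :: "'k ring" and V :: "('k, 'v, 'z) dgspace_scheme" +
  assumes dg: "dg_space k V"
begin

lemma d_deg: "deg_linear k V V 1 (diff V)" and dd: "v \<in> carrier V ==> diff V (diff V v) = \<zero>\<^sub>V" using dg by (auto simp: dg_space_def)

lemmas dl = deg_linearD[OF d_deg]

lemma d0: "diff V \<zero>\<^sub>V = \<zero>\<^sub>V" by (rule additive_zero[OF ab ab deg_additive[OF d_deg]])

lemma BI: "v \<in> carrier V ==> diff V v \<in> coboundaries V" by (simp add: coboundaries_def)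

lemma ZD: "z \<in> cocycles V ==> z \<in> carrier V" "z \<in> cocycles V ==> diff V z = \<zero>\<^sub>V" by (simp_all add: cocycles_def)

lemma Z_subm: "submodule (cocycles V) k V" by (rule submI) (auto simp: cocycles_def dl d0)

lemma B_subm: "submodule (coboundaries V) k V"
proof (rule submI)
  show "\<zero>\<^sub>V \<in> coboundaries V" using BI[of "\<zero>\<^sub>V"] d0 by simp
qed (auto simp: coboundaries_def dl, metis imageI M.a_closed dl(2), metis imageI smult_closed dl(3))

lemma B_Z: "b \<in> coboundaries V ==> b \<in> cocycles V" by (auto simp: coboundaries_def cocycles_def dl dd)

lemma coset_eq: "x \<in> carrier V ==> y \<in> carrier V ==>
    coboundaries V +>\<^sub>V x = coboundaries V +>\<^sub>V y \<longleftrightarrow> x \<ominus>\<^sub>V y \<in> coboundaries V"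
proof -
  assume x: "x \<in> carrier V" and y: "y \<in> carrier V"
  have "additive_subgroup (coboundaries V) V" using B_subm by (simp add: additive_subgroup_def submodule_def)
  then interpret abelian_subgroup "coboundaries V" V by (intro abelian_subgroupI3 ab)
  show ?thesis using a_rcos_self[OF x] a_repr_independence'[OF _ y] a_rcos_module[OF y x] unfolding a_minus_def by metis
qed

lemma carrier_cohomology: "carrier (cohomology V) = (%z. coboundaries V +>\<^sub>V z) ` cocycles V"
  by (auto simp: cohomology_def FactRing_def A_RCOSETS_def RCOSETS_def a_r_coset_def r_coset_def)

end

lemma dgsI: "dg_space k V ==> dgs k V" by (simp add: dgs_def dgs_axioms_def gspaceI dg_space_def)

locale dgs2 = V: dgs k V + W: dgs k W
  for k :: "'k ring" and V :: "('k, 'v, 'y) dgspace_scheme" and W :: "('k, 'w, 'z) dgspace_scheme" +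
  fixes f
  assumes ch: "chain_map k V W f"
begin

lemma f_deg: "deg_linear k V W 0 f" and fd: "v \<in> carrier V ==> f (diff V v) = diff W (f v)" using ch by (auto simp: chain_map_def)

lemmas fl = deg_linearD[OF f_deg]
lemmas fm = additive_diff[OF V.ab W.ab deg_additive[OF f_deg]]

lemma fZ: "z \<in> cocycles V ==> f z \<in> cocycles W" using additive_zero[OF V.ab W.ab deg_additive[OF f_deg]] by (auto simp: cocycles_def fl fd[symmetric])

lemma fB: "b \<in> coboundaries V ==> f b \<in> coboundaries W" by (auto simp: coboundaries_def fl fd)

lemma coset_map: "z \<in> carrier V ==> coboundaries W <+>\<^sub>W (f ` (coboundaries V +>\<^sub>V z)) = coboundaries W +>\<^sub>W f z"
proof -
  assume z: "z \<in> carrier V"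
  note bV = V.subm_car[OF V.B_subm] and bW = W.subm_car[OF W.B_subm]
  have e: "b \<oplus>\<^sub>W f (b' \<oplus>\<^sub>V z) = (b \<oplus>\<^sub>W f b') \<oplus>\<^sub>W f z" if "b \<in> coboundaries W" "b' \<in> coboundaries V" for b b'
    using bW[OF that(1)] bV[OF that(2)] z by (simp add: fl W.M.a_assoc)
  have "b \<oplus>\<^sub>W f z = b \<oplus>\<^sub>W f (\<zero>\<^sub>V \<oplus>\<^sub>V z)" for b using z by simp
  thus ?thesis using e W.subm_add[OF W.B_subm _ fB] V.subm_zero[OF V.B_subm]
    unfolding set_add_def set_mult_def a_r_coset_def r_coset_def by (fastforce simp: image_iff)
qed

text \<open>Cosets of coboundaries are compared through differences, which turns bijectivity on
  cohomology into two statements about cocycles.\<close>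

lemma quasi_iso_iff: "quasi_iso k V W f \<longleftrightarrow> (\<forall>z\<in>cocycles V. f z \<in> coboundaries W --> z \<in> coboundaries V)
    & (\<forall>w\<in>cocycles W. \<exists>z\<in>cocycles V. w \<ominus>\<^sub>W f z \<in> coboundaries W)" (is "_ \<longleftrightarrow> ?I & ?S")
proof -
  let ?h = "%X. coboundaries W <+>\<^sub>W (f ` X)"
  note cm = coset_map[OF V.ZD(1)]
  have "inj_on ?h (carrier (cohomology V)) \<longleftrightarrow>
      (\<forall>z\<in>cocycles V. \<forall>z'\<in>cocycles V. f (z \<ominus>\<^sub>V z') \<in> coboundaries W --> z \<ominus>\<^sub>V z' \<in> coboundaries V)"
    unfolding V.carrier_cohomology inj_on_def by (simp add: cm W.coset_eq V.coset_eq V.ZD fl fm)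
  also have "... \<longleftrightarrow> ?I"
  proof (intro iffI ballI impI)
    fix z assume h: "\<forall>z\<in>cocycles V. \<forall>z'\<in>cocycles V. f (z \<ominus>\<^sub>V z') \<in> coboundaries W --> z \<ominus>\<^sub>V z' \<in> coboundaries V"
      and z: "z \<in> cocycles V" "f z \<in> coboundaries W"
    have "z \<ominus>\<^sub>V \<zero>\<^sub>V = z" using V.ZD(1)[OF z(1)] by (simp add: a_minus_def V.minus_as_ksgn)
    thus "z \<in> coboundaries V" using h[rule_format, OF z(1) V.subm_zero[OF V.Z_subm]] z(2) by simp
  qed (use V.subm_minus[OF V.Z_subm] in blast)
  finally have 1: "inj_on ?h (carrier (cohomology V)) \<longleftrightarrow> ?I" .
  have 2: "?h ` carrier (cohomology V) = (%z. coboundaries W +>\<^sub>W f z) ` cocycles V"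
    unfolding V.carrier_cohomology image_image by (rule image_cong) (simp_all add: cm)
  have "?h ` carrier (cohomology V) = carrier (cohomology W) \<longleftrightarrow>
      (\<forall>w\<in>cocycles W. \<exists>z\<in>cocycles V. coboundaries W +>\<^sub>W w = coboundaries W +>\<^sub>W f z)" unfolding W.carrier_cohomology 2
  proof (intro iffI ballI)
    fix w assume e: "(%z. coboundaries W +>\<^sub>W f z) ` cocycles V = (%z. coboundaries W +>\<^sub>W z) ` cocycles W" and "w \<in> cocycles W"
    hence "coboundaries W +>\<^sub>W w \<in> (%z. coboundaries W +>\<^sub>W f z) ` cocycles V" by blast
    thus "\<exists>z\<in>cocycles V. coboundaries W +>\<^sub>W w = coboundaries W +>\<^sub>W f z" by blast
  next
    assume "\<forall>w\<in>cocycles W. \<exists>z\<in>cocycles V. coboundaries W +>\<^sub>W w = coboundaries W +>\<^sub>W f z"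
    thus "(%z. coboundaries W +>\<^sub>W f z) ` cocycles V = (%z. coboundaries W +>\<^sub>W z) ` cocycles W"
      by (intro subset_antisym image_subsetI imageI fZ) blast+
  qed
  also have "... \<longleftrightarrow> ?S" by (simp add: W.coset_eq W.ZD fl V.ZD cong: bex_cong)
  finally show ?thesis using 1 ch by (simp add: quasi_iso_def bij_betw_def)
qed

end

lemma dgs2I: "dg_space k V ==> dg_space k W ==> chain_map k V W f ==> dgs2 k V W f" by (simp add: dgs2_def dgs2_axioms_def dgsI)

context dga begin

sublocale D: dgs k A by (rule dgsI[OF A_dg])

lemma Z_mult: "x \<in> cocycles A ==> y \<in> cocycles A ==> x \<otimes>\<^sub>A y \<in> cocycles A"
proof -
  assume x: "x \<in> cocycles A" and y: "y \<in> cocycles A"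
  from dA_deg D.ZD[OF x] show ?thesis
  proof (induction rule: A.cocycle_induct)
    case (hom n z) thus ?case using D.ZD[OF y] A.gcar[OF hom(1)] by (simp add: cocycles_def leibA)
  next
    case (add u v)
    thus ?case using D.ZD[OF y] A.subm_add[OF D.Z_subm] by (simp add: AR.l_distr)
  qed
qed

lemma Z_B_mult: "x \<in> cocycles A ==> b \<in> coboundaries A ==> x \<otimes>\<^sub>A b \<in> coboundaries A"
proof -
  assume x: "x \<in> cocycles A" and "b \<in> coboundaries A"
  then obtain u where u: "u \<in> carrier A" "b = diff A u" by (auto simp: coboundaries_def)
  from dA_deg D.ZD[OF x] show ?thesis
  proof (induction rule: A.cocycle_induct)
    case (hom n z)
    have "z \<otimes>\<^sub>A b = diff A (ksgn k n \<odot>\<^sub>A (z \<otimes>\<^sub>A u))"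
      using hom u A.gcar[OF hom(1)] by (simp add: dA_lin leibA A.ksgn_ksgn A.ksgn_even)
    thus ?case using D.BI A.gcar[OF hom(1)] u by simp
  next
    case (add v w)
    thus ?case using u dA_lin A.subm_add[OF D.B_subm] by (simp add: AR.l_distr)
  qed
qed

lemma B_Z_mult: "b \<in> coboundaries A ==> x \<in> cocycles A ==> b \<otimes>\<^sub>A x \<in> coboundaries A"
proof -
  assume x: "x \<in> cocycles A" and "b \<in> coboundaries A"
  then obtain u where u: "u \<in> carrier A" "b = diff A u" by (auto simp: coboundaries_def)
  note xc = D.ZD[OF x]
  have "diff A u \<otimes>\<^sub>A x \<in> coboundaries A" using u(1)
  proof (induction rule: A.graded_induct)
    case (hom n u)
    hence "diff A u \<otimes>\<^sub>A x = diff A (u \<otimes>\<^sub>A x)" using xc A.gcar[OF hom] by (simp add: leibA dA_lin)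
    thus ?case using D.BI A.gcar[OF hom] xc by simp
  next
    case (add v w)
    thus ?case using dA_lin xc A.subm_add[OF D.B_subm] by (simp add: AR.l_distr)
  qed
  thus ?thesis by (simp add: u)
qed

lemma one_Z: "\<one>\<^sub>A \<in> cocycles A" by (simp add: cocycles_def dA_one)

text \<open>The coboundaries are an ideal in the ring of cocycles, so the quotient construction
  gives the cohomology ring.\<close>

lemma cohomology_simps:
  "x \<in> cocycles A ==> y \<in> cocycles A ==> (coboundaries A +>\<^sub>A x) \<otimes>\<^bsub>cohomology A\<^esub> (coboundaries A +>\<^sub>A y) = coboundaries A +>\<^sub>A (x \<otimes>\<^sub>A y)"
  "x \<in> cocycles A ==> y \<in> cocycles A ==> (coboundaries A +>\<^sub>A x) \<oplus>\<^bsub>cohomology A\<^esub> (coboundaries A +>\<^sub>A y) = coboundaries A +>\<^sub>A (x \<oplus>\<^sub>A y)"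
  "\<one>\<^bsub>cohomology A\<^esub> = coboundaries A +>\<^sub>A \<one>\<^sub>A"
  "ring (cohomology A)"
proof -
  let ?R = "A\<lparr>carrier := cocycles A\<rparr>" and ?B = "coboundaries A"
  have s: "submodule (cocycles A) k A" "submodule ?B k A" using D.Z_subm D.B_subm .
  interpret Zm: kmod k ?R using submodule.submodule_is_module[OF s(1) A.module_axioms] by (simp add: kmod_def)
  have r: "ring ?R" by (intro ringI Zm.M.abelian_group_axioms monoidI) (auto simp: Z_mult one_Z D.ZD(1) AR.m_assoc AR.l_distr AR.r_distr)
  have id: "ideal ?B ?R"
  proof (rule idealI[OF r])
    have "submodule ?B k ?R" by (rule Zm.submoduleI) (use A.subm_zero[OF s(2)] A.subm_add[OF s(2)] A.subm_smult[OF s(2)] D.B_Z in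
        \<open>auto simp: Zm.minus_as_ksgn\<close>)
    thus "subgroup ?B (add_monoid ?R)" by (simp add: submodule_def)
  qed (auto simp: Z_B_mult B_Z_mult)
  interpret ideal ?B ?R by (rule id)
  have c: "a_r_coset ?R = a_r_coset A" by (intro ext) (simp add: a_r_coset_def r_coset_def)
  show "x \<in> cocycles A ==> y \<in> cocycles A ==> (?B +>\<^sub>A x) \<otimes>\<^bsub>cohomology A\<^esub> (?B +>\<^sub>A y) = ?B +>\<^sub>A (x \<otimes>\<^sub>A y)"
    using rcoset_mult_add[of x y] by (simp add: cohomology_def FactRing_def c)
  show "x \<in> cocycles A ==> y \<in> cocycles A ==> (?B +>\<^sub>A x) \<oplus>\<^bsub>cohomology A\<^esub> (?B +>\<^sub>A y) = ?B +>\<^sub>A (x \<oplus>\<^sub>A y)"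
    using a_rcos_sum[of x y] by (simp add: cohomology_def FactRing_def c)
  show "\<one>\<^bsub>cohomology A\<^esub> = ?B +>\<^sub>A \<one>\<^sub>A" by (simp add: cohomology_def FactRing_def c)
  show "ring (cohomology A)" unfolding cohomology_def by (rule quotient_is_ring)
qed

end

text \<open>Products and the unit are respected up to coboundaries, which is what happens when
  endomorphisms are transported along a homotopy equivalence. The last assumption provides
  homogeneous preimages, so that the grading is matched exactly.\<close>

lemma quasi_iso_graded_ring_iso:
  fixes A :: "('k, 'a) dgspace" and B :: "('k, 'b) dgspace"
  assumes "dg_algebra k A" "dg_algebra k B" and q: "quasi_iso k A B f"
    and mult: "!!x y. x \<in> cocycles A ==> y \<in> cocycles A ==> f (x \<otimes>\<^sub>A y) \<ominus>\<^sub>B f x \<otimes>\<^sub>B f y \<in> coboundaries B"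
    and one: "f \<one>\<^sub>A \<ominus>\<^sub>B \<one>\<^sub>B \<in> coboundaries B"
    and hom: "!!w i. w \<in> cocycles B ==> w \<in> grade B i ==> \<exists>z\<in>cocycles A \<inter> grade A i. w \<ominus>\<^sub>B f z \<in> coboundaries B"
  shows "graded_ring_iso A B (%X. coboundaries B <+>\<^sub>B (f ` X))"
proof -
  interpret A: dga k A by (rule dga.intro[OF assms(1)])
  interpret B: dga k B by (rule dga.intro[OF assms(2)])
  interpret F: dgs2 k A B f using q by (intro dgs2I A.A_dg B.A_dg) (simp add: quasi_iso_def)
  let ?h = "%X. coboundaries B <+>\<^sub>B (f ` X)"
  note cm = F.coset_map[OF A.D.ZD(1)]
  have "?h \<in> ring_hom (cohomology A) (cohomology B)"
  proof (rule ring_hom_memI)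
    show "?h \<one>\<^bsub>cohomology A\<^esub> = \<one>\<^bsub>cohomology B\<^esub>"
      using one by (simp add: A.cohomology_simps B.cohomology_simps cm A.one_Z B.D.coset_eq F.fl)
    fix X assume "X \<in> carrier (cohomology A)"
    then obtain x where x: "x \<in> cocycles A" "X = coboundaries A +>\<^sub>A x" unfolding A.D.carrier_cohomology by blast
    show "?h X \<in> carrier (cohomology B)" using F.fZ[OF x(1)] by (auto simp: x(2) cm[OF x(1)] B.D.carrier_cohomology)
    fix Y assume "Y \<in> carrier (cohomology A)"
    then obtain y where y: "y \<in> cocycles A" "Y = coboundaries A +>\<^sub>A y" unfolding A.D.carrier_cohomology by blast
    note c = x(1) y(1) A.D.ZD(1)[OF x(1)] A.D.ZD(1)[OF y(1)]
    show "?h (X \<otimes>\<^bsub>cohomology A\<^esub> Y) = ?h X \<otimes>\<^bsub>cohomology B\<^esub> ?h Y"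
      using mult[OF c(1,2)] c by (simp add: x(2) y(2) A.cohomology_simps cm A.Z_mult B.cohomology_simps F.fZ B.D.coset_eq F.fl)
    show "?h (X \<oplus>\<^bsub>cohomology A\<^esub> Y) = ?h X \<oplus>\<^bsub>cohomology B\<^esub> ?h Y"
      using c by (simp add: x(2) y(2) A.cohomology_simps cm A.A.subm_add[OF A.D.Z_subm] B.cohomology_simps F.fZ F.fl)
  qed
  moreover have "?h ` cohomology_grade A i = cohomology_grade B i" for i
  proof -
    have "?h ` cohomology_grade A i = (%z. coboundaries B +>\<^sub>B f z) ` (cocycles A \<inter> grade A i)"
      unfolding cohomology_grade_def image_image by (rule image_cong) (simp_all add: cm)
    also have "... = cohomology_grade B i" unfolding cohomology_grade_def
    proof (intro subset_antisym subsetI)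
      fix X assume "X \<in> (%z. coboundaries B +>\<^sub>B z) ` (cocycles B \<inter> grade B i)"
      then obtain w where w: "w \<in> cocycles B" "w \<in> grade B i" "X = coboundaries B +>\<^sub>B w" by blast
      obtain z where "z \<in> cocycles A \<inter> grade A i" "w \<ominus>\<^sub>B f z \<in> coboundaries B" using hom[OF w(1,2)] by blast
      thus "X \<in> (%z. coboundaries B +>\<^sub>B f z) ` (cocycles A \<inter> grade A i)"
        using B.D.coset_eq[of w "f z"] w(3) B.D.ZD(1)[OF w(1)] F.fl A.D.ZD(1) by blast
    qed (use F.fZ deg_linear_grade[OF F.f_deg] in force)
    finally show ?thesis .
  qed
  ultimately show ?thesis using q by (simp add: graded_ring_iso_def ring_iso_def quasi_iso_def)
qed

section \<open>Subbimodules and chain maps\<close>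

definition transport :: "('k, 'a, 'm) dgbimod => 'm set => ('m => 'u) => ('k, 'a, 'u) dgbimod"
    \<comment> \<open>the subbimodule \<open>S\<close> of \<open>X\<close>, transported along a map that is injective on \<open>S\<close>\<close> where
  "transport X S j = \<lparr>carrier = j ` S, mult = undefined, one = undefined, zero = j \<zero>\<^sub>X,
     add = (%u v. j (inv_into S j u \<oplus>\<^sub>X inv_into S j v)), smult = (%r u. j (r \<odot>\<^sub>X inv_into S j u)),
     grade = (%n. j ` (S \<inter> grade X n)), diff = (%u. j (diff X (inv_into S j u))),
     lact = (%a u. j (lact X a (inv_into S j u))), ract = (%u a. j (ract X (inv_into S j u) a))\<rparr>"

definition chain_bimod_map :: "'k ring => ('k, 'a) dgspace => ('k, 'a, 'm) dgbimod => ('k, 'a, 'n) dgbimod => ('m => 'n) => bool" where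
  "chain_bimod_map k A M N f \<longleftrightarrow> bimod_linear k A M N 0 f & (\<forall>m\<in>carrier M. f (diff M m) = diff N (f m))"

locale chm = M: dbim k A M + N: dbim k A N
  for k :: "'k ring" and A :: "('k, 'a) dgspace" and M :: "('k, 'a, 'm) dgbimod" and N :: "('k, 'a, 'n) dgbimod" +
  fixes f assumes f: "chain_bimod_map k A M N f"
begin

lemma bl: "bimod_linear k A M N 0 f" and fd: "m \<in> carrier M ==> f (diff M m) = diff N (f m)" using f by (auto simp: chain_bimod_map_def)

lemma deg: "deg_linear k M N 0 f" by (rule bimod_linearD(1)[OF bl])
lemmas kl = deg_klinear[OF deg]
lemmas fl = klinearD[OF kl]
lemmas fm = additive_diff[OF M.M.ab N.M.ab klinear_additive[OF kl]]
lemmas f0 = additive_zero[OF M.M.ab N.M.ab klinear_additive[OF kl]]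

lemma fa: "a \<in> carrier A ==> m \<in> carrier M ==> f (lact M a m) = lact N a (f m)"
  and fr: "a \<in> carrier A ==> m \<in> carrier M ==> f (ract M m a) = ract N (f m) a"
proof -
  interpret MN: gbim2 k A M N ..
  show "a \<in> carrier A ==> m \<in> carrier M ==> f (ract M m a) = ract N (f m) a" by (rule MN.bl_r[OF bl])
  assume a: "a \<in> carrier A" and m: "m \<in> carrier M"
  from a show "f (lact M a m) = lact N a (f m)"
  proof (induction rule: M.A.graded_induct)
    case (hom i a) thus ?case using MN.bl_l[OF bl hom m] m fl by (simp add: N.la M.A.gcar)
  next
    case (add x y) thus ?case using m by (simp add: M.la N.la fl)
  qed
qed

end

lemma (in dbim) id_chm: "chm k A M M (%x. x)"
  using dbim_axioms by (auto simp: chm_def chm_axioms_def chain_bimod_map_def bimod_linear_def deg_linear_def klinear_def la ra A.gcar)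

lemma Hom_grade: "grade (Hom_bimod k A P N) n = {f \<in> extensional (carrier P). bimod_linear k A P N n f}"
  by (simp add: Hom_bimod_def hom_complex_def hom_graded_def Let_def)

context dbim2 begin

abbreviation "HB \<equiv> Hom_bimod k A M N"

lemma HB: "HB = HC" by (simp add: Hom_bimod_def)

lemma HB_diff: "f \<in> grade HB n ==> m \<in> carrier M ==> diff HB f m = diff N (f m) \<ominus>\<^sub>N ksgn k n \<odot>\<^sub>N f (diff M m)"
proof -
  assume "f \<in> grade HB n" and m: "m \<in> carrier M"
  hence "f \<in> BL n" by (simp only: Hom_grade)
  thus ?thesis unfolding HB using m by (rule HC_diff)
qed

lemma HB_dg: "dg_space k HB" unfolding HB by (rule HC_dg_space[OF M.dd N.dd])

sublocale HB: dgs k HB by (rule dgsI[OF HB_dg])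

lemma HB_app: "f \<in> carrier HB ==> g \<in> carrier HB ==> m \<in> carrier M ==> (f \<ominus>\<^sub>HB g) m = f m \<ominus>\<^sub>N g m"
  "m \<in> carrier M ==> (f \<oplus>\<^sub>HB g) m = f m \<oplus>\<^sub>N g m" "m \<in> carrier M ==> \<zero>\<^sub>HB m = \<zero>\<^sub>N"
  "m \<in> carrier M ==> (r \<odot>\<^sub>HB f) m = r \<odot>\<^sub>N f m"
  "f \<in> carrier HB ==> m \<in> carrier M ==> f m \<in> carrier N" using H_minus[of f g m] H_F[of f] by (simp_all add: HB HC_minus hom_simps H_simps mem_F)

lemma HB_eqI: "f \<in> carrier HB ==> g \<in> carrier HB ==> (!!m. m \<in> carrier M ==> f m = g m) ==> f = g" using H_eqI[of f g] by (simp add: HB hom_simps)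

lemma HB_bl: "f \<in> grade HB n ==> bimod_linear k A M N n f" by (simp add: Hom_grade)

lemma HB_restrict: "bimod_linear k A M N n h ==> restrict h (carrier M) \<in> grade HB n"
  using M.M.gcar M.la M.ra M.A.gcar by (auto simp: Hom_grade bimod_linear_def deg_linear_def klinear_def image_subset_iff)

end

lemma dbim2I: "dbim k A M ==> dbim k A N ==> dbim2 k A M N" by (rule dbim2.intro)

text \<open>Functoriality of Hom in both variables at once. Both maps have degree 0, so no signs
  arise.\<close>

lemma hom_comp:
  assumes b: "chm k A P' P b" and a: "chm k A N N' a"
  shows "chain_map k (Hom_bimod k A P N) (Hom_bimod k A P' N') (%F. \<lambda>t\<in>carrier P'. a (F (b t)))"
proof -
  interpret b: chm k A P' P b by fact
  interpret a: chm k A N N' a by fact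
  interpret H: dbim2 k A P N by (intro dbim2I b.N.dbim_axioms a.M.dbim_axioms)
  interpret H': dbim2 k A P' N' by (intro dbim2I b.M.dbim_axioms a.N.dbim_axioms)
  let ?T = "%F. \<lambda>t\<in>carrier P'. a (F (b t))"
  have g: "?T F \<in> grade H'.HB n" if F: "F \<in> grade H.HB n" for F n
  proof -
    note Fb = H.HB_bl[OF F]
    have d: "deg_linear k P' N' n (?T F)" using deg_linear_compose[OF deg_linear_compose[OF b.deg bimod_linearD(1)[OF Fb]] a.deg]
      by (auto simp: deg_linear_def klinear_def b.M.M.gcar image_subset_iff)
    have "bimod_linear k A P' N' n (?T F)" by (rule H'.bimod_linearI[OF d])
        (simp_all add: b.M.la b.M.ra b.M.A.gcar b.fa b.fr b.fl H.bl_l[OF Fb] H.bl_r[OF Fb] H.bl[OF Fb] a.fl a.fa a.fr a.M.la)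
    thus ?thesis by (simp add: Hom_grade)
  qed
  have Fc: "!!F t. F \<in> carrier H.HB ==> t \<in> carrier P' ==> F (b t) \<in> carrier N" using H.HB_app(5) b.fl by blast
  have Te: "?T (F \<oplus>\<^sub>H.HB G) = ?T F \<oplus>\<^sub>H'.HB ?T G" if "F \<in> carrier H.HB" "G \<in> carrier H.HB" for F G
    using Fc that by (auto simp: H.HB_app b.fl a.fl H'.HB hom_simps H'.H_simps intro!: restrict_ext)
  have c: "?T F \<in> carrier H'.HB" if "F \<in> carrier H.HB" for F using that
  proof (induction rule: H.HB.graded_induct)
    case (hom n F) thus ?case using H'.HB.gcar[OF g] by blast
  next
    case (add F G)
    show ?case unfolding Te[OF add(1,2)] by (rule H'.HB.M.a_closed[OF add(3,4)])
  qed
  have D: "?T (diff H.HB F) = diff H'.HB (?T F)" if "F \<in> carrier H.HB" for F using that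
  proof (induction rule: H.HB.graded_induct)
    case (hom n F)
    note Fb = H.bl[OF H.HB_bl[OF hom]] and Fc = H.HB.gcar[OF hom]
    show ?case
    proof (rule H'.HB_eqI[OF c[OF H.HB.dl(1)[OF Fc]] H'.HB.dl(1)[OF c[OF Fc]]])
      fix t assume t: "t \<in> carrier P'"
      thus "?T (diff H.HB F) t = diff H'.HB (?T F) t"
        by (simp add: H'.HB_diff[OF g[OF hom]] H.HB_diff[OF hom] b.fl Fb a.fm a.fl a.M.d_lin a.fd b.N.d_lin b.M.d_lin b.fd)
    qed
  next
    case (add F G)
    note cs = c[OF add(1)] c[OF add(2)] c[OF H.HB.dl(1)[OF add(1)]] c[OF H.HB.dl(1)[OF add(2)]]
    show ?case unfolding H.HB.dl(2)[OF add(1,2)] Te[OF H.HB.dl(1)[OF add(1)] H.HB.dl(1)[OF add(2)]] Te[OF add(1,2)]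
      H'.HB.dl(2)[OF cs(1,2)] add(3,4) ..
  qed
  have "klinear k H.HB H'.HB ?T" unfolding klinear_def
  proof (intro conjI ballI Pi_I)
    show "?T F \<in> carrier H'.HB" if "F \<in> carrier H.HB" for F using c[OF that] .
  qed (use Fc in \<open>auto simp: H.HB_app b.fl a.fl H'.HB hom_simps H'.H_simps intro!: restrict_ext\<close>)
  thus ?thesis using g D by (auto simp: chain_map_def deg_linear_def)
qed

section \<open>Subbimodules copied into another type\<close>

locale subbim = X: dbim k A X for k :: "'k ring" and A :: "('k, 'a) dgspace" and X :: "('k, 'a, 'm) dgbimod" +
  fixes S :: "'m set" and j :: "'m => 'u"
  assumes S: "X.M.subm S" and Sh: "s \<in> S ==> hcomp X n s \<in> S" and Sd: "s \<in> S ==> diff X s \<in> S"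
    and Sa: "a \<in> carrier A ==> s \<in> S ==> lact X a s \<in> S & ract X s a \<in> S"
    and inj: "inj_on j S"
begin

abbreviation "Y \<equiv> transport X S j"
abbreviation "i \<equiv> inv_into S j"

lemma ij [simp]: "s \<in> S ==> i (j s) = s" using inj by simp

lemma iS: "u \<in> carrier Y ==> i u \<in> S" by (auto simp: transport_def)

lemma iI: "u \<in> carrier Y ==> v \<in> carrier Y ==> i u = i v ==> u = v" by (auto simp: transport_def)

lemmas Sc = X.M.subm_car[OF S] and Ss = X.M.subm_zero[OF S] X.M.subm_add[OF S] X.M.subm_smult[OF S]

lemma Ycl: "s \<in> S ==> j s \<in> carrier Y" by (simp add: transport_def)

lemma Y_simps:
  "\<zero>\<^sub>Y \<in> carrier Y" "i \<zero>\<^sub>Y = \<zero>\<^sub>X"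
  "u \<in> carrier Y ==> v \<in> carrier Y ==> u \<oplus>\<^sub>Y v \<in> carrier Y" "u \<in> carrier Y ==> v \<in> carrier Y ==> i (u \<oplus>\<^sub>Y v) = i u \<oplus>\<^sub>X i v"
  "r \<in> carrier k ==> u \<in> carrier Y ==> r \<odot>\<^sub>Y u \<in> carrier Y" "r \<in> carrier k ==> u \<in> carrier Y ==> i (r \<odot>\<^sub>Y u) = r \<odot>\<^sub>X i u"
  "u \<in> carrier Y ==> diff Y u \<in> carrier Y" "u \<in> carrier Y ==> i (diff Y u) = diff X (i u)"
  "a \<in> carrier A ==> u \<in> carrier Y ==> lact Y a u \<in> carrier Y" "a \<in> carrier A ==> u \<in> carrier Y ==> i (lact Y a u) = lact X a (i u)"
  "a \<in> carrier A ==> u \<in> carrier Y ==> ract Y u a \<in> carrier Y" "a \<in> carrier A ==> u \<in> carrier Y ==> i (ract Y u a) = ract X (i u) a"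
  using Ss Sd Sa by (auto simp: transport_def)

lemma Y_grade: "u \<in> grade Y n \<longleftrightarrow> u \<in> carrier Y & i u \<in> grade X n" by (auto simp: transport_def)

lemma iX: "u \<in> carrier Y ==> i u \<in> carrier X" using iS Sc by blast

lemma mY: "module k Y"
proof (intro moduleI abelian_groupI)
  show "\<exists>v\<in>carrier Y. v \<oplus>\<^sub>Y u = \<zero>\<^sub>Y" if "u \<in> carrier Y" for u
  proof -
    have "\<ominus>\<^sub>X i u \<in> S" using X.M.subm_uminus[OF S iS[OF that]] .
    hence "j (\<ominus>\<^sub>X i u) \<oplus>\<^sub>Y u = \<zero>\<^sub>Y" using that iX[OF that] Ycl by (intro iI) (simp_all add: Y_simps X.M.M.l_neg)
    thus ?thesis using Ycl \<open>\<ominus>\<^sub>X i u \<in> S\<close> by blast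
  qed
qed (auto intro!: iI simp: Y_simps iX X.A.R.cring_axioms X.M.M.a_ac X.M.smult_l_distr X.M.smult_r_distr X.M.smult_assoc1)

lemma gsY: "graded_space k Y"
proof (rule graded_spaceI[OF mY])
  interpret Y: kmod k Y using mY by (simp add: kmod_def)
  have a: "additive Y X i" by (simp add: additive_def Y_simps iX)
  show "submodule (grade Y n) k Y" for n
  proof (rule Y.submoduleI)
    show sm: "r \<odot>\<^sub>Y u \<in> grade Y n" if "r \<in> carrier k" "u \<in> grade Y n" for r u using that by (auto simp: Y_grade Y_simps)
    show "\<ominus>\<^sub>Y u \<in> grade Y n" if "u \<in> grade Y n" for u using sm[of "ksgn k 1" u] that by (simp add: Y.minus_as_ksgn Y_grade)
  qed (auto simp: Y_grade Y_simps)
  fix u assume u: "u \<in> carrier Y"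
  let ?N = "{n. hcomp X n (i u) ~= \<zero>\<^sub>X}" and ?u = "%n. j (hcomp X n (i u))"
  have f: "finite ?N" using X.M.hcomp_finite iX[OF u] .
  have h: "hcomp X n (i u) \<in> S" for n using Sh[OF iS[OF u]] .
  have "i (\<Oplus>\<^sub>Y n\<in>?N. ?u n) = (\<Oplus>\<^sub>X n\<in>?N. i (?u n))"
    by (rule additive_finsum[OF Y.M.abelian_group_axioms X.M.ab a f]) (simp add: Ycl h)
  also have "... = i u" using h X.M.hcomp_sum[OF iX[OF u] f subset_refl] by simp
  finally have "u = (\<Oplus>\<^sub>Y n\<in>?N. ?u n)" using u Y.M.finsum_closed[of ?u ?N] h Ycl by (intro iI) auto
  moreover have "?u n \<in> grade Y n" for n using h Ycl X.M.hcomp_g[OF iX[OF u]] by (simp add: Y_grade)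
  ultimately show "\<exists>N w. finite N & (\<forall>n\<in>N. w n \<in> grade Y n) & u = (\<Oplus>\<^sub>Y n\<in>N. w n)"
    using f by (intro exI[of _ ?N] exI[of _ ?u] conjI ballI)
next
  interpret Y: kmod k Y using mY by (simp add: kmod_def)
  have a: "additive Y X i" by (simp add: additive_def Y_simps iX)
  fix N w n assume N: "finite N" "!!n. w n \<in> grade Y n" "(\<Oplus>\<^sub>Y n\<in>N. w n) = \<zero>\<^sub>Y" "n \<in> N"
  have "(\<Oplus>\<^sub>X n\<in>N. i (w n)) = \<zero>\<^sub>X"
    using additive_finsum[OF Y.M.abelian_group_axioms X.M.ab a N(1), of w] N(2,3) by (simp add: Y_grade Y_simps)
  hence "i (w n) = \<zero>\<^sub>X" using X.M.hcomp_of_sum[of N "%n. i (w n)" n] N X.M.hcomp_hom[OF X.M.g_zero[of n], of n] by (simp add: Y_grade)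
  thus "w n = \<zero>\<^sub>Y" using N(2)[of n] by (intro iI) (simp_all add: Y_simps Y_grade)
qed

lemma Y_dbim: "dbim k A Y"
proof -
  have "graded_bimodule k A Y" unfolding graded_bimodule_def
  proof (intro conjI ballI allI)
    show "graded_space k Y" by (rule gsY)
    show "lact Y a m \<in> grade Y (p + n)" "ract Y m a \<in> grade Y (p + n)" if "a \<in> grade A p" "m \<in> grade Y n" for a m p n
      using that X.A.gcar X.la_g[of a p "i m" n] X.ra_g0[of a p "i m" n] by (simp_all add: Y_grade Y_simps)
  qed (auto intro!: iI simp: klinear_def Y_simps iX X.la X.ra X.la_one X.ra_one X.la_assoc X.ra_assoc X.lra)
  moreover have "dg_space k Y"
  proof -
    have "klinear k Y Y (diff Y)" unfolding klinear_def by (auto intro!: iI simp: Y_simps iX X.d_lin)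
    moreover have "diff Y u \<in> grade Y (n + 1)" if "u \<in> grade Y n" for u n using that X.d_g by (simp add: Y_grade Y_simps)
    moreover have "diff Y (diff Y u) = \<zero>\<^sub>Y" if "u \<in> carrier Y" for u by (rule iI) (simp_all add: that Y_simps iX X.dd)
    ultimately show ?thesis using gsY by (simp add: dg_space_def deg_linear_def image_subset_iff)
  qed
  ultimately have "dg_bimodule k A Y" unfolding dg_bimodule_def
  proof (intro conjI ballI allI)
    fix n a m assume a: "a \<in> grade A n" and m: "m \<in> carrier Y"
    note ac = X.A.gcar[OF a]
    show "diff Y (lact Y a m) = lact Y (diff A a) m \<oplus>\<^sub>Y ksgn k n \<odot>\<^sub>Y lact Y a (diff Y m)"
      using ac m by (intro iI) (simp_all add: Y_simps iX X.leib_l[OF a] X.dA_lin)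
  next
    fix n m a assume m: "m \<in> grade Y n" and a: "a \<in> carrier A"
    thus "diff Y (ract Y m a) = ract Y (diff Y m) a \<oplus>\<^sub>Y ksgn k n \<odot>\<^sub>Y ract Y m (diff A a)"
      by (intro iI) (simp_all add: Y_simps Y_grade iX X.leib_r[of "i m" n] X.dA_lin)
  qed
  thus ?thesis by (rule dbimI[OF X.dga_axioms])
qed

lemma i_chm: "chm k A Y X i" using Y_dbim X.dbim_axioms
  by (auto simp: chm_def chm_axioms_def chain_bimod_map_def bimod_linear_def deg_linear_def klinear_def Y_simps iX Y_grade X.A.gcar X.la X.ra)

lemma j_chm: "S = carrier X ==> chm k A X Y j"
proof -
  assume SX: "S = carrier X"
  have e: "u = v" if "u \<in> carrier Y" "v \<in> carrier Y" "i u = i v" for u v using iI that .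
  have jc: "j x \<in> carrier Y" "i (j x) = x" if "x \<in> carrier X" for x using Ycl[of x] ij[of x] equalityD2[OF SX] that by blast+
  have "chain_bimod_map k A X Y j" unfolding chain_bimod_map_def bimod_linear_def deg_linear_def klinear_def image_subset_iff Y_grade
    by (auto intro!: e simp: jc Y_simps X.A.gcar X.la X.ra X.d_lin X.M.gcar)
  thus ?thesis using Y_dbim X.dbim_axioms by (simp add: chm_def chm_axioms_def)
qed

text \<open>A map with values in S factors through the copy \<open>Y\<close>, where acyclicity of
  Hom provides a primitive; \<open>i\<close> carries it back to X.\<close>

lemma null_homotopic:
  assumes P: "dbim k A P" and ac: "acyclic_space (Hom_bimod k A P Y)"
    and F: "F \<in> grade (Hom_bimod k A P X) n" "diff (Hom_bimod k A P X) F = \<zero>\<^bsub>Hom_bimod k A P X\<^esub>" "!!t. t \<in> carrier P ==> F t \<in> S"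
  shows "\<exists>G\<in>grade (Hom_bimod k A P X) (n - 1). diff (Hom_bimod k A P X) G = F & (\<forall>t\<in>carrier P. G t \<in> S)"
proof -
  interpret P: dbim k A P by fact
  interpret Y: dbim k A Y by (rule Y_dbim)
  interpret PX: dbim2 k A P X by (intro dbim2I P X.dbim_axioms)
  interpret PY: dbim2 k A P Y by (intro dbim2I P Y_dbim)
  let ?T = "%F. \<lambda>t\<in>carrier P. i (F t)"
  interpret T: dgs2 k PY.HB PX.HB ?T by (rule dgs2I[OF PY.HB_dg PX.HB_dg hom_comp[OF P.id_chm i_chm]])
  define F' where "F' = (\<lambda>t\<in>carrier P. j (F t))"
  note Fb = PX.HB_bl[OF F(1)]
  have F': "F' t \<in> carrier Y" "i (F' t) = F t" if "t \<in> carrier P" for t using that F(3) Ycl by (simp_all add: F'_def)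
  have d: "deg_linear k P Y n F'" unfolding deg_linear_def klinear_def using deg_linear_grade[OF bimod_linearD(1)[OF Fb]] P.M.gcar
    by (auto intro!: iI simp: F' Y_simps PX.bl[OF Fb] Y_grade)
  have "bimod_linear k A P Y n F'" by (rule PY.bimod_linearI[OF d]; rule iI) (simp_all add: F' Y_simps P.la P.ra X.A.gcar PX.bl_l[OF Fb] PX.bl_r[OF Fb])
  hence F'g: "F' \<in> grade PY.HB n" by (simp add: Hom_grade F'_def)
  note F'c = PY.HB.gcar[OF F'g]
  have FF: "?T F' = F" using F' PX.HB.gcar[OF F(1)] T.fl(1)[OF F'c] by (intro PX.HB_eqI) auto
  have "diff PY.HB F' = \<zero>\<^sub>PY.HB"
  proof (rule PY.HB_eqI[OF PY.HB.dl(1)[OF F'c]])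
    fix t assume t: "t \<in> carrier P"
    have "i (diff PY.HB F' t) = ?T (diff PY.HB F') t" using t by simp
    also have "... = i (\<zero>\<^sub>PY.HB t)" unfolding T.fd[OF F'c] FF F(2) using t by (simp add: PX.HB_app PY.HB_app Y_simps)
    finally show "diff PY.HB F' t = \<zero>\<^sub>PY.HB t" using t by (intro iI) (simp_all add: PY.HB_app PY.HB.dl F'c)
  qed simp
  then obtain G where G: "G \<in> grade PY.HB (n - 1)" "diff PY.HB G = F'" using acyclic_spaceD[OF PY.HB_dg ac F'g] by blast
  have "?T G \<in> grade PX.HB (n - 1)" using deg_linear_grade[OF T.f_deg G(1)] by simp
  moreover have "diff PX.HB (?T G) = F" using T.fd[OF PY.HB.gcar[OF G(1)]] G(2) FF by simp
  moreover have "?T G t \<in> S" if "t \<in> carrier P" for t using that PY.HB_app(5)[OF PY.HB.gcar[OF G(1)]] iS by simp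
  ultimately show ?thesis by blast
qed

end

section \<open>Kernels of chain maps, and lifting along surjections\<close>

context chm begin

abbreviation "ker \<equiv> {m \<in> carrier M. f m = \<zero>\<^sub>N}"

lemma ker_subbim:
  assumes "inj_on j ker" shows "subbim k A M ker j"
proof (rule subbim.intro[OF M.dbim_axioms], rule subbim_axioms.intro)
  show "M.M.subm ker" by (rule M.M.submI) (auto simp: fl f0)
  have gN: "gspace k N" ..
  show "hcomp M n s \<in> ker" if "s \<in> ker" for s n using M.M.hcomp_deg[OF gN deg, of s n] that N.M.hcomp_hom[OF N.M.g_zero[of n], of n] by simp
  have "diff N \<zero>\<^sub>N = \<zero>\<^sub>N" by (rule additive_zero[OF N.M.ab N.M.ab deg_additive[OF N.d_deg]])
  thus "diff M s \<in> ker" if "s \<in> ker" for s using that by (simp add: M.d_lin fd)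
qed (simp_all add: assms M.la M.ra fa fr N.la_zero2 N.ra_zero2)

lemma ker_acyclic:
  assumes "inj_on j ker" "f ` carrier M = carrier N" and q: "quasi_iso k M N f"
  shows "acyclic_space (transport M ker j)"
proof -
  interpret s: subbim k A M ker j by (rule ker_subbim[OF assms(1)])
  interpret Y: dbim k A "transport M ker j" by (rule s.Y_dbim)
  interpret F: dgs2 k M N f using M.dgM N.dgM q by (intro dgs2I) (simp_all add: dg_bimodule_def quasi_iso_def)
  have dg: "dg_space k (transport M ker j)" using Y.dgM by (simp add: dg_bimodule_def)
  note inj = F.quasi_iso_iff[THEN iffD1, OF q, THEN conjunct1, rule_format] and surj = F.quasi_iso_iff[THEN iffD1, OF q, THEN conjunct2, rule_format]
  show ?thesis
  proof (rule acyclic_spaceI[OF dg])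
    fix n u assume ug: "u \<in> grade (transport M ker j) n" and du: "diff (transport M ker j) u = \<zero>\<^bsub>transport M ker j\<^esub>"
    note u = Y.M.gcar[OF ug]
    let ?z = "inv_into ker j u"
    have z: "?z \<in> carrier M" "f ?z = \<zero>\<^sub>N" "diff M ?z = \<zero>\<^sub>M" using s.iS[OF u] s.Y_simps(8)[OF u] du s.Y_simps(2) by auto
    have "?z \<in> coboundaries M" using inj[of ?z] z N.M.subm_zero[OF F.W.B_subm] by (simp add: cocycles_def)
    then obtain y where y: "y \<in> carrier M" "diff M y = ?z" by (auto simp: coboundaries_def)
    have "f y \<in> cocycles N" using y z fd[OF y(1)] fl(1) by (simp add: cocycles_def)
    then obtain w where w: "w \<in> cocycles M" "f y \<ominus>\<^sub>N f w \<in> coboundaries N" using surj by blast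
    then obtain b where b: "b \<in> carrier N" "f y \<ominus>\<^sub>N f w = diff N b" by (auto simp: coboundaries_def)
    then obtain v where v: "v \<in> carrier M" "b = f v" using assms(2) by auto
    note wc = F.V.ZD[OF w(1)]
    \<comment> \<open>The primitive y of \<open>?z\<close> is corrected by a cocycle w whose image
      has the class of f y, and then by a boundary, so that f kills it while its differential is
      unchanged.\<close>
    let ?y = "(y \<ominus>\<^sub>M w) \<ominus>\<^sub>M diff M v"
    have c: "y \<ominus>\<^sub>M w \<in> carrier M" "diff M v \<in> carrier M" using y wc v M.d_lin by simp_all
    have "f ?y = \<zero>\<^sub>N" using y wc v c b fl N.d_lin by (simp add: fm fd) (simp add: a_minus_def N.M.M.r_neg)
    moreover note dm = additive_diff[OF M.M.ab M.M.ab deg_additive[OF M.d_deg]]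
    have "diff M ?y = ?z" using y wc v c z M.d_lin by (simp add: dm M.dd) (simp add: a_minus_def M.M.minus_as_ksgn)
    ultimately have "?y \<in> ker" "diff M ?y = ?z" using c by simp_all
    thus "\<exists>v\<in>carrier (transport M ker j). diff (transport M ker j) v = u" using u s.Ycl by (intro bexI[of _ "j ?y"] s.iI) (simp_all add: s.Y_simps)
  qed
qed

text \<open>A graded lift h commutes with the differentials up to an error with values in the
  kernel. That error is a cocycle, hence the differential of a map G into the kernel, and h - G is a
  chain map with the same composite.\<close>

lemma chain_lift:
  assumes P: "dbim k A P" and h: "bimod_linear k A P M 0 h" and p: "chain_bimod_map k A P N p" "!!t. t \<in> carrier P ==> f (h t) = p t"
    and j: "inj_on j ker" and ac: "acyclic_space (Hom_bimod k A P (transport M ker j))"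
  shows "\<exists>\<alpha>. chain_bimod_map k A P M \<alpha> & (\<forall>t\<in>carrier P. f (\<alpha> t) = p t)"
proof -
  interpret P: dbim k A P by fact
  interpret p: chm k A P N p by (simp add: chm_def chm_axioms_def P N.dbim_axioms p(1))
  interpret PM: dbim2 k A P M by (intro dbim2I P M.dbim_axioms)
  interpret s: subbim k A M ker j by (rule ker_subbim[OF j])
  let ?h = "restrict h (carrier P)" and ?D = "diff PM.HB"
  have hg: "?h \<in> grade PM.HB 0" by (rule PM.HB_restrict[OF h])
  note hc = PM.HB.gcar[OF hg] and hb = PM.HB_bl[OF hg]
  have "f (?D ?h t) = \<zero>\<^sub>N" if t: "t \<in> carrier P" for t using t P.d_lin(1)[OF t] PM.bl(1)[OF h] p.fl(1)[OF P.d_lin(1)[OF t]]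
    by (simp add: PM.HB_diff[OF hg t] fm M.d_lin fd[symmetric] p(2)) (simp add: fd p(2) p.fd a_minus_def N.M.M.r_neg)
  hence k: "?D ?h t \<in> ker" if "t \<in> carrier P" for t using PM.HB_app(5)[OF PM.HB.dl(1)[OF hc] that] that by simp
  have "?D ?h \<in> grade PM.HB 1" using deg_linear_grade[OF PM.HB.d_deg hg] by simp
  then obtain G where G: "G \<in> grade PM.HB 0" "?D G = ?D ?h" "!!t. t \<in> carrier P ==> G t \<in> ker"
    using s.null_homotopic[where n = 1, OF P ac _ PM.HB.dd[OF hc] k] by auto
  note Gc = PM.HB.gcar[OF G(1)]
  let ?\<alpha> = "?h \<ominus>\<^sub>PM.HB G"
  have ag: "?\<alpha> \<in> grade PM.HB 0" using hg G(1) by simp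
  note ab = PM.HB_bl[OF ag]
  have "?D ?\<alpha> = \<zero>\<^sub>PM.HB" using additive_diff[OF PM.HB.ab PM.HB.ab deg_additive[OF PM.HB.d_deg] hc Gc] G(2) PM.HB.dl(1)[OF hc]
    by (simp add: a_minus_def PM.HB.M.r_neg)
  hence "?\<alpha> (diff P t) = diff M (?\<alpha> t)" if "t \<in> carrier P" for t
    using PM.HB_diff[OF ag that] PM.HB_app(3)[OF that] M.M.diff_zero_eq[of "diff M (?\<alpha> t)" "?\<alpha> (diff P t)"]
      PM.bl(1)[OF ab] M.d_lin(1) P.d_lin(1) that by simp
  moreover have "f (?\<alpha> t) = p t" if "t \<in> carrier P" for t
  proof -
    have "?\<alpha> t = h t \<ominus>\<^sub>M G t" using PM.HB_app(1)[OF hc Gc that] that by simp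
    thus ?thesis using G(3)[OF that] PM.bl(1)[OF h that] p.fl(1)[OF that] p(2)[OF that] fm by (simp add: a_minus_def N.M.minus_as_ksgn)
  qed
  ultimately show ?thesis using ab by (auto simp: chain_bimod_map_def)
qed

text \<open>The difference of the two lifts is a cocycle with values in the kernel, so
  \<open>null_homotopic\<close> applies to it.\<close>

lemma lift_unique:
  assumes P: "dbim k A P" and u: "chain_bimod_map k A P M u" and v: "chain_bimod_map k A P M v"
    and e: "!!t. t \<in> carrier P ==> f (u t) = f (v t)"
    and j: "inj_on j ker" and ac: "acyclic_space (Hom_bimod k A P (transport M ker j))"
  shows "restrict u (carrier P) \<ominus>\<^bsub>Hom_bimod k A P M\<^esub> restrict v (carrier P) \<in> coboundaries (Hom_bimod k A P M)"
proof -
  interpret P: dbim k A P by fact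
  interpret PM: dbim2 k A P M by (intro dbim2I P M.dbim_axioms)
  interpret s: subbim k A M ker j by (rule ker_subbim[OF j])
  let ?d = "restrict u (carrier P) \<ominus>\<^sub>PM.HB restrict v (carrier P)"
  have r: "restrict w (carrier P) \<in> grade PM.HB 0 & diff PM.HB (restrict w (carrier P)) = \<zero>\<^sub>PM.HB" if "chain_bimod_map k A P M w" for w
  proof -
    interpret w: chm k A P M w by (simp add: chm_def chm_axioms_def P M.dbim_axioms that)
    note g = PM.HB_restrict[OF w.bl]
    have "diff PM.HB (restrict w (carrier P)) = \<zero>\<^sub>PM.HB" by (rule PM.HB_eqI[OF PM.HB.dl(1)[OF PM.HB.gcar[OF g]]])
        (simp_all add: PM.HB_diff[OF g] PM.HB_app P.d_lin w.fd w.fl M.d_lin a_minus_def M.M.M.r_neg)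
    thus ?thesis using g by blast
  qed
  note ru = r[OF u] and rv = r[OF v]
  note c = PM.HB.gcar[OF ru[THEN conjunct1]] PM.HB.gcar[OF rv[THEN conjunct1]]
  have "?d \<in> grade PM.HB 0" using ru rv by simp
  moreover have "diff PM.HB ?d = \<zero>\<^sub>PM.HB" using additive_diff[OF PM.HB.ab PM.HB.ab deg_additive[OF PM.HB.d_deg] c] ru rv
    by (simp add: a_minus_def PM.HB.minus_as_ksgn)
  moreover have "?d t \<in> ker" if t: "t \<in> carrier P" for t
    using PM.HB_app(1)[OF c t] PM.HB_app(5)[OF c(1) t] PM.HB_app(5)[OF c(2) t] t e[OF t] by (simp add: fm fl) (simp add: a_minus_def fl N.M.M.r_neg)
  ultimately obtain G where "G \<in> grade PM.HB (0 - 1)" "diff PM.HB G = ?d" using s.null_homotopic[where n = 0, OF P ac] by blast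
  thus ?thesis unfolding coboundaries_def by (metis PM.HB.gcar imageI)
qed

end

section \<open>Semi-projectivity of the twisted tensor product\<close>

lemma (in dbim) contraction:
  assumes "field k" "acyclic_space M"
  shows "\<exists>h. deg_linear k M M (- 1) h & (\<forall>m\<in>carrier M. diff M (h m) \<oplus>\<^sub>M h (diff M m) = m)"
proof -
  have gM: "gspace k M" ..
  have im: "m \<in> diff M ` carrier M \<longleftrightarrow> m \<in> carrier M & diff M m = \<zero>\<^sub>M" for m
    using assms(2) by (auto simp: acyclic_space_def cocycles_def coboundaries_def)
  obtain s where "\<forall>y\<in>diff M ` carrier M. s y \<in> carrier M & diff M (s y) = y
    & (\<forall>z\<in>diff M ` carrier M. s (y \<oplus>\<^sub>M z) = s y \<oplus>\<^sub>M s z)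
    & (\<forall>r\<in>carrier k. s (r \<odot>\<^sub>M y) = r \<odot>\<^sub>M s y)
    & (\<forall>i. y \<in> grade M (i + 1) --> s y \<in> grade M i)" using M.graded_section[OF assms(1) gM d_deg] by (rule exE)
  note s0 = bspec[OF this, OF im[THEN iffD2, OF conjI]]
  have s: "!!y. y \<in> carrier M ==> diff M y = \<zero>\<^sub>M ==> s y \<in> carrier M & diff M (s y) = y"
    "!!y z. y \<in> carrier M ==> diff M y = \<zero>\<^sub>M ==> z \<in> carrier M ==> diff M z = \<zero>\<^sub>M ==> s (y \<oplus>\<^sub>M z) = s y \<oplus>\<^sub>M s z"
    "!!r y. r \<in> carrier k ==> y \<in> carrier M ==> diff M y = \<zero>\<^sub>M ==> s (r \<odot>\<^sub>M y) = r \<odot>\<^sub>M s y"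
    "!!i y. y \<in> carrier M ==> diff M y = \<zero>\<^sub>M ==> y \<in> grade M (i + 1) ==> s y \<in> grade M i" by (simp_all add: s0 im)
  \<comment> \<open>The projection onto the cocycles defined by the section \<open>s\<close> of the
    differential. The contraction is \<open>s\<close> after \<open>p\<close>, which makes sense
    since every cocycle is a boundary.\<close>
  define p where "p v = v \<ominus>\<^sub>M s (diff M v)" for v
  have sd: "s (diff M v) \<in> carrier M" "diff M (s (diff M v)) = diff M v" if "v \<in> carrier M" for v using that by (simp_all add: s(1) dd d_lin)
  have pv: "p v \<in> carrier M" "diff M (p v) = \<zero>\<^sub>M" if "v \<in> carrier M" for v
    using that sd[OF that] d_lin additive_diff[OF M.ab M.ab deg_additive[OF d_deg], of v "s (diff M v)"]
    by (simp_all add: p_def) (simp add: a_minus_def M.M.r_neg)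
  have pa: "p (x \<oplus>\<^sub>M y) = p x \<oplus>\<^sub>M p y" if "x \<in> carrier M" "y \<in> carrier M" for x y
    using that sd by (simp add: p_def d_lin s(2) dd a_minus_def M.M.minus_add M.M.a_ac)
  have pr: "p (r \<odot>\<^sub>M x) = r \<odot>\<^sub>M p x" if "r \<in> carrier k" "x \<in> carrier M" for x r
    using that sd by (simp add: p_def d_lin s(3) dd a_minus_def M.smult_r_distr M.smult_r_minus)
  show ?thesis
  proof (intro exI[of _ "%v. s (p v)"] conjI ballI)
    have "klinear k M M (%v. s (p v))" unfolding klinear_def using s pv by (auto simp: pa pr)
    moreover have "s (p v) \<in> grade M (i - 1)" if "v \<in> grade M i" for v i
    proof -
      have "s (diff M v) \<in> grade M i" using s(4)[of "diff M v" i] d_g[OF that] M.gcar[OF that] d_lin(1) dd by simp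
      thus ?thesis using s(4)[OF pv[OF M.gcar[OF that]], of "i - 1"] that by (simp add: p_def)
    qed
    ultimately show "deg_linear k M M (- 1) (%v. s (p v))" by (auto simp: deg_linear_def)
    fix m assume m: "m \<in> carrier M"
    have "p (diff M m) = diff M m \<ominus>\<^sub>M s \<zero>\<^sub>M" using m by (simp add: p_def dd)
    moreover have "s \<zero>\<^sub>M = \<zero>\<^sub>M" using s(4)[of "\<zero>\<^sub>M"] s(3)[of "\<zero>\<^sub>k" "\<zero>\<^sub>M"] s(1)[of "\<zero>\<^sub>M"] d_lin(3)[of "\<zero>\<^sub>k" "\<zero>\<^sub>M"] d_lin(1)[of "\<zero>\<^sub>M"] by simp
    ultimately have "p (diff M m) = diff M m" using m by (simp add: a_minus_def d_lin M.minus_as_ksgn)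
    thus "diff M (s (p m)) \<oplus>\<^sub>M s (p (diff M m)) = m" using s(1)[OF pv[OF m]] m sd[OF m] by (simp add: p_def a_minus_def M.M.a_assoc M.M.l_neg)
  qed
qed

locale twf = tw k A C \<pi> + cc: conn_coal k C
  for k :: "'k ring" and A :: "('k, 'a) dgspace" and C :: "('k, 'c) coalg" and \<pi> +
  assumes pi_g0: "\<pi> cc.g = \<zero>\<^sub>A"

context twf begin

abbreviation "W \<equiv> cc.W"

lemma span_g: "C.subm (addl C k cc.g {\<zero>\<^sub>C})" by (rule C.addl_subm[OF C.subm_trivial cc.g(2)])

lemma zero_span_g:
  assumes "klinear k C X f" "f cc.g = \<zero>\<^sub>X" "module k X" "s \<in> addl C k cc.g {\<zero>\<^sub>C}"
  shows "f s = \<zero>\<^sub>X"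
proof -
  interpret X: kmod k X using assms(3) by (simp add: kmod_def)
  show ?thesis using assms(4) cc.g(2) klinearD(3)[OF assms(1) _ cc.g(2)] assms(2) by (auto simp: addl_def)
qed

text \<open>For c in \<open>W (Suc m)\<close> the comultiplication lies in kg (x) C + C (x) W m, and
  also in W m (x) C + C (x) kg. A bilinear map that kills both summands of one of these sums kills
  it. The map \<beta> has to be free of degree-dependent signs, because W m is not known to be
  graded.\<close>

lemma sweedler_separate:
  assumes N: "module k N" and b: "bilin k C C N \<beta>" and p: "bifam k C C N \<phi>"
    and e: "!!i j x y. x \<in> grade C i ==> y \<in> grade C j ==> \<phi> i j x y = \<beta> x y" and c: "c \<in> W (Suc m)"
    and z: "(\<forall>y\<in>carrier C. \<beta> cc.g y = \<zero>\<^sub>N) & (\<forall>x\<in>carrier C. \<forall>y\<in>W m. \<beta> x y = \<zero>\<^sub>N)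
      \<or> (\<forall>x\<in>carrier C. \<beta> x cc.g = \<zero>\<^sub>N) & (\<forall>x\<in>W m. \<forall>y\<in>carrier C. \<beta> x y = \<zero>\<^sub>N)"
  shows "sweedler C N \<phi> c = \<zero>\<^sub>N"
proof -
  note cc = cc.W_car[OF c]
  obtain xs where xs: "set xs \<subseteq> carrier C \<times> carrier C" "comult C c = tensor_class k C C xs" using cc.comult_cases[OF cc] .
  have s: "sweedler C N \<phi> c = tsum N \<beta> xs" by (rule cc.sw_tsum[OF N b xs(2,1) p e])
  note gs = C.addl_self[OF C.subm_trivial cc.g(2)]
  from z show ?thesis
  proof
    assume z: "(\<forall>y\<in>carrier C. \<beta> cc.g y = \<zero>\<^sub>N) & (\<forall>x\<in>carrier C. \<forall>y\<in>W m. \<beta> x y = \<zero>\<^sub>N)"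
    have "tsum N \<beta> xs = \<zero>\<^sub>N"
    proof (rule CC.L.tsum_separate[OF cc.fk N b span_g cc.W_subm[of m] _ _ xs(1)])
      show "\<beta> x y = \<zero>\<^sub>N" if "x \<in> addl C k cc.g {\<zero>\<^sub>C}" "y \<in> carrier C" for x y
        by (rule zero_span_g[OF bilin_left[OF b that(2)] _ N that(1)]) (use z that in blast)
      show "\<beta> x y = \<zero>\<^sub>N" if "x \<in> carrier C" "y \<in> W m" for x y using z that by blast
      show "tsum C (%x. smult C (f x)) xs \<in> W m" if "form k C f" "!!s. s \<in> addl C k cc.g {\<zero>\<^sub>C} ==> f s = \<zero>\<^sub>k" for f
        using cc.rho_tsum[OF that(1) xs(2,1)] c that(1) that(2)[OF gs] by auto
    qed
    thus ?thesis using s by simp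
  next
    assume z: "(\<forall>x\<in>carrier C. \<beta> x cc.g = \<zero>\<^sub>N) & (\<forall>x\<in>W m. \<forall>y\<in>carrier C. \<beta> x y = \<zero>\<^sub>N)"
    have "tsum N (%y x. \<beta> x y) (map prod.swap xs) = \<zero>\<^sub>N"
    proof (rule CC.L.tsum_separate[OF cc.fk N bilin_flip[OF b] span_g cc.W_subm[of m]])
      show "\<beta> y x = \<zero>\<^sub>N" if "x \<in> addl C k cc.g {\<zero>\<^sub>C}" "y \<in> carrier C" for x y
        by (rule zero_span_g[OF bilin_right[OF b that(2)] _ N that(1)]) (use z that in blast)
      show "\<beta> y x = \<zero>\<^sub>N" if "x \<in> carrier C" "y \<in> W m" for x y using z that by blast
      show "set (map prod.swap xs) \<subseteq> carrier C \<times> carrier C" using xs(1) by auto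
      show "tsum C (%x. smult C (f x)) (map prod.swap xs) \<in> W m" if "form k C f" "!!s. s \<in> addl C k cc.g {\<zero>\<^sub>C} ==> f s = \<zero>\<^sub>k" for f
        using cc.W_lam[OF c conjI[OF that(1) that(2)[OF gs]]] cc.lam_tsum[OF that(1) xs(2,1)] by (simp add: tsum_swap)
    qed
    thus ?thesis using s by (simp add: tsum_swap)
  qed
qed

text \<open>The two twisting terms vanish: \<pi> kills g and f kills the generators over W m, which
  accounts for both parts of the comultiplication of c.\<close>

lemma bl_dgen_W:
  assumes N: "gbim k A N" and f: "bimod_linear k A K N n f" and z: "!!y. y \<in> W m ==> f (gen y) = \<zero>\<^sub>N"
    and c: "c \<in> W (Suc m)"
  shows "f (dgen c) = f (gen (diff C c))"
proof -
  interpret N: gbim k A N by fact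
  have mN: "module k N" by (rule N.M.module_axioms)
  have fk: "klinear k K N f" by (rule deg_klinear[OF bimod_linearD(1)[OF f]])
  note fg = klinear_compose[OF gen_kl fk] and fl = klinearD[OF fk]
  have fgr: "f (gen x) \<in> grade N (i + n)" if "x \<in> grade C i" for x i using deg_linear_grade[OF bimod_linearD(1)[OF f] gen_g[OF that]] .
  note cc = cc.W_car[OF c]
  have s0: "N.M.sg 1 \<zero>\<^sub>N = \<zero>\<^sub>N" "A.sg n \<zero>\<^sub>A = \<zero>\<^sub>A" using N.M.sg(2)[OF N.M.g_zero] A.sg(2)[OF A.g_zero] by simp_all
  have sc: "klinear k N N (%v. ksgn k n \<odot>\<^sub>N v)" by (simp add: klinear_def N.M.smult_r_distr N.M.smult_comm)
  \<comment> \<open>The exponent n (p + 1) is n times the degree of \<pi> x, so the sign is absorbed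
    by applying \<open>A.sg n\<close> to \<pi> x.\<close>
  have "SL N (%p. n * (p + 1)) \<pi> (%y. f (gen y)) c = \<zero>\<^sub>N"
  proof (rule sweedler_separate[OF mN bilin_comp[OF N.la_bilin klinear_compose[OF pi_kl A.sg(1)] fg] bla[OF N pi_kl fg] _ c])
    show "ksgn k (n * (i + 1)) \<odot>\<^sub>N lact N (\<pi> x) (f (gen y)) = lact N (A.sg n (\<pi> x)) (f (gen y))"
      if "x \<in> grade C i" "y \<in> grade C j" for i j x y using that by (simp add: A.sg(2)[OF pi_g] N.la C.gcar pi_lin fl gen_lin)
    show "(\<forall>y\<in>carrier C. lact N (A.sg n (\<pi> cc.g)) (f (gen y)) = \<zero>\<^sub>N) & (\<forall>x\<in>carrier C. \<forall>y\<in>W m. lact N (A.sg n (\<pi> x)) (f (gen y)) = \<zero>\<^sub>N) \<or>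
      (\<forall>x\<in>carrier C. lact N (A.sg n (\<pi> x)) (f (gen cc.g)) = \<zero>\<^sub>N) & (\<forall>x\<in>W m. \<forall>y\<in>carrier C. lact N (A.sg n (\<pi> x)) (f (gen y)) = \<zero>\<^sub>N)"
      by (rule disjI1) (simp add: pi_g0 s0 z N.la_zero N.la_zero2 fl gen_lin pi_lin klinearD[OF A.sg(1)])
  qed
  \<comment> \<open>The required exponent is the degree of x, whereas \<open>f (gen x)\<close> has
    that degree plus n; \<open>N.M.sg 1\<close> is therefore corrected by the constant
    (-1)^n.\<close>
  moreover have "SR N (%p. p) (%x. f (gen x)) \<pi> c = \<zero>\<^sub>N"
  proof (rule sweedler_separate[OF mN bilin_comp[OF N.ra_bilin klinear_compose[OF fg klinear_compose[OF N.M.sg(1)[of 1] sc]] pi_kl] bra[OF N fg pi_kl] _ c])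
    show "ksgn k i \<odot>\<^sub>N ract N (f (gen x)) (\<pi> y) = ract N (ksgn k n \<odot>\<^sub>N N.M.sg 1 (f (gen x))) (\<pi> y)"
      if "x \<in> grade C i" "y \<in> grade C j" for i j x y
      using that ksgn_cong[of "n + (i + n)" i k] by (simp add: N.M.sg(2)[OF fgr] N.ra C.gcar pi_lin fl gen_lin N.M.ksgn_ksgn)
    show "(\<forall>y\<in>carrier C. ract N (ksgn k n \<odot>\<^sub>N N.M.sg 1 (f (gen cc.g))) (\<pi> y) = \<zero>\<^sub>N) & (\<forall>x\<in>carrier C. \<forall>y\<in>W m. ract N (ksgn k n \<odot>\<^sub>N N.M.sg 1 (f (gen x))) (\<pi> y) = \<zero>\<^sub>N) \<or>
      (\<forall>x\<in>carrier C. ract N (ksgn k n \<odot>\<^sub>N N.M.sg 1 (f (gen x))) (\<pi> cc.g) = \<zero>\<^sub>N) & (\<forall>x\<in>W m. \<forall>y\<in>carrier C. ract N (ksgn k n \<odot>\<^sub>N N.M.sg 1 (f (gen x))) (\<pi> y) = \<zero>\<^sub>N)"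
      by (rule disjI2) (simp add: pi_g0 s0 z N.ra_zero N.ra_zero2 fl gen_lin pi_lin klinearD[OF N.M.sg(1)])
  qed
  ultimately show ?thesis using bl_dgen[OF N f cc] fl gen_lin d_lin cc by (simp add: a_minus_def N.M.minus_as_ksgn)
qed

lemma K_null:
  assumes N: "dbim k A N" and ac: "acyclic_space N"
    and F: "F \<in> grade (Hom_bimod k A K N) n" "diff (Hom_bimod k A K N) F = \<zero>\<^bsub>Hom_bimod k A K N\<^esub>"
  shows "\<exists>G\<in>grade (Hom_bimod k A K N) (n - 1). diff (Hom_bimod k A K N) G = F"
proof -
  interpret N: dbim k A N by fact
  interpret KN: dbim2 k A K N by (intro dbim2I KD.dbim_axioms N)
  note gN = N.gbim_axioms
  let ?H = "Hom_bimod k A K N"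
  let ?D = "diff ?H"
  obtain h where h: "deg_linear k N N (- 1) h" "!!m. m \<in> carrier N ==> diff N (h m) \<oplus>\<^sub>N h (diff N m) = m"
    using N.contraction[OF cc.fk ac] by blast
  note hk = deg_klinear[OF h(1)]
  note hl = klinearD[OF hk] and h0 = additive_zero[OF N.M.ab N.M.ab klinear_additive[OF hk]]
  note nd0 = additive_zero[OF N.M.ab N.M.ab deg_additive[OF N.d_deg]]
  note Hc = KN.HB.gcar and Dl = KN.HB.dl
  note Dm = additive_diff[OF KN.HB.ab KN.HB.ab deg_additive[OF KN.HB.d_deg]]
  have cl: "f (gen c) \<in> carrier N" if "f \<in> grade ?H i" "c \<in> carrier C" for f i c by (rule KN.HB_app(5)[OF Hc[OF that(1)] gen_lin(1)[OF that(2)]])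
  have Hm: "(f \<ominus>\<^bsub>?H\<^esub> f') (gen c) = f (gen c) \<ominus>\<^sub>N f' (gen c)" if "f \<in> carrier ?H" "f' \<in> carrier ?H" "c \<in> carrier C" for f f' c
    by (rule KN.HB_app(1)[OF that(1,2) gen_lin(1)[OF that(3)]])
  have Dgen: "?D f (gen c) = diff N (f (gen c)) \<ominus>\<^sub>N ksgn k i \<odot>\<^sub>N f (dgen c)" if "f \<in> grade ?H i" "c \<in> carrier C" for f i c
    using KN.HB_diff[OF that(1) gen_lin(1)[OF that(2)]] dK_gen[OF that(2)] by simp
  \<comment> \<open>A first approximation to a primitive of f: the contraction applied to its values
    on generators.\<close>
  define B where "B f = ext N (n - 1) (%c. h (f (gen c)))" for f
  have Bd: "deg_linear k C N (n - 1) (%c. h (f (gen c)))" if "f \<in> grade ?H n" for f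
    using deg_linear_compose[OF deg_linear_compose[OF gen_deg bimod_linearD(1)[OF KN.HB_bl[OF that]]] h(1)] by simp
  have B: "B f \<in> grade ?H (n - 1)" "!!c. c \<in> carrier C ==> B f (gen c) = h (f (gen c))" if "f \<in> grade ?H n" for f
    using ext_bl[OF gN Bd[OF that]] ext_ext ext_gen[OF gN deg_klinear[OF Bd[OF that]]] by (simp_all add: B_def Hom_grade)
  \<comment> \<open>Over \<open>W (Suc j)\<close> the twisting terms vanish for f and for
    \<open>B f\<close>. The cocycle condition replaces the differential of \<open>f (gen c)\<close>
    by the value of f on \<open>gen (diff C c)\<close>, up to sign, and the contraction identity
    then returns \<open>f (gen c)\<close>. This works wherever \<open>diff C c\<close> lies in the
    filtration.\<close>
  have key: "?D (B f) (gen c) = f (gen c)"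
    if f: "f \<in> grade ?H n" "?D f = \<zero>\<^bsub>?H\<^esub>" "!!c. c \<in> W j ==> f (gen c) = \<zero>\<^sub>N" and c: "c \<in> W (Suc j)" for f j c
  proof -
    note ccar = cc.W_car[OF c] and dcar = d_lin(1)[OF cc.W_car[OF c]]
    let ?x = "f (gen c)" and ?y = "f (gen (diff C c))"
    have xc: "?x \<in> carrier N" "?y \<in> carrier N" using cl[OF f(1)] ccar dcar by blast+
    have "B f (dgen c) = h ?y" using bl_dgen_W[OF gN KN.HB_bl[OF B(1)[OF f(1)]] _ c] B(2)[OF f(1)] f(3) h0 cc.W_car dcar by simp
    hence 1: "?D (B f) (gen c) = diff N (h ?x) \<ominus>\<^sub>N ksgn k (n - 1) \<odot>\<^sub>N h ?y"
      using Dgen[OF B(1)[OF f(1)] ccar] B(2)[OF f(1) ccar] by simp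
    have "diff N ?x \<ominus>\<^sub>N ksgn k n \<odot>\<^sub>N ?y = \<zero>\<^sub>N"
      using Dgen[OF f(1) ccar] f(2) KN.HB_app(3)[OF gen_lin(1)[OF ccar]] bl_dgen_W[OF gN KN.HB_bl[OF f(1)] f(3) c] by simp
    hence "diff N ?x = ksgn k n \<odot>\<^sub>N ?y" using N.M.diff_zero_eq xc N.d_lin(1) by simp
    hence 2: "diff N (h ?x) \<oplus>\<^sub>N ksgn k n \<odot>\<^sub>N h ?y = ?x" using h(2)[OF xc(1)] xc hl by simp
    show ?thesis unfolding 1 using 2 xc hl by (simp add: a_minus_def N.M.minus_as_ksgn N.M.ksgn_ksgn)
  qed
  \<comment> \<open>What is left of F after j corrections; it vanishes on the generators over W
    j.\<close>
  define Fs where "Fs = rec_nat F (%_ f. f \<ominus>\<^bsub>?H\<^esub> ?D (B f))"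
  have Fs_simps: "Fs 0 = F" "Fs (Suc j) = Fs j \<ominus>\<^bsub>?H\<^esub> ?D (B (Fs j))" for j by (simp_all add: Fs_def)
  have Fs: "Fs j \<in> grade ?H n & ?D (Fs j) = \<zero>\<^bsub>?H\<^esub> & (\<forall>c\<in>W j. Fs j (gen c) = \<zero>\<^sub>N)" for j
  proof (induction j)
    case 0
    have "F (gen \<zero>\<^sub>C) = \<zero>\<^sub>N"
      by (rule additive_zero[OF C.ab N.M.ab klinear_additive[OF klinear_compose[OF gen_kl KN.bl_lin[OF KN.HB_bl[OF F(1)]]]]])
    thus ?case using F by (simp add: Fs_simps)
  next
    case (Suc j)
    hence f: "Fs j \<in> grade ?H n" "?D (Fs j) = \<zero>\<^bsub>?H\<^esub>" "!!c. c \<in> W j ==> Fs j (gen c) = \<zero>\<^sub>N" by blast+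
    note Bc = Hc[OF B(1)[OF f(1)]]
    have DB: "?D (B (Fs j)) \<in> grade ?H n" using deg_linear_grade[OF KN.HB.d_deg B(1)[OF f(1)]] by simp
    have "Fs (Suc j) \<in> grade ?H n" unfolding Fs_simps using f(1) DB by simp
    moreover have "?D (Fs (Suc j)) = \<zero>\<^bsub>?H\<^esub>"
      unfolding Fs_simps Dm[OF Hc[OF f(1)] Hc[OF DB]] f(2) KN.HB.dd[OF Bc] by (simp add: a_minus_def KN.HB.minus_as_ksgn)
    moreover have "Fs (Suc j) (gen c) = \<zero>\<^sub>N" if "c \<in> W (Suc j)" for c
      using Hm[OF Hc[OF f(1)] Hc[OF DB] cc.W_car[OF that]] cl[OF f(1) cc.W_car[OF that]] key[OF f that] by (simp add: Fs_simps a_minus_def N.M.M.r_neg)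
    ultimately show ?case by blast
  qed
  hence FsB: "Fs j \<in> grade ?H n" "!!c. c \<in> W j ==> Fs j (gen c) = \<zero>\<^sub>N" for j by blast+
  \<comment> \<open>The accumulated corrections. On generators over W j they no longer change after
    stage j, which gives the limit \<psi>.\<close>
  define Gs where "Gs = rec_nat \<zero>\<^bsub>?H\<^esub> (%j f. f \<oplus>\<^bsub>?H\<^esub> B (Fs j))"
  have Gs_simps: "Gs 0 = \<zero>\<^bsub>?H\<^esub>" "Gs (Suc j) = Gs j \<oplus>\<^bsub>?H\<^esub> B (Fs j)" for j by (simp_all add: Gs_def)
  have GsB: "Gs j \<in> grade ?H (n - 1)" for j by (induction j) (simp_all add: Gs_simps B(1)[OF FsB(1)])
  have DGs: "?D (Gs j) = F \<ominus>\<^bsub>?H\<^esub> Fs j" for j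
  proof (induction j)
    case 0 thus ?case using KN.HB.d0 Hc[OF F(1)] by (simp add: Gs_simps Fs_simps a_minus_def KN.HB.M.r_neg)
  next
    case (Suc j)
    note c = Hc[OF F(1)] Hc[OF FsB(1)] Dl(1)[OF Hc[OF B(1)[OF FsB(1)]]]
    have "?D (Gs (Suc j)) = (F \<ominus>\<^bsub>?H\<^esub> Fs j) \<oplus>\<^bsub>?H\<^esub> ?D (B (Fs j))"
      unfolding Gs_simps Dl(2)[OF Hc[OF GsB] Hc[OF B(1)[OF FsB(1)]]] Suc ..
    also have "... = F \<ominus>\<^bsub>?H\<^esub> Fs (Suc j)" using c by (simp add: Fs_simps a_minus_def KN.HB.M.minus_add KN.HB.M.a_assoc)
    finally show ?case .
  qed
  have Gst: "Gs (j + i) (gen c) = Gs j (gen c)" if "c \<in> W j" for i j c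
  proof (induction i)
    case (Suc i)
    have c: "c \<in> W (j + i)" using that cc.W_mono[of j "j + i"] by auto
    note ccar = cc.W_car[OF that]
    show ?case using Suc KN.HB_app(2)[OF gen_lin(1)[OF ccar]] B(2)[OF FsB(1) ccar] FsB(2)[OF c] h0 cl[OF GsB ccar] by (simp add: Gs_simps)
  qed simp
  define \<psi> where "\<psi> c = Gs (LEAST j. c \<in> W j) (gen c)" for c
  have psi: "\<psi> c = Gs j (gen c)" if "c \<in> W j" for c j
    using Gst[OF LeastI[of "%j. c \<in> W j", OF that], of "j - (LEAST j. c \<in> W j)"] Least_le[of "%j. c \<in> W j", OF that] by (simp add: \<psi>_def)
  have both: "\<exists>j. c \<in> W j & c' \<in> W j" if c: "c \<in> carrier C" "c' \<in> carrier C" for c c'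
  proof -
    obtain i j where "c \<in> W i" "c' \<in> W j" using cc.W_exhaust c by blast
    thus ?thesis using cc.W_mono[of i "max i j"] cc.W_mono[of j "max i j"] by (intro exI[of _ "max i j"]) auto
  qed
  have pd: "deg_linear k C N (n - 1) \<psi>" unfolding deg_linear_def klinear_def
  proof (intro conjI ballI allI Pi_I subsetI)
    fix x assume x: "x \<in> carrier C"
    then obtain j where j: "x \<in> W j" using cc.W_exhaust by blast
    show "\<psi> x \<in> carrier N" using psi[OF j] cl[OF GsB x] by simp
    show "\<psi> (r \<odot>\<^sub>C x) = r \<odot>\<^sub>N \<psi> x" if r: "r \<in> carrier k" for r
      using psi[OF j] psi[OF C.subm_smult[OF cc.W_subm r j]] x r KN.bl(3)[OF KN.HB_bl[OF GsB[of j]]] by (simp add: gen_lin)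
    fix y assume y: "y \<in> carrier C"
    obtain j where j: "x \<in> W j" "y \<in> W j" using both[OF x y] by blast
    show "\<psi> (x \<oplus>\<^sub>C y) = \<psi> x \<oplus>\<^sub>N \<psi> y"
      using psi[OF j(1)] psi[OF j(2)] psi[OF C.subm_add[OF cc.W_subm j]] x y KN.bl(2)[OF KN.HB_bl[OF GsB[of j]]] by (simp add: gen_lin)
  next
    fix i y assume "y \<in> \<psi> ` grade C i"
    then obtain c where c: "c \<in> grade C i" "y = \<psi> c" by blast
    obtain j where j: "c \<in> W j" using cc.W_exhaust[OF C.gcar[OF c(1)]] by blast
    have "Gs j (gen c) \<in> grade N (i + (n - 1))" by (rule deg_linear_grade[OF bimod_linearD(1)[OF KN.HB_bl[OF GsB]] gen_g[OF c(1)]])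
    thus "y \<in> grade N (i + (n - 1))" by (simp add: c(2) psi[OF j])
  qed
  define G where "G = ext N (n - 1) \<psi>"
  have G: "G \<in> grade ?H (n - 1)" using ext_bl[OF gN pd] ext_ext by (simp add: G_def Hom_grade)
  have Gg: "G (gen c) = \<psi> c" if "c \<in> carrier C" for c unfolding G_def by (rule ext_gen[OF gN deg_klinear[OF pd] that])
  have DG: "?D G \<in> grade ?H n" using deg_linear_grade[OF KN.HB.d_deg G] by simp
  have "?D G t = F t" if t: "t \<in> carrier K" for t
  proof (rule bl_uniq[OF gN KN.HB_bl[OF DG] KN.HB_bl[OF F(1)] _ t])
    fix i c assume "c \<in> grade C i"
    hence c: "c \<in> carrier C" by (rule C.gcar)
    \<comment> \<open>At a stage that contains both c and its differential, the remainder
      \<open>?R\<close> vanishes on \<open>gen c\<close> and, the twisting terms being zero, also on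
      \<open>dgen c\<close>.\<close>
    obtain j where j: "c \<in> W j" "diff C c \<in> W j" using both[OF c d_lin(1)[OF c]] by blast
    let ?R = "G \<ominus>\<^bsub>?H\<^esub> Gs j"
    have R: "?R \<in> grade ?H (n - 1)" using G GsB by simp
    have Rg: "?R (gen y) = \<zero>\<^sub>N" if "y \<in> W j" for y
      using Hm[OF Hc[OF G] Hc[OF GsB] cc.W_car[OF that]] Gg[OF cc.W_car[OF that]] psi[OF that] cl[OF GsB cc.W_car[OF that]]
      by (simp add: a_minus_def N.M.M.r_neg)
    have cS: "c \<in> W (Suc j)" using cc.W_Suc j(1) by blast
    have "?R (dgen c) = \<zero>\<^sub>N" using bl_dgen_W[OF gN KN.HB_bl[OF R] Rg cS] Rg[OF j(2)] by simp
    hence "?D ?R (gen c) = \<zero>\<^sub>N" using Dgen[OF R c] Rg[OF j(1)] nd0 by (simp add: a_minus_def N.M.minus_as_ksgn)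
    moreover have "(F \<ominus>\<^bsub>?H\<^esub> Fs j) (gen c) = F (gen c)"
      using Hm[OF Hc[OF F(1)] Hc[OF FsB(1)] c] FsB(2)[OF j(1)] cl[OF F(1) c] by (simp add: a_minus_def N.M.minus_as_ksgn)
    ultimately have "?D G (gen c) \<ominus>\<^sub>N F (gen c) = \<zero>\<^sub>N"
      using Dm[OF Hc[OF G] Hc[OF GsB[of j]]] Hm[OF Hc[OF DG] Dl(1)[OF Hc[OF GsB[of j]]] c] DGs[of j] by simp
    thus "?D G (gen c) = F (gen c)" using cl[OF DG c] cl[OF F(1) c] N.M.diff_zero_eq by simp
  qed
  hence "?D G = F" by (rule KN.HB_eqI[OF Hc[OF DG] Hc[OF F(1)]])
  thus ?thesis using G by blast
qed

lemma K_Hom_acyclic: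
  assumes N: "dbim k A N" and ac: "acyclic_space N"
  shows "acyclic_space (Hom_bimod k A K N)"
proof -
  interpret KN: dbim2 k A K N by (intro dbim2I KD.dbim_axioms N)
  show ?thesis by (rule acyclic_spaceI[OF KN.HB_dg]) (use K_null[OF N ac] KN.HB.gcar in blast)
qed

text \<open>A graded linear section of the surjection provides a lift on generators, and K is free
  on them.\<close>

lemma K_lift:
  assumes X: "graded_bimodule k A X" and Y: "graded_bimodule k A Y" and q: "bimod_linear k A X Y 0 q" "q ` carrier X = carrier Y"
    and f: "bimod_linear k A K Y 0 f"
  shows "\<exists>h. bimod_linear k A K X 0 h & (\<forall>m\<in>carrier K. q (h m) = f m)"
proof -
  have gX: "gbim k A X" and gY: "gbim k A Y" using X Y by (simp_all add: gbimI[OF dga_axioms])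
  interpret X: gbim k A X by (rule gX)
  interpret Y: gbim k A Y by (rule gY)
  interpret XY: gbim2 k A X Y by (intro gbim2.intro gX gY)
  interpret KX: gbim2 k A K X by (intro gbim2.intro KBx gX)
  interpret KY: gbim2 k A K Y by (intro gbim2.intro KBx gY)
  have gsY: "gspace k Y" ..
  obtain s where "\<forall>y\<in>q ` carrier X. s y \<in> carrier X & q (s y) = y
    & (\<forall>z\<in>q ` carrier X. s (y \<oplus>\<^sub>Y z) = s y \<oplus>\<^sub>X s z) & (\<forall>r\<in>carrier k. s (r \<odot>\<^sub>Y y) = r \<odot>\<^sub>X s y)
    & (\<forall>i. y \<in> grade Y (i + 0) --> s y \<in> grade X i)" using X.M.graded_section[OF cc.fk gsY bimod_linearD(1)[OF q(1)]] by (rule exE)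
  hence s: "deg_linear k Y X 0 s" "!!y. y \<in> carrier Y ==> q (s y) = y" unfolding q(2) deg_linear_def klinear_def using Y.M.gcar by auto
  have d: "deg_linear k C X 0 (%c. s (f (gen c)))" using deg_linear_compose[OF deg_linear_compose[OF gen_deg bimod_linearD(1)[OF f]] s(1)] by simp
  let ?h = "ext X 0 (%c. s (f (gen c)))"
  have h: "bimod_linear k A K X 0 ?h" by (rule ext_bl[OF gX d])
  have qh: "bimod_linear k A K Y 0 (%m. q (?h m))"
  proof (rule KY.bimod_linearI)
    show "deg_linear k K Y 0 (%m. q (?h m))" using deg_linear_compose[OF bimod_linearD(1)[OF h] bimod_linearD(1)[OF q(1)]] by simp
  qed (simp_all add: KX.bl_l[OF h] KX.bl_r[OF h] XY.bl_l[OF q(1)] XY.bl_r[OF q(1)] KX.bl[OF h] X.la A.gcar Y.la XY.bl[OF q(1)])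
  have "q (?h m) = f m" if "m \<in> carrier K" for m
  proof (rule bl_uniq[OF gY qh f _ that])
    fix j c assume "c \<in> grade C j"
    hence c: "c \<in> carrier C" by (rule C.gcar)
    show "q (?h (gen c)) = f (gen c)" unfolding ext_gen[OF gX deg_klinear[OF d] c] by (rule s(2)[OF KY.bl(1)[OF f gen_lin(1)[OF c]]])
  qed
  thus ?thesis using h by blast
qed

lemma K_semi_projective: "semi_projective u k A K" unfolding semi_projective_def graded_projective_def
  using K_dg K_lift K_Hom_acyclic[OF dbimI[OF dga_axioms]] by blast

end

section \<open>Homotopy equivalent bimodules\<close>

lemma End_simps:
  "carrier (End_bimod k A M) = carrier (Hom_bimod k A M M)" "\<zero>\<^bsub>End_bimod k A M\<^esub> = \<zero>\<^bsub>Hom_bimod k A M M\<^esub>"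
  "add (End_bimod k A M) = add (Hom_bimod k A M M)" "smult (End_bimod k A M) = smult (Hom_bimod k A M M)"
  "grade (End_bimod k A M) = grade (Hom_bimod k A M M)" "diff (End_bimod k A M) = diff (Hom_bimod k A M M)"
  "f \<otimes>\<^bsub>End_bimod k A M\<^esub> g = compose (carrier M) f g" "\<one>\<^bsub>End_bimod k A M\<^esub> = restrict (%m. m) (carrier M)"
  by (simp_all add: End_bimod_def)

lemma End_cohomology:
  "cocycles (End_bimod k A M) = cocycles (Hom_bimod k A M M)" "coboundaries (End_bimod k A M) = coboundaries (Hom_bimod k A M M)"
  "f \<ominus>\<^bsub>End_bimod k A M\<^esub> g = f \<ominus>\<^bsub>Hom_bimod k A M M\<^esub> g"
  by (simp_all add: cocycles_def coboundaries_def End_simps a_minus_cong_struct[of "End_bimod k A M" "Hom_bimod k A M M"])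

lemma End_dga: "dbim k A M ==> dga k (End_bimod k A M)" by (intro dga.intro dbim_end.E_dga dbim_end.intro dbim2I)

text \<open>With d = e - 1 one has e x e - x = d x e + x d, and coboundaries absorb multiplication
  by cocycles.\<close>

lemma (in dga) conjugate_one:
  assumes e: "e \<in> cocycles A" "e \<ominus>\<^sub>A \<one>\<^sub>A \<in> coboundaries A" and x: "x \<in> cocycles A"
  shows "x \<ominus>\<^sub>A e \<otimes>\<^sub>A x \<otimes>\<^sub>A e \<in> coboundaries A"
proof -
  let ?d = "e \<ominus>\<^sub>A \<one>\<^sub>A"
  note c = D.ZD(1)[OF e(1)] D.ZD(1)[OF x]
  have "?d \<otimes>\<^sub>A (x \<otimes>\<^sub>A e) \<oplus>\<^sub>A x \<otimes>\<^sub>A ?d \<in> coboundaries A"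
    by (intro A.subm_add[OF D.B_subm] B_Z_mult Z_B_mult Z_mult e x)
  also have "?d \<otimes>\<^sub>A (x \<otimes>\<^sub>A e) \<oplus>\<^sub>A x \<otimes>\<^sub>A ?d = e \<otimes>\<^sub>A x \<otimes>\<^sub>A e \<ominus>\<^sub>A x"
    using c by (simp add: a_minus_def AR.l_distr AR.r_distr AR.l_minus AR.r_minus AR.m_assoc A.M.a_assoc A.M.r_neg1)
  finally have "\<ominus>\<^sub>A (e \<otimes>\<^sub>A x \<otimes>\<^sub>A e \<ominus>\<^sub>A x) \<in> coboundaries A" by (rule A.subm_uminus[OF D.B_subm])
  thus ?thesis using c by (simp add: a_minus_def A.M.minus_add A.M.a_comm)
qed

locale hequiv = a: chm k A M K \<alpha> + b: chm k A K M \<beta>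
  for k :: "'k ring" and A :: "('k, 'a) dgspace" and M :: "('k, 'a, 'm) dgbimod" and K :: "('k, 'a, 'n) dgbimod" and \<alpha> \<beta> +
  assumes ba: "restrict (%m. \<beta> (\<alpha> m)) (carrier M) \<ominus>\<^bsub>Hom_bimod k A M M\<^esub> restrict (%m. m) (carrier M) \<in> coboundaries (Hom_bimod k A M M)"
    and ab: "restrict (%m. \<alpha> (\<beta> m)) (carrier K) \<ominus>\<^bsub>Hom_bimod k A K K\<^esub> restrict (%m. m) (carrier K) \<in> coboundaries (Hom_bimod k A K K)"
begin

abbreviation "EM \<equiv> End_bimod k A M"
abbreviation "EK \<equiv> End_bimod k A K"
abbreviation "T \<equiv> %F. \<lambda>t\<in>carrier K. \<alpha> (F (\<beta> t))"
abbreviation "T' \<equiv> %F. \<lambda>t\<in>carrier M. \<beta> (F (\<alpha> t))"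

lemma EM: "dga k EM" and EK: "dga k EK" by (rule End_dga[OF a.M.dbim_axioms], rule End_dga[OF a.N.dbim_axioms])

lemma T: "chain_map k EM EK T" and T': "chain_map k EK EM T'" using hom_comp[OF b.chm_axioms a.chm_axioms] hom_comp[OF a.chm_axioms b.chm_axioms]
  by (simp_all add: chain_map_def deg_linear_def klinear_def End_simps)

text \<open>This endomorphism is the image of the identity of K under the chain map
  \<open>T'\<close>.\<close>

lemma e_cocycle: "restrict (%m. \<beta> (\<alpha> m)) (carrier M) \<in> cocycles EM"
proof -
  interpret EM: dga k EM by (rule EM)
  interpret EK: dga k EK by (rule EK)
  interpret T': dgs2 k EK EM T' by (rule dgs2I[OF EK.A_dg EM.A_dg T'])
  have "T' \<one>\<^sub>EK = restrict (%m. \<beta> (\<alpha> m)) (carrier M)" by (auto simp: End_simps a.fl intro!: restrict_ext)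
  thus ?thesis using T'.fZ[OF EK.one_Z] by simp
qed

text \<open>The composite of T and T' multiplies F on both sides by \<beta>\<alpha>, which is the
  identity up to a coboundary.\<close>

lemma conjugate:
  assumes F: "F \<in> cocycles EM" shows "F \<ominus>\<^sub>EM T' (T F) \<in> coboundaries EM"
proof -
  interpret EM: dga k EM by (rule EM)
  interpret MM: dbim2 k A M M by (intro dbim2I a.M.dbim_axioms)
  let ?e = "restrict (%m. \<beta> (\<alpha> m)) (carrier M)"
  have Fc: "F m \<in> carrier M" if "m \<in> carrier M" for m using EM.D.ZD(1)[OF F] MM.HB_app(5) that by (simp add: End_simps)
  have "T' (T F) = ?e \<otimes>\<^sub>EM F \<otimes>\<^sub>EM ?e" by (auto simp: End_simps compose_def a.fl b.fl Fc intro!: restrict_ext)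
  thus ?thesis using EM.conjugate_one[OF e_cocycle _ F] ba by (simp add: End_cohomology End_simps)
qed

end

lemma (in hequiv) swap: "hequiv k A K M \<beta> \<alpha>" by (simp add: hequiv_def hequiv_axioms_def a.chm_axioms b.chm_axioms ba ab)

lemma (in hequiv) graded_iso: "\<exists>\<theta>. graded_ring_iso EM EK \<theta>"
proof -
  interpret s: hequiv k A K M \<beta> \<alpha> by (rule swap)
  interpret EM: dga k EM by (rule EM)
  interpret EK: dga k EK by (rule EK)
  interpret T: dgs2 k EM EK T by (rule dgs2I[OF EM.A_dg EK.A_dg T])
  interpret T': dgs2 k EK EM T' by (rule dgs2I[OF EK.A_dg EM.A_dg T'])
  interpret MM: dbim2 k A M M by (intro dbim2I a.M.dbim_axioms)
  let ?e = "restrict (%m. \<beta> (\<alpha> m)) (carrier M)"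
  have q: "quasi_iso k EM EK T" unfolding T.quasi_iso_iff
  proof (intro conjI ballI impI)
    fix F assume F: "F \<in> cocycles EM" "T F \<in> coboundaries EK"
    have "(F \<ominus>\<^sub>EM T' (T F)) \<oplus>\<^sub>EM T' (T F) \<in> coboundaries EM"
      by (rule EM.A.subm_add[OF EM.D.B_subm conjugate[OF F(1)] T'.fB[OF F(2)]])
    thus "F \<in> coboundaries EM" using EM.D.ZD(1)[OF F(1)] T'.fl(1)[OF T.fl(1)[OF EM.D.ZD(1)[OF F(1)]]] by (simp add: a_minus_def EM.A.M.a_assoc EM.A.M.l_neg)
  next
    fix G assume G: "G \<in> cocycles EK"
    thus "\<exists>F\<in>cocycles EM. G \<ominus>\<^sub>EK T F \<in> coboundaries EK" using s.conjugate[OF G] T'.fZ[OF G] by blast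
  qed
  have "graded_ring_iso EM EK (%X. coboundaries EK <+>\<^sub>EK (T ` X))"
  proof (rule quasi_iso_graded_ring_iso[OF EM.dgA EK.dgA q])
    show "T \<one>\<^sub>EM \<ominus>\<^sub>EK \<one>\<^sub>EK \<in> coboundaries EK"
    proof -
      have "T \<one>\<^sub>EM = restrict (%m. \<alpha> (\<beta> m)) (carrier K)" by (auto simp: End_simps b.fl intro!: restrict_ext)
      thus ?thesis using ab by (simp add: End_cohomology End_simps)
    qed
    show "\<exists>F\<in>cocycles EM \<inter> grade EM i. G \<ominus>\<^sub>EK T F \<in> coboundaries EK" if G: "G \<in> cocycles EK" "G \<in> grade EK i" for G i
      by (rule bexI[of _ "T' G"], rule s.conjugate[OF G(1)], rule IntI[OF T'.fZ[OF G(1)] deg_linear_grade[OF T'.f_deg G(2), unfolded add_0_right]])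
    fix F G assume F: "F \<in> cocycles EM" and G: "G \<in> cocycles EM"
    note c = EM.D.ZD(1)[OF F] EM.D.ZD(1)[OF G] EM.D.ZD(1)[OF e_cocycle]
    have v: "F m \<in> carrier M" "G m \<in> carrier M" if "m \<in> carrier M" for m using c MM.HB_app(5) that by (simp_all add: End_simps)
    \<comment> \<open>The product contains \<beta>\<alpha> between F and G. The defect of
      multiplicativity is thus, up to sign, T applied to F (\<beta>\<alpha> - 1) G, which is a
      coboundary.\<close>
    have "T F \<otimes>\<^sub>EK T G = T (F \<otimes>\<^sub>EM (?e \<otimes>\<^sub>EM G))"
      by (auto simp: End_simps compose_def a.fl b.fl v intro!: restrict_ext)
    hence "T (F \<otimes>\<^sub>EM G) \<ominus>\<^sub>EK T F \<otimes>\<^sub>EK T G = T ((F \<otimes>\<^sub>EM G) \<ominus>\<^sub>EM (F \<otimes>\<^sub>EM (?e \<otimes>\<^sub>EM G)))"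
      using c by (simp only: T.fm EM.AR.m_closed)
    also have "(F \<otimes>\<^sub>EM G) \<ominus>\<^sub>EM (F \<otimes>\<^sub>EM (?e \<otimes>\<^sub>EM G)) = \<ominus>\<^sub>EM (F \<otimes>\<^sub>EM ((?e \<ominus>\<^sub>EM \<one>\<^sub>EM) \<otimes>\<^sub>EM G))"
      using c unfolding a_minus_def by (simp only: EM.AR.l_distr EM.AR.r_distr EM.AR.l_minus EM.AR.r_minus EM.AR.l_one EM.AR.one_closed EM.A.M.a_inv_closed
          EM.AR.m_closed EM.A.M.minus_add EM.A.M.minus_minus EM.A.M.a_comm)
    finally have eq: "T (F \<otimes>\<^sub>EM G) \<ominus>\<^sub>EK T F \<otimes>\<^sub>EK T G = T (\<ominus>\<^sub>EM (F \<otimes>\<^sub>EM ((?e \<ominus>\<^sub>EM \<one>\<^sub>EM) \<otimes>\<^sub>EM G)))" .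
    have ba': "?e \<ominus>\<^sub>EM \<one>\<^sub>EM \<in> coboundaries EM" using ba by (simp add: End_cohomology End_simps)
    show "T (F \<otimes>\<^sub>EM G) \<ominus>\<^sub>EK T F \<otimes>\<^sub>EK T G \<in> coboundaries EK"
      unfolding eq by (rule T.fB[OF EM.A.subm_uminus[OF EM.D.B_subm EM.Z_B_mult[OF F EM.B_Z_mult[OF ba' G]]]])
  qed
  thus ?thesis by blast
qed

lemma graded_ring_iso_inv:
  fixes A :: "('k, 'a) dgspace" and B :: "('k, 'b) dgspace"
  assumes "dga k A" "graded_ring_iso A B \<theta>" shows "graded_ring_iso B A (inv_into (carrier (cohomology A)) \<theta>)"
proof -
  interpret A: dga k A by fact
  have \<theta>: "\<theta> \<in> ring_iso (cohomology A) (cohomology B)" "!!i. \<theta> ` cohomology_grade A i = cohomology_grade B i"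
    using assms(2) by (auto simp: graded_ring_iso_def)
  have "cohomology_grade A i \<subseteq> carrier (cohomology A)" for i by (auto simp: A.D.carrier_cohomology cohomology_grade_def)
  moreover have "inj_on \<theta> (carrier (cohomology A))" using \<theta>(1) by (simp add: ring_iso_def bij_betw_def)
  ultimately show ?thesis using ring_iso_set_sym[OF A.cohomology_simps(4) \<theta>(1)] \<theta>(2)
    by (simp add: graded_ring_iso_def \<theta>(2)[symmetric] inv_into_image_cancel)
qed

lemma graded_ring_iso_trans: "graded_ring_iso A B \<theta> ==> graded_ring_iso B C \<eta> ==> graded_ring_iso A C (\<eta> \<circ> \<theta>)"
  unfolding graded_ring_iso_def image_comp[symmetric] by (metis ring_iso_set_trans)

section \<open>The map \<open>l\<close> for an acyclic twisting cochain\<close>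

lemma (in dga) R_dbim: "dbim k A (regular_bimodule A)" by (rule dbimI[OF dga_axioms regular_dg])

lemma (in dga) regular_chm:
  assumes "dbim k A M" "bimod_linear k A M (regular_bimodule A) 0 p" "quasi_iso k M A p"
  shows "chm k A M (regular_bimodule A) p"
  using assms R_dbim by (simp add: chm_def chm_axioms_def chain_bimod_map_def quasi_iso_def chain_map_def regular_simps)

text \<open>A and its regular bimodule have the same cocycles, coboundaries and differences, so the
  criterion on cocycles is the same for both.\<close>

lemma (in dga) regular_quasi_iso:
  assumes "dbim k A M" and q: "quasi_iso k M A p"
  shows "quasi_iso k M (regular_bimodule A) p"
proof -
  let ?R = "regular_bimodule A"
  have dg: "dg_space k M" "dg_space k ?R" using dbim.dgM[OF assms(1)] regular_dg by (simp_all add: dg_bimodule_def)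
  interpret A': dgs2 k M A p using q dg A_dg by (intro dgs2I) (simp_all add: quasi_iso_def)
  have "chain_map k M ?R p" using q by (simp add: quasi_iso_def chain_map_def deg_linear_def klinear_def regular_simps)
  then interpret R': dgs2 k M ?R p using dg by (intro dgs2I)
  have "cocycles ?R = cocycles A" "coboundaries ?R = coboundaries A" "!!x y. x \<ominus>\<^bsub>?R\<^esub> y = x \<ominus>\<^sub>A y"
    by (simp_all add: cocycles_def coboundaries_def regular_simps a_minus_cong_struct[of ?R A])
  thus ?thesis using q unfolding A'.quasi_iso_iff R'.quasi_iso_iff by simp
qed

locale twa = twf k A C \<pi>
  for k :: "'k ring" and A :: "('k, 'a) dgspace" and C :: "('k, 'c) coalg" and \<pi> +
  assumes aq: "quasi_iso k K A aug"
begin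

lemma aug_chm: "chm k A K R aug" by (rule regular_chm[OF KD.dbim_axioms aug_bl aq])

end

sublocale twa \<subseteq> au: chm k A "twisted_tensor k A C \<pi>" "regular_bimodule A" "tw_augmentation A C" by (rule aug_chm)

context twa begin

text \<open>The generator over g multiplied by \<open>a\<close> from the left is sent to
  \<open>a\<close>, because \<epsilon>(g) = 1.\<close>

lemma aug_surj: "aug ` carrier K = carrier R"
proof
  show "carrier R \<subseteq> aug ` carrier K"
  proof
    fix a assume "a \<in> carrier R"
    hence a: "a \<in> carrier A" by (simp add: regular_simps)
    have "aug (lact K a (gen cc.g)) = a" using au.fa[OF a gen_lin(1)[OF cc.g(2)]] a by (simp add: aug_gen cc.g regular_simps)
    thus "a \<in> aug ` carrier K" using KB.la(1)[OF a gen_lin(1)[OF cc.g(2)]] by force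
  qed
qed (use au.fl in blast)

lemma aug_quasi_iso: "quasi_iso k K R aug" by (rule regular_quasi_iso[OF KD.dbim_axioms aq])

lemma ker_Hom_acyclic: "inj_on j au.ker ==> acyclic_space (Hom_bimod k A K (transport K au.ker j))"
  by (rule K_Hom_acyclic[OF subbim.Y_dbim[OF au.ker_subbim] au.ker_acyclic[OF _ aug_surj aug_quasi_iso]])

abbreviation "E \<equiv> End_bimod k A K"
abbreviation "P F \<equiv> \<lambda>t\<in>carrier K. aug (F t)"

interpretation KR: dbim2 k A K R by (intro dbim2I KD.dbim_axioms R_dbim)

lemma P_chain: "chain_map k E KR.HB P" using hom_comp[OF KD.id_chm aug_chm] by (simp add: chain_map_def deg_linear_def klinear_def End_simps)

lemma lm_chain: "chain_map k Htw E lm" using lm_dga_hom by (simp add: dg_algebra_hom_def)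

lemma Htw_dg: "dg_space k Htw" using Htw_dga by (simp add: dg_algebra_def)

interpretation P: dgs2 k E KR.HB P by (rule dgs2I[OF KEE.A_dg KR.HB_dg P_chain])
interpretation l: dgs2 k Htw E lm by (rule dgs2I[OF Htw_dg KEE.A_dg lm_chain])

lemma P_lm:
  assumes "f \<in> carrier Htw" "P (lm f) = \<zero>\<^sub>KR.HB" shows "f = \<zero>\<^sub>Htw"
proof (rule HK.H_eqI)
  show "f \<in> carrier HK.H" "\<zero>\<^sub>Htw \<in> carrier HK.H" using assms(1) Htw.subm_zero[OF l.V.Z_subm] by (simp_all add: Htw_simps)
  fix c assume c: "c \<in> carrier C"
  have "f c = P (lm f) (gen c)" using aug_lm[OF assms(1) c] gen_lin(1)[OF c] by simp
  thus "f c = \<zero>\<^sub>Htw c" using c gen_lin(1)[OF c] by (simp add: assms(2) KR.HB_app Htw_simps HK.H_simps regular_simps)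
qed

text \<open>The value f(c) is the augmentation of G on the generator of c. After the augmentation G
  and l(f) are bimodule maps that agree on generators, hence equal.\<close>

lemma section_hom:
  assumes G: "G \<in> grade E n"
  shows "\<exists>f\<in>grade Htw n. P (G \<ominus>\<^sub>E lm f) = \<zero>\<^sub>KR.HB"
proof -
  define f where "f = (\<lambda>c\<in>carrier C. aug (G (gen c)))"
  have Gb: "bimod_linear k A K K n G" using G by (simp add: End_simps Hom_grade)
  have "deg_linear k C A n f" using deg_linear_compose[OF deg_linear_compose[OF gen_deg bimod_linearD(1)[OF Gb]] au.deg]
    by (auto simp: f_def deg_linear_def klinear_def regular_simps C.gcar image_subset_iff)
  hence f: "f \<in> grade Htw n" by (simp add: Htw_simps f_def)
  have fc: "f \<in> carrier Htw" using Htw.gcar[OF f] .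
  have R: "G \<ominus>\<^sub>E lm f \<in> grade E n" using G deg_linear_grade[OF l.f_deg f] by simp
  note Gc = KEE.A.gcar[OF G] and lc = l.fl(1)[OF fc]
  have PR: "P (G \<ominus>\<^sub>E lm f) \<in> grade KR.HB n" using deg_linear_grade[OF P.f_deg R] by simp
  have "P (G \<ominus>\<^sub>E lm f) t = \<zero>\<^sub>KR.HB t" if t: "t \<in> carrier K" for t
  proof (rule bl_uniq[OF R_gbim KR.HB_bl[OF PR] KR.HB_bl[OF KR.HB.g_zero] _ t])
    fix j c assume "c \<in> grade C j"
    hence c: "c \<in> carrier C" by (rule C.gcar)
    note gc = gen_lin(1)[OF c]
    have "(G \<ominus>\<^sub>E lm f) (gen c) = G (gen c) \<ominus>\<^sub>K lm f (gen c)"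
      using KE.HB_app(1)[OF _ _ gc] Gc lc by (simp add: End_cohomology End_simps)
    moreover have "G (gen c) \<in> carrier K" "lm f (gen c) \<in> carrier K" using KE.HB_app(5)[OF _ gc] Gc lc by (simp_all add: End_simps)
    moreover have "aug (G (gen c)) = aug (lm f (gen c))" using aug_lm[OF fc c] c by (simp add: f_def)
    ultimately show "P (G \<ominus>\<^sub>E lm f) (gen c) = \<zero>\<^sub>KR.HB (gen c)"
      using gc by (simp add: au.fm KR.HB_app au.fl) (simp add: a_minus_def au.N.M.M.r_neg au.fl)
  qed
  hence "P (G \<ominus>\<^sub>E lm f) = \<zero>\<^sub>KR.HB" using KR.HB.gcar[OF PR] by (intro KR.HB_eqI) auto
  thus ?thesis using f by blast
qed

lemma section_all:
  assumes "G \<in> carrier E" shows "\<exists>f\<in>carrier Htw. P (G \<ominus>\<^sub>E lm f) = \<zero>\<^sub>KR.HB" using assms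
proof (induction rule: KEE.A.graded_induct)
  case (hom n G) thus ?case using section_hom[OF hom] Htw.gcar by blast
next
  case (add F G)
  then obtain f g where f: "f \<in> carrier Htw" "P (F \<ominus>\<^sub>E lm f) = \<zero>\<^sub>KR.HB" and g: "g \<in> carrier Htw" "P (G \<ominus>\<^sub>E lm g) = \<zero>\<^sub>KR.HB" by blast
  note c = add(1,2) l.fl(1)[OF f(1)] l.fl(1)[OF g(1)]
  have "(F \<oplus>\<^sub>E G) \<ominus>\<^sub>E lm (f \<oplus>\<^sub>Htw g) = (F \<ominus>\<^sub>E lm f) \<oplus>\<^sub>E (G \<ominus>\<^sub>E lm g)"
    using c by (simp add: l.fl f(1) g(1) a_minus_def KEE.A.M.minus_add KEE.A.M.a_ac)
  hence "P ((F \<oplus>\<^sub>E G) \<ominus>\<^sub>E lm (f \<oplus>\<^sub>Htw g)) = \<zero>\<^sub>KR.HB" using P.fl(2)[of "F \<ominus>\<^sub>E lm f" "G \<ominus>\<^sub>E lm g"] c f g by simp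
  thus ?case using f(1) g(1) by blast
qed

lemma diff_section:
  assumes "G \<in> carrier E" "f \<in> carrier Htw" "P (G \<ominus>\<^sub>E lm f) = \<zero>\<^sub>KR.HB"
  shows "P (diff E G \<ominus>\<^sub>E lm (diff Htw f)) = \<zero>\<^sub>KR.HB"
proof -
  note c = assms(1) l.fl(1)[OF assms(2)]
  have "diff E (G \<ominus>\<^sub>E lm f) = diff E G \<ominus>\<^sub>E lm (diff Htw f)"
    using additive_diff[OF KEE.A.ab KEE.A.ab deg_additive[OF KEE.dA_deg] c] l.fd[OF assms(2)] by simp
  thus ?thesis using P.fd[of "G \<ominus>\<^sub>E lm f"] c assms(3) KR.HB.d0 by simp
qed

text \<open>After the augmentation l(f) equals the cocycle G, and P after l is injective, so f is a
  cocycle. The remainder takes values in the kernel of the augmentation, and Hom from K to that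
  kernel is acyclic.\<close>

lemma lm_approx:
  assumes G: "G \<in> cocycles E" "G \<in> grade E n"
  shows "\<exists>f\<in>cocycles Htw \<inter> grade Htw n. G \<ominus>\<^sub>E lm f \<in> coboundaries E"
proof -
  note Gc = KEE.D.ZD[OF G(1)]
  obtain f where f: "f \<in> grade Htw n" "P (G \<ominus>\<^sub>E lm f) = \<zero>\<^sub>KR.HB" using section_hom[OF G(2)] by blast
  note fc = Htw.gcar[OF f(1)]
  note dc = l.fl(1)[OF l.V.dl(1)[OF fc]]
  have "P (\<zero>\<^sub>E \<ominus>\<^sub>E lm (diff Htw f)) = \<zero>\<^sub>KR.HB" using diff_section[OF Gc(1) fc f(2)] Gc(2) by simp
  hence "\<zero>\<^sub>KR.HB \<ominus>\<^sub>KR.HB P (lm (diff Htw f)) = \<zero>\<^sub>KR.HB"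
    using P.fm[of "\<zero>\<^sub>E" "lm (diff Htw f)"] dc additive_zero[OF KEE.A.ab KR.HB.ab deg_additive[OF P.f_deg]] by simp
  hence "P (lm (diff Htw f)) = \<zero>\<^sub>KR.HB" using KR.HB.diff_zero_eq[of "\<zero>\<^sub>KR.HB" "P (lm (diff Htw f))"] P.fl(1)[OF dc] by simp
  hence df: "diff Htw f = \<zero>\<^sub>Htw" using P_lm l.V.dl(1)[OF fc] by blast
  hence fZ: "f \<in> cocycles Htw" using fc by (simp add: cocycles_def)
  let ?R = "G \<ominus>\<^sub>E lm f"
  have R: "?R \<in> grade E n" "?R \<in> cocycles E" using G(2) deg_linear_grade[OF l.f_deg f(1)] KEE.A.subm_minus[OF KEE.D.Z_subm G(1) l.fZ[OF fZ]] by simp_all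
  interpret s: subbim k A K au.ker "%x. x" by (rule au.ker_subbim) simp
  have "?R t \<in> au.ker" if t: "t \<in> carrier K" for t
    using KE.HB_app(5)[of ?R t] KEE.D.ZD(1)[OF R(2)] t fun_cong[OF f(2), of t] by (simp add: KR.HB_app End_simps)
  then obtain S where "S \<in> grade KE.HB (n - 1)" "diff KE.HB S = ?R"
    using s.null_homotopic[where n = n, OF KD.dbim_axioms ker_Hom_acyclic, of ?R] R KEE.D.ZD(2)[OF R(2)] by (auto simp: End_simps)
  hence "?R \<in> coboundaries E" using KE.HB.gcar unfolding coboundaries_def End_simps by (metis imageI)
  thus ?thesis using fZ f(1) by blast
qed

lemma lm_quasi_iso: "quasi_iso k Htw E lm" unfolding l.quasi_iso_iff
proof (intro conjI ballI impI)
  fix f assume f: "f \<in> cocycles Htw" "lm f \<in> coboundaries E"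
  then obtain G where G: "G \<in> carrier E" "lm f = diff E G" by (auto simp: coboundaries_def)
  \<comment> \<open>The primitive G of l(f) has the same image under P as some l(h); injectivity of
    P after l then gives f = d h.\<close>
  obtain h where h: "h \<in> carrier Htw" "P (G \<ominus>\<^sub>E lm h) = \<zero>\<^sub>KR.HB" using section_all[OF G(1)] by blast
  note c = l.V.ZD(1)[OF f(1)] l.V.dl(1)[OF h(1)]
  have "P (lm (f \<ominus>\<^sub>Htw diff Htw h)) = \<zero>\<^sub>KR.HB" using diff_section[OF G(1) h] c by (simp add: l.fm G(2)[symmetric])
  hence "f \<ominus>\<^sub>Htw diff Htw h = \<zero>\<^sub>Htw" using P_lm c by simp
  thus "f \<in> coboundaries Htw" using Htw.diff_zero_eq[OF c] l.V.BI[OF h(1)] by simp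
next
  fix G assume "G \<in> cocycles E"
  hence "G \<in> carrier E" "diff E G = \<zero>\<^sub>E" using KEE.D.ZD by blast+
  with KEE.dA_deg show "\<exists>f\<in>cocycles Htw. G \<ominus>\<^sub>E lm f \<in> coboundaries E"
  proof (induction rule: KEE.A.cocycle_induct)
    case (hom n G)
    thus ?case using lm_approx[of G n] KEE.A.gcar by (auto simp: cocycles_def)
  next
    case (add F G)
    then obtain f g where f: "f \<in> cocycles Htw" "F \<ominus>\<^sub>E lm f \<in> coboundaries E" and g: "g \<in> cocycles Htw" "G \<ominus>\<^sub>E lm g \<in> coboundaries E" by blast
    note c = l.V.ZD(1)[OF f(1)] l.V.ZD(1)[OF g(1)] l.fl(1)[OF l.V.ZD(1)[OF f(1)]] l.fl(1)[OF l.V.ZD(1)[OF g(1)]]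
    have "(F \<oplus>\<^sub>E G) \<ominus>\<^sub>E lm (f \<oplus>\<^sub>Htw g) = (F \<ominus>\<^sub>E lm f) \<oplus>\<^sub>E (G \<ominus>\<^sub>E lm g)"
      using c add(1,2) by (simp add: l.fl a_minus_def KEE.A.M.minus_add KEE.A.M.a_ac)
    thus ?case using KEE.A.subm_add[OF KEE.D.B_subm f(2) g(2)] Htw.subm_add[OF l.V.Z_subm f(1) g(1)] by (metis)
  qed
qed

lemma lm_graded_iso: "graded_ring_iso Htw E (%X. coboundaries E <+>\<^sub>E (lm ` X))"
proof (rule quasi_iso_graded_ring_iso[OF Htw_dga KE.E_dga lm_quasi_iso])
  show "lm (x \<otimes>\<^sub>Htw y) \<ominus>\<^sub>E lm x \<otimes>\<^sub>E lm y \<in> coboundaries E" if "x \<in> cocycles Htw" "y \<in> cocycles Htw" for x y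
    using lm_mult[OF l.V.ZD(1)[OF that(1)] l.V.ZD(1)[OF that(2)]] KEE.A.subm_zero[OF KEE.D.B_subm] l.fl(1)[OF l.V.ZD(1)[OF that(1)]] l.fl(1)[OF l.V.ZD(1)[OF that(2)]]
    by (simp add: a_minus_def KEE.A.M.r_neg)
  show "lm \<one>\<^sub>Htw \<ominus>\<^sub>E \<one>\<^sub>E \<in> coboundaries E" using lm_one KEE.A.subm_zero[OF KEE.D.B_subm] by (simp add: a_minus_def KEE.A.M.r_neg)
qed (rule lm_approx)

lemma K_semi_proj_approx: "semi_proj_approx u k A K aug" using K_semi_projective aug_bl aug_surj aq by (simp add: semi_proj_approx_def regular_simps)

end

section \<open>Hochschild cohomology\<close>

lemma (in chm) comp_bl:
  assumes "dbim k A P" "bimod_linear k A P M 0 g" shows "bimod_linear k A P N 0 (%t. f (g t))"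
proof -
  interpret P: dbim k A P by fact
  interpret PM: dbim2 k A P M by (intro dbim2I P.dbim_axioms M.dbim_axioms)
  note g = PM.bl[OF assms(2)]
  have "deg_linear k P N 0 (%t. f (g t))" using deg_linear_compose[OF bimod_linearD(1)[OF assms(2)] deg] by simp
  moreover have "f (g (lact P a (ract P m b))) = ksgn k (0 * i) \<odot>\<^sub>N lact N a (ract N (f (g m)) b)"
    if "a \<in> grade A i" "m \<in> carrier P" "b \<in> carrier A" for a i m b
    using that M.A.gcar[OF that(1)] g(1) bimod_linearD(2)[OF assms(2) that] by (simp add: fl fa fr M.la M.ra N.la N.ra)
  ultimately show ?thesis unfolding bimod_linear_def by blast
qed

lemma (in dbim) whole_subbim: "inj_on j (carrier M) ==> subbim k A M (carrier M) j"
proof (rule subbim.intro[OF dbim_axioms], rule subbim_axioms.intro)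
  show "M.subm (carrier M)" by (rule M.submI) auto
qed (use M.gcar M.hcomp_g in \<open>auto simp: d_lin la ra\<close>)

text \<open>Projectivity of M is tested by modules with carrier in 'u. K is copied there along
  \<iota>, and R along a right inverse of p, whose values are elements of M and hence in 'u.\<close>

lemma graded_projective_lift:
  fixes M :: "('k, 'a, 'u) dgbimod" and K :: "('k, 'a, 'n) dgbimod" and \<iota> :: "'n => 'u"
  assumes "chm k A M R p" "chm k A K R q" and q: "q ` carrier K = carrier R" and p: "p ` carrier M = carrier R"
    and \<iota>: "inj_on \<iota> (carrier K)" and M: "graded_projective TYPE('u) k A M"
  shows "\<exists>h. bimod_linear k A M K 0 h & (\<forall>m\<in>carrier M. q (h m) = p m)"
proof -
  interpret p: chm k A M R p by fact
  interpret q: chm k A K R q by fact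
  let ?\<sigma> = "inv_into (carrier M) p"
  interpret s: subbim k A K "carrier K" \<iota> by (rule q.M.whole_subbim[OF \<iota>])
  have \<sigma>: "inj_on ?\<sigma> (carrier R)" using inj_on_inv_into[of "carrier R" p "carrier M"] p by simp
  interpret t: subbim k A R "carrier R" ?\<sigma> by (rule p.N.whole_subbim[OF \<sigma>])
  interpret i: chm k A s.Y K s.i by (rule s.i_chm)
  interpret j: chm k A R t.Y ?\<sigma> by (rule t.j_chm) simp
  have gb: "graded_bimodule k A s.Y" "graded_bimodule k A t.Y" using i.M.gb j.N.gb .
  have qb: "bimod_linear k A s.Y t.Y 0 (%x. ?\<sigma> (q (s.i x)))" by (rule j.comp_bl[OF i.M.dbim_axioms q.comp_bl[OF i.M.dbim_axioms i.bl]])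
  have "(%x. ?\<sigma> (q (s.i x))) ` carrier s.Y = ?\<sigma> ` q ` carrier K" by (force simp: transport_def image_image s.ij)
  hence qs: "(%x. ?\<sigma> (q (s.i x))) ` carrier s.Y = carrier t.Y" by (simp add: q transport_def)
  obtain g where g: "bimod_linear k A M s.Y 0 g" "!!m. m \<in> carrier M ==> ?\<sigma> (q (s.i (g m))) = ?\<sigma> (p m)"
    using M[unfolded graded_projective_def, rule_format, of s.Y t.Y "%x. ?\<sigma> (q (s.i x))" "%m. ?\<sigma> (p m)"]
      gb qb qs j.comp_bl[OF p.M.dbim_axioms p.bl] by blast
  have "q (s.i (g m)) = p m" if m: "m \<in> carrier M" for m
    using inj_onD[OF \<sigma> g(2)[OF m]] p.fl(1)[OF m] q.fl(1)[OF i.fl(1)] klinearD(1)[OF deg_klinear[OF bimod_linearD(1)[OF g(1)]] m] by blast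
  thus ?thesis using i.comp_bl[OF p.M.dbim_axioms g(1)] by blast
qed

context twa begin

text \<open>The two directions are not symmetric: maps out of K may be tested by modules in any
  type, maps out of M by modules in 'u. The kernel of K -> A is therefore copied along \<iota> when
  M is the source and used as it stands when K is; the kernel of p already lies in 'u.\<close>

lemma HH:
  fixes M :: "('k, 'a, 'u) dgbimod" and \<iota> :: "_ => 'u"
  assumes \<iota>: "inj_on \<iota> (carrier K)" and M: "semi_proj_approx TYPE('u) k A M p"
  shows "\<exists>\<theta>. graded_ring_iso (End_bimod k A M) Htw \<theta>"
proof -
  have sp: "semi_projective TYPE('u) k A M" and pl: "bimod_linear k A M R 0 p" and ps: "p ` carrier M = carrier R" and pq: "quasi_iso k M A p"
    using M by (simp_all add: semi_proj_approx_def regular_simps)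
  have Md: "dbim k A M" using sp by (intro dbimI[OF dga_axioms]) (simp add: semi_projective_def)
  interpret p: chm k A M R p by (rule regular_chm[OF Md pl pq])
  note pq' = regular_quasi_iso[OF Md pq]
  have M_ac: "acyclic_space (Hom_bimod k A M N)" if "dbim k A N" "acyclic_space N" for N :: "('k, 'a, 'u) dgbimod"
    using sp that dbim.dgM by (auto simp: semi_projective_def)
  have \<iota>k: "inj_on \<iota> au.ker" by (rule inj_on_subset[OF \<iota>]) simp
  have idk: "inj_on (%x. x) au.ker" and idp: "inj_on (%x. x) p.ker" by simp_all
  note Tk = subbim.Y_dbim[OF au.ker_subbim[OF \<iota>k]] au.ker_acyclic[OF \<iota>k aug_surj aug_quasi_iso]
  note Tp = subbim.Y_dbim[OF p.ker_subbim[OF idp]] p.ker_acyclic[OF idp ps pq']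
  obtain h where h: "bimod_linear k A M K 0 h" "!!m. m \<in> carrier M ==> aug (h m) = p m"
    using graded_projective_lift[OF p.chm_axioms aug_chm aug_surj ps \<iota>] sp by (auto simp: semi_projective_def)
  obtain \<alpha> where \<alpha>: "chain_bimod_map k A M K \<alpha>" "!!m. m \<in> carrier M ==> aug (\<alpha> m) = p m"
    using au.chain_lift[OF Md h(1) p.f h(2) \<iota>k M_ac[OF Tk]] by blast
  obtain h' where h': "bimod_linear k A K M 0 h'" "!!t. t \<in> carrier K ==> p (h' t) = aug t"
    using K_lift[OF p.M.gb gbim.gb[OF R_gbim] p.bl ps aug_bl] by blast
  obtain \<beta> where \<beta>: "chain_bimod_map k A K M \<beta>" "!!t. t \<in> carrier K ==> p (\<beta> t) = aug t"
    using p.chain_lift[OF KD.dbim_axioms h'(1) au.f h'(2) idp K_Hom_acyclic[OF Tp]] by blast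
  interpret \<alpha>: chm k A M K \<alpha> by (simp add: chm_def chm_axioms_def Md KD.dbim_axioms \<alpha>(1))
  interpret \<beta>: chm k A K M \<beta> by (simp add: chm_def chm_axioms_def Md KD.dbim_axioms \<beta>(1))
  have comp: "chain_bimod_map k A M M (%m. \<beta> (\<alpha> m))" "chain_bimod_map k A K K (%t. \<alpha> (\<beta> t))"
    using \<beta>.comp_bl[OF Md \<alpha>.bl] \<alpha>.comp_bl[OF KD.dbim_axioms \<beta>.bl]
    by (simp_all add: chain_bimod_map_def \<alpha>.fd \<beta>.fd \<alpha>.fl \<beta>.fl)
  have id: "chain_bimod_map k A M M (%x. x)" "chain_bimod_map k A K K (%x. x)" using p.M.id_chm KD.id_chm by (simp_all add: chm_def chm_axioms_def)
  interpret e: hequiv k A M K \<alpha> \<beta>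
  proof unfold_locales
    show "restrict (%m. \<beta> (\<alpha> m)) (carrier M) \<ominus>\<^bsub>Hom_bimod k A M M\<^esub> restrict (%m. m) (carrier M) \<in> coboundaries (Hom_bimod k A M M)"
      by (rule p.lift_unique[OF Md comp(1) id(1) _ idp M_ac[OF Tp]]) (simp add: \<alpha>(2) \<beta>(2) \<alpha>.fl)
    show "restrict (%t. \<alpha> (\<beta> t)) (carrier K) \<ominus>\<^bsub>Hom_bimod k A K K\<^esub> restrict (%t. t) (carrier K) \<in> coboundaries (Hom_bimod k A K K)"
      by (rule au.lift_unique[OF KD.dbim_axioms comp(2) id(2) _ idk ker_Hom_acyclic[OF idk]]) (simp add: \<alpha>(2) \<beta>(2) \<beta>.fl)
  qed
  obtain \<theta> where "graded_ring_iso (End_bimod k A M) E \<theta>" using e.graded_iso by blast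
  from graded_ring_iso_trans[OF this graded_ring_iso_inv[OF dga.intro[OF Htw_dga] lm_graded_iso]] show ?thesis by blast
qed

end

text \<open>The type 'u is an arbitrary universe of test modules. The injection \<iota> says that it
  has room for copies of K and of the kernel of its augmentation, with which the semi-projectivity
  of M is tested.\<close>

theorem theorem1p1:
  fixes k :: "'k ring" and A :: "('k, 'a) dgspace" and C :: "('k, 'c) coalg" and \<pi> :: "'c \<Rightarrow> 'a"
  assumes "field k" and "dg_algebra k A" and "curved_dg_coalgebra k C"
    and "twisting_cochain k C A \<pi>"
  shows "dg_algebra_hom k (Hom_tw k C A \<pi>) (End_bimod k A (twisted_tensor k A C \<pi>))
           (l_map k C A \<pi>)
    \<and> (acyclic_cochain k C A \<pi> \<longrightarrow>
         quasi_iso k (Hom_tw k C A \<pi>) (End_bimod k A (twisted_tensor k A C \<pi>)) (l_map k C A \<pi>)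
       \<and> semi_proj_approx TYPE('u) k A (twisted_tensor k A C \<pi>) (tw_augmentation A C)
       \<and> (\<forall>(M :: ('k, 'a, 'u) dgbimod) p.
            (\<exists>\<iota> :: _ \<Rightarrow> 'u. inj_on \<iota> (carrier (twisted_tensor k A C \<pi>)))
            \<and> semi_proj_approx TYPE('u) k A M p
            \<longrightarrow> (\<exists>\<theta>. graded_ring_iso (End_bimod k A M) (Hom_tw k C A \<pi>) \<theta>)))"
proof (intro conjI impI)
  interpret field k by fact
  interpret tw k A C \<pi> by (intro tw.intro dga.intro coal.intro tw_axioms.intro assms is_cring)
  show "dg_algebra_hom k Htw (End_bimod k A K) lm" by (rule lm_dga_hom)
next
  assume ac: "acyclic_cochain k C A \<pi>"
  interpret field k by fact
  interpret tw k A C \<pi> by (intro tw.intro dga.intro coal.intro tw_axioms.intro assms is_cring)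
  have ad: "admissible k C A \<pi>" and aq: "quasi_iso k K A aug" using ac by (simp_all add: acyclic_cochain_def)
  interpret cc: conn_coal k C by unfold_locales (use assms(1) ad in \<open>simp_all add: admissible_def\<close>)
  interpret twa k A C \<pi> by unfold_locales (use ad cc.g(1) aq in \<open>simp_all add: admissible_def\<close>)
  show "quasi_iso k Htw (End_bimod k A K) lm" by (rule lm_quasi_iso)
  show "semi_proj_approx TYPE('u) k A K aug" by (rule K_semi_proj_approx)
  show "\<forall>(M :: ('k, 'a, 'u) dgbimod) p. (\<exists>\<iota> :: _ => 'u. inj_on \<iota> (carrier K)) & semi_proj_approx TYPE('u) k A M p
      --> (\<exists>\<theta>. graded_ring_iso (End_bimod k A M) Htw \<theta>)" using HH by blast
qed

end
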